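(* Every Kisin module is isogenous to a Kisin module of HN-type.
   Context: $p$ prime, $\mathbb{F}$ perfect of characteristic $p$, $\mathfrak{S}=W(\mathbb{F})[[u]]$ with Frobenius $\varphi$ ($\varphi(u)=u^p$), $K$ a finite totally ramified extension of $W(\mathbb{F})[1/p]$ with $E(u)$ the Eisenstein minimal polynomial of a uniformizer. A Kisin module is a finite free $\mathfrak{S}$-module $M$ with an isomorphism $\varphi_M:\varphi^*M[1/E]\to M[1/E]$, where $\varphi^*M=\mathfrak{S}\otimes_{\varphi,\mathfrak{S}}M$. Two Kisin modules are isogenous if they become isomorphic in the isogeny category (same objects, morphisms $\mathrm{Hom}\otimes_{\mathbb{Z}}\mathbb{Q}_p$). Slope of a Kisin module: $\deg M/\mathrm{rank}_{\mathfrak{S}}M$ with $\deg M=\sum a_i$, where $M_{(E)}$ has a basis $(e_i)$ with $\varphi_M(\varphi^*M)_{(E)}=\bigoplus\mathfrak{S}_{(E)}E^{-a_i}e_i$. $M/pM$ is a free $\mathbb{F}[[u]]$-module with Frobenius isomorphism after inverting $u$; it is semistable if every $\varphi$-stable submodule $N$ with $(M/pM)/N$ torsion free has slope $\le$ that of $M/pM$, slopes computed with degree $\nu(N,\varphi(\varphi^*N))$ (sum of exponents of the relative position over $\mathbb{F}[[u]]$) divided by rank. A Kisin module is semistable if $M/pM$ is; it is HN-type if it has a flag $0=M_0\subset\cdots\subset M_r=M$ of $\varphi$-stable submodules which are Kisin modules, with $M_i/M_{i-1}$ free and semistable of slopes $\mu_1>\cdots>\mu_r$. *)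

theory Defs
  imports
    "HOL-Computational_Algebra.Computational_Algebra"
    "HOL-Algebra.Module"
    "HOL-Algebra.AbelCoset"
begin

definition univ_ring :: "'r::comm_ring_1 ring" where
  "univ_ring = \<lparr>carrier = UNIV, mult = (*), one = 1, zero = 0, add = (+)\<rparr>"

section \<open>The base rings\<close>

definition perfect_of_char :: "nat \<Rightarrow> 'f::field itself \<Rightarrow> bool" where
  "perfect_of_char p _ \<longleftrightarrow> prime p \<and> CHAR('f) = p \<and> (\<forall>x::'f. \<exists>y. y ^ p = x)"

text \<open>
  For a perfect field \<open>F\<close> of characteristic \<open>p\<close>, the ring of Witt vectors \<open>W(F)\<close> is, up to unique
  isomorphism, the strict \<open>p\<close>-ring with residue field \<open>F\<close>: \<open>p\<close> is not a zero divisor, the ring is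
  \<open>p\<close>-adically separated and complete, and reduction \<open>res\<close> modulo \<open>p\<close> identifies its quotient by
  \<open>p\<close> with \<open>F\<close>. The Witt vector Frobenius is the (unique) ring endomorphism \<open>\<sigma>\<close> that induces the
  \<open>p\<close>-th power map on \<open>F\<close>.
\<close>
definition witt_vectors :: "nat \<Rightarrow> ('w::idom \<Rightarrow> 'f::field) \<Rightarrow> ('w \<Rightarrow> 'w) \<Rightarrow> bool" where
  "witt_vectors p res \<sigma> \<longleftrightarrow>
     (of_nat p :: 'w) \<noteq> 0 \<and>
     (\<forall>x::'w. (\<forall>n. of_nat p ^ n dvd x) \<longrightarrow> x = 0) \<and>
     (\<forall>s::nat \<Rightarrow> 'w. (\<forall>n. of_nat p ^ n dvd s (Suc n) - s n) \<longrightarrow>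
        (\<exists>l. \<forall>n. of_nat p ^ n dvd l - s n)) \<and>
     res \<in> ring_hom univ_ring univ_ring \<and> surj res \<and> (\<forall>x. res x = 0 \<longleftrightarrow> of_nat p dvd x) \<and>
     \<sigma> \<in> ring_hom univ_ring univ_ring \<and> (\<forall>x. res (\<sigma> x) = res x ^ p)"

text \<open>The subfield \<open>W(F)[1/p]\<close> of \<open>K\<close>, for an embedding \<open>\<iota>\<close> of \<open>W(F)\<close> into \<open>K\<close>.\<close>
definition base_field :: "nat \<Rightarrow> ('w::idom \<Rightarrow> 'k::field) \<Rightarrow> 'k set" where
  "base_field p \<iota> = {\<iota> a / of_nat p ^ n | a n. True}"

text \<open>The integral closure of \<open>W(F)\<close> in \<open>K\<close>.\<close>
definition integers :: "('w::idom \<Rightarrow> 'k::field) \<Rightarrow> 'k set" where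
  "integers \<iota> = {x. \<exists>f. lead_coeff f = 1 \<and> poly (map_poly \<iota> f) x = 0}"

text \<open>
  \<open>K\<close> is finite over \<open>W(F)[1/p]\<close>, the element \<open>\<pi>\<close> generates the maximal ideal (the non-units) of its
  ring of integers, and the residue field extension is trivial.
\<close>
definition totally_ramified_with_uniformizer ::
    "nat \<Rightarrow> ('w::idom \<Rightarrow> 'k::field) \<Rightarrow> 'k \<Rightarrow> bool" where
  "totally_ramified_with_uniformizer p \<iota> \<pi> \<longleftrightarrow>
     \<iota> \<in> ring_hom univ_ring univ_ring \<and> inj \<iota> \<and>
     (\<exists>B. finite B \<and> (\<forall>x. \<exists>c. (\<forall>b\<in>B. c b \<in> base_field p \<iota>) \<and> x = (\<Sum>b\<in>B. c b * b))) \<and>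
     {x \<in> integers \<iota>. x = 0 \<or> inverse x \<notin> integers \<iota>} = {\<pi> * y | y. y \<in> integers \<iota>} \<and>
     (\<forall>x \<in> integers \<iota>. \<exists>w. \<exists>y \<in> integers \<iota>. x = \<iota> w + \<pi> * y)"

definition eisenstein :: "nat \<Rightarrow> 'w::idom poly \<Rightarrow> bool" where
  "eisenstein p E \<longleftrightarrow> lead_coeff E = 1 \<and> degree E \<ge> 1 \<and>
     (\<forall>i<degree E. of_nat p dvd coeff E i) \<and> \<not> of_nat p ^ 2 dvd coeff E 0"

definition minimal_polynomial ::
    "nat \<Rightarrow> ('w::idom \<Rightarrow> 'k::field) \<Rightarrow> 'k \<Rightarrow> 'w poly \<Rightarrow> bool" where
  "minimal_polynomial p \<iota> \<pi> E \<longleftrightarrow> lead_coeff E = 1 \<and> poly (map_poly \<iota> E) \<pi> = 0 \<and>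
     (\<forall>q. q \<noteq> 0 \<and> (\<forall>i. coeff q i \<in> base_field p \<iota>) \<and> poly q \<pi> = 0 \<longrightarrow> degree E \<le> degree q)"

text \<open>The Frobenius of \<open>W(F)[[u]]\<close>: \<open>\<sigma>\<close> on coefficients and \<open>u \<mapsto> u ^ p\<close>.\<close>
definition fps_frob :: "nat \<Rightarrow> ('w::zero \<Rightarrow> 'w) \<Rightarrow> 'w fps \<Rightarrow> 'w fps" where
  "fps_frob p \<sigma> f = Abs_fps (\<lambda>n. if p dvd n then \<sigma> (fps_nth f (n div p)) else 0)"

definition fps_reduce :: "('w \<Rightarrow> 'f) \<Rightarrow> 'w fps \<Rightarrow> 'f fps" where
  "fps_reduce res f = Abs_fps (\<lambda>n. res (fps_nth f n))"

section \<open>Bases and localizations\<close>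

text \<open>
  The family \<open>b 0, \<dots>, b (n - 1)\<close> in \<open>V\<close> is a basis of \<open>N\<close> over the subring \<open>A\<close> of the ring of
  scalars of \<open>V\<close>.
\<close>
definition is_basis ::
    "('a::zero, 'v, 'x) module_scheme \<Rightarrow> 'a set \<Rightarrow> nat \<Rightarrow> (nat \<Rightarrow> 'v) \<Rightarrow> 'v set \<Rightarrow> bool" where
  "is_basis V A n b N \<longleftrightarrow>
     (\<forall>i<n. b i \<in> carrier V) \<and>
     N = {\<Oplus>\<^bsub>V\<^esub>i\<in>{..<n}. c i \<odot>\<^bsub>V\<^esub> b i | c. \<forall>i<n. c i \<in> A} \<and>
     (\<forall>c. (\<forall>i<n. c i \<in> A) \<and> (\<Oplus>\<^bsub>V\<^esub>i\<in>{..<n}. c i \<odot>\<^bsub>V\<^esub> b i) = \<zero>\<^bsub>V\<^esub> \<longrightarrow> (\<forall>i<n. c i = 0))"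

definition module_rank :: "('r::zero, 'm, 'x) module_scheme \<Rightarrow> nat" where
  "module_rank M = (THE n. \<exists>b. is_basis M UNIV n b (carrier M))"

text \<open>
  The element \<open>x / s\<close> of \<open>Frac(R) \<otimes> M\<close>, as an equivalence class of fractions. For torsion free \<open>M\<close>,
  all localizations of \<open>M\<close> embed into \<open>Frac(R) \<otimes> M\<close>, and they are defined as subsets of it below.
\<close>
definition fraction :: "('r::idom, 'm, 'x) module_scheme \<Rightarrow> 'm \<Rightarrow> 'r \<Rightarrow> ('m \<times> 'r) set" where
  "fraction M x s = {(y, t). y \<in> carrier M \<and> t \<noteq> 0 \<and>
     (\<exists>r. r \<noteq> 0 \<and> (r * t) \<odot>\<^bsub>M\<^esub> x = (r * s) \<odot>\<^bsub>M\<^esub> y)}"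

text \<open>
  The vector space \<open>Frac(R) \<otimes> M\<close>. The unions range over all representatives and hence are unions of
  copies of one and the same class; the fields \<open>mult\<close> and \<open>one\<close> are irrelevant for modules.
\<close>
definition frac_module ::
    "('r::idom, 'm, 'x) module_scheme \<Rightarrow> ('r fract, ('m \<times> 'r) set) module" where
  "frac_module M = \<lparr>
     carrier = {fraction M x s | x s. x \<in> carrier M \<and> s \<noteq> 0},
     mult = undefined, one = undefined,
     zero = fraction M \<zero>\<^bsub>M\<^esub> 1,
     add = (\<lambda>X Y. \<Union>{fraction M (t \<odot>\<^bsub>M\<^esub> x \<oplus>\<^bsub>M\<^esub> s \<odot>\<^bsub>M\<^esub> y) (s * t) | x s y t.
       (x, s) \<in> X \<and> (y, t) \<in> Y}),
     smult = (\<lambda>c X. \<Union>{fraction M (a \<odot>\<^bsub>M\<^esub> x) (b * s) | a b x s.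
       (x, s) \<in> X \<and> b \<noteq> 0 \<and> c = Fract a b})\<rparr>"

text \<open>\<open>R\<close>, \<open>R[1/e]\<close> and \<open>R\<^sub>(\<^sub>e\<^sub>)\<close> as subrings of \<open>Frac(R)\<close>.\<close>
definition integral_scalars :: "'r::idom fract set" where
  "integral_scalars = {Fract a 1 | a. True}"

definition scalars_inverting :: "'r::idom \<Rightarrow> 'r fract set" where
  "scalars_inverting e = {Fract a (e ^ k) | a k. True}"

definition scalars_local :: "'r::idom \<Rightarrow> 'r fract set" where
  "scalars_local e = {Fract a s | a s. \<not> e dvd s}"

text \<open>The images of \<open>M\<close> and \<open>N[1/e]\<close>, \<open>N \<subseteq> M\<close>, in \<open>Frac(R) \<otimes> M\<close>.\<close>
definition lattice_of :: "('r::idom, 'm, 'x) module_scheme \<Rightarrow> ('m \<times> 'r) set set" where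
  "lattice_of M = {fraction M x 1 | x. x \<in> carrier M}"

definition inverting ::
    "'r::idom \<Rightarrow> ('r, 'm, 'x) module_scheme \<Rightarrow> 'm set \<Rightarrow> ('m \<times> 'r) set set" where
  "inverting e M N = {fraction M x (e ^ k) | x k. x \<in> N}"

text \<open>\<open>L\<^sub>(\<^sub>e\<^sub>)\<close> for an \<open>R\<close>-submodule \<open>L\<close> of a \<open>Frac(R)\<close>-vector space \<open>V\<close>.\<close>
definition localize :: "'r::idom \<Rightarrow> ('r fract, 'v, 'x) module_scheme \<Rightarrow> 'v set \<Rightarrow> 'v set" where
  "localize e V L = {Fract 1 s \<odot>\<^bsub>V\<^esub> v | s v. \<not> e dvd s \<and> v \<in> L}"

text \<open>
  The degree \<open>\<nu>(L, L')\<close> of the relative position of two lattices over a discrete valuation ring \<open>A\<close>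
  with uniformizer \<open>\<pi>\<close>: if \<open>L\<close> has basis \<open>b i\<close> and \<open>L'\<close> has basis \<open>\<pi> ^ (- a i) b i\<close>, it is the sum
  of the \<open>a i\<close>.
\<close>
definition relative_degree ::
    "('a::field, 'v, 'x) module_scheme \<Rightarrow> 'a set \<Rightarrow> 'a \<Rightarrow> 'v set \<Rightarrow> 'v set \<Rightarrow> int" where
  "relative_degree V A \<pi> L L' = (THE d. \<exists>n b a. is_basis V A n b L \<and>
     is_basis V A n (\<lambda>i. (\<pi> powi (- a i)) \<odot>\<^bsub>V\<^esub> b i) L' \<and> d = (\<Sum>i<n. a i))"

section \<open>Modules with Frobenius\<close>

text \<open>
  By the universal property of \<open>\<phi>\<^sup>*M = R \<otimes>\<^bsub>\<phi>,R\<^esub> M\<close>, a linear map \<open>\<phi>\<^sup>*M[1/e] \<rightarrow> M[1/e]\<close> is the same as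
  a \<open>\<phi>\<close>-semilinear map \<open>frob\<close> from \<open>M\<close> to \<open>M[1/e]\<close>, \<open>frob x\<close> being the image of \<open>1 \<otimes> x\<close>.
\<close>
record ('r, 'm) phi_module = "('r, 'm) module" +
  frob :: "'m \<Rightarrow> ('m \<times> 'r) set"

text \<open>
  If \<open>b\<close> is a basis of \<open>M\<close>, then the \<open>1 \<otimes> b i\<close> are a basis of \<open>\<phi>\<^sup>*M[1/e]\<close> over \<open>R[1/e]\<close>; the last
  clause says that the linear map sends it to a basis of \<open>M[1/e]\<close>, that is, it is an isomorphism.
\<close>
definition frobenius_module :: "('r::idom \<Rightarrow> 'r) \<Rightarrow> 'r \<Rightarrow> ('r, 'm) phi_module \<Rightarrow> bool" where
  "frobenius_module \<phi> e M \<longleftrightarrow>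
     module univ_ring M \<and>
     (\<forall>x\<in>carrier M. frob M x \<in> inverting e M (carrier M)) \<and>
     (\<forall>x\<in>carrier M. \<forall>y\<in>carrier M.
        frob M (x \<oplus>\<^bsub>M\<^esub> y) = frob M x \<oplus>\<^bsub>frac_module M\<^esub> frob M y) \<and>
     (\<forall>a. \<forall>x\<in>carrier M. frob M (a \<odot>\<^bsub>M\<^esub> x) = Fract (\<phi> a) 1 \<odot>\<^bsub>frac_module M\<^esub> frob M x) \<and>
     (\<exists>n b. is_basis M UNIV n b (carrier M) \<and>
        is_basis (frac_module M) (scalars_inverting e) n (\<lambda>i. frob M (b i))
          (inverting e M (carrier M)))"

text \<open>The image of \<open>\<phi>\<^sup>*M\<close> in \<open>Frac(R) \<otimes> M\<close>.\<close>
definition frob_image :: "('r::idom, 'm) phi_module \<Rightarrow> ('m \<times> 'r) set set" where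
  "frob_image M = {\<Oplus>\<^bsub>frac_module M\<^esub>i\<in>{..<n}. Fract (c i) 1 \<odot>\<^bsub>frac_module M\<^esub> frob M (x i)
     | (n::nat) c x. \<forall>i<n. x i \<in> carrier M}"

definition frob_stable :: "'r::idom \<Rightarrow> ('r, 'm) phi_module \<Rightarrow> 'm set \<Rightarrow> bool" where
  "frob_stable e M N \<longleftrightarrow> (\<forall>x\<in>N. frob M x \<in> inverting e M N)"

text \<open>
  A stable submodule as a module with Frobenius. Intersecting turns a class of fractions over \<open>M\<close>
  that has a numerator in \<open>N\<close> into the corresponding class over \<open>N\<close>.
\<close>
definition sub_module :: "('r::idom, 'm) phi_module \<Rightarrow> 'm set \<Rightarrow> ('r, 'm) phi_module" where
  "sub_module M N = M\<lparr>carrier := N, frob := (\<lambda>x. frob M x \<inter> (N \<times> UNIV))\<rparr>"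

text \<open>
  The quotient \<open>M/N\<close> as a module over \<open>R'\<close>, for a surjective ring homomorphism \<open>\<rho>\<close> from \<open>R\<close> to \<open>R'\<close>
  whose kernel maps \<open>M\<close> into \<open>N\<close>. The Frobenius sends \<open>x + N\<close> to \<open>(y + N) / \<rho> s\<close> if that of \<open>M\<close>
  sends \<open>x\<close> to \<open>y / s\<close>.
\<close>
definition quotient_module ::
    "('r \<Rightarrow> 's) \<Rightarrow> ('r, 'm, 'x) module_scheme \<Rightarrow> 'm set \<Rightarrow> ('s, 'm set) module" where
  "quotient_module \<rho> M N = \<lparr>
     carrier = a_rcosets\<^bsub>M\<^esub> N,
     mult = undefined, one = undefined,
     zero = N,
     add = set_add M,
     smult = (\<lambda>a X. \<Union>{N +>\<^bsub>M\<^esub> (r \<odot>\<^bsub>M\<^esub> x) | r x. \<rho> r = a \<and> x \<in> X})\<rparr>"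

definition quotient_phi_module ::
    "('r::idom \<Rightarrow> 's::idom) \<Rightarrow> ('r, 'm) phi_module \<Rightarrow> 'm set \<Rightarrow> ('s, 'm set) phi_module" where
  "quotient_phi_module \<rho> M N = (let Q = quotient_module \<rho> M N in \<lparr>
     carrier = carrier Q, mult = mult Q, one = one Q, zero = zero Q, add = add Q, smult = smult Q,
     frob = (\<lambda>X. \<Union>{fraction Q (N +>\<^bsub>M\<^esub> y) (\<rho> s) | x y s.
       x \<in> X \<and> (y, s) \<in> frob M x \<and> \<rho> s \<noteq> 0})\<rparr>)"

section \<open>Kisin modules\<close>

definition kisin_module ::
    "nat \<Rightarrow> ('w::idom \<Rightarrow> 'w) \<Rightarrow> 'w poly \<Rightarrow> ('w fps, 'm) phi_module \<Rightarrow> bool" where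
  "kisin_module p \<sigma> E M \<longleftrightarrow> frobenius_module (fps_frob p \<sigma>) (fps_of_poly E) M"

definition kisin_degree :: "'w::idom poly \<Rightarrow> ('w fps, 'm) phi_module \<Rightarrow> int" where
  "kisin_degree E M = relative_degree (frac_module M)
     (scalars_local (fps_of_poly E)) (Fract (fps_of_poly E) 1)
     (localize (fps_of_poly E) (frac_module M) (lattice_of M))
     (localize (fps_of_poly E) (frac_module M) (frob_image M))"

definition kisin_slope :: "'w::idom poly \<Rightarrow> ('w fps, 'm) phi_module \<Rightarrow> real" where
  "kisin_slope E M = real_of_int (kisin_degree E M) / real (module_rank M)"

text \<open>Slopes over \<open>F[[u]]\<close>.\<close>
definition torsion_slope :: "('f::field fps, 'm) phi_module \<Rightarrow> real" where
  "torsion_slope N = real_of_int (relative_degree (frac_module N)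
     integral_scalars (Fract fps_X 1) (lattice_of N) (frob_image N)) / real (module_rank N)"

definition torsion_semistable :: "('f::field fps, 'm) phi_module \<Rightarrow> bool" where
  "torsion_semistable M \<longleftrightarrow> (\<forall>N.
     submodule N univ_ring M \<and> N \<noteq> {\<zero>\<^bsub>M\<^esub>} \<and> frob_stable fps_X M N \<and>
     (\<forall>a. \<forall>x\<in>carrier M. a \<noteq> 0 \<and> a \<odot>\<^bsub>M\<^esub> x \<in> N \<longrightarrow> x \<in> N) \<longrightarrow>
     torsion_slope (sub_module M N) \<le> torsion_slope M)"

text \<open>\<open>M/pM\<close> as a module over \<open>F[[u]]\<close>.\<close>
definition mod_p ::
    "nat \<Rightarrow> ('w::idom \<Rightarrow> 'f::field) \<Rightarrow> ('w fps, 'm) phi_module \<Rightarrow> ('f fps, 'm set) phi_module" where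
  "mod_p p res M =
     quotient_phi_module (fps_reduce res) M {of_nat p \<odot>\<^bsub>M\<^esub> x | x. x \<in> carrier M}"

definition kisin_semistable ::
    "nat \<Rightarrow> ('w::idom \<Rightarrow> 'f::field) \<Rightarrow> ('w fps, 'm) phi_module \<Rightarrow> bool" where
  "kisin_semistable p res M \<longleftrightarrow> torsion_semistable (mod_p p res M)"

text \<open>
  The inclusions in the flag are strict because the slope of a graded piece is only defined if the
  piece is nonzero.
\<close>
definition HN_type :: "nat \<Rightarrow> ('w::idom \<Rightarrow> 'f::field) \<Rightarrow> ('w \<Rightarrow> 'w) \<Rightarrow> 'w poly \<Rightarrow>
    ('w fps, 'm) phi_module \<Rightarrow> bool" where
  "HN_type p res \<sigma> E M \<longleftrightarrow> (\<exists>r Fil.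
     Fil 0 = {\<zero>\<^bsub>M\<^esub>} \<and> Fil r = carrier M \<and>
     (\<forall>i\<le>r. submodule (Fil i) univ_ring M \<and> frob_stable (fps_of_poly E) M (Fil i) \<and>
        kisin_module p \<sigma> E (sub_module M (Fil i))) \<and>
     (\<forall>i<r. Fil i \<subset> Fil (Suc i)) \<and>
     (let Gr = (\<lambda>i. quotient_phi_module id (sub_module M (Fil (Suc i))) (Fil i)) in
       (\<forall>i<r. kisin_module p \<sigma> E (Gr i) \<and> kisin_semistable p res (Gr i)) \<and>
       (\<forall>i j. i < j \<and> j < r \<longrightarrow> kisin_slope E (Gr j) < kisin_slope E (Gr i))))"

definition kisin_hom ::
    "('r::idom, 'm) phi_module \<Rightarrow> ('r, 'n) phi_module \<Rightarrow> ('m \<Rightarrow> 'n) set" where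
  "kisin_hom M M' = {f. f \<in> carrier M \<rightarrow> carrier M' \<and>
     (\<forall>x\<in>carrier M. \<forall>y\<in>carrier M. f (x \<oplus>\<^bsub>M\<^esub> y) = f x \<oplus>\<^bsub>M'\<^esub> f y) \<and>
     (\<forall>a. \<forall>x\<in>carrier M. f (a \<odot>\<^bsub>M\<^esub> x) = a \<odot>\<^bsub>M'\<^esub> f x) \<and>
     (\<forall>x\<in>carrier M. \<forall>(y, s)\<in>frob M x. frob M' (f x) = fraction M' (f y) s)}"

text \<open>
  A morphism in the isogeny category is an element \<open>f / p ^ a\<close> of \<open>Hom[1/p]\<close>, and \<open>h / p ^ a\<close> and
  \<open>h' / p ^ b\<close> agree there iff \<open>p ^ (c + b) h = p ^ (c + a) h'\<close> for some \<open>c\<close>. The definition says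
  that some \<open>f / p ^ a\<close> and \<open>g / p ^ b\<close> are inverse to each other.
\<close>
definition isogenous ::
    "nat \<Rightarrow> ('r::idom, 'm) phi_module \<Rightarrow> ('r, 'n) phi_module \<Rightarrow> bool" where
  "isogenous p M M' \<longleftrightarrow> (\<exists>f\<in>kisin_hom M M'. \<exists>g\<in>kisin_hom M' M. \<exists>a b c.
     (\<forall>x\<in>carrier M. of_nat p ^ c \<odot>\<^bsub>M\<^esub> g (f x) = of_nat p ^ (c + a + b) \<odot>\<^bsub>M\<^esub> x) \<and>
     (\<forall>y\<in>carrier M'. of_nat p ^ c \<odot>\<^bsub>M'\<^esub> f (g y) = of_nat p ^ (c + a + b) \<odot>\<^bsub>M'\<^esub> y))"

end

theory Submission
  imports "Jordan_Normal_Form.Char_Poly" Defs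
begin

text \<open>
  In coordinates, a Kisin module with \<open>E ^ h\<close> times its Frobenius integral is a square matrix \<open>A\<close> over
  \<open>S = W(F)[[u]]\<close> whose determinant divides a power of \<open>E\<close>, and its slope is \<open>h - v(det A) / n\<close>, where \<open>v\<close>
  is the \<open>E\<close>-adic valuation. As \<open>E\<close> is \<open>u ^ e\<close> modulo \<open>p\<close>, slopes can be read off modulo \<open>p\<close>.

  The proof is Langton's algorithm. In an isogeny class choose a lattice whose reduction modulo \<open>p\<close> has
  the smallest possible maximal slope and, then, the smallest possible rank of the maximal
  destabilizing submodule \<open>D\<close>. Modifying the lattice along \<open>D\<close> gives a lattice whose reduction is an
  extension of \<open>D\<close> by the quotient; by minimality its destabilizing submodule is a complement mapping
  isomorphically to \<open>D\<close>, because a proper inclusion of modules of equal rank lowers the degree by a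
  multiple of \<open>p - 1\<close>. Hence the modifications can be iterated, they converge \<open>p\<close>-adically, and \<open>D\<close>
  lifts to a Frobenius-stable direct summand of the lattice. All slopes of the quotient modulo \<open>p\<close>
  are smaller than that of \<open>D\<close>, so induction on the rank applies to it.
\<close>

text \<open>The chain of modified lattices is traded for one equation. In a basis lifting one
  adapted to \<open>D\<close> the Frobenius has blocks \<open>a, b, c, d\<close> with
  \<open>c\<close> divisible by \<open>p\<close>, and the graph of \<open>X\<close> is stable iff
  \<open>c + d \<phi>(X) = X (a + b \<phi>(X))\<close>. If \<open>X\<close> solves this modulo
  \<open>p ^ j\<close>, with error \<open>p ^ j c'\<close>, then scaling the complement by
  \<open>p ^ j\<close> gives a lattice whose reduction has \<open>c'\<close> below the diagonal.
  Gaining one more power of \<open>p\<close> amounts to solving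
  \<open>c' + d \<phi>(x) = x a\<close> modulo \<open>p\<close>, and such an \<open>x\<close> is
  exactly a complement mapping isomorphically to \<open>D\<close>; this is where minimality enters.

  A best lattice exists because an isogeny changes determinants only by units: throughout the class
  the valuation of a destabilizing submodule is at most that of the reduced determinant. A large
  slope is a small \<open>v / k\<close>, so the best lattice maximizes \<open>v / k\<close>.

  The factor \<open>p - 1\<close> has this origin: an inclusion \<open>T\<close> of modules with
  Frobenius \<open>y\<close> and \<open>\<alpha>\<close> satisfies
  \<open>\<alpha> \<phi>(T) = T y\<close>, and \<open>\<phi>\<close> multiplies the valuation of
  \<open>det T\<close> by \<open>p\<close>.\<close>

lemma swaprows_mat_det_unit:
  assumes "k < n" "l < n"
  shows "det (swaprows_mat n k l :: 'r::comm_ring_1 mat) dvd 1"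
proof (cases "k = l")
  case True
  have "swaprows_mat n k l = (1\<^sub>m n :: 'r mat)"
    unfolding True by (rule eq_matI) auto
  then show ?thesis by simp
next
  case False
  then show ?thesis using det_swaprows_mat[OF assms False, where ?'a = 'r] by simp
qed

lemma prime_elem_not_dvd_unit:
  assumes "prime_elem (e :: 'r::idom)" "y dvd 1"
  shows "\<not> e dvd y"
  using assms dvd_trans[of e y 1] by (auto simp: prime_elem_def)

section \<open>Smith normal form after inverting the elements prime to one prime\<close>

definition diag_rect :: "nat \<Rightarrow> nat \<Rightarrow> nat \<Rightarrow> (nat \<Rightarrow> 'r::zero) \<Rightarrow> 'r mat" where
  "diag_rect m n r t = mat m n (\<lambda>(i, j). if i = j \<and> i < r then t i else 0)"

lemma diag_rect_carrier [simp]: "diag_rect m n r t \<in> carrier_mat m n"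
  by (simp add: diag_rect_def)

lemma det_diag_rect:
  "det (diag_rect n n n t :: 'r::comm_ring_1 mat) = (\<Prod>i<n. t i)"
proof -
  have "det (diag_rect n n n t) = prod_list (diag_mat (diag_rect n n n t))"
    by (rule det_upper_triangular[of _ n]) (auto simp: diag_rect_def)
  also have "diag_mat (diag_rect n n n t) = map t [0..<n]"
    by (auto simp: diag_mat_def diag_rect_def)
  also have "prod_list (map t [0..<n]) = prod t (set [0..<n])"
    by (subst prod.distinct_set_conv_list) auto
  finally show ?thesis by (simp add: atLeast0LessThan)
qed

text \<open>Instead of dividing by the pivot \<open>y\<close>, the other rows and columns are
  multiplied by it: \<open>P\<close> has blocks \<open>1, 0, - c, y\<close> and \<open>Q\<close> has
  blocks \<open>1, - r, 0, y\<close>. Their determinants are powers of \<open>y\<close>, hence prime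
  to \<open>e\<close>, and no fractions appear.\<close>

lemma clear_first_row_and_column:
  fixes y :: "'r::idom"
  assumes B: "B \<in> carrier_mat (Suc m) (Suc n)" and y: "B $$ (0, 0) = y"
    and e: "prime_elem e" "\<not> e dvd y"
  shows "\<exists>P Q D. P \<in> carrier_mat (Suc m) (Suc m) \<and> Q \<in> carrier_mat (Suc n) (Suc n) \<and>
    D \<in> carrier_mat m n \<and> \<not> e dvd det P \<and> \<not> e dvd det Q \<and>
    P * B * Q = four_block_mat (mat 1 1 (\<lambda>_. y)) (0\<^sub>m 1 n) (0\<^sub>m m 1) D"
proof -
  obtain Y r c D where sb: "split_block B 1 1 = (Y, r, c, D)"
    by (metis prod_cases4)
  note s = split_block[OF sb, of m n]
  have c: "Y \<in> carrier_mat 1 1" "r \<in> carrier_mat 1 n" "c \<in> carrier_mat m 1" "D \<in> carrier_mat m n"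
    and Beq: "B = four_block_mat Y r c D" using s B by auto
  have Y: "Y = mat 1 1 (\<lambda>_. y)" using sb y by (auto simp: split_block_def Let_def)
  define P where "P = four_block_mat (1\<^sub>m 1) (0\<^sub>m 1 m) (- c) (y \<cdot>\<^sub>m 1\<^sub>m m)"
  define Q where "Q = four_block_mat (1\<^sub>m 1) (- r) (0\<^sub>m n 1) (y \<cdot>\<^sub>m 1\<^sub>m n)"
  define D' where "D' = - c * r + y \<cdot>\<^sub>m D"
  have D': "D' \<in> carrier_mat m n" using c unfolding D'_def by auto
  have cY: "- c * Y + y \<cdot>\<^sub>m c = 0\<^sub>m m 1"
    using c by (intro eq_matI) (auto simp: Y scalar_prod_def)
  have Yr: "Y * - r + y \<cdot>\<^sub>m r = 0\<^sub>m 1 n"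
    using c by (intro eq_matI) (auto simp: Y scalar_prod_def)
  have y1: "(y \<cdot>\<^sub>m 1\<^sub>m m) * c = y \<cdot>\<^sub>m c" "(y \<cdot>\<^sub>m 1\<^sub>m m) * D = y \<cdot>\<^sub>m D"
    "r * (y \<cdot>\<^sub>m 1\<^sub>m n) = y \<cdot>\<^sub>m r" "D' * (y \<cdot>\<^sub>m 1\<^sub>m n) = y \<cdot>\<^sub>m D'"
    using c D' by (auto simp: mult_smult_assoc_mat[of _ m m] mult_smult_distrib[of _ _ n])
  have PB: "P * B = four_block_mat Y r (0\<^sub>m m 1) D'"
    unfolding P_def Beq
    by (subst mult_four_block_mat[of _ 1 1 _ m _ m _ _ 1 _ n])
       (use c cY y1 in \<open>auto simp: D'_def\<close>)
  have PBQ: "P * B * Q = four_block_mat Y (0\<^sub>m 1 n) (0\<^sub>m m 1) (y \<cdot>\<^sub>m D')"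
    unfolding PB unfolding Q_def
    by (subst mult_four_block_mat[of _ 1 1 _ n _ m _ _ 1 _ n])
       (use c Yr y1 D' in \<open>auto\<close>)
  have yk: "\<not> e dvd y ^ k" for k using e prime_elem_dvd_power by blast
  have dP: "det P = y ^ m" unfolding P_def
    by (subst det_four_block_mat_upper_right_zero[of _ 1 _ m]) (use c in auto)
  have dQ: "det Q = y ^ n" unfolding Q_def
    by (subst det_four_block_mat_lower_left_zero[of _ 1 _ n]) (use c in auto)
  show ?thesis
    by (intro exI[of _ P] exI[of _ Q] exI[of _ "y \<cdot>\<^sub>m D'"] conjI)
       (use c D' PBQ Y dP dQ yk in \<open>auto simp: P_def Q_def intro!: four_block_carrier_mat[of _ 1 1, simplified]\<close>)
qed

text \<open>
  Smith normal form over the discrete valuation ring obtained by localizing at the prime element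
  \<open>e\<close>, with denominators cleared: the transformations are only invertible after localization.
\<close>
lemma local_smith_form:
  fixes e :: "'r::idom"
  assumes e: "prime_elem e" and val: "\<And>x. x \<noteq> 0 \<Longrightarrow> \<exists>k y. x = e ^ k * y \<and> \<not> e dvd y"
    and A: "A \<in> carrier_mat m n"
  shows "\<exists>P Q t r. P \<in> carrier_mat m m \<and> Q \<in> carrier_mat n n \<and> \<not> e dvd det P \<and> \<not> e dvd det Q \<and>
    r \<le> m \<and> r \<le> n \<and> (\<forall>i<r. t i \<noteq> 0) \<and> P * A * Q = diag_rect m n r t"
  using A
proof (induction m arbitrary: n A)
  have e1: "\<not> e dvd 1" using e by (auto simp: prime_elem_def)
  have zero_case: "\<exists>P Q t r. P \<in> carrier_mat m m \<and> Q \<in> carrier_mat n n \<and> \<not> e dvd det P \<and>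
      \<not> e dvd det Q \<and> r \<le> m \<and> r \<le> n \<and> (\<forall>i<r. t i \<noteq> 0) \<and> P * A * Q = diag_rect m n r t"
    if "A = 0\<^sub>m m n" for A m n
    by (rule exI[of _ "1\<^sub>m m"], rule exI[of _ "1\<^sub>m n"], rule exI[of _ "\<lambda>_. 0"], rule exI[of _ 0])
       (use that e1 in \<open>auto simp: diag_rect_def zero_mat_def\<close>)
  { case 0
    then show ?case by (intro zero_case) auto }
  { case (Suc m)
    note A = Suc.prems
    show ?case
    proof (cases "A = 0\<^sub>m (Suc m) n")
      case True
      then show ?thesis by (rule zero_case)
    next
      case False
      then obtain i j where ij: "i < Suc m" "j < n" "A $$ (i, j) \<noteq> 0"
        using A by (metis carrier_matD eq_matI index_zero_mat(1) index_zero_mat(2) index_zero_mat(3))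
      define has where "has k \<longleftrightarrow> (\<exists>i<Suc m. \<exists>j<n. \<exists>y. A $$ (i, j) = e ^ k * y \<and> \<not> e dvd y)" for k
      have "\<exists>k. has k" using val[OF ij(3)] ij unfolding has_def by blast
      then have h: "has (LEAST k. has k)" by (rule LeastI_ex)
      \<comment> \<open>\<open>e ^ k\<close> is the highest power dividing every entry of
        \<open>A\<close>, and some entry is \<open>e ^ k\<close> times a factor prime to
        \<open>e\<close>; that entry becomes the pivot.\<close>
      define k where "k = (LEAST k. has k)"
      obtain i j y where y: "i < Suc m" "j < n" "A $$ (i, j) = e ^ k * y" "\<not> e dvd y"
        using h unfolding has_def k_def by blast
      obtain n' where n: "n = Suc n'" using y by (cases n) auto
      have dv: "e ^ k dvd A $$ (i, j)" if "i < Suc m" "j < n" for i j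
      proof (cases "A $$ (i, j) = 0")
        case False
        obtain k' y' where k': "A $$ (i, j) = e ^ k' * y'" "\<not> e dvd y'" using val[OF False] by blast
        then have "has k'" unfolding has_def using that by blast
        then have "k \<le> k'" unfolding k_def by (rule Least_le)
        then show ?thesis using k' by (auto simp: le_imp_power_dvd)
      qed simp
      define B where "B = mat (Suc m) n (\<lambda>(i, j). SOME z. A $$ (i, j) = e ^ k * z)"
      have Bij: "A $$ (i, j) = e ^ k * B $$ (i, j)" if "i < Suc m" "j < n" for i j
        using dv[OF that] that unfolding B_def dvd_def by (auto intro: someI_ex)
      have Bc: "B \<in> carrier_mat (Suc m) (Suc n')" by (auto simp: B_def n)
      have AB: "A = e ^ k \<cdot>\<^sub>m B" using A Bc Bij by (intro eq_matI) (auto simp: n)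
      have e0: "e \<noteq> 0" using e by auto
      have By: "B $$ (i, j) = y" using Bij[of i j] y e0 by simp
      define P1 where "P1 = (swaprows_mat (Suc m) 0 i :: 'r mat)"
      define Q1 where "Q1 = (swaprows_mat (Suc n') 0 j :: 'r mat)"
      have P1: "P1 \<in> carrier_mat (Suc m) (Suc m)" "\<not> e dvd det P1"
        unfolding P1_def using y prime_elem_not_dvd_unit[OF e swaprows_mat_det_unit] by auto
      have Q1: "Q1 \<in> carrier_mat (Suc n') (Suc n')" "\<not> e dvd det Q1"
        unfolding Q1_def using y n prime_elem_not_dvd_unit[OF e swaprows_mat_det_unit] by auto
      have "P1 * B * Q1 = swapcols 0 j (swaprows 0 i B)"
        unfolding P1_def Q1_def using y n Bc
        by (subst swapcols_mat[of _ "Suc m" "Suc n'"], auto simp: swaprows_mat[of _ "Suc m" "Suc n'"])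
      then have B00: "(P1 * B * Q1) $$ (0, 0) = y" using Bc y n By by auto
      have c1: "P1 * B * Q1 \<in> carrier_mat (Suc m) (Suc n')" using P1 Q1 Bc by auto
      obtain P2 Q2 D where 2: "P2 \<in> carrier_mat (Suc m) (Suc m)" "Q2 \<in> carrier_mat (Suc n') (Suc n')"
        "D \<in> carrier_mat m n'" "\<not> e dvd det P2" "\<not> e dvd det Q2"
        "P2 * (P1 * B * Q1) * Q2 = four_block_mat (mat 1 1 (\<lambda>_. y)) (0\<^sub>m 1 n') (0\<^sub>m m 1) D"
        using clear_first_row_and_column[OF c1 B00 e y(4)] by blast
      obtain P3 Q3 t r where 3: "P3 \<in> carrier_mat m m" "Q3 \<in> carrier_mat n' n'" "\<not> e dvd det P3"
        "\<not> e dvd det Q3" "r \<le> m" "r \<le> n'" "\<forall>i<r. t i \<noteq> 0" "P3 * D * Q3 = diag_rect m n' r t"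
        using Suc.IH[OF 2(3)] by blast
      define P4 where "P4 = four_block_mat (1\<^sub>m 1) (0\<^sub>m 1 m) (0\<^sub>m m 1) P3"
      define Q4 where "Q4 = four_block_mat (1\<^sub>m 1) (0\<^sub>m 1 n') (0\<^sub>m n' 1) Q3"
      have P4: "P4 \<in> carrier_mat (Suc m) (Suc m)" "\<not> e dvd det P4"
        using 3 unfolding P4_def
        by (auto simp: det_four_block_mat_lower_left_zero[of _ 1 _ m] intro!: four_block_carrier_mat[of _ 1 1, simplified])
      have Q4: "Q4 \<in> carrier_mat (Suc n') (Suc n')" "\<not> e dvd det Q4"
        using 3 unfolding Q4_def
        by (auto simp: det_four_block_mat_lower_left_zero[of _ 1 _ n'] intro!: four_block_carrier_mat[of _ 1 1, simplified])
      define P where "P = P4 * (P2 * P1)"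
      define Q where "Q = Q1 * (Q2 * Q4)"
      have P: "P \<in> carrier_mat (Suc m) (Suc m)" "\<not> e dvd det P"
        using P1 2 P4 unfolding P_def
        by (auto simp: det_mult[of _ "Suc m"] prime_elem_dvd_mult_iff[OF e])
      have Q: "Q \<in> carrier_mat (Suc n') (Suc n')" "\<not> e dvd det Q"
        using Q1 2 Q4 unfolding Q_def
        by (auto simp: det_mult[of _ "Suc n'"] prime_elem_dvd_mult_iff[OF e])
      have "P * B * Q = P4 * (P2 * (P1 * B * Q1) * Q2) * Q4"
        unfolding P_def Q_def using P1 Q1 P4 Q4 2(1-3) Bc
        by (simp add: assoc_mult_mat[of _ "Suc m" "Suc m" _ "Suc m" _ "Suc n'"]
            assoc_mult_mat[of _ "Suc m" "Suc m" _ "Suc n'" _ "Suc n'"]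
            assoc_mult_mat[of _ "Suc m" "Suc m" _ "Suc m" _ "Suc m"]
            assoc_mult_mat[of _ "Suc m" "Suc n'" _ "Suc n'" _ "Suc n'"]
            assoc_mult_mat[of _ "Suc n'" "Suc n'" _ "Suc n'" _ "Suc n'"]
            del: assoc_mult_mat)
      also have "\<dots> = P4 * four_block_mat (mat 1 1 (\<lambda>_. y)) (0\<^sub>m 1 n') (0\<^sub>m m 1) D * Q4"
        by (simp only: 2(6))
      also have "P4 * four_block_mat (mat 1 1 (\<lambda>_. y)) (0\<^sub>m 1 n') (0\<^sub>m m 1) D =
          four_block_mat (mat 1 1 (\<lambda>_. y)) (0\<^sub>m 1 n') (0\<^sub>m m 1) (P3 * D)"
        unfolding P4_def by (subst mult_four_block_mat[of _ 1 1 _ m _ m _ _ 1 _ n']) (use 2 3 in auto)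
      also have "\<dots> * Q4 = four_block_mat (mat 1 1 (\<lambda>_. y)) (0\<^sub>m 1 n') (0\<^sub>m m 1) (P3 * D * Q3)"
        unfolding Q4_def by (subst mult_four_block_mat[of _ 1 1 _ n' _ m _ _ 1 _ n']) (use 2 3 in auto)
      finally have PBQ: "P * B * Q = four_block_mat (mat 1 1 (\<lambda>_. y)) (0\<^sub>m 1 n') (0\<^sub>m m 1) (diag_rect m n' r t)"
        by (simp only: 3(8))
      \<comment> \<open>The power \<open>e ^ k\<close> split off from \<open>A\<close> returns in
        every diagonal entry.\<close>
      define t' where "t' = (\<lambda>i. e ^ k * (case i of 0 \<Rightarrow> y | Suc i' \<Rightarrow> t i'))"
      have "P * A * Q = e ^ k \<cdot>\<^sub>m (P * B * Q)"
        unfolding AB using P Q Bc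
        by (simp add: mult_smult_distrib[of _ "Suc m" "Suc m" _ "Suc n'"]
            mult_smult_assoc_mat[of _ "Suc m" "Suc n'" _ "Suc n'"] del: assoc_mult_mat)
      also have "\<dots> = diag_rect (Suc m) n (Suc r) t'"
        unfolding PBQ diag_rect_def n t'_def
        by (intro eq_matI) (auto split: nat.splits)
      finally have "P * A * Q = diag_rect (Suc m) n (Suc r) t'" .
      moreover have "\<forall>i<Suc r. t' i \<noteq> 0" using 3(7) e0 y by (auto simp: t'_def split: nat.splits)
      ultimately show ?thesis using P Q 3(5,6) unfolding n
        by (intro exI[of _ P] exI[of _ Q] exI[of _ t'] exI[of _ "Suc r"]) auto
    qed }
qed

section \<open>Invertible matrices and block matrices\<close>

lemma mat_assoc:
  fixes A :: "'r::semiring_0 mat"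
  assumes "dim_col A = dim_row B" "dim_col B = dim_row C"
  shows "A * B * C = A * (B * C)"
  by (rule assoc_mult_mat[of _ "dim_row A" "dim_row B" _ "dim_row C" _ "dim_col C"]) (use assms in auto)

declare assoc_mult_mat [simp del]

lemma (in comm_ring_hom) mat_hom_mult_dim:
  assumes "dim_col A = dim_row B"
  shows "map_mat hom (A * B) = map_mat hom A * map_mat hom B"
  by (rule mat_hom_mult[of _ "dim_row A" "dim_row B" _ "dim_col B"]) (use assms in auto)

lemma (in comm_ring_hom) mat_hom_zero: "map_mat hom (0\<^sub>m m n) = 0\<^sub>m m n"
  by (intro eq_matI) auto

definition inverse_mats :: "nat \<Rightarrow> 'r::comm_ring_1 mat \<Rightarrow> 'r mat \<Rightarrow> bool" where
  "inverse_mats n U V \<longleftrightarrow> U \<in> carrier_mat n n \<and> V \<in> carrier_mat n n \<and> U * V = 1\<^sub>m n \<and> V * U = 1\<^sub>m n"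

lemma inverse_matsD:
  assumes "inverse_mats n U V"
  shows "U \<in> carrier_mat n n" "V \<in> carrier_mat n n" "U * V = 1\<^sub>m n" "V * U = 1\<^sub>m n"
  using assms by (auto simp: inverse_mats_def)

lemma inverse_mats_cancel:
  assumes "inverse_mats n U V"
  shows "A \<in> carrier_mat n m \<Longrightarrow> U * (V * A) = A" "A \<in> carrier_mat n m \<Longrightarrow> V * (U * A) = A"
  using inverse_matsD[OF assms] by (auto simp flip: assoc_mult_mat)

lemma inverse_mats_det:
  assumes "inverse_mats n U V"
  shows "det U * det V = 1" "det U dvd 1" "det V dvd 1"
proof -
  show "det U * det V = 1"
    using inverse_matsD[OF assms] det_mult[of U n V] by simp
  then show "det U dvd 1" "det V dvd 1" by (metis dvd_triv_left, metis dvd_triv_right)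
qed

lemma inverse_mats_exists:
  fixes U :: "'r::comm_ring_1 mat"
  assumes U: "U \<in> carrier_mat n n" and "det U dvd 1"
  shows "\<exists>V. inverse_mats n U V"
proof -
  obtain z where z: "1 = det U * z" using assms(2) by (auto simp: dvd_def)
  note a = adj_mat[OF U]
  have "inverse_mats n U (z \<cdot>\<^sub>m adj_mat U)"
    unfolding inverse_mats_def using U a z
    by (auto simp: mult_smult_distrib[of _ n n _ n] mult_smult_assoc_mat[of _ n n _ n] mult.commute)
  then show ?thesis by blast
qed

lemma inverse_mats_hom:
  assumes "comm_ring_hom f" "inverse_mats n U V"
  shows "inverse_mats n (map_mat f U) (map_mat f V)"
proof -
  interpret f: comm_ring_hom f by fact
  show ?thesis using inverse_matsD[OF assms(2)]
    by (auto simp: inverse_mats_def f.mat_hom_one simp flip: f.mat_hom_mult)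
qed

lemma det_nonzero_cancel_left:
  fixes T :: "'r::idom mat"
  assumes T: "T \<in> carrier_mat n n" "det T \<noteq> 0" and Y: "Y \<in> carrier_mat n m" and 0: "T * Y = 0\<^sub>m n m"
  shows "Y = 0\<^sub>m n m"
proof -
  note a = adj_mat[OF T(1)]
  have "adj_mat T * T * Y = adj_mat T * (T * Y)" using assoc_mult_mat[OF a(1) T(1) Y] .
  then have "det T \<cdot>\<^sub>m Y = 0\<^sub>m n m" using a T Y 0 by (simp add: mult_smult_assoc_mat[of _ n n _ m])
  then have "det T * Y $$ (i, j) = 0" if "i < n" "j < m" for i j
    using that Y by (metis carrier_matD index_smult_mat(1) index_zero_mat(1))
  then show ?thesis using T Y by (intro eq_matI) auto
qed

lemma det_nonzero_cancel_right:
  fixes T :: "'r::idom mat"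
  assumes T: "T \<in> carrier_mat n n" "det T \<noteq> 0" and Y: "Y \<in> carrier_mat m n" and 0: "Y * T = 0\<^sub>m m n"
  shows "Y = 0\<^sub>m m n"
proof -
  note a = adj_mat[OF T(1)]
  have "Y * T * adj_mat T = Y * (T * adj_mat T)" by (rule assoc_mult_mat[OF Y T(1) a(1)])
  then have "det T \<cdot>\<^sub>m Y = 0\<^sub>m m n" using a T Y 0 by (simp add: mult_smult_distrib[of _ m n _ n] del: assoc_mult_mat)
  then have "det T * Y $$ (i, j) = 0" if "i < m" "j < n" for i j
    using that Y by (metis carrier_matD index_smult_mat(1) index_zero_mat(1))
  then show ?thesis using T Y by (intro eq_matI) auto
qed

text \<open>Padding \<open>L\<close> by zero columns and \<open>C\<close> by zero rows to size
  \<open>k\<close> does not change the product. If \<open>n < k\<close>, the padded \<open>L\<close>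
  kills a unit vector, so its determinant is 0, although the two determinants multiply to 1.\<close>

lemma left_invertible_rank_le:
  fixes L :: "'r::idom mat"
  assumes L: "L \<in> carrier_mat k n" and C: "C \<in> carrier_mat n k" and LC: "L * C = 1\<^sub>m k"
  shows "k \<le> n"
proof (rule ccontr)
  assume "\<not> k \<le> n"
  then have nk: "n < k" by simp
  define L' where "L' = mat k k (\<lambda>(i, j). if j < n then L $$ (i, j) else 0)"
  define C' where "C' = mat k k (\<lambda>(i, j). if i < n then C $$ (i, j) else 0)"
  have c: "L' \<in> carrier_mat k k" "C' \<in> carrier_mat k k" by (auto simp: L'_def C'_def)
  have "L' * C' = L * C"
  proof (rule eq_matI)
    fix i j assume ij: "i < dim_row (L * C)" "j < dim_col (L * C)"
    have "(L' * C') $$ (i, j) = (\<Sum>x\<in>{0..<k}. L' $$ (i, x) * C' $$ (x, j))"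
      using ij c L C by (auto simp: scalar_prod_def)
    also have "\<dots> = (\<Sum>x\<in>{0..<n}. L' $$ (i, x) * C' $$ (x, j))"
      by (rule sum.mono_neutral_right) (use nk ij L C in \<open>auto simp: L'_def C'_def\<close>)
    also have "\<dots> = (\<Sum>x\<in>{0..<n}. L $$ (i, x) * C $$ (x, j))"
      by (rule sum.cong) (use nk ij L C in \<open>auto simp: L'_def C'_def\<close>)
    also have "\<dots> = (L * C) $$ (i, j)" using ij L C by (auto simp: scalar_prod_def)
    finally show "(L' * C') $$ (i, j) = (L * C) $$ (i, j)" .
  qed (use c L C in auto)
  then have "det L' * det C' = 1" using LC det_mult[OF c] by simp
  moreover have "det L' = 0"
  proof -
    have "L' *\<^sub>v unit_vec k n = 0\<^sub>v k"
      using nk c by (intro eq_vecI) (auto simp: L'_def)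
    moreover have "unit_vec k n \<noteq> (0\<^sub>v k :: 'r vec)"
      using nk by (metis index_unit_vec(2) index_zero_vec(1) zero_neq_one)
    ultimately show ?thesis
      using det_0_iff_vec_prod_zero[OF c(1)] unit_vec_carrier by blast
  qed
  ultimately show False by simp
qed

lemma four_block_mat_eqD:
  assumes "four_block_mat A B C D = four_block_mat A' B' C' D'"
    and "A \<in> carrier_mat m n" "A' \<in> carrier_mat m n" "B \<in> carrier_mat m n'" "B' \<in> carrier_mat m n'"
    "C \<in> carrier_mat m' n" "C' \<in> carrier_mat m' n" "D \<in> carrier_mat m' n'" "D' \<in> carrier_mat m' n'"
  shows "A = A'" "B = B'" "C = C'" "D = D'"
proof -
  let ?F = "four_block_mat A B C D" and ?G = "four_block_mat A' B' C' D'"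
  have F: "?F $$ x = ?G $$ x" for x by (simp add: assms(1))
  show "A = A'"
  proof (rule eq_matI)
    fix i j assume "i < dim_row A'" "j < dim_col A'"
    then show "A $$ (i, j) = A' $$ (i, j)" using F[of "(i, j)"] assms(2-) by simp
  qed (use assms in auto)
  show "B = B'"
  proof (rule eq_matI)
    fix i j assume "i < dim_row B'" "j < dim_col B'"
    then show "B $$ (i, j) = B' $$ (i, j)" using F[of "(i, n + j)"] assms(2-) by simp
  qed (use assms in auto)
  show "C = C'"
  proof (rule eq_matI)
    fix i j assume "i < dim_row C'" "j < dim_col C'"
    then show "C $$ (i, j) = C' $$ (i, j)" using F[of "(m + i, j)"] assms(2-) by simp
  qed (use assms in auto)
  show "D = D'"
  proof (rule eq_matI)
    fix i j assume "i < dim_row D'" "j < dim_col D'"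
    then show "D $$ (i, j) = D' $$ (i, j)" using F[of "(m + i, n + j)"] assms(2-) by simp
  qed (use assms in auto)
qed

lemma four_block_mat_exists:
  assumes "A \<in> carrier_mat (m + m') (n + n')"
  obtains a b c d where "a \<in> carrier_mat m n" "b \<in> carrier_mat m n'" "c \<in> carrier_mat m' n"
    "d \<in> carrier_mat m' n'" "A = four_block_mat a b c d"
proof -
  obtain a b c d where "split_block A m n = (a, b, c, d)" by (metis prod_cases4)
  from split_block[OF this, of m' n'] that assms show thesis by auto
qed

lemma inverse_mats_triangular:
  fixes X :: "'r::comm_ring_1 mat"
  assumes "X \<in> carrier_mat l k"
  shows "inverse_mats (k + l) (four_block_mat (1\<^sub>m k) (0\<^sub>m k l) X (1\<^sub>m l))
    (four_block_mat (1\<^sub>m k) (0\<^sub>m k l) (- X) (1\<^sub>m l))"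
proof -
  have "- X + X = 0\<^sub>m l k" "X + - X = 0\<^sub>m l k" "- 0\<^sub>m k k = (0\<^sub>m k k :: 'r mat)"
    using assms by (intro eq_matI; auto)+
  then show ?thesis using assms
    by (auto simp: inverse_mats_def mult_four_block_mat[of _ k k _ l _ l _ _ k _ l])
qed

text \<open>Ranks are at most \<open>n\<close>, so multiplying by \<open>n!\<close> turns the
  fractions \<open>v / k\<close> into natural numbers in the same order. This gives slopes a measure
  whose least and greatest values can be taken.\<close>

lemma cross_mult_le_iff_fact:
  fixes k l n v w :: nat
  assumes "0 < k" "k \<le> n" "0 < l" "l \<le> n"
  shows "v * l \<le> w * k \<longleftrightarrow> v * (fact n div k) \<le> w * (fact n div l)"
proof -
  have k: "fact n = k * (fact n div k)" and l: "fact n = l * (fact n div l)"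
    using assms by (simp_all add: dvd_fact)
  have X: "fact n * (v * l) = (k * l) * (v * (fact n div k))" by (subst k) (simp add: ac_simps)
  have Y: "fact n * (w * k) = (k * l) * (w * (fact n div l))" by (subst l) (simp add: ac_simps)
  have "v * l \<le> w * k \<longleftrightarrow> fact n * (v * l) \<le> fact n * (w * k)"
    by (subst nat_mult_le_cancel1) auto
  also have "\<dots> \<longleftrightarrow> v * (fact n div k) \<le> w * (fact n div l)" unfolding X Y
    using assms by (subst nat_mult_le_cancel1) auto
  finally show ?thesis .
qed

section \<open>Modules with Frobenius over \<open>F[[u]]\<close>\<close>

lemma fps_unit_iff_subdegree:
  "(f :: 'f::field fps) dvd 1 \<longleftrightarrow> f \<noteq> 0 \<and> subdegree f = 0"
  by (auto simp: fps_is_unit_iff subdegree_eq_0_iff)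

lemma fps_X_dvd_iff: "fps_X dvd (f :: 'f::field fps) \<longleftrightarrow> f $ 0 = 0"
proof (cases "f = 0")
  case False
  then have "fps_X dvd f \<longleftrightarrow> subdegree f \<noteq> 0" by (simp add: fps_dvd_iff Suc_le_eq)
  then show ?thesis using False by (simp add: subdegree_eq_0_iff)
qed simp

lemma fps_X_prime: "prime_elem (fps_X :: 'f::field fps)"
  by (rule prime_elemI) (auto simp: fps_is_unit_iff fps_X_dvd_iff)

lemma fps_not_X_dvd_iff: "\<not> fps_X dvd (f :: 'f::field fps) \<longleftrightarrow> f dvd 1"
  by (simp add: fps_X_dvd_iff fps_is_unit_iff)

lemma fps_X_valuation:
  assumes "(x :: 'f::field fps) \<noteq> 0"
  shows "\<exists>k y. x = fps_X ^ k * y \<and> \<not> fps_X dvd y"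
proof (intro exI conjI)
  show "x = fps_X ^ subdegree x * unit_factor x"
    by (subst mult.commute) (simp add: subdegree_decompose)
  show "\<not> fps_X dvd unit_factor x" using assms by (simp add: fps_X_dvd_iff)
qed

text \<open>The slope estimates use of the Frobenius of \<open>F[[u]]\<close> that it is an
  injective endomorphism and multiplies valuations by some \<open>q \<ge> 2\<close>.\<close>

locale fps_frobenius = \<phi>: comm_ring_hom \<phi> for \<phi> :: "'f::field fps \<Rightarrow> 'f fps" +
  fixes q :: nat
  assumes phi_zero: "\<phi> f = 0 \<Longrightarrow> f = 0"
    and phi_subdegree: "subdegree (\<phi> f) = q * subdegree f"
    and q_ge_2: "q \<ge> 2"
begin

abbreviation Phi :: "'f fps mat \<Rightarrow> 'f fps mat" where "Phi \<equiv> map_mat \<phi>"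

text \<open>
  The free module with Frobenius matrix \<open>A\<close> has a Frobenius-stable direct summand of rank \<open>k\<close>, spanned
  by the columns of \<open>C\<close>, whose Frobenius determinant has valuation \<open>v\<close>. Its slope is \<open>- v / k\<close> up to
  the twist that makes \<open>A\<close> integral.
\<close>
definition stable_sub :: "'f fps mat \<Rightarrow> nat \<Rightarrow> nat \<Rightarrow> nat \<Rightarrow> bool" where
  "stable_sub A n k v \<longleftrightarrow> 0 < k \<and> (\<exists>C L a. C \<in> carrier_mat n k \<and> L \<in> carrier_mat k n \<and>
     a \<in> carrier_mat k k \<and> L * C = 1\<^sub>m k \<and> A * Phi C = C * a \<and> v = subdegree (det a))"

lemma stable_sub_rank_le: "stable_sub A n k v \<Longrightarrow> k \<le> n"
  unfolding stable_sub_def using left_invertible_rank_le by blast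

lemma stable_sub_self:
  assumes "A \<in> carrier_mat n n" "0 < n"
  shows "stable_sub A n n (subdegree (det A))"
  unfolding stable_sub_def using assms
  by (intro conjI exI[of _ "1\<^sub>m n"] exI[of _ A]) (auto simp: \<phi>.mat_hom_one)

text \<open>Inclusions compose: \<open>C\<close> spans a stable summand with Frobenius
  \<open>A'\<close>, and a stable summand of it is one of the whole module. With
  \<open>m = n\<close> and \<open>C\<close> invertible this is a change of basis.\<close>

lemma stable_sub_trans:
  assumes A: "A \<in> carrier_mat n n" and C: "C \<in> carrier_mat n m" and L: "L \<in> carrier_mat m n"
    and A': "A' \<in> carrier_mat m m" and LC: "L * C = 1\<^sub>m m" and AC: "A * Phi C = C * A'"
    and sub: "stable_sub A' m k v"
  shows "stable_sub A n k v"
proof -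
  obtain C' L' a where 1: "C' \<in> carrier_mat m k" "L' \<in> carrier_mat k m" "a \<in> carrier_mat k k"
    "L' * C' = 1\<^sub>m k" "A' * Phi C' = C' * a" "v = subdegree (det a)" "0 < k"
    using sub unfolding stable_sub_def by blast
  have "L' * L * (C * C') = L' * ((L * C) * C')" using 1(1-3) C L by (simp add: mat_assoc)
  also have "\<dots> = 1\<^sub>m k" unfolding LC using 1 by simp
  finally have i: "L' * L * (C * C') = 1\<^sub>m k" .
  have "A * Phi (C * C') = A * Phi C * Phi C'"
    using 1(1-3) A C by (simp add: \<phi>.mat_hom_mult[of _ n m _ k] assoc_mult_mat[of _ n n _ m _ k])
  also have "\<dots> = C * (A' * Phi C')" unfolding AC using 1(1-3) A' C by (simp add: assoc_mult_mat[of _ n m _ m _ k])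
  also have "\<dots> = C * C' * a" unfolding 1(5) using 1(1-3) C by (simp add: assoc_mult_mat[of _ n m _ k _ k])
  finally show ?thesis unfolding stable_sub_def using 1 C L i
    by (intro conjI exI[of _ "C * C'"] exI[of _ "L' * L"] exI[of _ a]) auto
qed

lemma stable_sub_of_block:
  assumes a: "a \<in> carrier_mat k k" and b: "b \<in> carrier_mat k l" and d: "d \<in> carrier_mat l l"
    and sub: "stable_sub a k m w"
  shows "stable_sub (four_block_mat a b (0\<^sub>m l k) d) (k + l) m w"
proof -
  let ?A = "four_block_mat a b (0\<^sub>m l k) d"
  \<comment> \<open>Blocks of width 0 turn the inclusion of the first \<open>k\<close> coordinates
    into a block matrix, so that block multiplication computes with it.\<close>
  let ?C = "four_block_mat (1\<^sub>m k) (0\<^sub>m k 0) (0\<^sub>m l k) (0\<^sub>m l 0) :: 'f fps mat"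
  let ?L = "four_block_mat (1\<^sub>m k) (0\<^sub>m k l) (0\<^sub>m 0 k) (0\<^sub>m 0 l) :: 'f fps mat"
  let ?a = "four_block_mat a (0\<^sub>m k 0) (0\<^sub>m 0 k) (0\<^sub>m 0 0)"
  have a': "?a = a" using a by (intro eq_matI) auto
  have one: "four_block_mat (1\<^sub>m k) (0\<^sub>m k 0) (0\<^sub>m 0 k) (0\<^sub>m 0 0) = (1\<^sub>m k :: 'f fps mat)"
    by (intro eq_matI) auto
  have PC: "Phi ?C = ?C" by (intro eq_matI) (auto simp: \<phi>.hom_zero)
  have LC: "?L * ?C = 1\<^sub>m k"
    by (subst mult_four_block_mat[of _ k k _ l _ 0 _ _ k _ 0]) (auto simp: one)
  have AC: "?A * Phi ?C = ?C * ?a"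
    unfolding PC by (subst (1 2) mult_four_block_mat[of _ k k _ l _ l _ _ k _ 0] mult_four_block_mat[of _ k k _ 0 _ l _ _ k _ 0])
       (use a b d in auto)
  show ?thesis
    by (rule stable_sub_trans[OF _ _ _ a LC AC[unfolded a'] sub])
       (use a d in \<open>auto intro!: four_block_carrier_mat[of _ k k _ l 0, simplified] four_block_carrier_mat[of _ k k _ 0 l, simplified]\<close>)
qed

text \<open>A vector killed by \<open>a\<close> is killed by \<open>A * Phi C\<close>. But
  \<open>A\<close> is injective and \<open>Phi C\<close> has the left inverse
  \<open>Phi L\<close>.\<close>

lemma stable_sub_det_nonzero:
  assumes A: "A \<in> carrier_mat n n" "det A \<noteq> 0" and C: "C \<in> carrier_mat n k" and L: "L \<in> carrier_mat k n"
    and a: "a \<in> carrier_mat k k" and LC: "L * C = 1\<^sub>m k" and AC: "A * Phi C = C * a"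
  shows "det a \<noteq> 0"
proof
  assume "det a = 0"
  then obtain w where w: "w \<in> carrier_vec k" "w \<noteq> 0\<^sub>v k" "a *\<^sub>v w = 0\<^sub>v k"
    using det_0_iff_vec_prod_zero[OF a] by blast
  have "A *\<^sub>v (Phi C *\<^sub>v w) = (A * Phi C) *\<^sub>v w" using A C w by simp
  also have "\<dots> = C *\<^sub>v (a *\<^sub>v w)" unfolding AC using a C w by simp
  also have "\<dots> = 0\<^sub>v n" unfolding w(3) using C by (intro eq_vecI) auto
  finally have "A *\<^sub>v (Phi C *\<^sub>v w) = 0\<^sub>v n" .
  then have PCw: "Phi C *\<^sub>v w = 0\<^sub>v n"
    using det_0_iff_vec_prod_zero[OF A(1)] A(2) C w by (metis map_carrier_mat mult_mat_vec_carrier)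
  have "w = Phi (L * C) *\<^sub>v w" unfolding LC using w by (simp add: \<phi>.mat_hom_one)
  also have "\<dots> = Phi L *\<^sub>v (Phi C *\<^sub>v w)" using L C w by (simp add: \<phi>.mat_hom_mult[of _ k n _ k])
  also have "\<dots> = 0\<^sub>v k" unfolding PCw using L by (intro eq_vecI) auto
  finally show False using w by simp
qed

text \<open>The new summand is the preimage of the given summand of the quotient \<open>d\<close>.
  It contains the submodule with Frobenius \<open>a\<close>, so ranks and valuations add.\<close>

lemma stable_sub_extend:
  assumes a: "a \<in> carrier_mat k k" and b: "b \<in> carrier_mat k l" and d: "d \<in> carrier_mat l l"
    and nz: "det a \<noteq> 0" "det d \<noteq> 0" and sub: "stable_sub d l m w"
  shows "stable_sub (four_block_mat a b (0\<^sub>m l k) d) (k + l) (k + m) (subdegree (det a) + w)"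
proof -
  obtain C L x where 1: "C \<in> carrier_mat l m" "L \<in> carrier_mat m l" "x \<in> carrier_mat m m"
    "L * C = 1\<^sub>m m" "d * Phi C = C * x" "w = subdegree (det x)" "0 < m"
    using sub unfolding stable_sub_def by blast
  let ?C = "four_block_mat (1\<^sub>m k) (0\<^sub>m k m) (0\<^sub>m l k) C"
  let ?L = "four_block_mat (1\<^sub>m k) (0\<^sub>m k l) (0\<^sub>m m k) L"
  let ?x = "four_block_mat a (b * Phi C) (0\<^sub>m m k) x"
  have PC: "Phi ?C = four_block_mat (1\<^sub>m k) (0\<^sub>m k m) (0\<^sub>m l k) (Phi C)"
    using 1 by (subst map_four_block_mat) (auto simp: \<phi>.mat_hom_one \<phi>.mat_hom_zero)
  have LC: "?L * ?C = 1\<^sub>m (k + m)"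
    by (subst mult_four_block_mat[of _ k k _ l _ m _ _ k _ m]) (use 1 in auto)
  have AC: "four_block_mat a b (0\<^sub>m l k) d * Phi ?C = ?C * ?x"
    unfolding PC using assms 1
    by (simp add: mult_four_block_mat[of _ k k _ l _ l _ _ k _ m] mult_four_block_mat[of _ k k _ m _ l _ _ k _ m])
  have v: "subdegree (det a) + w = subdegree (det ?x)"
    using 1 a b nz stable_sub_det_nonzero[OF d nz(2) 1(1-5)]
    by (subst det_four_block_mat_lower_left_zero[of _ k _ m]) auto
  show ?thesis unfolding stable_sub_def
    by (intro conjI exI[of _ ?C] exI[of _ ?L] exI[of _ ?x] LC AC v)
       (use a 1(1-3,7) in auto)
qed

text \<open>Power series prime to \<open>u\<close> are units, so here the transformations are
  invertible over the ring itself.\<close>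

lemma smith_form:
  fixes A :: "'f fps mat"
  assumes "A \<in> carrier_mat m n"
  obtains P P' Q Q' t r where "inverse_mats m P P'" "inverse_mats n Q Q'" "r \<le> m" "r \<le> n"
    "\<forall>i<r. t i \<noteq> 0" "P * A * Q = diag_rect m n r t"
proof -
  obtain P Q t r where 1: "P \<in> carrier_mat m m" "Q \<in> carrier_mat n n" "\<not> fps_X dvd det P"
    "\<not> fps_X dvd det Q" "r \<le> m" "r \<le> n" "\<forall>i<r. t i \<noteq> 0" "P * A * Q = diag_rect m n r t"
    using local_smith_form[OF fps_X_prime fps_X_valuation assms] by blast
  obtain P' where P': "inverse_mats m P P'"
    using inverse_mats_exists[OF 1(1)] 1(3) fps_not_X_dvd_iff by blast
  obtain Q' where Q': "inverse_mats n Q Q'"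
    using inverse_mats_exists[OF 1(2)] 1(4) fps_not_X_dvd_iff by blast
  show thesis by (rule that[OF P' Q' 1(5-8)])
qed

lemma diag_rect_block:
  "diag_rect (r + m) (r + n) r t = four_block_mat (diag_rect r r r t) (0\<^sub>m r n) (0\<^sub>m m r) (0\<^sub>m m n)"
  by (intro eq_matI) (auto simp: diag_rect_def)

lemma conjugate_det_subdegree:
  assumes "inverse_mats k Q Q'" "a \<in> carrier_mat k k"
  shows "subdegree (det (Q' * a * Phi Q)) = subdegree (det a)"
proof -
  note Q = inverse_matsD[OF assms(1)] inverse_mats_det[OF assms(1)]
  have PQ: "det (Phi Q) dvd 1"
    using Q by (metis \<phi>.hom_det \<phi>.hom_dvd_1)
  have "det (Q' * a * Phi Q) = det Q' * det a * det (Phi Q)"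
    using Q assms(2) by (simp add: det_mult[of _ k])
  moreover have "subdegree (f * g * h) = subdegree g" if "f dvd 1" "h dvd 1" for f g h :: "'f fps"
  proof (cases "g = 0")
    case False
    have "f \<noteq> 0" "h \<noteq> 0" "subdegree f = 0" "subdegree h = 0" using that fps_unit_iff_subdegree by blast+
    then show ?thesis using False by simp
  qed simp
  ultimately show ?thesis using PQ Q by (simp del: fps_is_unit_iff)
qed

text \<open>A left inverse forces the Smith form of \<open>C\<close> to have \<open>k\<close>
  diagonal entries, all of them units. After a base change \<open>Q\<close> of its source,
  \<open>C\<close> is therefore made of the first \<open>k\<close> columns of an invertible matrix,
  so its columns extend to a basis.\<close>

lemma left_invertible_summand:
  fixes C :: "'f fps mat"
  assumes C: "C \<in> carrier_mat (k + l) k" and L: "L \<in> carrier_mat k (k + l)" and LC: "L * C = 1\<^sub>m k"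
  obtains U V Q Q' where "inverse_mats (k + l) U V" "inverse_mats k Q Q'"
    "C * Q = U * four_block_mat (1\<^sub>m k) (0\<^sub>m k 0) (0\<^sub>m l k) (0\<^sub>m l 0)"
proof -
  let ?n = "k + l"
  let ?J = "four_block_mat (1\<^sub>m k) (0\<^sub>m k 0) (0\<^sub>m l k) (0\<^sub>m l 0) :: 'f fps mat"
  obtain P P' Q Q' t r where 1: "inverse_mats ?n P P'" "inverse_mats k Q Q'" "r \<le> ?n" "r \<le> k"
    "\<forall>i<r. t i \<noteq> 0" "P * C * Q = diag_rect ?n k r t"
    by (rule smith_form[OF C])
  note P = inverse_matsD[OF 1(1)] and Q = inverse_matsD[OF 1(2)]
  let ?D = "diag_rect ?n k r t"
  \<comment> \<open>Transported to the Smith bases, \<open>L\<close> is a left inverse of the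
    diagonal matrix; reading off diagonal entries shows that the \<open>t i\<close> are
    units.\<close>
  define X where "X = Q' * L * P'"
  have X: "X \<in> carrier_mat k ?n" unfolding X_def using P Q L by auto
  have "X * ?D = Q' * (L * ((P' * P) * (C * Q)))"
    unfolding X_def 1(6)[symmetric] using P(1,2) Q(1,2) L C by (simp add: mat_assoc)
  also have "\<dots> = Q' * ((L * C) * Q)"
    unfolding P(4) using L C P(1,2) Q(1,2) by (simp add: mat_assoc)
  also have "\<dots> = 1\<^sub>m k" unfolding LC using Q by simp
  finally have XD: "X * ?D = 1\<^sub>m k" .
  have XDi: "(X * ?D) $$ (i, i) = X $$ (i, i) * (if i < r then t i else 0)" if "i < k" for i
  proof -
    have "(X * ?D) $$ (i, i) = (\<Sum>j\<in>{0..<?n}. X $$ (i, j) * ?D $$ (j, i))"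
      using X that by (auto simp: scalar_prod_def diag_rect_def)
    also have "\<dots> = (\<Sum>j\<in>{i}. X $$ (i, j) * ?D $$ (j, i))"
      by (rule sum.mono_neutral_right) (use that in \<open>auto simp: diag_rect_def\<close>)
    also have "\<dots> = X $$ (i, i) * (if i < r then t i else 0)" using that by (auto simp: diag_rect_def)
    finally show ?thesis .
  qed
  have unit: "X $$ (i, i) * (if i < r then t i else 0) = 1" if "i < k" for i
    using XDi[OF that] that unfolding XD by simp
  have r: "r = k"
  proof (rule ccontr)
    assume "r \<noteq> k"
    then have "r < k" using 1 by simp
    from unit[OF this] show False by simp
  qed
  have tu: "t i dvd 1" if "i < k" for i using unit[OF that] that r by (metis dvd_triv_right)
  \<comment> \<open>Filling up with ones turns the rectangular diagonal matrix into an invertible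
    square one.\<close>
  define s where "s = (\<lambda>i. if i < k then t i else 1)"
  define T where "T = diag_rect ?n ?n ?n s"
  have T: "T \<in> carrier_mat ?n ?n" by (simp add: T_def)
  have "det T = (\<Prod>i<?n. s i)" unfolding T_def by (rule det_diag_rect)
  moreover have "(\<Prod>i<m. s i) dvd 1" for m
    by (induction m) (use tu in \<open>auto simp: s_def simp del: fps_is_unit_iff intro: is_unit_mult_iff[THEN iffD2]\<close>)
  ultimately have "det T dvd 1" by simp
  then have U: "det (P' * T) dvd 1" using inverse_mats_det[OF 1(1)] P T
    by (simp add: det_mult[of _ ?n])
  have Uc: "P' * T \<in> carrier_mat ?n ?n" using P T by simp
  obtain V where V: "inverse_mats ?n (P' * T) V" using inverse_mats_exists[OF Uc U] by blast
  have TJ: "T * ?J = ?D"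
  proof (rule eq_matI)
    fix i j assume "i < dim_row ?D" "j < dim_col ?D"
    then have ij: "i < ?n" "j < k" by (auto simp: diag_rect_def)
    have "(T * ?J) $$ (i, j) = (\<Sum>x\<in>{0..<?n}. T $$ (i, x) * ?J $$ (x, j))"
      using ij T by (auto simp: scalar_prod_def)
    also have "\<dots> = (\<Sum>x\<in>{j}. T $$ (i, x) * ?J $$ (x, j))"
      by (rule sum.mono_neutral_right) (use ij in \<open>auto simp: T_def diag_rect_def\<close>)
    also have "\<dots> = ?D $$ (i, j)" using ij r by (auto simp: T_def diag_rect_def s_def)
    finally show "(T * ?J) $$ (i, j) = ?D $$ (i, j)" .
  qed (auto simp: T_def diag_rect_def)
  have "C * Q = P' * (P * (C * Q))" using inverse_mats_cancel(2)[OF 1(1), of "C * Q" k] C Q by simp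
  also have "P * (C * Q) = T * ?J" unfolding TJ 1(6)[symmetric] using P C Q by (simp add: mat_assoc)
  also have "P' * (T * ?J) = P' * T * ?J" using P T by (simp add: mat_assoc)
  finally show thesis using that[OF V 1(2)] by simp
qed

text \<open>In a basis that starts with one of the summand, stability says that the lower left block
  of the Frobenius vanishes. The block \<open>a\<close> arises from the matrix in the definition by
  the base change \<open>Q\<close>, which keeps the valuation of its determinant.\<close>

lemma stable_sub_adapted_basis:
  assumes A: "A \<in> carrier_mat n n" and sub: "stable_sub A n k v"
  obtains U V a b d l where "n = k + l" "inverse_mats n U V" "a \<in> carrier_mat k k"
    "b \<in> carrier_mat k l" "d \<in> carrier_mat l l" "subdegree (det a) = v"
    "A * Phi U = U * four_block_mat a b (0\<^sub>m l k) d"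
proof -
  define l where "l = n - k"
  have n: "n = k + l" using stable_sub_rank_le[OF sub] by (simp add: l_def)
  obtain C L a where 1: "C \<in> carrier_mat n k" "L \<in> carrier_mat k n" "a \<in> carrier_mat k k"
    "L * C = 1\<^sub>m k" "A * Phi C = C * a" "v = subdegree (det a)" "0 < k"
    using sub unfolding stable_sub_def by blast
  define J where "J = (four_block_mat (1\<^sub>m k) (0\<^sub>m k 0) (0\<^sub>m l k) (0\<^sub>m l 0) :: 'f fps mat)"
  obtain U V Q Q' where 2: "inverse_mats n U V" "inverse_mats k Q Q'" "C * Q = U * J"
    by (rule left_invertible_summand[OF 1(1,2)[unfolded n] 1(4), folded n J_def])
  note U = inverse_matsD[OF 2(1)] and Q = inverse_matsD[OF 2(2)]
  have J: "J \<in> carrier_mat n k" unfolding n J_def by (rule four_block_carrier_mat[of _ k k _ l 0, simplified]) auto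
  define a' where "a' = Q' * a * Phi Q"
  have a': "a' \<in> carrier_mat k k" using Q 1 by (auto simp: a'_def intro!: mult_carrier_mat[of _ k k])
  define A' where "A' = V * (A * Phi U)"
  have A': "A' \<in> carrier_mat n n" using U A by (simp add: A'_def)
  have PJ: "Phi J = J" unfolding J_def by (intro eq_matI) (auto simp: \<phi>.hom_zero)
  have "A' * J = V * (A * Phi (U * J))"
    using A U J by (simp add: A'_def \<phi>.mat_hom_mult[of _ n n _ k] PJ mat_assoc)
  also have "\<dots> = V * (A * Phi C * Phi Q)"
    unfolding 2(3)[symmetric] using A U 1(1) Q by (simp add: \<phi>.mat_hom_mult[of _ n k _ k] mat_assoc)
  also have "\<dots> = V * (C * ((Q * Q') * (a * Phi Q)))"
    unfolding 1(5) Q(3) using U 1(1-3) Q by (simp add: mat_assoc)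
  also have "\<dots> = V * ((C * Q) * a')" unfolding a'_def using U(1,2) 1(1-3) Q(1,2) by (simp add: mat_assoc)
  also have "\<dots> = J * a'" unfolding 2(3) using U J a' inverse_mats_cancel(2)[OF 2(1), of "J * a'" k]
    by (simp add: mat_assoc)
  finally have AJ: "A' * J = J * a'" .
  obtain x b y d where bl: "x \<in> carrier_mat k k" "b \<in> carrier_mat k l" "y \<in> carrier_mat l k"
    "d \<in> carrier_mat l l" "A' = four_block_mat x b y d"
    using four_block_mat_exists A' unfolding n by metis
  have e1: "A' * J = four_block_mat x (0\<^sub>m k 0) y (0\<^sub>m l 0)"
    unfolding bl(5) J_def by (subst mult_four_block_mat[of _ k k _ l _ l _ _ k _ 0]) (use bl in auto)
  have "J * four_block_mat a' (0\<^sub>m k 0) (0\<^sub>m 0 k) (0\<^sub>m 0 0) = four_block_mat a' (0\<^sub>m k 0) (0\<^sub>m l k) (0\<^sub>m l 0)"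
    unfolding J_def by (subst mult_four_block_mat[of _ k k _ 0 _ l _ _ k _ 0]) (use a' in auto)
  moreover have "four_block_mat a' (0\<^sub>m k 0) (0\<^sub>m 0 k) (0\<^sub>m 0 0) = a'" using a' by (intro eq_matI) auto
  ultimately have e2: "J * a' = four_block_mat a' (0\<^sub>m k 0) (0\<^sub>m l k) (0\<^sub>m l 0)" by simp
  have xy: "x = a'" "y = 0\<^sub>m l k"
    using four_block_mat_eqD[OF AJ[unfolded e1 e2], of k k 0 l] bl a' by auto
  have "A * Phi U = U * A'" unfolding A'_def using inverse_mats_cancel(1)[OF 2(1), of "A * Phi U" n] A U by simp
  moreover have "subdegree (det a') = v" unfolding a'_def 1(6) by (rule conjugate_det_subdegree[OF 2(2) 1(3)])
  ultimately show thesis using that[OF n 2(1) a' bl(2) bl(4)] bl xy by simp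
qed

text \<open>This is the maximal destabilizing submodule of Harder-Narasimhan theory. Slopes are
  \<open>- v / k\<close> up to a shift, so the largest slope is the smallest \<open>v / k\<close>,
  and ties are broken by the larger rank.\<close>

definition destabilizing :: "'f fps mat \<Rightarrow> nat \<Rightarrow> nat \<Rightarrow> nat \<Rightarrow> bool" where
  "destabilizing A n k v \<longleftrightarrow> stable_sub A n k v \<and>
     (\<forall>l w. stable_sub A n l w \<longrightarrow> v * l \<le> w * k \<and> (v * l = w * k \<longrightarrow> l \<le> k))"

lemma destabilizing_exists:
  assumes A: "A \<in> carrier_mat n n" "0 < n"
  obtains k v where "destabilizing A n k v"
proof -
  \<comment> \<open>This is \<open>n!\<close> times \<open>v / k\<close>, a natural number, so it
    attains a minimum; among the minima the rank, bounded by \<open>n\<close>, attains a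
    maximum.\<close>
  define g where "g = (\<lambda>(k, v). v * (fact n div k) :: nat)"
  define S where "S = {(k, v). stable_sub A n k v}"
  have S: "0 < fst x" "fst x \<le> n" if "x \<in> S" for x
  proof -
    have "stable_sub A n (fst x) (snd x)" using that by (auto simp: S_def)
    then show "0 < fst x" "fst x \<le> n" using stable_sub_rank_le unfolding stable_sub_def by blast+
  qed
  have cmp: "snd x * fst y \<le> snd y * fst x \<longleftrightarrow> g x \<le> g y" if xy: "x \<in> S" "y \<in> S" for x y
    using cross_mult_le_iff_fact[OF S[OF xy(1)] S[OF xy(2)]] by (simp add: g_def case_prod_beta)
  have "(n, subdegree (det A)) \<in> S" using stable_sub_self[OF A] by (simp add: S_def)
  then obtain x0 where x0: "x0 \<in> S" "\<forall>y. y \<in> S \<longrightarrow> g x0 \<le> g y"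
    using ex_has_least_nat[of "\<lambda>x. x \<in> S" _ g] by blast
  obtain x where x: "x \<in> S" "g x = g x0" "\<forall>y. y \<in> S \<and> g y = g x0 \<longrightarrow> fst y \<le> fst x"
  proof -
    have "\<exists>x. (x \<in> S \<and> g x = g x0) \<and> (\<forall>y. (y \<in> S \<and> g y = g x0) \<longrightarrow> fst y \<le> fst x)"
      by (rule ex_has_greatest_nat[of _ x0 _ "Suc n"]) (use x0 S in \<open>auto simp: less_Suc_eq_le\<close>)
    then show thesis using that by blast
  qed
  have "destabilizing A n (fst x) (snd x)"
    unfolding destabilizing_def
  proof (intro conjI allI impI)
    show "stable_sub A n (fst x) (snd x)" using x by (auto simp: S_def)
    fix l w assume "stable_sub A n l w"
    then have y: "(l, w) \<in> S" by (simp add: S_def)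
    then show "snd x * l \<le> w * fst x" using cmp[OF x(1) y] x x0 by simp
    assume "snd x * l = w * fst x"
    then have "g (l, w) \<le> g x" using cmp[OF y x(1)] by simp
    then have "g (l, w) = g x0" using x0 x y by (metis le_antisym)
    then show "l \<le> fst x" using x y by fastforce
  qed
  then show thesis by (rule that)
qed

text \<open>Summands of \<open>a\<close> are summands of \<open>A\<close>. A summand of
  \<open>d\<close> of rank \<open>m\<close> has a preimage of rank \<open>k + m > k\<close>, and
  equality of slopes would contradict the maximality of the rank \<open>k\<close>; hence the strict
  inequality for \<open>d\<close>.\<close>

lemma destabilizing_adapted_basis:
  assumes A: "A \<in> carrier_mat n n" "det A \<noteq> 0" and D: "destabilizing A n k v"
  obtains U V a b d l where "n = k + l" "inverse_mats n U V" "a \<in> carrier_mat k k"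
    "b \<in> carrier_mat k l" "d \<in> carrier_mat l l" "subdegree (det a) = v" "det a \<noteq> 0" "det d \<noteq> 0"
    "A * Phi U = U * four_block_mat a b (0\<^sub>m l k) d"
    "\<forall>m w. stable_sub a k m w \<longrightarrow> v * m \<le> w * k" "\<forall>m w. stable_sub d l m w \<longrightarrow> v * m < w * k"
proof -
  have sub: "stable_sub A n k v"
    and le: "\<And>m w. stable_sub A n m w \<Longrightarrow> v * m \<le> w * k"
    and eq: "\<And>m w. stable_sub A n m w \<Longrightarrow> v * m = w * k \<Longrightarrow> m \<le> k"
    using D by (auto simp: destabilizing_def)
  obtain U V a b d l where 1: "n = k + l" "inverse_mats n U V" "a \<in> carrier_mat k k"
    "b \<in> carrier_mat k l" "d \<in> carrier_mat l l" "subdegree (det a) = v"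
    "A * Phi U = U * four_block_mat a b (0\<^sub>m l k) d"
    by (rule stable_sub_adapted_basis[OF A(1) sub])
  note U = inverse_matsD[OF 1(2)]
  let ?A = "four_block_mat a b (0\<^sub>m l k) d"
  have Ac: "?A \<in> carrier_mat n n" using 1 by auto
  have k0: "0 < k" using sub by (simp add: stable_sub_def)
  have up: "stable_sub A n m w" if "stable_sub ?A n m w" for m w
    using stable_sub_trans[OF A(1) U(1,2) Ac U(4) 1(7) that] .
  have "det (A * Phi U) = det U * det ?A" unfolding 1(7) using U Ac by (simp add: det_mult)
  moreover have "det (A * Phi U) \<noteq> 0"
    using A U inverse_mats_det[OF 1(2)] by (auto simp: det_mult[of _ n] dest: phi_zero)
  ultimately have nz: "det a \<noteq> 0" "det d \<noteq> 0"
    using 1 by (auto simp: det_four_block_mat_lower_left_zero[of _ k _ l])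
  have A1: "v * m \<le> w * k" if "stable_sub a k m w" for m w
    by (rule le[OF up]) (use stable_sub_of_block[OF 1(3-5) that] 1(1) in simp)
  have D1: "v * m < w * k" if s: "stable_sub d l m w" for m w
  proof -
    have "stable_sub A n (k + m) (v + w)"
      using up stable_sub_extend[OF 1(3-5) nz s] 1 by simp
    from le[OF this] eq[OF this] s show ?thesis
      by (auto simp: stable_sub_def algebra_simps le_less)
  qed
  show thesis using that[OF 1(1-6) nz 1(7)] A1 D1 by blast
qed

end

context fps_frobenius
begin

text \<open>
  A stable summand \<open>C\<close> of the extension of \<open>a\<close> by \<open>d\<close> is itself an extension of its image in \<open>a\<close> by its
  intersection with \<open>d\<close>. Slopes in \<open>d\<close> are too small, and passing from the image to its saturation
  raises the slope strictly; so a summand of the slope and rank of \<open>a\<close> is the graph of a map \<open>x\<close>.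
\<close>
lemma stable_sub_graph:
  assumes a: "a \<in> carrier_mat k k" and c: "c \<in> carrier_mat l k" and d: "d \<in> carrier_mat l l"
    and nz: "det a \<noteq> 0" "det d \<noteq> 0" and k0: "0 < k"
    and suba: "\<And>m w. stable_sub a k m w \<Longrightarrow> subdegree (det a) * m \<le> w * k"
    and subd: "\<And>m w. stable_sub d l m w \<Longrightarrow> subdegree (det a) * m < w * k"
    and sub: "stable_sub (four_block_mat a (0\<^sub>m k l) c d) (k + l) k' v'"
    and le: "v' * k \<le> subdegree (det a) * k'"
    and eq: "v' * k = subdegree (det a) * k' \<Longrightarrow> k \<le> k'"
  shows "\<exists>x\<in>carrier_mat l k. c + d * Phi x = x * a"
proof -
  let ?v = "subdegree (det a)"
  let ?B = "four_block_mat a (0\<^sub>m k l) c d"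
  obtain C L y where 1: "C \<in> carrier_mat (k + l) k'" "L \<in> carrier_mat k' (k + l)" "y \<in> carrier_mat k' k'"
    "L * C = 1\<^sub>m k'" "?B * Phi C = C * y" "v' = subdegree (det y)" "0 < k'"
    using sub unfolding stable_sub_def by blast
  have Bc: "?B \<in> carrier_mat (k + l) (k + l)" using a d by simp
  have detB: "det ?B \<noteq> 0"
    using nz a c d by (simp add: det_four_block_mat_upper_right_zero[of _ k _ l])
  have ynz: "det y \<noteq> 0" using stable_sub_det_nonzero[OF Bc detB 1(1-5)] .
  \<comment> \<open>The last \<open>l\<close> coordinates span a stable submodule with Frobenius
    \<open>d\<close>, and \<open>a\<close> is the Frobenius of the quotient. \<open>P\<close>
    projects the summand to this quotient; the blocks of width or height 0 are padding.\<close>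
  obtain P P0 R R0 where C: "P \<in> carrier_mat k k'" "P0 \<in> carrier_mat k 0" "R \<in> carrier_mat l k'"
    "R0 \<in> carrier_mat l 0" "C = four_block_mat P P0 R R0"
    by (rule four_block_mat_exists[of C k l k' 0]) (use 1(1) in auto)
  obtain L1 L2 L3 L4 where L: "L1 \<in> carrier_mat k' k" "L2 \<in> carrier_mat k' l" "L3 \<in> carrier_mat 0 k"
    "L4 \<in> carrier_mat 0 l" "L = four_block_mat L1 L2 L3 L4"
    by (rule four_block_mat_exists[of L k' 0 k l]) (use 1(2) in auto)
  obtain Y Y2 Y3 Y4 where Y: "Y \<in> carrier_mat k' k'" "Y2 \<in> carrier_mat k' 0" "Y3 \<in> carrier_mat 0 k'"
    "Y4 \<in> carrier_mat 0 0" "y = four_block_mat Y Y2 Y3 Y4"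
    by (rule four_block_mat_exists[of y k' 0 k' 0]) (use 1(3) in auto)
  have yY: "y = Y" unfolding Y(5) using Y(1,4) by (intro eq_matI) auto
  have one: "1\<^sub>m k' = four_block_mat (1\<^sub>m k') (0\<^sub>m k' 0) (0\<^sub>m 0 k') (0\<^sub>m 0 0 :: 'f fps mat)"
    by (intro eq_matI) auto
  have PC: "Phi C = four_block_mat (Phi P) (Phi P0) (Phi R) (Phi R0)"
    unfolding C(5) by (rule map_four_block_mat[OF C(1-4)])
  have LC: "L1 * P + L2 * R = 1\<^sub>m k'"
  proof -
    have "L * C = four_block_mat (L1 * P + L2 * R) (L1 * P0 + L2 * R0) (L3 * P + L4 * R) (L3 * P0 + L4 * R0)"
      unfolding C(5) L(5) by (rule mult_four_block_mat) (use C(1-4) L(1-4) in auto)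
    note e = trans[OF trans[OF this[symmetric] 1(4)] one]
    show ?thesis
      by (rule four_block_mat_eqD(1)[OF e, of k' k' 0 0]) (use C(1-4) L(1-4) in auto)
  qed
  have E: "a * Phi P + 0\<^sub>m k l * Phi R = P * Y + P0 * Y3" "c * Phi P + d * Phi R = R * Y + R0 * Y3"
  proof -
    have e1: "?B * Phi C = four_block_mat (a * Phi P + 0\<^sub>m k l * Phi R) (a * Phi P0 + 0\<^sub>m k l * Phi R0)
        (c * Phi P + d * Phi R) (c * Phi P0 + d * Phi R0)"
      unfolding PC by (rule mult_four_block_mat) (use a c d C(1-4) in auto)
    have e2: "C * y = four_block_mat (P * Y + P0 * Y3) (P * Y2 + P0 * Y4) (R * Y + R0 * Y3) (R * Y2 + R0 * Y4)"
      unfolding C(5) Y(5) by (rule mult_four_block_mat) (use Y(1-4) C(1-4) in auto)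
    note e = 1(5)[unfolded e1 e2]
    show "a * Phi P + 0\<^sub>m k l * Phi R = P * Y + P0 * Y3"
      by (rule four_block_mat_eqD(1)[OF e, of k k' 0 l]) (use a c d C(1-4) Y(1-4) in auto)
    show "c * Phi P + d * Phi R = R * Y + R0 * Y3"
      by (rule four_block_mat_eqD(3)[OF e, of k k' 0 l]) (use a c d C(1-4) Y(1-4) in auto)
  qed
  have z: "P0 * Y3 = 0\<^sub>m k k'" "R0 * Y3 = 0\<^sub>m l k'"
    using C(2,4) Y(3) by (auto intro!: eq_matI simp: scalar_prod_def)
  have aP: "a * Phi P = P * y" and cP: "c * Phi P + d * Phi R = R * y"
    using E a d c C(1,3) Y(1) unfolding z yY by auto

  \<comment> \<open>In Smith bases for \<open>P\<close>, \<open>r\<close> is the rank of the image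
    of the summand in the quotient, \<open>k3\<close> the rank of its intersection with the
    submodule, and \<open>T\<close> the inclusion of the image in its saturation.\<close>
  obtain S S' Q Q' t r where sn: "inverse_mats k S S'" "inverse_mats k' Q Q'" "r \<le> k" "r \<le> k'"
    "\<forall>i<r. t i \<noteq> 0" "S * P * Q = diag_rect k k' r t"
    by (rule smith_form[OF C(1)])
  note S = inverse_matsD[OF sn(1)] and Q = inverse_matsD[OF sn(2)]
  define k2 where "k2 = k - r"
  define k3 where "k3 = k' - r"
  have kk: "k = r + k2" "k' = r + k3" using sn by (auto simp: k2_def k3_def)
  define T where "T = diag_rect r r r t"
  have T: "T \<in> carrier_mat r r" "det T \<noteq> 0" using sn(5) by (auto simp: T_def det_diag_rect)
  have SPQ: "S * P * Q = four_block_mat T (0\<^sub>m r k3) (0\<^sub>m k2 r) (0\<^sub>m k2 k3)"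
    unfolding sn(6) T_def unfolding kk by (rule diag_rect_block)
  have PPc: "Phi P \<in> carrier_mat k k'" "Phi Q \<in> carrier_mat k' k'" "Phi S \<in> carrier_mat k k" "Phi S' \<in> carrier_mat k k"
    using C Q S by auto
  \<comment> \<open>\<open>a'\<close> and \<open>y'\<close> are the Frobenius matrices of the
    quotient and of the summand in these bases.\<close>
  define a' where "a' = S * a * Phi S'"
  define y' where "y' = Q' * y * Phi Q"
  have a'c: "a' \<in> carrier_mat k k" and y'c: "y' \<in> carrier_mat k' k'"
    using a S Q 1(3) PPc by (auto simp: a'_def y'_def intro!: mult_carrier_mat)
  have inv: "inverse_mats k (Phi S) (Phi S')" by (rule inverse_mats_hom[OF \<phi>.comm_ring_hom_axioms sn(1)])
  have aS: "a * Phi S' = S' * a'"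
    unfolding a'_def using inverse_mats_cancel(2)[OF sn(1), of "a * Phi S'" k] a S PPc by (simp add: mat_assoc)
  have "a' * Phi (S * P * Q) = S * (a * (Phi S' * (Phi S * (Phi P * Phi Q))))"
    unfolding a'_def using a S(1,2) C(1) Q(1,2) PPc by (simp add: mat_assoc \<phi>.mat_hom_mult_dim)
  also have "Phi S' * (Phi S * (Phi P * Phi Q)) = Phi P * Phi Q"
    by (rule inverse_mats_cancel(2)[OF inv, of _ k']) (use PPc in auto)
  also have "S * (a * (Phi P * Phi Q)) = S * (a * Phi P) * Phi Q"
    using a S(1,2) PPc by (simp add: mat_assoc)
  also have "\<dots> = S * (P * (y * Phi Q))" unfolding aP using S(1,2) C(1) PPc 1(3) by (simp add: mat_assoc)
  also have "\<dots> = S * (P * (Q * (Q' * (y * Phi Q))))"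
    using inverse_mats_cancel(1)[OF sn(2), of "y * Phi Q" k'] 1(3) PPc by simp
  also have "\<dots> = S * P * Q * y'" unfolding y'_def using S(1,2) C(1) PPc 1(3) Q(1,2) by (simp add: mat_assoc)
  finally have ay: "a' * Phi (S * P * Q) = S * P * Q * y'" .
  obtain \<alpha> \<beta> \<gamma> \<delta> where A: "\<alpha> \<in> carrier_mat r r" "\<beta> \<in> carrier_mat r k2" "\<gamma> \<in> carrier_mat k2 r"
    "\<delta> \<in> carrier_mat k2 k2" "a' = four_block_mat \<alpha> \<beta> \<gamma> \<delta>"
    by (rule four_block_mat_exists[of a' r k2 r k2]) (use a'c kk in auto)
  obtain y1 y2 y3 y4 where Y': "y1 \<in> carrier_mat r r" "y2 \<in> carrier_mat r k3" "y3 \<in> carrier_mat k3 r"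
    "y4 \<in> carrier_mat k3 k3" "y' = four_block_mat y1 y2 y3 y4"
    by (rule four_block_mat_exists[of y' r k3 r k3]) (use y'c kk in auto)
  have PSPQ: "Phi (S * P * Q) = four_block_mat (Phi T) (0\<^sub>m r k3) (0\<^sub>m k2 r) (0\<^sub>m k2 k3)"
    unfolding SPQ using T by (subst map_four_block_mat) (auto simp: \<phi>.mat_hom_zero)
  have PT: "Phi T \<in> carrier_mat r r" "det (Phi T) \<noteq> 0" using T phi_zero by auto
  \<comment> \<open>Hence \<open>\<alpha>\<close> is the Frobenius of the saturated image and
    \<open>y1\<close> that of the image itself. The vanishing of \<open>\<gamma>\<close> and
    \<open>y2\<close> says that the saturation and the intersection are stable.\<close>
  have F: "\<alpha> * Phi T = T * y1" "0\<^sub>m r k3 = T * y2" "\<gamma> * Phi T = 0\<^sub>m k2 r"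
  proof -
    have e1: "a' * Phi (S * P * Q) = four_block_mat (\<alpha> * Phi T) (0\<^sub>m r k3) (\<gamma> * Phi T) (0\<^sub>m k2 k3)"
      unfolding PSPQ A(5) by (subst mult_four_block_mat[of _ r r _ k2 _ k2 _ _ r _ k3]) (use A(1-4) PT in auto)
    have e2: "S * P * Q * y' = four_block_mat (T * y1) (T * y2) (0\<^sub>m k2 r) (0\<^sub>m k2 k3)"
      unfolding SPQ Y'(5) by (subst mult_four_block_mat[of _ r r _ k3 _ k2 _ _ r _ k3]) (use T Y'(1-4) in auto)
    note e = ay[unfolded e1 e2]
    show "\<alpha> * Phi T = T * y1" by (rule four_block_mat_eqD(1)[OF e, of r r k3 k2]) (use A(1-4) T PT Y'(1-4) in auto)
    show "0\<^sub>m r k3 = T * y2" by (rule four_block_mat_eqD(2)[OF e, of r r k3 k2]) (use A(1-4) T PT Y'(1-4) in auto)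
    show "\<gamma> * Phi T = 0\<^sub>m k2 r" by (rule four_block_mat_eqD(3)[OF e, of r r k3 k2]) (use A(1-4) T PT Y'(1-4) in auto)
  qed
  have y2: "y2 = 0\<^sub>m r k3" by (rule det_nonzero_cancel_left[OF T Y'(2) F(2)[symmetric]])
  have \<gamma>: "\<gamma> = 0\<^sub>m k2 r" by (rule det_nonzero_cancel_right[OF PT A(3) F(3)])
  have y'sub: "subdegree (det y') = v'" unfolding y'_def 1(6)
    by (rule conjugate_det_subdegree[OF sn(2) 1(3)])
  have y'nz: "det y' \<noteq> 0"
    unfolding y'_def using Q PPc 1(3) ynz inverse_mats_det[OF sn(2)]
    by (auto simp: det_mult[of _ k'] dest: phi_zero)
  have dety': "det y' = det y1 * det y4"
    unfolding Y'(5) y2 by (rule det_four_block_mat_upper_right_zero[OF Y'(1) refl Y'(3,4)])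
  have v': "v' = subdegree (det y1) + subdegree (det y4)"
    using y'nz unfolding y'sub[symmetric] dety' by simp
  have det\<alpha>: "det \<alpha> * \<phi> (det T) = det T * det y1"
    using arg_cong[OF F(1), of det] A(1) PT(1) T(1) Y'(1) by (simp add: det_mult[of _ r])
  have phiT: "\<phi> (det T) \<noteq> 0" using T phi_zero by blast
  have "det \<alpha> \<noteq> 0" using det\<alpha> y'nz dety' T(2) by auto
  \<comment> \<open>The factor \<open>q\<close> comes from \<open>Phi T\<close>: passing from the
    image to its saturation lowers the valuation by \<open>q - 1\<close> times that of
    \<open>det T\<close>.\<close>
  then have v1: "subdegree (det \<alpha>) + q * subdegree (det T) = subdegree (det T) + subdegree (det y1)"
    using arg_cong[OF det\<alpha>, of subdegree] y'nz dety' T(2) phiT by (auto simp: phi_subdegree)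
  have v\<alpha>: "?v * r \<le> subdegree (det \<alpha>) * k"
  proof (cases "r = 0")
    case False
    then have "stable_sub a' k r (subdegree (det \<alpha>))"
      unfolding A(5) \<gamma> kk by (intro stable_sub_of_block stable_sub_self A) auto
    then have "stable_sub a k r (subdegree (det \<alpha>))"
      by (rule stable_sub_trans[OF a S(2,1) a'c S(3) aS])
    from suba[OF this] show ?thesis .
  qed simp

  define PQ where "PQ = P * Q"
  have PQ: "PQ \<in> carrier_mat k k'" "PQ = S' * four_block_mat T (0\<^sub>m r k3) (0\<^sub>m k2 r) (0\<^sub>m k2 k3)"
    unfolding PQ_def using C Q inverse_mats_cancel(2)[OF sn(1), of "P * Q" k'] S(1,2)
    by (auto simp: mat_assoc simp flip: SPQ)
  obtain N1 N2 N3 N4 where N: "N1 \<in> carrier_mat k r" "N2 \<in> carrier_mat k k3" "N3 \<in> carrier_mat 0 r"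
    "N4 \<in> carrier_mat 0 k3" "PQ = four_block_mat N1 N2 N3 N4"
    by (rule four_block_mat_exists[of PQ k 0 r k3]) (use PQ(1) kk in auto)
  \<comment> \<open>The last \<open>k3\<close> columns of \<open>C * Q\<close> project to zero, that
    is, they lie in the submodule with Frobenius \<open>d\<close>.\<close>
  have N2: "N2 = 0\<^sub>m k k3"
  proof (rule eq_matI)
    fix i j assume "i < dim_row (0\<^sub>m k k3 :: 'f fps mat)" "j < dim_col (0\<^sub>m k k3 :: 'f fps mat)"
    then have ij: "i < k" "j < k3" by auto
    have "N2 $$ (i, j) = PQ $$ (i, r + j)" using N ij by auto
    also have "\<dots> = row S' i \<bullet> col (four_block_mat T (0\<^sub>m r k3) (0\<^sub>m k2 r) (0\<^sub>m k2 k3)) (r + j)"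
      unfolding PQ(2) using ij S T kk by simp
    also have "col (four_block_mat T (0\<^sub>m r k3) (0\<^sub>m k2 r) (0\<^sub>m k2 k3)) (r + j) = 0\<^sub>v k"
      using ij T kk by (intro eq_vecI) auto
    finally show "N2 $$ (i, j) = 0\<^sub>m k k3 $$ (i, j)" using ij S by auto
  qed (use N in auto)
  define RQ where "RQ = R * Q"
  have RQ: "RQ \<in> carrier_mat l k'" using C Q by (auto simp: RQ_def)
  obtain R1 R2 R3 R4 where R: "R1 \<in> carrier_mat l r" "R2 \<in> carrier_mat l k3" "R3 \<in> carrier_mat 0 r"
    "R4 \<in> carrier_mat 0 k3" "RQ = four_block_mat R1 R2 R3 R4"
    by (rule four_block_mat_exists[of RQ l 0 r k3]) (use RQ kk in auto)
  have "c * Phi PQ + d * Phi RQ = (c * Phi P + d * Phi R) * Phi Q"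
    unfolding PQ_def RQ_def using c d C Q PPc
    by (simp add: \<phi>.mat_hom_mult_dim mat_assoc add_mult_distrib_mat[of _ l k'])
  also have "\<dots> = R * (Q * (Q' * (y * Phi Q)))"
    unfolding cP using inverse_mats_cancel(1)[OF sn(2), of "y * Phi Q" k'] 1(3) PPc C by (simp add: mat_assoc)
  also have "\<dots> = RQ * y'" unfolding RQ_def y'_def using C(3) PPc 1(3) Q(1,2) by (simp add: mat_assoc)
  finally have cPQ: "c * Phi PQ + d * Phi RQ = RQ * y'" .
  have dR2: "d * Phi R2 = R2 * y4"
  proof -
    have fb: "M = four_block_mat M (0\<^sub>m l 0) (0\<^sub>m 0 n) (0\<^sub>m 0 0)" if "M \<in> carrier_mat l n" for M :: "'f fps mat" and n
      using that by (intro eq_matI) auto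
    have PPQ: "Phi PQ = four_block_mat (Phi N1) (0\<^sub>m k k3) (Phi N3) (Phi N4)"
      unfolding N(5) N2 by (subst map_four_block_mat) (use N(1-4) in \<open>auto simp: \<phi>.mat_hom_zero\<close>)
    have PRQ: "Phi RQ = four_block_mat (Phi R1) (Phi R2) (Phi R3) (Phi R4)"
      unfolding R(5) by (rule map_four_block_mat[OF R(1-4)])
    have "c * Phi PQ = four_block_mat (c * Phi N1) (0\<^sub>m l k3) (0\<^sub>m 0 r) (0\<^sub>m 0 k3)"
    proof -
      have "c * Phi PQ = four_block_mat c (0\<^sub>m l 0) (0\<^sub>m 0 k) (0\<^sub>m 0 0) * four_block_mat (Phi N1) (0\<^sub>m k k3) (Phi N3) (Phi N4)"
        using fb[OF c] PPQ by simp
      also have "\<dots> = four_block_mat (c * Phi N1) (0\<^sub>m l k3) (0\<^sub>m 0 r) (0\<^sub>m 0 k3)"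
        by (subst mult_four_block_mat[of _ l k _ 0 _ 0 _ _ r _ k3]) (use c N(1-4) in auto)
      finally show ?thesis .
    qed
    moreover have "d * Phi RQ = four_block_mat (d * Phi R1) (d * Phi R2) (0\<^sub>m 0 r) (0\<^sub>m 0 k3)"
    proof -
      have "d * Phi RQ = four_block_mat d (0\<^sub>m l 0) (0\<^sub>m 0 l) (0\<^sub>m 0 0) * four_block_mat (Phi R1) (Phi R2) (Phi R3) (Phi R4)"
        using fb[OF d] PRQ by simp
      also have "\<dots> = four_block_mat (d * Phi R1) (d * Phi R2) (0\<^sub>m 0 r) (0\<^sub>m 0 k3)"
        by (subst mult_four_block_mat[of _ l l _ 0 _ 0 _ _ r _ k3]) (use d R(1-4) in auto)
      finally show ?thesis .
    qed
    ultimately have e1: "c * Phi PQ + d * Phi RQ = four_block_mat (c * Phi N1 + d * Phi R1) (d * Phi R2) (0\<^sub>m 0 r) (0\<^sub>m 0 k3)"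
      by (simp, subst add_four_block_mat[of _ l r _ k3 _ 0]) (use c d N(1-4) R(1-4) in auto)
    have e2: "RQ * y' = four_block_mat (R1 * y1 + R2 * y3) (R2 * y4) (R3 * y1 + R4 * y3) (R4 * y4)"
      unfolding R(5) Y'(5) y2 by (subst mult_four_block_mat[of _ l r _ k3 _ 0 _ _ r _ k3]) (use R(1-4) Y'(1,3,4) in auto)
    show ?thesis
      by (rule four_block_mat_eqD(2)[OF cPQ[unfolded e1 e2], of l r k3 0]) (use c d R(1-4) N(1-4) Y'(1,3,4) in auto)
  qed
  \<comment> \<open>\<open>R2\<close> spans the intersection; the left inverse that makes it a
    summand of \<open>d\<close> is cut out of \<open>Q' * L\<close>. The extra 1 records that slopes
    in \<open>d\<close> are strictly too small, and it is absent if the intersection is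
    zero.\<close>
  have v4: "?v * k3 + (if k3 = 0 then 0 else 1) \<le> subdegree (det y4) * k"
  proof (cases "k3 = 0")
    case False
    obtain M1 M2 M3 M4 where M: "M1 \<in> carrier_mat r l" "M2 \<in> carrier_mat r 0" "M3 \<in> carrier_mat k3 l"
      "M4 \<in> carrier_mat k3 0" "Q' * L2 = four_block_mat M1 M2 M3 M4"
      by (rule four_block_mat_exists[of "Q' * L2" r k3 l 0]) (use Q L kk in auto)
    obtain H1 H2 H3 H4 where H: "H1 \<in> carrier_mat r k" "H2 \<in> carrier_mat r 0" "H3 \<in> carrier_mat k3 k"
      "H4 \<in> carrier_mat k3 0" "Q' * L1 = four_block_mat H1 H2 H3 H4"
      by (rule four_block_mat_exists[of "Q' * L1" r k3 k 0]) (use Q L kk in auto)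
    have "Q' * L1 * PQ + Q' * L2 * RQ = Q' * ((L1 * P + L2 * R) * Q)"
      unfolding PQ_def RQ_def using L(1,2) C(1,3) Q(1,2)
      by (simp add: mat_assoc add_mult_distrib_mat[of _ k' k'] mult_add_distrib_mat[of _ k' k' _ k'])
    also have "\<dots> = 1\<^sub>m k'" unfolding LC using Q by simp
    finally have o: "Q' * L1 * PQ + Q' * L2 * RQ = 1\<^sub>m k'" .
    have o1: "Q' * L1 * PQ = four_block_mat (H1 * N1 + H2 * N3) (H2 * N4) (H3 * N1 + H4 * N3) (H4 * N4)"
      unfolding H(5) N(5) N2 by (subst mult_four_block_mat[of _ r k _ 0 _ k3 _ _ r _ k3]) (use H(1-4) N(1,3,4) in auto)
    have o2: "Q' * L2 * RQ = four_block_mat (M1 * R1 + M2 * R3) (M1 * R2 + M2 * R4) (M3 * R1 + M4 * R3) (M3 * R2 + M4 * R4)"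
      unfolding M(5) R(5) by (rule mult_four_block_mat[OF M(1-4) R(1-4)])
    have o3: "four_block_mat (H1 * N1 + H2 * N3 + (M1 * R1 + M2 * R3)) (H2 * N4 + (M1 * R2 + M2 * R4))
        (H3 * N1 + H4 * N3 + (M3 * R1 + M4 * R3)) (H4 * N4 + (M3 * R2 + M4 * R4)) =
      four_block_mat (1\<^sub>m r) (0\<^sub>m r k3) (0\<^sub>m k3 r) (1\<^sub>m k3)"
      using o unfolding o1 o2 kk(2)
      by (subst (asm) add_four_block_mat[of _ r r _ k3 _ k3]) (use H(1-4) N(1,3,4) M(1-4) R(1-4) in auto)
    have "H4 * N4 + (M3 * R2 + M4 * R4) = 1\<^sub>m k3"
      by (rule four_block_mat_eqD(4)[OF o3, of r r k3 k3]) (use H(1-4) N(1,3,4) M(1-4) R(1-4) in auto)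
    moreover have "H4 * N4 = 0\<^sub>m k3 k3" "M4 * R4 = 0\<^sub>m k3 k3"
      using H(4) M(4) N(4) R(4) by (auto intro!: eq_matI simp: scalar_prod_def)
    moreover have "M3 * R2 \<in> carrier_mat k3 k3" using M R by auto
    ultimately have "M3 * R2 = 1\<^sub>m k3" by simp
    then have "stable_sub d l k3 (subdegree (det y4))"
      unfolding stable_sub_def using False R(2) M(3) Y'(4) dR2 by blast
    from subd[OF this] False show ?thesis by simp
  qed simp
  \<comment> \<open>The estimates add up to \<open>?v * k'\<close> plus a defect being at most
    \<open>v' * k\<close>. The defect collects \<open>subdegree (det T) * k\<close> and the 1 for a
    nonzero intersection. The bound \<open>le\<close> leaves no room for it, and then
    \<open>eq\<close> forces \<open>r = k\<close>.\<close>
  have fin: "k3 = 0 \<and> subdegree (det T) = 0 \<and> r = k"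
  proof -
    have "subdegree (det \<alpha>) + subdegree (det T) \<le> subdegree (det y1)"
    proof -
      have "2 * subdegree (det T) \<le> q * subdegree (det T)" using q_ge_2 by simp
      then show ?thesis using v1 by linarith
    qed
    then have "(subdegree (det \<alpha>) + subdegree (det T) + subdegree (det y4)) * k \<le> v' * k"
      unfolding v' by (intro mult_right_mono) auto
    then have "?v * r + subdegree (det T) * k + (?v * k3 + (if k3 = 0 then 0 else 1)) \<le> v' * k"
      using v\<alpha> v4 unfolding distrib_right by linarith
    then have main: "?v * k' + (subdegree (det T) * k + (if k3 = 0 then 0 else 1)) \<le> v' * k"
      unfolding kk(2) distrib_left by linarith
    then have z: "subdegree (det T) * k + (if k3 = 0 then 0 else 1) = 0" using le by linarith
    then have "k3 = 0" "subdegree (det T) = 0" using k0 by (auto split: if_splits)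
    moreover have "k \<le> k'" using eq main le by linarith
    ultimately show ?thesis using kk by linarith
  qed
  then have k'k: "k' = k" and k23: "k2 = 0" "k3 = 0" using kk by auto
  have detP: "det P dvd 1"
  proof -
    have Pc: "P \<in> carrier_mat k k" using C k'k by simp
    have Qc: "Q \<in> carrier_mat k k" using Q k'k by simp
    have "four_block_mat T (0\<^sub>m r k3) (0\<^sub>m k2 r) (0\<^sub>m k2 k3) = T" using T k23 by (intro eq_matI) auto
    then have "S * P * Q = T" using SPQ by simp
    then have "det S * det P * det Q = det T" using S(1) Pc Qc by (auto simp: det_mult[of _ k])
    moreover have "det T dvd 1" using fin T(2) fps_unit_iff_subdegree by blast
    ultimately show ?thesis by (metis dvd_mult_left dvd_mult_right dvd_trans dvd_refl)
  qed
  have Pc: "P \<in> carrier_mat k k" and Rc: "R \<in> carrier_mat l k" using C k'k by auto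
  obtain P' where P': "inverse_mats k P P'" using inverse_mats_exists[OF Pc detP] by blast
  note PP = inverse_matsD[OF P']
  have invP: "inverse_mats k (Phi P) (Phi P')" by (rule inverse_mats_hom[OF \<phi>.comm_ring_hom_axioms P'])
  \<comment> \<open>As \<open>P\<close> is invertible, the summand is the graph of the inverse of
    \<open>P\<close> followed by \<open>R\<close>.\<close>
  define x where "x = R * P'"
  have x: "x \<in> carrier_mat l k" using Rc PP by (simp add: x_def)
  have yP: "y = P' * (a * Phi P)" unfolding aP using inverse_mats_cancel(2)[OF P', of y k] 1(3) k'k by simp
  have "c + d * Phi x = (c * Phi P + d * Phi R) * Phi P'"
    unfolding x_def using c d Rc PP Pc inverse_matsD(3)[OF invP]
    by (simp add: \<phi>.mat_hom_mult_dim mat_assoc add_mult_distrib_mat[of _ l k])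
  also have "\<dots> = R * (P' * (a * (Phi P * Phi P')))"
    unfolding cP yP using a Rc PP(1,2) Pc by (simp add: mat_assoc)
  also have "\<dots> = x * a" unfolding x_def inverse_matsD(3)[OF invP] using a Rc PP by (simp add: mat_assoc)
  finally show ?thesis using x by blast
qed

end

section \<open>The ring \<open>W(F)[[u]]\<close>\<close>

lemma ring_hom_univ_ringD:
  assumes "f \<in> ring_hom univ_ring (univ_ring :: 'b::comm_ring_1 ring)"
  shows "comm_ring_hom (f :: 'a::comm_ring_1 \<Rightarrow> 'b)"
proof -
  have *: "f 1 = 1" "f (x + y) = f x + f y" "f (x * y) = f x * f y" for x y
    using assms by (auto simp: ring_hom_def univ_ring_def)
  then have "f 0 = 0" by (metis add_cancel_right_right)
  with * show ?thesis by unfold_locales auto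
qed

text \<open>Written as a substitution of \<open>u ^ p\<close>, the Frobenius inherits
  multiplicativity from the composition of power series.\<close>

lemma fps_frob_compose:
  assumes "0 < p"
  shows "fps_frob p s f = Abs_fps (\<lambda>n. s (fps_nth f n)) oo (fps_X ^ p :: 'r::comm_ring_1 fps)"
proof (rule fps_ext)
  fix n
  have "(Abs_fps (\<lambda>n. s (fps_nth f n)) oo (fps_X ^ p)) $ n =
      (\<Sum>i = 0..n. s (fps_nth f i) * (if n = p * i then 1 else 0))"
    by (simp add: fps_compose_nth fps_X_power_nth flip: power_mult)
  also have "\<dots> = (\<Sum>i \<in> (if p dvd n then {n div p} else {}). s (fps_nth f i) * (if n = p * i then 1 else 0))"
    by (rule sum.mono_neutral_right) (use assms in \<open>auto simp: div_le_dividend split: if_splits\<close>)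
  also have "\<dots> = fps_frob p s f $ n"
    by (auto simp: fps_frob_def)
  finally show "fps_frob p s f $ n = (Abs_fps (\<lambda>n. s (fps_nth f n)) oo (fps_X ^ p)) $ n" ..
qed

lemma comm_ring_hom_fps_map:
  assumes "comm_ring_hom s"
  shows "comm_ring_hom (\<lambda>f. Abs_fps (\<lambda>n. s (fps_nth f n)))"
proof -
  interpret s: comm_ring_hom s by fact
  show ?thesis
    by unfold_locales (auto simp: fps_eq_iff fps_mult_nth s.hom_sum s.hom_mult s.hom_add)
qed

lemma comm_ring_hom_fps_frob:
  fixes s :: "'r::idom \<Rightarrow> 'r"
  assumes "0 < p" "comm_ring_hom s"
  shows "comm_ring_hom (fps_frob p s)"
proof -
  obtain m where m: "comm_ring_hom m" "fps_frob p s = (\<lambda>f. m f oo (fps_X ^ p))"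
    using comm_ring_hom_fps_map[OF assms(2)] fps_frob_compose[OF assms(1), of s] by blast
  interpret m: comm_ring_hom m by fact
  show ?thesis
    unfolding m(2)
    by unfold_locales
       (use assms(1) in \<open>auto simp: m.hom_add m.hom_mult fps_compose_add_distrib fps_compose_mult_distrib\<close>)
qed

text \<open>Testing divisibility by powers of \<open>p\<close> on coefficients carries separatedness
  and completeness over from \<open>W(F)\<close> to \<open>W(F)[[u]]\<close>.\<close>

lemma fps_dvd_coeffs_iff:
  "(of_nat p ^ n :: 'w::idom fps) dvd f \<longleftrightarrow> (\<forall>i. (of_nat p ^ n :: 'w) dvd f $ i)"
proof -
  have c: "(of_nat p ^ n :: 'w fps) = fps_const (of_nat p ^ n)"
    by (simp add: fps_const_power flip: fps_of_nat)
  show ?thesis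
  proof
    assume "(of_nat p ^ n :: 'w fps) dvd f"
    then show "\<forall>i. (of_nat p ^ n :: 'w) dvd f $ i" unfolding c by (auto simp: dvd_def)
  next
    assume "\<forall>i. (of_nat p ^ n :: 'w) dvd f $ i"
    then obtain g where "\<And>i. f $ i = of_nat p ^ n * g i" unfolding dvd_def by metis
    then have "f = of_nat p ^ n * Abs_fps g" unfolding c by (auto simp: fps_eq_iff)
    then show "(of_nat p ^ n :: 'w fps) dvd f" by simp
  qed
qed

locale witt_base =
  fixes p :: nat and res :: "'w::idom \<Rightarrow> 'f::field" and \<sigma> :: "'w \<Rightarrow> 'w"
  assumes prime_p: "prime p" and witt: "witt_vectors p res \<sigma>"
begin

abbreviation pp :: "'w fps" where "pp \<equiv> of_nat p"

abbreviation \<phi> :: "'w fps \<Rightarrow> 'w fps" where "\<phi> \<equiv> fps_frob p \<sigma>"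

abbreviation \<phi>\<^sub>0 :: "'f fps \<Rightarrow> 'f fps" where "\<phi>\<^sub>0 \<equiv> fps_frob p (\<lambda>x. x ^ p)"

abbreviation red :: "'w fps \<Rightarrow> 'f fps" where "red \<equiv> fps_reduce res"

lemma p_pos: "0 < p" using prime_p prime_gt_0_nat by blast

lemma p_ge_2: "2 \<le> p" using prime_p prime_ge_2_nat by blast

lemma res_hom: "comm_ring_hom res" and \<sigma>_hom: "comm_ring_hom \<sigma>"
  using witt by (auto simp: witt_vectors_def intro: ring_hom_univ_ringD)

lemma res_zero_iff: "res x = 0 \<longleftrightarrow> of_nat p dvd x"
  and res_surj: "surj res" and res_\<sigma>: "res (\<sigma> x) = res x ^ p"
  using witt by (auto simp: witt_vectors_def)

text \<open>Additivity of the \<open>p\<close>-th power on \<open>F\<close> is read off from the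
  endomorphism \<open>\<sigma>\<close> that lifts it.\<close>

lemma power_p_hom: "comm_ring_hom (\<lambda>x::'f. x ^ p)"
proof -
  interpret r: comm_ring_hom res by (rule res_hom)
  interpret s: comm_ring_hom \<sigma> by (rule \<sigma>_hom)
  have ex: "\<exists>y. x = res y" for x using res_surj by (metis surjD)
  show ?thesis
  proof
    fix x y :: 'f
    obtain a b where "x = res a" "y = res b" using ex by metis
    then show "(x + y) ^ p = x ^ p + y ^ p"
      by (metis res_\<sigma> r.hom_add s.hom_add)
  qed (use p_pos in \<open>auto simp: power_mult_distrib\<close>)
qed

sublocale \<phi>: comm_ring_hom \<phi>
  by (rule comm_ring_hom_fps_frob[OF p_pos \<sigma>_hom])

sublocale red: comm_ring_hom red
  unfolding fps_reduce_def[abs_def] by (rule comm_ring_hom_fps_map[OF res_hom])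

text \<open>The lowest term \<open>a u ^ s\<close> goes to \<open>a ^ p u ^ (p s)\<close>, so
  valuations are multiplied by \<open>p\<close>.\<close>

sublocale frob: fps_frobenius \<phi>\<^sub>0 p
proof -
  interpret f: comm_ring_hom \<phi>\<^sub>0 by (rule comm_ring_hom_fps_frob[OF p_pos power_p_hom])
  have nth: "\<phi>\<^sub>0 f $ (p * n) = (f $ n) ^ p" for f :: "'f fps" and n
    using p_pos by (simp add: fps_frob_def)
  have z: "f = 0" if "\<phi>\<^sub>0 f = 0" for f :: "'f fps"
  proof (rule fps_ext)
    fix n
    have "(f $ n) ^ p = 0" using nth[of f n] that by simp
    then show "f $ n = 0 $ n" by simp
  qed
  have "subdegree (\<phi>\<^sub>0 f) = p * subdegree f" for f :: "'f fps"
  proof (cases "f = 0")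
    case True
    then show ?thesis by simp
  next
    case False
    show ?thesis
    proof (rule subdegreeI)
      show "\<phi>\<^sub>0 f $ (p * subdegree f) \<noteq> 0" using nth[of f "subdegree f"] False by simp
      fix i assume i: "i < p * subdegree f"
      show "\<phi>\<^sub>0 f $ i = 0"
      proof (cases "p dvd i")
        case True
        then obtain j where j: "i = p * j" by (auto simp: dvd_def)
        then have "j < subdegree f" using i p_pos by simp
        then have "f $ j = 0" by (rule nth_less_subdegree_zero)
        then have "(f $ j) ^ p = 0" using p_pos by simp
        then show ?thesis unfolding j nth .
      qed (simp add: fps_frob_def)
    qed
  qed
  with z p_ge_2 show "fps_frobenius \<phi>\<^sub>0 p" by unfold_locales auto
qed

lemma red_\<phi>: "red (\<phi> f) = \<phi>\<^sub>0 (red f)"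
proof -
  interpret r: comm_ring_hom res by (rule res_hom)
  show ?thesis by (simp add: fps_eq_iff fps_reduce_def fps_frob_def res_\<sigma>)
qed

lemma red_zero_iff: "red f = 0 \<longleftrightarrow> pp dvd f"
  using fps_dvd_coeffs_iff[of p 1 f] by (simp add: fps_eq_iff fps_reduce_def res_zero_iff)

lemma red_surj: "\<exists>f. red f = g"
proof
  show "red (Abs_fps (\<lambda>n. inv_into UNIV res (g $ n))) = g"
    using res_surj by (simp add: fps_eq_iff fps_reduce_def surj_f_inv_f)
qed

lemma \<phi>_of_nat: "\<phi> (of_nat n) = of_nat n"
  by (induction n) (auto simp: \<phi>.hom_add)

lemma pp_nonzero: "pp \<noteq> 0"
proof
  assume "pp = 0"
  then have "pp $ 0 = 0" by simp
  then have "(of_nat p :: 'w) = 0" by (simp flip: fps_of_nat)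
  then show False using witt by (simp add: witt_vectors_def)
qed

text \<open>The quotient by \<open>p\<close> is the domain \<open>F[[u]]\<close>.\<close>

lemma pp_prime: "prime_elem pp"
proof (rule prime_elemI)
  show "\<not> pp dvd 1" by (metis red.hom_one red_zero_iff zero_neq_one)
  fix a b assume "pp dvd a * b"
  then show "pp dvd a \<or> pp dvd b" by (simp flip: red_zero_iff add: red.hom_mult)
qed (rule pp_nonzero)

lemma pp_separated: "(\<And>n. pp ^ n dvd f) \<Longrightarrow> f = 0"
  using witt unfolding fps_dvd_coeffs_iff by (simp add: fps_eq_iff witt_vectors_def)

lemma pp_complete:
  assumes "\<And>n. pp ^ n dvd s (Suc n) - s n"
  shows "\<exists>l. \<forall>n. pp ^ n dvd l - s n"
proof -
  have "\<exists>l. \<forall>n. of_nat p ^ n dvd l - s n $ i" for i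
  proof -
    have "\<forall>n. of_nat p ^ n dvd s (Suc n) $ i - s n $ i"
      using assms unfolding fps_dvd_coeffs_iff by simp
    moreover have "\<forall>s::nat \<Rightarrow> 'w. (\<forall>n. of_nat p ^ n dvd s (Suc n) - s n) \<longrightarrow> (\<exists>l. \<forall>n. of_nat p ^ n dvd l - s n)"
      using witt unfolding witt_vectors_def by blast
    ultimately show ?thesis by fast
  qed
  then obtain l where "\<And>i n. of_nat p ^ n dvd l i - s n $ i" by metis
  then have "\<forall>n. pp ^ n dvd Abs_fps l - s n" unfolding fps_dvd_coeffs_iff by simp
  then show ?thesis by blast
qed

text \<open>If \<open>g\<close> inverts \<open>f\<close> modulo \<open>p\<close>, then
  \<open>z = 1 - f g\<close> is divisible by \<open>p\<close>, and the geometric series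
  \<open>g (1 + z + z ^ 2 + ...)\<close> converges \<open>p\<close>-adically to an inverse of
  \<open>f\<close>.\<close>

lemma red_unit_imp_unit:
  assumes "red f dvd 1"
  shows "f dvd 1"
proof -
  obtain g0 where "1 = red f * g0" using assms by (auto simp: dvd_def)
  then obtain g where g: "red f * red g = 1" using red_surj[of g0] by auto
  define z where "z = 1 - f * g"
  have "red z = 0" unfolding z_def using g by (simp add: red.hom_minus red.hom_mult)
  then have z: "pp ^ n dvd z ^ n" for n using red_zero_iff dvd_power_same by blast
  define s where "s = (\<lambda>n. g * (\<Sum>i<n. z ^ i))"
  have "pp ^ n dvd s (Suc n) - s n" for n using z[of n] by (simp add: s_def algebra_simps)
  then obtain l where l: "\<And>n. pp ^ n dvd l - s n" using pp_complete by blast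
  have fs: "f * s n = 1 - z ^ n" for n
  proof -
    have "f * s n = (1 - z) * (\<Sum>i<n. z ^ i)" by (simp add: s_def z_def)
    also have "\<dots> = 1 - z ^ n" using one_diff_power_eq[of z n] by simp
    finally show ?thesis .
  qed
  have "f * l - 1 = 0"
  proof (rule pp_separated)
    fix n
    have "f * l - 1 = f * (l - s n) - z ^ n" using fs[of n] by (simp add: algebra_simps)
    then show "pp ^ n dvd f * l - 1" using l[of n] z[of n] by (metis dvd_diff dvd_mult)
  qed
  then show ?thesis by (metis diff_eq_diff_eq diff_self dvd_triv_left)
qed

lemma lift_mat:
  assumes "M \<in> carrier_mat m n"
  obtains N where "N \<in> carrier_mat m n" "map_mat red N = M"
proof
  show "mat m n (\<lambda>ij. SOME f. red f = M $$ ij) \<in> carrier_mat m n" by simp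
  show "map_mat red (mat m n (\<lambda>ij. SOME f. red f = M $$ ij)) = M"
    using assms someI_ex[OF red_surj] by (intro eq_matI) auto
qed

text \<open>Any lift of an invertible matrix is invertible, since its determinant is a unit modulo
  \<open>p\<close>. So bases of the reduction lift to bases.\<close>

lemma lift_inverse_mats:
  assumes "inverse_mats n U V"
  obtains U' V' where "inverse_mats n U' V'" "map_mat red U' = U"
proof -
  obtain U' where U': "U' \<in> carrier_mat n n" "map_mat red U' = U"
    using lift_mat[OF inverse_matsD(1)[OF assms]] by blast
  have "red (det U') dvd 1" using U' inverse_mats_det(2)[OF assms] by (simp flip: red.hom_det)
  then have "det U' dvd 1" by (rule red_unit_imp_unit)
  then show thesis using inverse_mats_exists[OF U'(1)] U' that by blast
qed

end

text \<open>Prime factors are cancelled one at a time. Applied to \<open>E\<close>, it determines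
  the determinant of the Frobenius up to a unit; applied to \<open>p\<close>, that of an
  isogeny.\<close>

lemma prime_power_divisor:
  fixes e :: "'r::idom"
  assumes e: "prime_elem e" and "a dvd e ^ j"
  shows "\<exists>i w. a = e ^ i * w \<and> w dvd 1"
  using assms(2)
proof (induction j arbitrary: a)
  case 0
  then show ?case by (intro exI[of _ 0] exI[of _ a]) auto
next
  case (Suc j)
  show ?case
  proof (cases "e dvd a")
    case True
    then obtain b where b: "a = e * b" by (auto simp: dvd_def)
    then have "b dvd e ^ j" using Suc.prems e by (auto simp: prime_elem_def)
    then obtain i w where "b = e ^ i * w" "w dvd 1" using Suc.IH by blast
    then show ?thesis using b by (intro exI[of _ "Suc i"] exI[of _ w]) (auto simp: ac_simps)
  next
    case False
    obtain c where c: "e ^ Suc j = a * c" using Suc.prems by (auto simp: dvd_def)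
    then have "e dvd a * c" by (metis dvd_triv_left power_Suc)
    then have "e dvd c" using False e prime_elem_dvd_mult_iff by blast
    then obtain c' where "c = e * c'" by (auto simp: dvd_def)
    then have "e * e ^ j = e * (a * c')" using c by (simp add: ac_simps)
    then have "e ^ j = a * c'" using e by (simp add: prime_elem_def)
    then show ?thesis using Suc.IH by simp
  qed
qed

lemma (in comm_ring_hom) mat_hom_smult: "map_mat hom (c \<cdot>\<^sub>m M) = hom c \<cdot>\<^sub>m map_mat hom M"
  by (intro eq_matI) (auto simp: hom_mult)

lemma (in comm_ring_hom) mat_hom_add_dim:
  assumes "M \<in> carrier_mat m n" "N \<in> carrier_mat m n"
  shows "map_mat hom (M + N) = map_mat hom M + map_mat hom N"
  using assms by (intro eq_matI) (auto simp: hom_add)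

lemma (in comm_ring_hom) mat_hom_minus_dim:
  assumes "M \<in> carrier_mat m n" "N \<in> carrier_mat m n"
  shows "map_mat hom (M - N) = map_mat hom M - map_mat hom N"
  using assms by (intro eq_matI) (auto simp: hom_minus)

section \<open>Isogenies of Frobenius matrices\<close>

context witt_base
begin

abbreviation Ph :: "'w fps mat \<Rightarrow> 'w fps mat" where "Ph \<equiv> map_mat \<phi>"

abbreviation Red :: "'w fps mat \<Rightarrow> 'f fps mat" where "Red \<equiv> map_mat red"

lemma \<phi>_pp_power: "\<phi> (pp ^ k) = pp ^ k"
  by (simp add: \<phi>.hom_power \<phi>_of_nat)

lemma Red_Ph: "Red (Ph M) = frob.Phi (Red M)"
  by (intro eq_matI) (auto simp: red_\<phi>)

lemma Red_zeroD:
  assumes "M \<in> carrier_mat m n" "Red M = 0\<^sub>m m n"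
  shows "\<exists>M'\<in>carrier_mat m n. M = pp \<cdot>\<^sub>m M'"
proof -
  have "pp dvd M $$ (i, j)" if "i < m" "j < n" for i j
  proof -
    have "Red M $$ (i, j) = 0" using that by (simp add: assms(2))
    then show ?thesis using that assms(1) red_zero_iff by simp
  qed
  then have *: "\<exists>z. M $$ (i, j) = pp * z" if "i < m" "j < n" for i j using that by (auto simp: dvd_def)
  define M' where "M' = mat m n (\<lambda>(i, j). SOME z. M $$ (i, j) = pp * z)"
  have "M = pp \<cdot>\<^sub>m M'"
    using assms(1) someI_ex[OF *] by (intro eq_matI) (auto simp: M'_def)
  then show ?thesis by (auto simp: M'_def)
qed

lemma Red_pp_smult: "j > 0 \<Longrightarrow> M \<in> carrier_mat m n \<Longrightarrow> Red (pp ^ j \<cdot>\<^sub>m M) = 0\<^sub>m m n"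
proof -
  assume "j > 0" "M \<in> carrier_mat m n"
  moreover have "red pp = 0" by (simp add: red_zero_iff)
  ultimately show ?thesis by (intro eq_matI) (auto simp: red.hom_mult red.hom_power)
qed

text \<open>\<open>U\<close> embeds the lattice with Frobenius \<open>B\<close> into the one with
  Frobenius \<open>A\<close>, with cokernel killed by \<open>pp ^ k\<close>. Compatibility of
  \<open>V\<close> with the Frobenius follows by cancelling \<open>pp ^ k\<close>, which
  \<open>\<phi>\<close> fixes.\<close>

definition isog :: "nat \<Rightarrow> 'w fps mat \<Rightarrow> 'w fps mat \<Rightarrow> bool" where
  "isog n A B \<longleftrightarrow> (\<exists>U V k. U \<in> carrier_mat n n \<and> V \<in> carrier_mat n n \<and> U * V = pp ^ k \<cdot>\<^sub>m 1\<^sub>m n \<and>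
     V * U = pp ^ k \<cdot>\<^sub>m 1\<^sub>m n \<and> A * Ph U = U * B)"

lemma isog_inverse_mats:
  assumes "inverse_mats n U V" "A * Ph U = U * B"
  shows "isog n A B"
  unfolding isog_def using inverse_matsD[OF assms(1)] assms(2)
  by (intro exI[of _ U] exI[of _ V] exI[of _ 0]) auto

lemma isog_refl:
  assumes "A \<in> carrier_mat n n"
  shows "isog n A A"
  by (rule isog_inverse_mats[of _ "1\<^sub>m n" "1\<^sub>m n"])
     (use assms in \<open>auto simp: inverse_mats_def \<phi>.mat_hom_one\<close>)

lemma isog_trans:
  assumes A: "A \<in> carrier_mat n n" and B: "B \<in> carrier_mat n n" and C: "C \<in> carrier_mat n n"
    and AB: "isog n A B" and BC: "isog n B C"
  shows "isog n A C"
proof -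
  obtain U V k where 1: "U \<in> carrier_mat n n" "V \<in> carrier_mat n n" "U * V = pp ^ k \<cdot>\<^sub>m 1\<^sub>m n"
    "V * U = pp ^ k \<cdot>\<^sub>m 1\<^sub>m n" "A * Ph U = U * B" using AB unfolding isog_def by blast
  obtain U' V' k' where 2: "U' \<in> carrier_mat n n" "V' \<in> carrier_mat n n" "U' * V' = pp ^ k' \<cdot>\<^sub>m 1\<^sub>m n"
    "V' * U' = pp ^ k' \<cdot>\<^sub>m 1\<^sub>m n" "B * Ph U' = U' * C" using BC unfolding isog_def by blast
  have mm: "X * (pp ^ i \<cdot>\<^sub>m 1\<^sub>m n) * Y = pp ^ i \<cdot>\<^sub>m (X * Y)"
    if "X \<in> carrier_mat n n" "Y \<in> carrier_mat n n" for X Y :: "'w fps mat" and i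
    using that by (simp add: mult_smult_distrib[of _ n n _ n] mult_smult_assoc_mat[of _ n n _ n])
  have "U * U' * (V' * V) = U * (U' * V') * V" using 1(1,2) 2(1,2) by (simp add: mat_assoc)
  also have "\<dots> = pp ^ (k + k') \<cdot>\<^sub>m 1\<^sub>m n" unfolding 2(3) mm[OF 1(1,2)] 1(3)
    by (intro eq_matI) (auto simp: power_add)
  finally have a: "U * U' * (V' * V) = pp ^ (k + k') \<cdot>\<^sub>m 1\<^sub>m n" .
  have "V' * V * (U * U') = V' * (V * U) * U'" using 1(1,2) 2(1,2) by (simp add: mat_assoc)
  also have "\<dots> = pp ^ (k + k') \<cdot>\<^sub>m 1\<^sub>m n" unfolding 1(4) mm[OF 2(2,1)] 2(4)
    by (intro eq_matI) (auto simp: power_add)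
  finally have b: "V' * V * (U * U') = pp ^ (k + k') \<cdot>\<^sub>m 1\<^sub>m n" .
  have "A * Ph (U * U') = A * Ph U * Ph U'" using A 1(1,2) 2(1,2) by (simp add: \<phi>.mat_hom_mult_dim mat_assoc)
  also have "\<dots> = U * (B * Ph U')" unfolding 1(5) using 1(1) 2(1) B by (simp add: mat_assoc)
  also have "\<dots> = U * U' * C" unfolding 2(5) using 1(1) 2(1) C by (simp add: mat_assoc)
  finally show ?thesis unfolding isog_def using 1(1,2) 2(1,2) a b
    by (intro exI[of _ "U * U'"] exI[of _ "V' * V"] exI[of _ "k + k'"]) auto
qed

text \<open>The determinant of an isogeny is a power of \<open>p\<close> times a unit, and
  \<open>\<phi>\<close> fixes the power of \<open>p\<close>, so it cancels from
  \<open>det A * \<phi> (det U) = det U * det B\<close>.\<close>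

lemma isog_det:
  assumes A: "A \<in> carrier_mat n n" and B: "B \<in> carrier_mat n n" and AB: "isog n A B"
  shows "\<exists>w w'. w dvd 1 \<and> w' dvd 1 \<and> det A * w = det B * w'"
proof -
  obtain U V k where 1: "U \<in> carrier_mat n n" "V \<in> carrier_mat n n" "U * V = pp ^ k \<cdot>\<^sub>m 1\<^sub>m n"
    "V * U = pp ^ k \<cdot>\<^sub>m 1\<^sub>m n" "A * Ph U = U * B" using AB unfolding isog_def by blast
  have "det U * det V = (pp ^ k) ^ n" using 1(1,2) arg_cong[OF 1(3), of det] by (simp add: det_mult)
  then have "det U dvd pp ^ (k * n)" by (metis dvd_triv_left power_mult)
  then obtain i w where w: "det U = pp ^ i * w" "w dvd 1" using prime_power_divisor[OF pp_prime] by blast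
  have "det A * \<phi> (det U) = det U * det B" using arg_cong[OF 1(5), of det] A B 1(1) by (simp add: det_mult[of _ n])
  then have "pp ^ i * (det A * \<phi> w) = pp ^ i * (det B * w)"
    unfolding w by (simp add: \<phi>.hom_mult \<phi>_pp_power ac_simps)
  then have "det A * \<phi> w = det B * w" using pp_nonzero by simp
  then show ?thesis using w(2) \<phi>.hom_dvd_1 by blast
qed

lemma isog_det_Red:
  assumes A: "A \<in> carrier_mat n n" and B: "B \<in> carrier_mat n n" and AB: "isog n A B"
    and nz: "det (Red A) \<noteq> 0"
  shows "det (Red B) \<noteq> 0" "subdegree (det (Red B)) = subdegree (det (Red A))"
proof -
  obtain w w' where w: "w dvd 1" "w' dvd 1" "det A * w = det B * w'" using isog_det[OF A B AB] by blast
  have e: "det (Red A) * red w = det (Red B) * red w'"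
    using arg_cong[OF w(3), of red] by (simp add: red.hom_mult)
  have "red w dvd 1" "red w' dvd 1" using w red.hom_dvd_1 by blast+
  then have u: "red w \<noteq> 0" "red w' \<noteq> 0" "subdegree (red w) = 0" "subdegree (red w') = 0"
    using fps_unit_iff_subdegree by blast+
  show nzB: "det (Red B) \<noteq> 0" using e nz u by auto
  show "subdegree (det (Red B)) = subdegree (det (Red A))"
    using arg_cong[OF e, of subdegree] nz nzB u by simp
qed

text \<open>This is Langton's modification: the new lattice keeps the first \<open>k\<close> basis
  vectors and multiplies the others by \<open>pp ^ j\<close>. The first vectors span a submodule
  stable modulo \<open>pp ^ j\<close>; after the modification, if \<open>j > 0\<close>, it is the
  other vectors whose span is stable modulo \<open>p\<close>, so sub and quotient have changed
  places.\<close>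

lemma isog_scale_block:
  assumes a: "a \<in> carrier_mat k k" and b: "b \<in> carrier_mat k l" and c: "c \<in> carrier_mat l k" and d: "d \<in> carrier_mat l l"
  shows "isog (k + l) (four_block_mat a b (pp ^ j \<cdot>\<^sub>m c) d) (four_block_mat a (pp ^ j \<cdot>\<^sub>m b) c d)"
proof -
  let ?U = "four_block_mat (1\<^sub>m k) (0\<^sub>m k l) (0\<^sub>m l k) (pp ^ j \<cdot>\<^sub>m 1\<^sub>m l)"
  let ?V = "four_block_mat (pp ^ j \<cdot>\<^sub>m 1\<^sub>m k) (0\<^sub>m k l) (0\<^sub>m l k) (1\<^sub>m l)"
  have s: "pp ^ j \<cdot>\<^sub>m 1\<^sub>m (k + l) = four_block_mat (pp ^ j \<cdot>\<^sub>m 1\<^sub>m k) (0\<^sub>m k l) (0\<^sub>m l k) (pp ^ j \<cdot>\<^sub>m 1\<^sub>m l)"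
    by (intro eq_matI) auto
  have PU: "Ph ?U = ?U"
    by (intro eq_matI) (auto simp: \<phi>_pp_power)
  have UV: "?U * ?V = pp ^ j \<cdot>\<^sub>m 1\<^sub>m (k + l)" "?V * ?U = pp ^ j \<cdot>\<^sub>m 1\<^sub>m (k + l)"
    unfolding s by (subst mult_four_block_mat[of _ k k _ l _ l _ _ k _ l]; simp)+
  have "four_block_mat a b (pp ^ j \<cdot>\<^sub>m c) d * Ph ?U = ?U * four_block_mat a (pp ^ j \<cdot>\<^sub>m b) c d"
    unfolding PU using assms
    by (simp add: mult_four_block_mat[of _ k k _ l _ l _ _ k _ l] mult_smult_distrib[of _ k l _ l]
        mult_smult_distrib[of _ l l _ l] mult_smult_assoc_mat[of _ l l _ k] mult_smult_assoc_mat[of _ l l _ l])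
  then show ?thesis unfolding isog_def using UV
    by (intro exI[of _ ?U] exI[of _ ?V] exI[of _ j]) auto
qed

text \<open>Applying the isogeny to the last \<open>l\<close> coordinates alone leaves the submodule
  untouched and changes the off-diagonal block to \<open>b * Ph U\<close>.\<close>

lemma isog_lower_right:
  assumes a: "a \<in> carrier_mat k k" and b: "b \<in> carrier_mat k l" and d: "d \<in> carrier_mat l l" and d': "d' \<in> carrier_mat l l"
    and i: "isog l d d'"
  shows "\<exists>b'\<in>carrier_mat k l. isog (k + l) (four_block_mat a b (0\<^sub>m l k) d) (four_block_mat a b' (0\<^sub>m l k) d')"
proof -
  obtain U V j where 1: "U \<in> carrier_mat l l" "V \<in> carrier_mat l l" "U * V = pp ^ j \<cdot>\<^sub>m 1\<^sub>m l"
    "V * U = pp ^ j \<cdot>\<^sub>m 1\<^sub>m l" "d * Ph U = U * d'" using i unfolding isog_def by blast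
  let ?U = "four_block_mat (1\<^sub>m k) (0\<^sub>m k l) (0\<^sub>m l k) U"
  let ?V = "four_block_mat (pp ^ j \<cdot>\<^sub>m 1\<^sub>m k) (0\<^sub>m k l) (0\<^sub>m l k) V"
  have s: "pp ^ j \<cdot>\<^sub>m 1\<^sub>m (k + l) = four_block_mat (pp ^ j \<cdot>\<^sub>m 1\<^sub>m k) (0\<^sub>m k l) (0\<^sub>m l k) (pp ^ j \<cdot>\<^sub>m 1\<^sub>m l)"
    by (intro eq_matI) auto
  have PU: "Ph ?U = four_block_mat (1\<^sub>m k) (0\<^sub>m k l) (0\<^sub>m l k) (Ph U)"
    using 1 by (subst map_four_block_mat) (auto simp: \<phi>.mat_hom_one \<phi>.mat_hom_zero)
  have UV: "?U * ?V = pp ^ j \<cdot>\<^sub>m 1\<^sub>m (k + l)" "?V * ?U = pp ^ j \<cdot>\<^sub>m 1\<^sub>m (k + l)"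
    unfolding s using 1 by (subst mult_four_block_mat[of _ k k _ l _ l _ _ k _ l]; simp)+
  have "four_block_mat a b (0\<^sub>m l k) d * Ph ?U = four_block_mat a (b * Ph U) (0\<^sub>m l k) (d * Ph U)"
    unfolding PU using assms 1(1,2) by (simp add: mult_four_block_mat[of _ k k _ l _ l _ _ k _ l])
  moreover have "?U * four_block_mat a (b * Ph U) (0\<^sub>m l k) d' = four_block_mat a (b * Ph U) (0\<^sub>m l k) (U * d')"
    using assms 1(1,2) by (simp add: mult_four_block_mat[of _ k k _ l _ l _ _ k _ l])
  ultimately have "isog (k + l) (four_block_mat a b (0\<^sub>m l k) d) (four_block_mat a (b * Ph U) (0\<^sub>m l k) d')"
    unfolding isog_def using UV 1
    by (intro exI[of _ ?U] exI[of _ ?V] exI[of _ j]) auto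
  then show ?thesis using b 1 by (intro bexI[of _ "b * Ph U"]) auto
qed

section \<open>The limit of the modifications\<close>

text \<open>In the basis whose first \<open>k\<close> vectors span the graph of \<open>X\<close>,
  this is the lower left block of the Frobenius. Its vanishing, an equation of Riccati type, says
  that the graph is stable.\<close>

definition residual :: "'w fps mat \<Rightarrow> 'w fps mat \<Rightarrow> 'w fps mat \<Rightarrow> 'w fps mat \<Rightarrow> 'w fps mat \<Rightarrow> 'w fps mat" where
  "residual a b c d X = (c + d * Ph X) - X * (a + b * Ph X)"

lemma residual_conjugate:
  assumes a: "a \<in> carrier_mat k k" and b: "b \<in> carrier_mat k l" and c: "c \<in> carrier_mat l k"
    and d: "d \<in> carrier_mat l l" and X: "X \<in> carrier_mat l k"
  shows "isog (k + l) (four_block_mat a b c d)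
    (four_block_mat (a + b * Ph X) b (residual a b c d X) (d - X * b))"
proof (rule isog_inverse_mats[OF inverse_mats_triangular[OF X]])
  let ?V = "four_block_mat (1\<^sub>m k) (0\<^sub>m k l) X (1\<^sub>m l)"
  have PX: "Ph X \<in> carrier_mat l k" using X by simp
  have PV: "Ph ?V = four_block_mat (1\<^sub>m k) (0\<^sub>m k l) (Ph X) (1\<^sub>m l)"
    using X by (subst map_four_block_mat) (auto simp: \<phi>.mat_hom_one \<phi>.mat_hom_zero)
  have e: "X * (a + b * Ph X) + residual a b c d X = c + d * Ph X" "X * b + (d - X * b) = d"
    using assms PX by (auto intro!: eq_matI simp: residual_def)
  have rc: "residual a b c d X \<in> carrier_mat l k" using assms unfolding residual_def by auto
  have "?V * four_block_mat (a + b * Ph X) b (residual a b c d X) (d - X * b) =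
      four_block_mat (a + b * Ph X) b (c + d * Ph X) d"
    by (subst mult_four_block_mat[of _ k k _ l _ l _ _ k _ l]) (use assms rc e in auto)
  moreover have "four_block_mat a b c d * Ph ?V = four_block_mat (a + b * Ph X) b (c + d * Ph X) d"
    unfolding PV by (subst mult_four_block_mat[of _ k k _ l _ l _ _ k _ l]) (use assms PX in auto)
  ultimately show "four_block_mat a b c d * Ph ?V =
      ?V * four_block_mat (a + b * Ph X) b (residual a b c d X) (d - X * b)" by simp
qed

text \<open>This is an exact expansion around \<open>X\<close>: \<open>s\<close> is fixed by
  \<open>\<phi>\<close> and can be pulled out, and the last term is the quadratic one.\<close>

lemma residual_shift:
  assumes a: "a \<in> carrier_mat k k" and b: "b \<in> carrier_mat k l" and c: "c \<in> carrier_mat l k"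
    and d: "d \<in> carrier_mat l l" and X: "X \<in> carrier_mat l k" and x: "x \<in> carrier_mat l k" and s: "\<phi> s = s"
  shows "residual a b c d (X + s \<cdot>\<^sub>m x) = residual a b c d X +
    s \<cdot>\<^sub>m (d * Ph x - X * (b * Ph x) - x * (a + b * Ph X) - s \<cdot>\<^sub>m (x * (b * Ph x)))"
proof -
  have P: "Ph (X + s \<cdot>\<^sub>m x) = Ph X + s \<cdot>\<^sub>m Ph x"
    using X x s by (intro eq_matI) (auto simp: \<phi>.hom_add \<phi>.hom_mult)
  have PX: "Ph X \<in> carrier_mat l k" "Ph x \<in> carrier_mat l k" using X x by auto
  let ?a2 = "a + b * Ph X" and ?bx = "b * Ph x"
  have c2: "?a2 \<in> carrier_mat k k" "?bx \<in> carrier_mat k k" using a b PX by auto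
  have 1: "d * (Ph X + s \<cdot>\<^sub>m Ph x) = d * Ph X + s \<cdot>\<^sub>m (d * Ph x)"
    using d PX by (simp add: mult_add_distrib_mat[of _ l l] mult_smult_distrib[of _ l l _ k])
  have 2: "a + b * (Ph X + s \<cdot>\<^sub>m Ph x) = ?a2 + s \<cdot>\<^sub>m ?bx"
    using a b PX by (simp add: mult_add_distrib_mat[of _ k l] mult_smult_distrib[of _ k l _ k] assoc_add_mat[of _ k k])
  let ?Y = "?a2 + s \<cdot>\<^sub>m ?bx"
  have Y: "?Y \<in> carrier_mat k k" using c2 by simp
  have 3: "(X + s \<cdot>\<^sub>m x) * ?Y = X * ?Y + s \<cdot>\<^sub>m (x * ?Y)"
    using X x Y by (simp add: add_mult_distrib_mat[of _ l k] mult_smult_assoc_mat[of _ l k _ k])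
  have 4: "Z * ?Y = Z * ?a2 + s \<cdot>\<^sub>m (Z * ?bx)" if "Z \<in> carrier_mat l k" for Z
    using that c2 by (simp add: mult_add_distrib_mat[of _ l k _ k] mult_smult_distrib[of _ l k _ k])
  have cc: "d * Ph X \<in> carrier_mat l k" "d * Ph x \<in> carrier_mat l k" "X * ?a2 \<in> carrier_mat l k"
    "x * ?a2 \<in> carrier_mat l k" "X * ?bx \<in> carrier_mat l k" "x * ?bx \<in> carrier_mat l k"
    using d PX X x c2 by auto
  have gen: "(M0 + (M1 + s \<cdot>\<^sub>m M2)) - (M3 + s \<cdot>\<^sub>m M5 + s \<cdot>\<^sub>m (M4 + s \<cdot>\<^sub>m M6)) =
      (M0 + M1) - M3 + s \<cdot>\<^sub>m (M2 - M5 - M4 - s \<cdot>\<^sub>m M6)"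
    if "M0 \<in> carrier_mat l k" "M1 \<in> carrier_mat l k" "M2 \<in> carrier_mat l k" "M3 \<in> carrier_mat l k"
      "M4 \<in> carrier_mat l k" "M5 \<in> carrier_mat l k" "M6 \<in> carrier_mat l k" for M0 M1 M2 M3 M4 M5 M6
    using that by (intro eq_matI) (auto simp: algebra_simps)
  have "residual a b c d (X + s \<cdot>\<^sub>m x) = (c + (d * Ph X + s \<cdot>\<^sub>m (d * Ph x))) -
      (X * ?a2 + s \<cdot>\<^sub>m (X * ?bx) + s \<cdot>\<^sub>m (x * ?a2 + s \<cdot>\<^sub>m (x * ?bx)))"
    unfolding residual_def P 1 2 3 4[OF X] 4[OF x] ..
  also have "\<dots> = (c + d * Ph X) - X * ?a2 +
      s \<cdot>\<^sub>m (d * Ph x - X * ?bx - x * ?a2 - s \<cdot>\<^sub>m (x * ?bx))"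
    by (rule gen[OF c cc(1,2,3,4,5,6)])
  finally show ?thesis unfolding residual_def .
qed

text \<open>This is the continuity by which a limit of approximate solutions is a solution.\<close>

lemma residual_congruent:
  assumes a: "a \<in> carrier_mat k k" and b: "b \<in> carrier_mat k l" and c: "c \<in> carrier_mat l k"
    and d: "d \<in> carrier_mat l l" and X: "X \<in> carrier_mat l k" and x: "x \<in> carrier_mat l k"
  shows "\<exists>z\<in>carrier_mat l k. residual a b c d (X + pp ^ n \<cdot>\<^sub>m x) = residual a b c d X + pp ^ n \<cdot>\<^sub>m z"
  unfolding residual_shift[OF a b c d X x \<phi>_pp_power]
  by (intro bexI[of _ "d * Ph x - X * (b * Ph x) - x * (a + b * Ph X) - pp ^ n \<cdot>\<^sub>m (x * (b * Ph x))"])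
     (use assms in \<open>auto intro!: minus_carrier_mat\<close>)

text \<open>Successive approximation: if the residual is \<open>pp ^ j\<close> times
  \<open>c'\<close>, the correction of \<open>X\<close> by \<open>pp ^ j\<close> times
  \<open>x\<close> adds to \<open>c'\<close>, modulo \<open>p\<close>, the matrix
  \<open>d \<phi>(x) - x a\<close>, because \<open>X\<close> is zero modulo \<open>p\<close>. So
  \<open>step\<close> gains one power of \<open>p\<close>.\<close>

lemma residual_zero_exists:
  assumes a: "a \<in> carrier_mat k k" and b: "b \<in> carrier_mat k l" and c: "c \<in> carrier_mat l k"
    and d: "d \<in> carrier_mat l l" and c0: "Red c = 0\<^sub>m l k"
    and step: "\<And>X j c'. X \<in> carrier_mat l k \<Longrightarrow> Red X = 0\<^sub>m l k \<Longrightarrow> 0 < j \<Longrightarrow> c' \<in> carrier_mat l k \<Longrightarrow>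
      residual a b c d X = pp ^ j \<cdot>\<^sub>m c' \<Longrightarrow>
      \<exists>x\<in>carrier_mat l k. Red c' + Red d * frob.Phi x = x * Red a"
  shows "\<exists>X\<in>carrier_mat l k. Red X = 0\<^sub>m l k \<and> residual a b c d X = 0\<^sub>m l k"
proof -
  \<comment> \<open>The exponent is one more than the index: the start \<open>X = 0\<close> has
    residual \<open>c\<close>, which is already divisible by \<open>p\<close>.\<close>
  define good where "good j X \<longleftrightarrow> X \<in> carrier_mat l k \<and> Red X = 0\<^sub>m l k \<and>
    (\<exists>c'\<in>carrier_mat l k. residual a b c d X = pp ^ Suc j \<cdot>\<^sub>m c')" for j X
  define rel where "rel j X X' \<longleftrightarrow> (\<exists>x\<in>carrier_mat l k. X' = X + pp ^ Suc j \<cdot>\<^sub>m x)" for j X X'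
  have base: "\<exists>X. good 0 X"
  proof -
    obtain c' where c': "c' \<in> carrier_mat l k" "c = pp \<cdot>\<^sub>m c'" using Red_zeroD[OF c c0] by blast
    have "residual a b c d (0\<^sub>m l k) = c"
      using a b c d unfolding residual_def by (intro eq_matI) (auto simp: \<phi>.mat_hom_zero)
    then show ?thesis unfolding good_def using c' by (intro exI[of _ "0\<^sub>m l k"]) (auto simp: red.mat_hom_zero)
  qed
  have succ: "\<exists>X'. good (Suc j) X' \<and> rel j X X'" if g: "good j X" for j X
  proof -
    obtain c' where X: "X \<in> carrier_mat l k" "Red X = 0\<^sub>m l k" and c': "c' \<in> carrier_mat l k"
      "residual a b c d X = pp ^ Suc j \<cdot>\<^sub>m c'" using g unfolding good_def by blast
    obtain y where y: "y \<in> carrier_mat l k" "Red c' + Red d * frob.Phi y = y * Red a"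
      using step[OF X _ c'] by blast
    obtain x where x: "x \<in> carrier_mat l k" "Red x = y" using lift_mat[OF y(1)] by blast
    let ?s = "pp ^ Suc j"
    let ?Z = "d * Ph x - X * (b * Ph x) - x * (a + b * Ph X) - ?s \<cdot>\<^sub>m (x * (b * Ph x))"
    have PX: "Ph X \<in> carrier_mat l k" "Ph x \<in> carrier_mat l k" using X x by auto
    have cc: "d * Ph x \<in> carrier_mat l k" "X * (b * Ph x) \<in> carrier_mat l k" "x * (a + b * Ph X) \<in> carrier_mat l k"
      "x * (b * Ph x) \<in> carrier_mat l k" "b * Ph x \<in> carrier_mat k k" "b * Ph X \<in> carrier_mat k k"
      using a b d PX X x by auto
    have Zc: "?Z \<in> carrier_mat l k" using cc by (auto intro!: minus_carrier_mat)
    \<comment> \<open>Modulo \<open>p\<close> every term with a factor \<open>X\<close> or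
      \<open>?s\<close> drops out, which leaves the linear equation solved by
      \<open>y\<close>.\<close>
    have r1: "Red (d * Ph x) = Red d * frob.Phi y"
      using d PX x by (simp add: red.mat_hom_mult_dim Red_Ph)
    have r2: "Red (X * (b * Ph x)) = 0\<^sub>m l k"
      using red.mat_hom_mult[OF X(1) cc(5)] X(2) cc(5) left_mult_zero_mat[of "Red (b * Ph x)" k k l] by simp
    have "Red (b * Ph X) = 0\<^sub>m k k"
      using X b PX by (simp add: red.mat_hom_mult[of _ k l _ k] Red_Ph frob.\<phi>.mat_hom_zero)
    then have r3: "Red (x * (a + b * Ph X)) = y * Red a"
      using x a cc by (simp add: red.mat_hom_mult[of _ l k _ k] red.mat_hom_add_dim[of _ k k])
    have r4: "Red (?s \<cdot>\<^sub>m (x * (b * Ph x))) = 0\<^sub>m l k"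
      by (rule Red_pp_smult) (use cc in auto)
    have gen: "Red (M0 + (M1 - M2 - M3 - M4)) = Red M0 + (Red M1 - Red M2 - Red M3 - Red M4)"
      if "M0 \<in> carrier_mat l k" "M1 \<in> carrier_mat l k" "M2 \<in> carrier_mat l k" "M3 \<in> carrier_mat l k"
        "M4 \<in> carrier_mat l k" for M0 M1 M2 M3 M4
      using that by (intro eq_matI) (auto simp: red.hom_add red.hom_minus)
    have "Red (c' + ?Z) = Red c' + (Red (d * Ph x) - Red (X * (b * Ph x)) - Red (x * (a + b * Ph X)) - Red (?s \<cdot>\<^sub>m (x * (b * Ph x))))"
      by (rule gen) (use c'(1) cc in auto)
    also have "\<dots> = Red c' + Red d * frob.Phi y - y * Red a"
      unfolding r1 r2 r3 r4 using c'(1) d y(1) a by (intro eq_matI) (auto simp del: index_mult_mat(1))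
    also have "\<dots> = 0\<^sub>m l k" unfolding y(2) using y a by (intro eq_matI) auto
    finally have "Red (c' + ?Z) = 0\<^sub>m l k" .
    then obtain c'' where c'': "c'' \<in> carrier_mat l k" "c' + ?Z = pp \<cdot>\<^sub>m c''"
      using Red_zeroD[of "c' + ?Z" l k] c' Zc by auto
    have "residual a b c d (X + ?s \<cdot>\<^sub>m x) = ?s \<cdot>\<^sub>m c' + ?s \<cdot>\<^sub>m ?Z"
      unfolding residual_shift[OF a b c d X(1) x(1) \<phi>_pp_power] c'(2) ..
    also have "\<dots> = ?s \<cdot>\<^sub>m (c' + ?Z)" using add_smult_distrib_left_mat[OF c'(1) Zc, of ?s] by simp
    also have "\<dots> = pp ^ Suc (Suc j) \<cdot>\<^sub>m c''" unfolding c''(2) by (intro eq_matI) auto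
    finally have res: "residual a b c d (X + ?s \<cdot>\<^sub>m x) = pp ^ Suc (Suc j) \<cdot>\<^sub>m c''" .
    have "Red (X + ?s \<cdot>\<^sub>m x) = 0\<^sub>m l k"
      using X x Red_pp_smult[OF _ x(1), of "Suc j"] by (simp add: red.mat_hom_add_dim[of _ l k])
    then have "good (Suc j) (X + ?s \<cdot>\<^sub>m x)" unfolding good_def using res c'' X x by auto
    then show ?thesis unfolding rel_def using x by blast
  qed
  obtain f where f: "\<And>j. good j (f j)" "\<And>j. rel j (f j) (f (Suc j))"
    using dependent_nat_choice[of good rel] base succ by blast
  have fc: "f j \<in> carrier_mat l k" for j using f(1) by (simp add: good_def)
  have "\<exists>L. \<forall>n. pp ^ n dvd L - f n $$ (i, j)" if ij: "i < l" "j < k" for i j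
  proof (rule pp_complete)
    fix n
    obtain x where x: "x \<in> carrier_mat l k" "f (Suc n) = f n + pp ^ Suc n \<cdot>\<^sub>m x" using f(2) unfolding rel_def by blast
    then have "f (Suc n) $$ (i, j) - f n $$ (i, j) = pp ^ Suc n * x $$ (i, j)" using ij fc[of n] by simp
    then show "pp ^ n dvd f (Suc n) $$ (i, j) - f n $$ (i, j)" by (simp add: dvd_mult2)
  qed
  then obtain L where L: "\<And>i j n. i < l \<Longrightarrow> j < k \<Longrightarrow> pp ^ n dvd L i j - f n $$ (i, j)" by metis
  define X where "X = mat l k (\<lambda>(i, j). L i j)"
  have Xc: "X \<in> carrier_mat l k" by (simp add: X_def)
  have diff: "\<exists>x\<in>carrier_mat l k. X = f n + pp ^ n \<cdot>\<^sub>m x" for n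
  proof -
    have *: "\<exists>z. L i j - f n $$ (i, j) = pp ^ n * z" if "i < l" "j < k" for i j
      using L[OF that, of n] by (auto simp: dvd_def)
    define x where "x = mat l k (\<lambda>(i, j). SOME z. L i j - f n $$ (i, j) = pp ^ n * z)"
    have "X = f n + pp ^ n \<cdot>\<^sub>m x"
    proof (rule eq_matI)
      fix i j assume "i < dim_row (f n + pp ^ n \<cdot>\<^sub>m x)" "j < dim_col (f n + pp ^ n \<cdot>\<^sub>m x)"
      then have ij: "i < l" "j < k" by (auto simp: x_def)
      have "L i j - f n $$ (i, j) = pp ^ n * x $$ (i, j)" using someI_ex[OF *[OF ij]] ij by (simp add: x_def)
      then show "X $$ (i, j) = (f n + pp ^ n \<cdot>\<^sub>m x) $$ (i, j)" using ij fc[of n] by (simp add: X_def x_def algebra_simps)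
    qed (use Xc fc[of n] in \<open>auto simp: x_def\<close>)
    then show ?thesis by (auto simp: x_def)
  qed
  have "Red X = 0\<^sub>m l k"
  proof -
    obtain x where x: "x \<in> carrier_mat l k" "X = f 1 + pp ^ 1 \<cdot>\<^sub>m x" using diff[of 1] by blast
    have "Red (f 1) = 0\<^sub>m l k" using f(1)[of 1] by (simp add: good_def)
    then show ?thesis unfolding x(2) using x(1) fc[of 1] Red_pp_smult[OF _ x(1), of 1]
      by (simp add: red.mat_hom_add_dim[of _ l k])
  qed
  moreover have "residual a b c d X = 0\<^sub>m l k"
  proof (rule eq_matI)
    have rc: "residual a b c d X \<in> carrier_mat l k" using a b c d Xc unfolding residual_def by auto
    then show "dim_row (residual a b c d X) = dim_row (0\<^sub>m l k :: 'w fps mat)"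
      "dim_col (residual a b c d X) = dim_col (0\<^sub>m l k :: 'w fps mat)" by auto
    fix i j assume "i < dim_row (0\<^sub>m l k :: 'w fps mat)" "j < dim_col (0\<^sub>m l k :: 'w fps mat)"
    then have ij: "i < l" "j < k" by auto
    \<comment> \<open>\<open>X\<close> agrees with the \<open>n\<close>-th approximation modulo
      \<open>pp ^ n\<close>, and the residual of the latter is divisible by a still higher
      power.\<close>
    have "pp ^ n dvd residual a b c d X $$ (i, j)" for n
    proof -
      obtain x where x: "x \<in> carrier_mat l k" "X = f n + pp ^ n \<cdot>\<^sub>m x" using diff[of n] by blast
      obtain z where z: "z \<in> carrier_mat l k" "residual a b c d X = residual a b c d (f n) + pp ^ n \<cdot>\<^sub>m z"
        using residual_congruent[OF a b c d fc x(1)] unfolding x(2) by blast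
      obtain c' where c': "c' \<in> carrier_mat l k" "residual a b c d (f n) = pp ^ Suc n \<cdot>\<^sub>m c'"
        using f(1)[of n] unfolding good_def by blast
      have "residual a b c d X $$ (i, j) = pp ^ n * (pp * c' $$ (i, j) + z $$ (i, j))"
        unfolding z(2) c'(2) using z(1) c'(1) ij by (simp add: algebra_simps)
      then show ?thesis by simp
    qed
    then have "residual a b c d X $$ (i, j) = 0" by (rule pp_separated)
    then show "residual a b c d X $$ (i, j) = 0\<^sub>m l k $$ (i, j)" using ij by simp
  qed
  ultimately show ?thesis using Xc by blast
qed

end

section \<open>Harder-Narasimhan form of a Frobenius matrix\<close>

text \<open>Transitivity of \<open>V / K < v / k \<le> w / s\<close> with denominators cleared.
  \<open>V\<close> is an integer so that a bound satisfied by everything, a negative one, is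
  available.\<close>

lemma cross_mult_trans:
  fixes V :: int and K v k w s :: nat
  assumes "V * int k < int v * int K" "v * s \<le> w * k" "0 < s"
  shows "V * int s < int w * int K"
proof -
  have "int k * (V * int s) < int s * (int v * int K)" using assms(1,3) by (simp add: ac_simps)
  also have "int s * (int v * int K) \<le> int k * (int w * int K)"
    using mult_le_mono1[OF assms(2), of K] by (simp add: ac_simps flip: of_nat_mult)
  finally show ?thesis by (simp add: mult_less_cancel_left)
qed

definition diag_block :: "'r mat \<Rightarrow> (nat \<Rightarrow> nat) \<Rightarrow> nat \<Rightarrow> 'r mat" where
  "diag_block A N t = mat (N (Suc t) - N t) (N (Suc t) - N t) (\<lambda>(i, j). A $$ (N t + i, N t + j))"

context witt_base
begin

text \<open>
  Here \<open>N\<close> lists the partial sums of the block sizes. The slope of a block is minus its valuation divided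
  by its size, up to a common shift, so slopes decrease along the diagonal.
\<close>
definition hn_matrix :: "nat \<Rightarrow> 'w fps mat \<Rightarrow> nat \<Rightarrow> (nat \<Rightarrow> nat) \<Rightarrow> bool" where
  "hn_matrix n A r N \<longleftrightarrow> N 0 = 0 \<and> N r = n \<and> (\<forall>t<r. N t < N (Suc t)) \<and>
     (\<forall>t\<le>r. \<forall>i j. j < N t \<and> N t \<le> i \<and> i < n \<longrightarrow> A $$ (i, j) = 0) \<and>
     (\<forall>t<r. \<forall>m w. frob.stable_sub (Red (diag_block A N t)) (N (Suc t) - N t) m w \<longrightarrow>
        subdegree (det (Red (diag_block A N t))) * m \<le> w * (N (Suc t) - N t)) \<and>
     (\<forall>s t. s < t \<and> t < r \<longrightarrow> subdegree (det (Red (diag_block A N s))) * (N (Suc t) - N t) <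
        subdegree (det (Red (diag_block A N t))) * (N (Suc s) - N s))"

text \<open>The partial sums are shifted by \<open>k\<close> and preceded by 0, so that block
  \<open>Suc t\<close> is the old block \<open>t\<close>. What is new concerns block 0: its
  semistability \<open>ss\<close> and the comparison \<open>gt\<close> with the later
  slopes.\<close>

lemma hn_matrix_cons:
  assumes a: "a \<in> carrier_mat k k" and b: "b \<in> carrier_mat k l" and d: "d \<in> carrier_mat l l" and k: "0 < k"
    and ss: "\<forall>m w. frob.stable_sub (Red a) k m w \<longrightarrow> subdegree (det (Red a)) * m \<le> w * k"
    and hn: "hn_matrix l d r N"
    and gt: "\<forall>t<r. subdegree (det (Red a)) * (N (Suc t) - N t) < subdegree (det (Red (diag_block d N t))) * k"
  defines "N' \<equiv> \<lambda>t. case t of 0 \<Rightarrow> 0 | Suc t' \<Rightarrow> k + N t'"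
  defines "A \<equiv> four_block_mat a b (0\<^sub>m l k) d"
  shows "hn_matrix (k + l) A (Suc r) N'" "diag_block A N' 0 = a"
    "\<And>t. t < r \<Longrightarrow> diag_block A N' (Suc t) = diag_block d N t"
proof -
  have N: "N 0 = 0" "N r = l" "\<And>t. t < r \<Longrightarrow> N t < N (Suc t)"
    and z: "\<And>t i j. t \<le> r \<Longrightarrow> j < N t \<Longrightarrow> N t \<le> i \<Longrightarrow> i < l \<Longrightarrow> d $$ (i, j) = 0"
    and sd: "\<And>t m w. t < r \<Longrightarrow> frob.stable_sub (Red (diag_block d N t)) (N (Suc t) - N t) m w \<Longrightarrow>
        subdegree (det (Red (diag_block d N t))) * m \<le> w * (N (Suc t) - N t)"
    and lt: "\<And>s t. s < t \<Longrightarrow> t < r \<Longrightarrow> subdegree (det (Red (diag_block d N s))) * (N (Suc t) - N t) <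
        subdegree (det (Red (diag_block d N t))) * (N (Suc s) - N s)"
    using hn unfolding hn_matrix_def by blast+
  have le: "N t \<le> l" if "t \<le> r" for t
  proof -
    have "N t \<le> N r" using that
      by (induction rule: inc_induct) (use N(3) in \<open>auto intro: less_imp_le order_trans\<close>)
    then show ?thesis using N by simp
  qed
  show D0: "diag_block A N' 0 = a"
    unfolding diag_block_def N'_def A_def using a d N by (intro eq_matI) auto
  show DS: "diag_block A N' (Suc t) = diag_block d N t" if "t < r" for t
    unfolding diag_block_def N'_def A_def using a d le[of "Suc t"] that by (intro eq_matI) auto
  have N'S: "N' (Suc (Suc t)) - N' (Suc t) = N (Suc t) - N t" for t by (simp add: N'_def)
  have N'0: "N' (Suc 0) - N' 0 = k" by (simp add: N'_def N)
  show "hn_matrix (k + l) A (Suc r) N'"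
    unfolding hn_matrix_def
  proof (intro conjI allI impI)
    show "N' 0 = 0" "N' (Suc r) = k + l" by (auto simp: N'_def N)
    show "N' t < N' (Suc t)" if "t < Suc r" for t
      using that k N by (cases t) (auto simp: N'_def)
    fix t i j assume t: "t \<le> Suc r" and ij: "j < N' t \<and> N' t \<le> i \<and> i < k + l"
    then obtain t' where t': "t = Suc t'" by (cases t) (auto simp: N'_def)
    show "A $$ (i, j) = 0"
    proof (cases "j < k")
      case True
      then show ?thesis using t' ij a d by (auto simp: A_def N'_def)
    next
      case False
      then show ?thesis using z[of t' "j - k" "i - k"] t t' ij a d by (auto simp: A_def N'_def)
    qed
  next
    fix t m w
    assume t: "t < Suc r" and s: "frob.stable_sub (Red (diag_block A N' t)) (N' (Suc t) - N' t) m w"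
    show "subdegree (det (Red (diag_block A N' t))) * m \<le> w * (N' (Suc t) - N' t)"
    proof (cases t)
      case 0
      then show ?thesis using s ss by (simp add: D0 N'0 del: red.hom_det)
    next
      case (Suc t')
      then show ?thesis using s sd[of t'] t by (simp add: DS N'S del: red.hom_det)
    qed
  next
    fix s t assume "s < t \<and> t < Suc r"
    then obtain t' where t: "t = Suc t'" "t' < r" "s < Suc t'" by (cases t) auto
    show "subdegree (det (Red (diag_block A N' s))) * (N' (Suc t) - N' t) <
        subdegree (det (Red (diag_block A N' t))) * (N' (Suc s) - N' s)"
    proof (cases s)
      case 0
      then show ?thesis using gt t by (simp add: D0 DS N'0 N'S del: red.hom_det)
    next
      case (Suc s')
      then show ?thesis using lt[of s' t'] t by (simp add: DS N'S del: red.hom_det)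
    qed
  qed
qed

text \<open>One complete run of Langton's algorithm. The last conclusion compares the lifted
  submodule with the maximal slope of the original reduction, so that upper bounds for slopes are
  inherited.\<close>

lemma destabilizing_lifts:
  assumes A: "A \<in> carrier_mat n n" and nz: "det (Red A) \<noteq> 0" and n: "0 < n"
  obtains k l v a b d where "n = k + l" "0 < k" "a \<in> carrier_mat k k" "b \<in> carrier_mat k l"
    "d \<in> carrier_mat l l" "isog n A (four_block_mat a b (0\<^sub>m l k) d)"
    "v = subdegree (det (Red a))" "det (Red d) \<noteq> 0"
    "\<forall>m w. frob.stable_sub (Red a) k m w \<longrightarrow> v * m \<le> w * k"
    "\<forall>m w. frob.stable_sub (Red d) l m w \<longrightarrow> v * m < w * k"
    "\<exists>k0 v0. frob.destabilizing (Red A) n k0 v0 \<and> v0 * k \<le> v * k0"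
proof -
  \<comment> \<open>All invariants of maximal destabilizing submodules that occur in the isogeny
    class.\<close>
  define T where "T = {(k, v). \<exists>B\<in>carrier_mat n n. isog n A B \<and> frob.destabilizing (Red B) n k v}"
  define g where "g = (\<lambda>(k, v). v * (fact n div k) :: nat)"
  let ?\<delta> = "subdegree (det (Red A))"
  have T: "0 < fst x \<and> fst x \<le> n \<and> snd x \<le> ?\<delta>" if "x \<in> T" for x
  proof -
    obtain B where B: "B \<in> carrier_mat n n" "isog n A B" "frob.destabilizing (Red B) n (fst x) (snd x)"
      using \<open>x \<in> T\<close> by (auto simp: T_def)
    then have ss: "frob.stable_sub (Red B) n (fst x) (snd x)" by (simp add: frob.destabilizing_def)
    have k: "0 < fst x" "fst x \<le> n"
      using ss frob.stable_sub_rank_le[OF ss] unfolding frob.stable_sub_def by blast+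
    have "frob.stable_sub (Red B) n n (subdegree (det (Red B)))"
      using B n by (intro frob.stable_sub_self) auto
    \<comment> \<open>The whole module competes with the destabilizing submodule, and the valuation
      of its determinant is an isogeny invariant. This bounds the valuations in
      \<open>T\<close>.\<close>
    then have "snd x * n \<le> subdegree (det (Red B)) * fst x"
      using B(3) unfolding frob.destabilizing_def by blast
    also have "\<dots> \<le> ?\<delta> * n" using isog_det_Red(2)[OF A B(1,2) nz] k by (simp del: red.hom_det)
    finally show ?thesis using k n by simp
  qed
  have cmp: "snd x * fst y \<le> snd y * fst x \<longleftrightarrow> g x \<le> g y" if "x \<in> T" "y \<in> T" for x y
    using cross_mult_le_iff_fact[of "fst x" n "fst y" "snd x" "snd y"] T[OF that(1)] T[OF that(2)]
    by (simp add: g_def case_prod_beta)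
  have inT: "(k, v) \<in> T" if "B \<in> carrier_mat n n" "isog n A B" "frob.destabilizing (Red B) n k v" for B k v
    using that by (auto simp: T_def)
  obtain k0 v0 where kv0: "frob.destabilizing (Red A) n k0 v0"
    using frob.destabilizing_exists[of "Red A" n] A n by auto
  have T0: "(k0, v0) \<in> T" by (rule inT[OF A isog_refl[OF A] kv0])
  have gb: "g x < Suc (?\<delta> * fact n)" if "x \<in> T" for x
    using T[OF that] unfolding g_def case_prod_beta
    by (intro le_imp_less_Suc mult_mono) (auto simp: div_le_dividend)
  \<comment> \<open>Large \<open>g\<close> means small slope: \<open>x1\<close> realizes the least
    maximal slope in the class, and \<open>x\<close> below the least rank among those.\<close>
  obtain x1 where x1: "x1 \<in> T" "\<And>y. y \<in> T \<Longrightarrow> g y \<le> g x1"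
    using ex_has_greatest_nat[of "\<lambda>x. x \<in> T" "(k0, v0)" g "Suc (?\<delta> * fact n)"] T0 gb by blast
  obtain x where x: "x \<in> T" "g x = g x1" "\<And>y. y \<in> T \<Longrightarrow> g y = g x1 \<Longrightarrow> fst x \<le> fst y"
  proof -
    have "\<exists>x. (x \<in> T \<and> g x = g x1) \<and> (\<forall>y. (y \<in> T \<and> g y = g x1) \<longrightarrow> fst x \<le> fst y)"
      by (rule ex_has_least_nat[of _ x1]) (use x1 in auto)
    then show thesis using that by blast
  qed
  define k v where "k = fst x" and "v = snd x"
  have max: "v' * k \<le> v * k'" and min: "v' * k = v * k' \<Longrightarrow> k \<le> k'" if "(k', v') \<in> T" for k' v'
  proof -
    have gy: "g (k', v') \<le> g x" using x1(2)[OF that] x by simp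
    then show "v' * k \<le> v * k'" using cmp[OF that x(1)] by (simp add: k_def v_def)
    assume "v' * k = v * k'"
    then have "g x \<le> g (k', v')" using cmp[OF x(1) that] by (simp add: k_def v_def)
    then show "k \<le> k'" using x(3)[OF that] gy x(2) by (simp add: k_def)
  qed
  obtain B where B: "B \<in> carrier_mat n n" "isog n A B" "frob.destabilizing (Red B) n k v"
    using x(1) by (auto simp: T_def k_def v_def)
  have RB: "Red B \<in> carrier_mat n n" using B by simp
  have k0: "0 < k" using B(3) by (simp add: frob.destabilizing_def frob.stable_sub_def)
  obtain Ub Vb ab bb db l where 1: "n = k + l" "inverse_mats n Ub Vb" "ab \<in> carrier_mat k k"
    "bb \<in> carrier_mat k l" "db \<in> carrier_mat l l" "subdegree (det ab) = v" "det ab \<noteq> 0" "det db \<noteq> 0"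
    "Red B * frob.Phi Ub = Ub * four_block_mat ab bb (0\<^sub>m l k) db"
    "\<forall>m w. frob.stable_sub ab k m w \<longrightarrow> v * m \<le> w * k" "\<forall>m w. frob.stable_sub db l m w \<longrightarrow> v * m < w * k"
    by (rule frob.destabilizing_adapted_basis[OF RB isog_det_Red(1)[OF A B(1,2) nz] B(3)])
  \<comment> \<open>A basis adapted to the destabilizing submodule modulo \<open>p\<close> is
    lifted; in it the lower left block \<open>c\<close> is divisible by \<open>p\<close>.\<close>
  obtain U V where UV: "inverse_mats n U V" "Red U = Ub" using lift_inverse_mats[OF 1(2)] by blast
  note U = inverse_matsD[OF UV(1)]
  define A1 where "A1 = V * (B * Ph U)"
  have A1: "A1 \<in> carrier_mat n n" using U B by (simp add: A1_def)
  have BU: "B * Ph U = U * A1" unfolding A1_def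
    using inverse_mats_cancel(1)[OF UV(1), of "B * Ph U" n] U B by simp
  have iA1: "isog n A A1"
    by (rule isog_trans[OF A B(1) A1 B(2) isog_inverse_mats[OF UV(1) BU]])
  have RU: "inverse_mats n Ub (Red V)" using inverse_mats_hom[OF red.comm_ring_hom_axioms UV(1)] UV(2) by simp
  have "Ub * Red A1 = Red B * frob.Phi Ub"
    using arg_cong[OF BU, of Red] U B A1 by (simp add: red.mat_hom_mult[of _ n n _ n] Red_Ph UV(2))
  then have "Ub * Red A1 = Ub * four_block_mat ab bb (0\<^sub>m l k) db" using 1(9) by simp
  then have "Red V * (Ub * Red A1) = Red V * (Ub * four_block_mat ab bb (0\<^sub>m l k) db)" by simp
  then have RA1: "Red A1 = four_block_mat ab bb (0\<^sub>m l k) db"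
    using inverse_mats_cancel(2)[OF RU, of _ n] A1 1(1,3,4,5) by simp
  obtain a b c d where bl: "a \<in> carrier_mat k k" "b \<in> carrier_mat k l" "c \<in> carrier_mat l k"
    "d \<in> carrier_mat l l" "A1 = four_block_mat a b c d"
    by (rule four_block_mat_exists[of A1 k l k l]) (use A1 1(1) in auto)
  have "four_block_mat (Red a) (Red b) (Red c) (Red d) = four_block_mat ab bb (0\<^sub>m l k) db"
    using RA1 unfolding bl(5) by (simp add: map_four_block_mat[OF bl(1-4)])
  note rb = four_block_mat_eqD[OF this, of k k l l]
  have R: "Red a = ab" "Red c = 0\<^sub>m l k" "Red d = db" using rb bl(1-4) 1(3-5) by auto
  have X2: "Red (a + b * Ph X) = ab" "Red (d - X * b) = db"
    if X: "X \<in> carrier_mat l k" "Red X = 0\<^sub>m l k" for X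
  proof -
    have "Red (b * Ph X) = 0\<^sub>m k k"
      using X bl by (simp add: red.mat_hom_mult[of _ k l _ k] Red_Ph frob.\<phi>.mat_hom_zero)
    then show "Red (a + b * Ph X) = ab" using bl X 1(3) by (simp add: red.mat_hom_add_dim[of _ k k] R)
    have "Red (X * b) = 0\<^sub>m l l" using X bl by (simp add: red.mat_hom_mult[of _ l k _ l])
    moreover have "db - 0\<^sub>m l l = db" using 1(5) by (intro eq_matI) auto
    ultimately show "Red (d - X * b) = db" using bl X by (simp add: red.mat_hom_minus_dim[of _ l l] R)
  qed
  \<comment> \<open>Conjugating by the graph of \<open>X\<close> and modifying by
    \<open>pp ^ j\<close> gives a lattice of the class whose reduction has \<open>c'\<close> below
    the diagonal. By the choice of \<open>(k, v)\<close> its destabilizing submodule satisfies the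
    hypotheses of the graph lemma, which solves the equation for \<open>c'\<close>.\<close>
  have step: "\<exists>x\<in>carrier_mat l k. Red c' + Red d * frob.Phi x = x * Red a"
    if X: "X \<in> carrier_mat l k" "Red X = 0\<^sub>m l k" and j: "0 < j" and c': "c' \<in> carrier_mat l k"
      and e: "residual a b c d X = pp ^ j \<cdot>\<^sub>m c'" for X j c'
  proof -
    define a2 d2 where "a2 = a + b * Ph X" and "d2 = d - X * b"
    have ad: "a2 \<in> carrier_mat k k" "d2 \<in> carrier_mat l l" "Red a2 = ab" "Red d2 = db"
      using X2[OF X] bl X by (auto simp: a2_def d2_def intro!: minus_carrier_mat)
    define B' where "B' = four_block_mat a2 (pp ^ j \<cdot>\<^sub>m b) c' d2"
    have B': "B' \<in> carrier_mat n n" unfolding B'_def 1(1) using ad by simp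
    have m: "four_block_mat a2 b (pp ^ j \<cdot>\<^sub>m c') d2 \<in> carrier_mat n n" unfolding 1(1) using ad by simp
    have "isog n A1 (four_block_mat a2 b (pp ^ j \<cdot>\<^sub>m c') d2)"
      using residual_conjugate[OF bl(1-4) X(1)] unfolding a2_def d2_def bl(5) e 1(1) .
    moreover have "isog n (four_block_mat a2 b (pp ^ j \<cdot>\<^sub>m c') d2) B'"
      unfolding B'_def 1(1) by (rule isog_scale_block) (use ad bl c' in auto)
    ultimately have iB': "isog n A B'" using isog_trans A A1 m B' iA1 by meson
    have RB': "Red B' = four_block_mat ab (0\<^sub>m k l) (Red c') db"
      unfolding B'_def using ad bl c' Red_pp_smult[OF j bl(2)] by (simp add: map_four_block_mat[of _ k k _ l _ l])
    obtain k' v' where kv': "frob.destabilizing (Red B') n k' v'"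
      using frob.destabilizing_exists[of "Red B'" n] B' n by auto
    have T': "(k', v') \<in> T" by (rule inT[OF B' iB' kv'])
    have sub: "frob.stable_sub (four_block_mat ab (0\<^sub>m k l) (Red c') db) (k + l) k' v'"
      using kv' unfolding frob.destabilizing_def RB' 1(1) by blast
    show ?thesis unfolding R
    proof (rule frob.stable_sub_graph[OF 1(3) _ 1(5,7,8) k0 _ _ sub])
      show "Red c' \<in> carrier_mat l k" using c' by simp
      show "subdegree (det ab) * m \<le> w * k" if "frob.stable_sub ab k m w" for m w
        using 1(10) that unfolding 1(6) by blast
      show "subdegree (det ab) * m < w * k" if "frob.stable_sub db l m w" for m w
        using 1(11) that unfolding 1(6) by blast
      show "v' * k \<le> subdegree (det ab) * k'" unfolding 1(6) by (rule max[OF T'])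
      show "v' * k = subdegree (det ab) * k' \<Longrightarrow> k \<le> k'" unfolding 1(6) by (rule min[OF T'])
    qed
  qed
  have "\<exists>X\<in>carrier_mat l k. Red X = 0\<^sub>m l k \<and> residual a b c d X = 0\<^sub>m l k"
    by (rule residual_zero_exists[OF bl(1-4) R(2)]) (rule step)
  then obtain X where X: "X \<in> carrier_mat l k" "Red X = 0\<^sub>m l k" "residual a b c d X = 0\<^sub>m l k" by blast
  \<comment> \<open>Conjugating by the graph of the limit makes the lower left block zero and leaves
    the reductions of \<open>a\<close> and \<open>d\<close> as they were.\<close>
  define a2 d2 where "a2 = a + b * Ph X" and "d2 = d - X * b"
  have ad: "a2 \<in> carrier_mat k k" "d2 \<in> carrier_mat l l" "Red a2 = ab" "Red d2 = db"
    using X2[OF X(1,2)] bl X by (auto simp: a2_def d2_def intro!: minus_carrier_mat)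
  have m: "four_block_mat a2 b (0\<^sub>m l k) d2 \<in> carrier_mat n n" unfolding 1(1) using ad by simp
  have i2: "isog n A1 (four_block_mat a2 b (0\<^sub>m l k) d2)"
    using residual_conjugate[OF bl(1-4) X(1)] unfolding a2_def d2_def bl(5) X(3) 1(1) .
  have "isog n A (four_block_mat a2 b (0\<^sub>m l k) d2)" by (rule isog_trans[OF A A1 m iA1 i2])
  moreover have "\<exists>k0 v0. frob.destabilizing (Red A) n k0 v0 \<and> v0 * k \<le> v * k0" using kv0 max[OF T0] by blast
  ultimately show thesis using that[OF 1(1) k0 ad(1) bl(2) ad(2), of v] 1(6,8,10,11) by (simp add: ad(3,4) del: red.hom_det)
qed

text \<open>To see that slopes decrease along the diagonal, the induction carries a strict upper
  bound \<open>- V / K\<close> for all slopes \<open>- w / m\<close>. For the quotient the bound is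
  the slope of the piece just split off.\<close>

lemma isog_hn_matrix:
  fixes V :: int
  assumes "A \<in> carrier_mat n n" "det (Red A) \<noteq> 0" "0 < K"
    "\<And>m w. frob.stable_sub (Red A) n m w \<Longrightarrow> V * int m < int w * int K"
  shows "\<exists>A'\<in>carrier_mat n n. \<exists>r N. isog n A A' \<and> hn_matrix n A' r N \<and>
    (\<forall>t<r. V * int (N (Suc t) - N t) < int (subdegree (det (Red (diag_block A' N t)))) * int K)"
  using assms
proof (induction n arbitrary: A V K rule: less_induct)
  case (less n)
  note A = less.prems(1) and nz = less.prems(2) and K = less.prems(3) and sub = less.prems(4)
  show ?case
  proof (cases "n = 0")
    case True
    then have "hn_matrix n A 0 (\<lambda>_. 0)" unfolding hn_matrix_def by auto
    then show ?thesis using isog_refl[OF A] A by (intro bexI[of _ A] exI[of _ 0] exI[of _ "\<lambda>_. 0"]) auto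
  next
    case False
    then have "0 < n" by simp
    obtain k l v a b d where 1: "n = k + l" "0 < k" "a \<in> carrier_mat k k" "b \<in> carrier_mat k l"
      "d \<in> carrier_mat l l" "isog n A (four_block_mat a b (0\<^sub>m l k) d)"
      "v = subdegree (det (Red a))" "det (Red d) \<noteq> 0"
      "\<forall>m w. frob.stable_sub (Red a) k m w \<longrightarrow> v * m \<le> w * k"
      "\<forall>m w. frob.stable_sub (Red d) l m w \<longrightarrow> v * m < w * k"
      "\<exists>k0 v0. frob.destabilizing (Red A) n k0 v0 \<and> v0 * k \<le> v * k0"
      by (rule destabilizing_lifts[OF A nz \<open>0 < n\<close>])
    obtain k0 v0 where 2: "frob.destabilizing (Red A) n k0 v0" "v0 * k \<le> v * k0" using 1(11) by blast
    \<comment> \<open>The bound is given for the reduction of \<open>A\<close>; it passes to the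
      lifted submodule because the slope of the latter is at most the maximal slope of that
      reduction.\<close>
    have "V * int k0 < int v0 * int K" using 2(1) sub unfolding frob.destabilizing_def by blast
    then have Vk: "V * int k < int v * int K" using cross_mult_trans[of V k0 v0 K k v] 2(2) 1(2) by simp
    have "l < n" using 1 by simp
    have "int v * int m < int w * int k" if "frob.stable_sub (Red d) l m w" for m w
      using 1(10) that by (simp flip: of_nat_mult)
    from less.IH[OF \<open>l < n\<close> 1(5,8,2) this] obtain d' r N where 3: "d' \<in> carrier_mat l l" "isog l d d'"
      "hn_matrix l d' r N" "\<forall>t<r. v * (N (Suc t) - N t) < subdegree (det (Red (diag_block d' N t))) * k"
      by (auto simp flip: of_nat_mult simp del: red.hom_det)
    obtain b' where b': "b' \<in> carrier_mat k l" "isog n (four_block_mat a b (0\<^sub>m l k) d) (four_block_mat a b' (0\<^sub>m l k) d')"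
      using isog_lower_right[OF 1(3-5) 3(1,2)] unfolding 1(1) by blast
    let ?A = "four_block_mat a b' (0\<^sub>m l k) d'"
    let ?N = "\<lambda>t. case t of 0 \<Rightarrow> 0 | Suc t' \<Rightarrow> k + N t'"
    have Ac: "?A \<in> carrier_mat n n" "four_block_mat a b (0\<^sub>m l k) d \<in> carrier_mat n n"
      unfolding 1(1) using 1 3 by auto
    have iA: "isog n A ?A" by (rule isog_trans[OF A Ac(2,1) 1(6) b'(2)])
    note hc = hn_matrix_cons[OF 1(3) b'(1) 3(1) 1(2) 1(9)[unfolded 1(7)] 3(3) 3(4)[unfolded 1(7)]]
    have "V * int (?N (Suc t) - ?N t) < int (subdegree (det (Red (diag_block ?A ?N t)))) * int K" if t: "t < Suc r" for t
    proof (cases t)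
      case 0
      have "N 0 = 0" using 3(3) by (simp add: hn_matrix_def)
      then show ?thesis using Vk 0 hc(2) 1(7) by (simp del: red.hom_det)
    next
      case (Suc t')
      then have t': "t' < r" using t by simp
      have pos: "0 < N (Suc t') - N t'" using 3(3) t' by (simp add: hn_matrix_def)
      have "V * int (N (Suc t') - N t') < int (subdegree (det (Red (diag_block d' N t')))) * int K"
        by (rule cross_mult_trans[OF Vk less_imp_le[OF 3(4)[rule_format, OF t']] pos])
      then show ?thesis using hc(3)[OF t'] Suc by (simp del: red.hom_det)
    qed
    then show ?thesis using Ac(1) iA hc(1) unfolding 1(1)
      by (intro bexI[of _ ?A] exI[of _ "Suc r"] exI[of _ ?N]) auto
  qed
qed

end

section \<open>The Eisenstein polynomial as a prime element\<close>

locale kisin_base = witt_base p res \<sigma> for p :: nat and res :: "'w::idom \<Rightarrow> 'f::field" and \<sigma> :: "'w \<Rightarrow> 'w" +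
  fixes \<iota> :: "'w \<Rightarrow> 'k::field" and \<pi> :: 'k and E :: "'w poly"
  assumes \<iota>_hom: "comm_ring_hom \<iota>" and \<iota>_inj: "inj \<iota>"
    and min_poly: "minimal_polynomial p \<iota> \<pi> E" and eisen: "eisenstein p E"
begin

abbreviation EE :: "'w fps" where "EE \<equiv> fps_of_poly E"

lemma lead_E: "coeff E (degree E) = 1" and degree_E: "0 < degree E"
  using eisen by (auto simp: eisenstein_def)

lemma red_EE: "red EE = fps_X ^ degree E"
proof (rule fps_ext)
  fix n
  interpret r: comm_ring_hom res by (rule res_hom)
  have "res (coeff E n) = (if n = degree E then 1 else 0)"
  proof (cases n "degree E" rule: linorder_cases)
    case less
    then show ?thesis using eisen res_zero_iff by (auto simp: eisenstein_def)
  next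
    case equal
    then show ?thesis using lead_E by simp
  next
    case greater
    then show ?thesis by (simp add: coeff_eq_0)
  qed
  then show "red EE $ n = fps_X ^ degree E $ n" by (simp add: fps_reduce_def fps_X_power_nth)
qed

lemma witt_separated: "(\<And>n. of_nat p ^ n dvd (x :: 'w)) \<Longrightarrow> x = 0"
  using witt by (simp add: witt_vectors_def)

text \<open>Modulo \<open>p\<close>, division by \<open>E\<close> is division by
  \<open>u ^ e\<close>, a mere shift, and the error \<open>u ^ e - E\<close> is \<open>pp\<close>
  times some \<open>G\<close>. Iterating on the error produces quotient and remainder as
  \<open>p\<close>-adically convergent series.\<close>

lemma weierstrass_division: "\<exists>q r. f = EE * q + r \<and> (\<forall>i\<ge>degree E. r $ i = 0)"
proof -
  let ?e = "degree E"
  have "red (fps_X ^ ?e - EE) = 0"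
  proof -
    have "red (fps_X ^ ?e) = fps_X ^ ?e"
    proof -
      interpret r: comm_ring_hom res by (rule res_hom)
      show ?thesis by (auto simp: fps_eq_iff fps_reduce_def fps_X_power_nth)
    qed
    then show ?thesis by (simp add: red.hom_minus red_EE)
  qed
  then obtain G where G: "fps_X ^ ?e - EE = pp * G" using red_zero_iff by (auto simp: dvd_def)
  \<comment> \<open>\<open>T k\<close> is what remains to be divided after \<open>k\<close> rounds,
    with \<open>pp ^ k\<close> taken out. Its shift and its cutoff are the contributions of this
    round to quotient and remainder.\<close>
  define T where "T = (\<lambda>k. ((\<lambda>g. G * fps_shift ?e g) ^^ k) f)"
  define s where "s = (\<lambda>n. \<Sum>k<n. pp ^ k * fps_shift ?e (T k))"
  define t where "t = (\<lambda>n. \<Sum>k<n. pp ^ k * fps_cutoff ?e (T k))"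
  have T: "T k = EE * fps_shift ?e (T k) + pp * T (Suc k) + fps_cutoff ?e (T k)" for k
  proof -
    have "T k = fps_shift ?e (T k) * fps_X ^ ?e + fps_cutoff ?e (T k)" by (simp add: fps_shift_cutoff)
    also have "fps_X ^ ?e = EE + pp * G" using G by (simp add: algebra_simps)
    finally show ?thesis by (simp add: T_def algebra_simps)
  qed
  have inv: "f = EE * s n + t n + pp ^ n * T n" for n
  proof (induction n)
    case 0
    then show ?case by (simp add: s_def t_def T_def)
  next
    case (Suc n)
    have "pp ^ n * T n = pp ^ n * (EE * fps_shift ?e (T n) + pp * T (Suc n) + fps_cutoff ?e (T n))"
      using T[of n] by simp
    then show ?case using Suc by (simp add: s_def t_def algebra_simps)
  qed
  have "pp ^ n dvd s (Suc n) - s n" for n by (simp add: s_def)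
  then obtain q where q: "\<And>n. pp ^ n dvd q - s n" using pp_complete by blast
  have "(f - EE * q) $ i = 0" if i: "i \<ge> ?e" for i
  proof (rule witt_separated)
    fix n
    have "f - EE * q - t n = pp ^ n * T n - EE * (q - s n)"
      using inv[of n] by (simp add: algebra_simps)
    then have "pp ^ n dvd f - EE * q - t n" using q[of n] by (metis dvd_diff dvd_mult dvd_triv_left)
    then have "of_nat p ^ n dvd (f - EE * q - t n) $ i" unfolding fps_dvd_coeffs_iff by blast
    moreover have "t n $ i = 0"
    proof -
      have c: "pp ^ k = fps_const (of_nat p ^ k)" for k
        by (simp add: fps_const_power flip: fps_of_nat)
      show ?thesis using i unfolding t_def c by (simp add: fps_sum_nth)
    qed
    ultimately show "of_nat p ^ n dvd (f - EE * q) $ i" by simp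
  qed
  then show ?thesis by (intro exI[of _ q] exI[of _ "f - EE * q"]) auto
qed

text \<open>Modulo \<open>p\<close> the product is \<open>u ^ e\<close> times \<open>q\<close>, so
  its coefficients from index \<open>e\<close> on are all those of \<open>q\<close>. Hence
  \<open>p\<close> divides \<open>q\<close>, and \<open>q / p\<close> satisfies the hypothesis
  again.\<close>

lemma weierstrass_unique:
  assumes "\<And>i. i \<ge> degree E \<Longrightarrow> (EE * q) $ i = 0"
  shows "q = 0"
proof (rule pp_separated)
  fix n
  show "pp ^ n dvd q" using assms
  proof (induction n arbitrary: q)
    case (Suc n)
    have "red q = 0"
    proof (rule fps_ext)
      fix i
      interpret r: comm_ring_hom res by (rule res_hom)
      have "red q $ i = (fps_X ^ degree E * red q) $ (degree E + i)"
        by (simp add: fps_X_power_mult_nth)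
      also have "\<dots> = red (EE * q) $ (degree E + i)" by (simp add: red.hom_mult red_EE)
      also have "\<dots> = 0" using Suc.prems[of "degree E + i"] by (simp add: fps_reduce_def)
      finally show "red q $ i = 0 $ i" by simp
    qed
    then obtain q' where q': "q = pp * q'" using red_zero_iff by (auto simp: dvd_def)
    have "(EE * q') $ i = 0" if "i \<ge> degree E" for i
    proof -
      have "EE * q = fps_const (of_nat p) * (EE * q')" by (simp add: q' algebra_simps fps_of_nat)
      then have "of_nat p * (EE * q') $ i = 0" using Suc.prems[OF that] by (metis fps_mult_left_const_nth)
      then show ?thesis using witt by (simp add: witt_vectors_def)
    qed
    then show ?case using Suc.IH q' by simp
  qed simp
qed

text \<open>Weierstrass remainders are polynomials of smaller degree than \<open>E\<close>, and by
  minimality of \<open>E\<close> such a polynomial vanishes at \<open>\<pi>\<close> only if it is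
  zero. If \<open>E\<close> divides a product, the product of the two remainders vanishes at
  \<open>\<pi>\<close>, so one of them is zero.\<close>

lemma EE_prime: "prime_elem EE"
proof (rule prime_elemI)
  interpret i: comm_ring_hom \<iota> by (rule \<iota>_hom)
  interpret mp: map_poly_comm_ring_hom \<iota> ..
  have E0: "E \<noteq> 0" using degree_E by auto
  show "EE \<noteq> 0" using E0 by simp
  have "red EE $ 0 = 0" using degree_E by (simp add: red_EE fps_X_power_nth)
  then have "\<not> red EE dvd 1" by (simp add: fps_is_unit_iff)
  then show "\<not> EE dvd 1" using red.hom_dvd_1 by blast
  define ev where "ev = (\<lambda>g. poly (map_poly \<iota> g) \<pi>)"
  have ev: "ev (g * h) = ev g * ev h" for g h by (simp add: ev_def mp.hom_mult)
  have evE: "ev E = 0" using min_poly by (simp add: minimal_polynomial_def ev_def)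
  have ev0: "g = 0" if "ev g = 0" "\<And>i. i \<ge> degree E \<Longrightarrow> coeff g i = 0" for g
  proof (rule ccontr)
    assume g: "g \<noteq> 0"
    have cf: "coeff (map_poly \<iota> g) i = \<iota> (coeff g i)" for i by (simp add: coeff_map_poly)
    have nz: "map_poly \<iota> g \<noteq> 0"
    proof
      assume "map_poly \<iota> g = 0"
      then have "\<iota> (coeff g i) = \<iota> 0" for i using cf[of i] by simp
      then show False using g \<iota>_inj by (auto simp: inj_def poly_eq_iff)
    qed
    have "coeff (map_poly \<iota> g) i \<in> base_field p \<iota>" for i
      unfolding cf base_field_def by (intro CollectI exI[of _ "coeff g i"] exI[of _ 0]) simp
    then have "degree E \<le> degree (map_poly \<iota> g)"
      using min_poly nz that(1) unfolding minimal_polynomial_def ev_def by blast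
    then have "coeff (map_poly \<iota> g) (degree (map_poly \<iota> g)) = 0" unfolding cf using that(2) by simp
    then show False using nz leading_coeff_0_iff by blast
  qed
  fix a b assume ab: "EE dvd a * b"
  obtain q1 and r1 :: "'w fps" where 1: "a = EE * q1 + r1" "\<And>i. i \<ge> degree E \<Longrightarrow> r1 $ i = 0"
    using weierstrass_division by blast
  obtain q2 and r2 :: "'w fps" where 2: "b = EE * q2 + r2" "\<And>i. i \<ge> degree E \<Longrightarrow> r2 $ i = 0"
    using weierstrass_division by blast
  have rp: "\<exists>g. fps_of_poly g = r" if "\<And>i. i \<ge> degree E \<Longrightarrow> r $ i = 0" for r :: "'w fps"
  proof
    show "fps_of_poly (\<Sum>i<degree E. monom (r $ i) i) = r"
    proof (rule fps_ext)
      fix n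
      have "coeff (\<Sum>i<degree E. monom (r $ i) i) n = (\<Sum>i<degree E. if i = n then r $ i else 0)"
        by (simp add: coeff_sum)
      also have "\<dots> = r $ n" using that[of n] by (auto simp: sum.delta)
      finally show "fps_of_poly (\<Sum>i<degree E. monom (r $ i) i) $ n = r $ n" by simp
    qed
  qed
  obtain g1 g2 where g: "fps_of_poly g1 = r1" "fps_of_poly g2 = r2" using rp[OF 1(2)] rp[OF 2(2)] by blast
  have "r1 * r2 = a * b - EE * (q1 * b + q2 * r1)" by (simp add: 1(1) 2(1) algebra_simps)
  then have "EE dvd r1 * r2" using ab by (metis dvd_diff dvd_triv_left)
  then have d: "EE dvd fps_of_poly (g1 * g2)" by (simp add: g fps_of_poly_mult)
  \<comment> \<open>Pseudo-division is true division because \<open>E\<close> is monic. The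
    remainder \<open>t\<close> turns out to be divisible by \<open>E\<close> as a power series, so
    uniqueness of Weierstrass division makes it zero.\<close>
  obtain s t where st: "pseudo_divmod (g1 * g2) E = (s, t)" by (cases "pseudo_divmod (g1 * g2) E")
  have eq: "g1 * g2 = E * s + t" and t: "t = 0 \<or> degree t < degree E"
    using pseudo_divmod[OF E0 st] lead_E by auto
  have "EE dvd fps_of_poly t"
  proof -
    have "fps_of_poly t = fps_of_poly (g1 * g2) - EE * fps_of_poly s"
      unfolding eq by (simp add: fps_of_poly_add fps_of_poly_mult)
    then show ?thesis using d by (metis dvd_diff dvd_triv_left)
  qed
  then obtain z where z: "fps_of_poly t = EE * z" by (auto simp: dvd_def)
  have "z = 0"
  proof (rule weierstrass_unique)
    fix i assume "i \<ge> degree E"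
    then have "coeff t i = 0" using t by (auto simp: coeff_eq_0)
    then show "(EE * z) $ i = 0" unfolding z[symmetric] by simp
  qed
  then have "fps_of_poly t = 0" using z by simp
  then have "t = 0" by (simp add: fps_eq_iff poly_eq_iff)
  then have "ev g1 * ev g2 = 0" using eq ev[of g1 g2] ev[of E s] evE by simp
  then have "ev g1 = 0 \<or> ev g2 = 0" by simp
  moreover have "coeff g1 i = 0" "coeff g2 i = 0" if "i \<ge> degree E" for i
    using 1(2)[OF that] 2(2)[OF that] g by (metis fps_of_poly_nth)+
  ultimately have "g1 = 0 \<or> g2 = 0" using ev0 by blast
  then have "r1 = 0 \<or> r2 = 0" using g by auto
  then show "EE dvd a \<or> EE dvd b" using 1(1) 2(1) by auto
qed

text \<open>If all powers of \<open>E\<close> divide \<open>x\<close>, then modulo \<open>p\<close>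
  all powers of \<open>u\<close> do, so \<open>p\<close> divides \<open>x\<close>. As
  \<open>p\<close> is prime and divides no power of \<open>E\<close>, the same holds for
  \<open>x / p\<close>, and separatedness gives \<open>x = 0\<close>. With primality, this makes the
  localization at \<open>E\<close> a discrete valuation ring.\<close>

lemma EE_valuation:
  assumes "x \<noteq> 0"
  shows "\<exists>k y. x = EE ^ k * y \<and> \<not> EE dvd y"
proof (rule ccontr)
  assume neg: "\<not> (\<exists>k y. x = EE ^ k * y \<and> \<not> EE dvd y)"
  have all: "EE ^ k dvd x" for k
  proof (induction k)
    case (Suc k)
    then obtain y where y: "x = EE ^ k * y" by (auto simp: dvd_def)
    then have "EE dvd y" using neg by blast
    then show ?case using y by (auto simp: dvd_def ac_simps)
  qed simp
  have "pp ^ n dvd z" if "\<And>k. EE ^ k dvd z" for n z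
    using that
  proof (induction n arbitrary: z)
    case (Suc n)
    have "red z = 0"
    proof (rule ccontr)
      assume nz: "red z \<noteq> 0"
      let ?k = "Suc (subdegree (red z))"
      have "red (EE ^ ?k) dvd red z" using Suc.prems red.hom_dvd by blast
      then have "fps_X ^ (degree E * ?k) dvd red z" unfolding red.hom_power red_EE power_mult .
      then have "degree E * ?k \<le> subdegree (red z)" using nz by (simp add: fps_dvd_iff)
      moreover have "1 * ?k \<le> degree E * ?k" using degree_E by (intro mult_le_mono1) simp
      ultimately have "1 * ?k \<le> subdegree (red z)" by (rule order_trans[rotated])
      then show False by simp
    qed
    then obtain z' where z': "z = pp * z'" using red_zero_iff by (auto simp: dvd_def)
    have "EE ^ k dvd z'" for k
    proof -
      obtain y where y: "pp * z' = EE ^ k * y" using Suc.prems[of k] z' by (auto simp: dvd_def)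
      then have "pp dvd EE ^ k * y" by (metis dvd_triv_left)
      moreover have "\<not> pp dvd EE ^ k" by (simp flip: red_zero_iff add: red.hom_power red_EE)
      ultimately have "pp dvd y" using pp_prime prime_elem_dvd_mult_iff by blast
      then obtain y' where "y = pp * y'" by (auto simp: dvd_def)
      then have "pp * z' = pp * (EE ^ k * y')" using y by (simp add: ac_simps)
      then show ?thesis using pp_nonzero by simp
    qed
    then show ?case using Suc.IH z' by simp
  qed simp
  then have "x = 0" using all pp_separated by blast
  then show False using assms by simp
qed

end

section \<open>Bases of modules\<close>

lemma univ_ring_simps [simp]:
  "carrier univ_ring = UNIV" "x \<otimes>\<^bsub>univ_ring\<^esub> y = x * y" "x \<oplus>\<^bsub>univ_ring\<^esub> y = x + y"
  "\<one>\<^bsub>univ_ring\<^esub> = 1" "\<zero>\<^bsub>univ_ring\<^esub> = 0"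
  by (auto simp: univ_ring_def)

lemma cring_univ_ring: "cring (univ_ring :: 'r::comm_ring_1 ring)"
  by (intro cringI abelian_groupI comm_monoidI)
     (auto simp: algebra_simps intro: exI[of _ "- x" for x])

locale umod = Module.module "univ_ring :: 'r::comm_ring_1 ring" V
  for V :: "('r::comm_ring_1, 'v, 'x) module_scheme" (structure)
begin

definition lin :: "nat \<Rightarrow> (nat \<Rightarrow> 'v) \<Rightarrow> (nat \<Rightarrow> 'r) \<Rightarrow> 'v" where
  "lin n b c = (\<Oplus>i\<in>{..<n}. c i \<odot> b i)"

lemma umod_smult [simp]:
  "x \<in> carrier V \<Longrightarrow> a \<odot> x \<in> carrier V"
  "x \<in> carrier V \<Longrightarrow> 1 \<odot> x = x"
  "x \<in> carrier V \<Longrightarrow> 0 \<odot> x = \<zero>"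
  "a \<odot> \<zero> = \<zero>"
  using smult_closed[of a x] smult_one[of x] smult_l_null[of x] smult_r_null[of a] by auto

lemma umod_add_smult: "x \<in> carrier V \<Longrightarrow> (a + b) \<odot> x = a \<odot> x \<oplus> b \<odot> x"
  using smult_l_distr[of a b x] by simp

lemma umod_smult_add: "x \<in> carrier V \<Longrightarrow> y \<in> carrier V \<Longrightarrow> a \<odot> (x \<oplus> y) = a \<odot> x \<oplus> a \<odot> y"
  using smult_r_distr[of a x y] by simp

lemma umod_smult_smult: "x \<in> carrier V \<Longrightarrow> a \<odot> (b \<odot> x) = (a * b) \<odot> x"
  using smult_assoc1[of a b x] by simp

lemma umod_minus: "x \<in> carrier V \<Longrightarrow> (- 1) \<odot> x = \<ominus> x"
proof -
  assume x: "x \<in> carrier V"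
  have "(- 1) \<odot> x \<oplus> x = (- 1 + 1) \<odot> x" using umod_add_smult[OF x, of "- 1" 1] x by simp
  then have "(- 1) \<odot> x \<oplus> x = \<zero>" using x by simp
  then show ?thesis using x M.minus_equality by simp
qed

lemma lin_0: "lin 0 b c = \<zero>"
  by (simp add: lin_def)

lemma lin_Suc: "b \<in> {..<Suc n} \<rightarrow> carrier V \<Longrightarrow> lin (Suc n) b c = lin n b c \<oplus> c n \<odot> b n"
  unfolding lin_def lessThan_Suc
  by (subst M.finsum_insert) (auto simp: M.a_comm Pi_def intro!: M.finsum_closed)

lemma lin_closed: "b \<in> {..<n} \<rightarrow> carrier V \<Longrightarrow> lin n b c \<in> carrier V"
  unfolding lin_def by (rule M.finsum_closed) auto

lemma lin_cong:
  assumes "\<And>i. i < n \<Longrightarrow> b i = b' i" "\<And>i. i < n \<Longrightarrow> c i = c' i" "b \<in> {..<n} \<rightarrow> carrier V"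
  shows "lin n b c = lin n b' c'"
proof -
  have "b' i \<in> carrier V" if "i < n" for i using assms(1)[OF that] assms(3) that by (auto simp: Pi_def)
  then show ?thesis unfolding lin_def by (intro M.finsum_cong') (use assms in auto)
qed

lemma lin_zero: "b \<in> {..<n} \<rightarrow> carrier V \<Longrightarrow> lin n b (\<lambda>_. 0) = \<zero>"
proof (induction n)
  case (Suc n)
  then have "b \<in> {..<n} \<rightarrow> carrier V" "b n \<in> carrier V" by auto
  then show ?case using Suc by (simp add: lin_Suc)
qed (simp add: lin_0)

lemma lin_add:
  assumes "b \<in> {..<n} \<rightarrow> carrier V"
  shows "lin n b (\<lambda>i. c i + d i) = lin n b c \<oplus> lin n b d"
  using assms
proof (induction n)
  case (Suc n)
  have b: "b \<in> {..<n} \<rightarrow> carrier V" "b n \<in> carrier V" using Suc.prems by auto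
  have 1: "lin n b c \<in> carrier V" "lin n b d \<in> carrier V"
    "c n \<odot> b n \<in> carrier V" "d n \<odot> b n \<in> carrier V"
    using b by (auto intro: lin_closed)
  then show ?case using Suc b by (simp add: lin_Suc umod_add_smult M.a_ac)
qed (simp add: lin_0)

lemma lin_smult:
  assumes "b \<in> {..<n} \<rightarrow> carrier V"
  shows "lin n b (\<lambda>i. a * c i) = a \<odot> lin n b c"
  using assms
proof (induction n)
  case (Suc n)
  have b: "b \<in> {..<n} \<rightarrow> carrier V" "b n \<in> carrier V" using Suc.prems by auto
  then have "lin n b c \<in> carrier V" by (auto intro: lin_closed)
  then show ?case using Suc b by (simp add: lin_Suc umod_smult_add umod_smult_smult)
qed (simp add: lin_0)

lemma lin_unit:
  assumes "b \<in> {..<n} \<rightarrow> carrier V" "j < n"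
  shows "lin n b (\<lambda>i. if i = j then 1 else 0) = b j"
proof -
  have "lin m b (\<lambda>i. if i = j then 1 else 0) = (if j < m then b j else \<zero>)" if "m \<le> n" for m
    using that
  proof (induction m)
    case (Suc m)
    then have "b \<in> {..<Suc m} \<rightarrow> carrier V" "b m \<in> carrier V" "b j \<in> carrier V" using assms by auto
    then show ?case using Suc assms by (auto simp: lin_Suc less_Suc_eq)
  qed (simp add: lin_0)
  then show ?thesis using assms by auto
qed

lemma lin_lin:
  assumes "b \<in> {..<n} \<rightarrow> carrier V"
  shows "lin m (\<lambda>j. lin n b (C j)) d = lin n b (\<lambda>i. \<Sum>j<m. C j i * d j)"
proof (induction m)
  case (Suc m)
  have c: "lin n b (C j) \<in> carrier V" for j by (rule lin_closed[OF assms])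
  have "lin n b (\<lambda>i. \<Sum>j<Suc m. C j i * d j) = lin n b (\<lambda>i. \<Sum>j<m. C j i * d j) \<oplus> lin n b (\<lambda>i. d m * C m i)"
    by (subst lin_add[OF assms, symmetric]) (auto simp: ac_simps)
  then show ?case using Suc c by (simp add: lin_Suc lin_smult[OF assms])
qed (simp add: lin_0 lin_zero[OF assms])

lemma is_basis_lin:
  "is_basis V A n b N \<longleftrightarrow> (\<forall>i<n. b i \<in> carrier V) \<and> N = {lin n b c | c. \<forall>i<n. c i \<in> A} \<and>
     (\<forall>c. (\<forall>i<n. c i \<in> A) \<and> lin n b c = \<zero> \<longrightarrow> (\<forall>i<n. c i = 0))"
  unfolding is_basis_def lin_def ..

end

text \<open>Coefficient rings are subsets of one ring, because a lattice and its localizations lie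
  in the same vector space over the field of fractions.\<close>

definition subring_set :: "'r::comm_ring_1 set \<Rightarrow> bool" where
  "subring_set A \<longleftrightarrow> 0 \<in> A \<and> 1 \<in> A \<and> (\<forall>x\<in>A. \<forall>y\<in>A. x + y \<in> A \<and> x - y \<in> A \<and> x * y \<in> A)"

lemma subring_set_sum: "subring_set A \<Longrightarrow> (\<And>i. i < n \<Longrightarrow> f i \<in> A) \<Longrightarrow> (\<Sum>i<n. f i) \<in> A" for n :: nat
  by (induction n) (auto simp: subring_set_def)

lemma subring_set_UNIV: "subring_set UNIV" by (simp add: subring_set_def)

text \<open>Matrices act on coefficient functions rather than on vectors, to compose with
  \<open>lin\<close>; values of the function from index \<open>n\<close> on are ignored.\<close>

definition mat_apply :: "nat \<Rightarrow> 'r::comm_ring_1 mat \<Rightarrow> (nat \<Rightarrow> 'r) \<Rightarrow> nat \<Rightarrow> 'r" where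
  "mat_apply n C d i = (\<Sum>j<n. C $$ (i, j) * d j)"

lemma mat_apply_mult:
  assumes "C \<in> carrier_mat k m" "D \<in> carrier_mat m n" "i < k"
  shows "mat_apply m C (mat_apply n D d) i = mat_apply n (C * D) d i"
proof -
  have e: "(C * D) $$ (i, j) = (\<Sum>l<m. C $$ (i, l) * D $$ (l, j))" if "j < n" for j
    using assms that by (auto simp: scalar_prod_def atLeast0LessThan)
  have "mat_apply n (C * D) d i = (\<Sum>j<n. \<Sum>l<m. C $$ (i, l) * D $$ (l, j) * d j)"
    unfolding mat_apply_def by (rule sum.cong) (auto simp: e sum_distrib_right)
  also have "\<dots> = mat_apply m C (mat_apply n D d) i"
    unfolding mat_apply_def by (subst sum.swap) (simp add: sum_distrib_left mult.assoc)
  finally show ?thesis ..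
qed

lemma mat_apply_one: "i < n \<Longrightarrow> mat_apply n (1\<^sub>m n) d i = d i"
  unfolding mat_apply_def
  by (subst sum.mono_neutral_right[of _ "{i}"]) auto

lemma mat_apply_cong: "(\<And>j. j < n \<Longrightarrow> d j = d' j) \<Longrightarrow> mat_apply n C d i = mat_apply n C d' i"
  unfolding mat_apply_def by (intro sum.cong) auto

lemma mat_apply_zero: "mat_apply n C (\<lambda>_. 0) i = 0"
  by (simp add: mat_apply_def)

definition mat_in :: "'r set \<Rightarrow> 'r mat \<Rightarrow> bool" where
  "mat_in A C \<longleftrightarrow> (\<forall>i<dim_row C. \<forall>j<dim_col C. C $$ (i, j) \<in> A)"

lemma mat_apply_in:
  assumes "subring_set A" "C \<in> carrier_mat m n" "mat_in A C" "\<And>j. j < n \<Longrightarrow> d j \<in> A" "i < m"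
  shows "mat_apply n C d i \<in> A"
  unfolding mat_apply_def using assms
  by (intro subring_set_sum) (auto simp: mat_in_def subring_set_def)

context umod
begin

definition columns :: "nat \<Rightarrow> (nat \<Rightarrow> 'v) \<Rightarrow> 'r mat \<Rightarrow> nat \<Rightarrow> 'v" where
  "columns n b C j = lin n b (\<lambda>i. C $$ (i, j))"

lemma lin_columns:
  assumes "b \<in> {..<n} \<rightarrow> carrier V"
  shows "lin m (columns n b C) d = lin n b (mat_apply m C d)"
  unfolding columns_def mat_apply_def by (subst lin_lin[OF assms]) auto

lemma columns_closed: "b \<in> {..<n} \<rightarrow> carrier V \<Longrightarrow> columns n b C j \<in> carrier V"
  unfolding columns_def by (rule lin_closed)

lemma is_basisD:
  assumes "is_basis V A n b N"
  shows "b \<in> {..<n} \<rightarrow> carrier V" "N = {lin n b c | c. \<forall>i<n. c i \<in> A}"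
    "(\<And>i. i < n \<Longrightarrow> c i \<in> A) \<Longrightarrow> lin n b c = \<zero> \<Longrightarrow> i < n \<Longrightarrow> c i = 0"
  using assms unfolding is_basis_lin by blast+

lemma basis_coords_unique:
  assumes "subring_set A" "is_basis V A n b N" "\<And>i. i < n \<Longrightarrow> c i \<in> A" "\<And>i. i < n \<Longrightarrow> d i \<in> A"
    "lin n b c = lin n b d" "i < n"
  shows "c i = d i"
proof -
  note b = is_basisD(1)[OF assms(2)]
  have "lin n b (\<lambda>i. c i + (- 1) * d i) = lin n b c \<oplus> \<ominus> lin n b d"
    by (simp only: lin_add[OF b] lin_smult[OF b] umod_minus[OF lin_closed[OF b]])
  also have "\<dots> = \<zero>" unfolding assms(5) using lin_closed[OF b] by (simp add: M.r_neg)
  finally have "lin n b (\<lambda>i. c i - d i) = \<zero>" by simp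
  moreover have "\<And>i. i < n \<Longrightarrow> c i - d i \<in> A" using assms(1,3,4) by (auto simp: subring_set_def)
  ultimately have "c i - d i = 0" using is_basisD(3)[OF assms(2), of "\<lambda>i. c i - d i"] assms(6) by blast
  then show ?thesis by simp
qed

lemma basis_change:
  assumes A: "subring_set A" and b: "is_basis V A n b N" and CD: "inverse_mats n C D"
    and C: "mat_in A C" and D: "mat_in A D"
  shows "is_basis V A n (columns n b C) N"
proof -
  note bc = is_basisD(1)[OF b] and inv = inverse_matsD[OF CD]
  have cc: "lin n (columns n b C) (mat_apply n D c) = lin n b c" for c
    unfolding lin_columns[OF bc]
    by (rule lin_cong) (auto simp: mat_apply_mult[OF inv(1,2)] inv mat_apply_one bc)
  show ?thesis unfolding is_basis_lin
  proof (intro conjI allI impI)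
    show "columns n b C i \<in> carrier V" for i by (rule columns_closed[OF bc])
    show "N = {lin n (columns n b C) c | c. \<forall>i<n. c i \<in> A}"
    proof (intro equalityI subsetI)
      fix x assume "x \<in> N"
      then obtain c where c: "x = lin n b c" "\<forall>i<n. c i \<in> A" using is_basisD(2)[OF b] by blast
      then show "x \<in> {lin n (columns n b C) c | c. \<forall>i<n. c i \<in> A}"
        using cc[of c] mat_apply_in[OF A inv(2) D, of c]
        by (intro CollectI exI[of _ "mat_apply n D c"]) auto
    next
      fix x assume "x \<in> {lin n (columns n b C) c | c. \<forall>i<n. c i \<in> A}"
      then obtain c where c: "x = lin n (columns n b C) c" "\<forall>i<n. c i \<in> A" by blast
      then show "x \<in> N" unfolding is_basisD(2)[OF b] lin_columns[OF bc]
        using mat_apply_in[OF A inv(1) C, of c] by blast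
    qed
    fix c i assume c: "(\<forall>i<n. c i \<in> A) \<and> lin n (columns n b C) c = \<zero>" and i: "i < n"
    then have "lin n b (mat_apply n C c) = \<zero>" by (simp add: lin_columns[OF bc])
    then have "mat_apply n C c j = 0" if "j < n" for j
      using is_basisD(3)[OF b, of "mat_apply n C c"] mat_apply_in[OF A inv(1) C, of c] c that by blast
    then have "mat_apply n D (mat_apply n C c) i = 0"
      using mat_apply_cong[of n "mat_apply n C c" "\<lambda>_. 0"] by (simp add: mat_apply_zero)
    then show "c i = 0" using i by (simp add: mat_apply_mult[OF inv(2,1)] inv mat_apply_one)
  qed
qed

lemma basis_coords_exists:
  assumes "is_basis V A n b N" "x \<in> N"
  shows "\<exists>c. x = lin n b c \<and> (\<forall>i<n. c i \<in> A)"
  using assms is_basisD(2) by blast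

lemma basis_in:
  assumes "subring_set A" "is_basis V A n b N" "j < n"
  shows "b j \<in> N"
proof -
  have "b j = lin n b (\<lambda>i. if i = j then 1 else 0)" using lin_unit[OF is_basisD(1)[OF assms(2)] assms(3)] by simp
  then show ?thesis unfolding is_basisD(2)[OF assms(2)]
    using assms(1) by (intro CollectI exI[of _ "\<lambda>i. if i = j then 1 else 0"]) (auto simp: subring_set_def)
qed

lemma basis_transition:
  assumes A: "subring_set A" and b: "is_basis V A n b N" and b': "is_basis V A m b' N"
  shows "\<exists>C\<in>carrier_mat n m. mat_in A C \<and> (\<forall>j<m. b' j = columns n b C j)"
proof -
  have "\<exists>c. b' j = lin n b c \<and> (\<forall>i<n. c i \<in> A)" if "j < m" for j
    by (rule basis_coords_exists[OF b basis_in[OF A b' that]])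
  then obtain c where c: "\<And>j. j < m \<Longrightarrow> b' j = lin n b (c j)" "\<And>i j. j < m \<Longrightarrow> i < n \<Longrightarrow> c j i \<in> A" by metis
  let ?C = "mat n m (\<lambda>(i, j). c j i)"
  have "b' j = columns n b ?C j" if "j < m" for j
    unfolding c(1)[OF that] columns_def using that is_basisD(1)[OF b] by (intro lin_cong) auto
  then show ?thesis using c(2) by (intro bexI[of _ ?C]) (auto simp: mat_in_def)
qed

lemma basis_transition_product:
  assumes A: "subring_set A" and b: "is_basis V A n b N" and b': "is_basis V A m b' N"
    and C: "C \<in> carrier_mat n m" "mat_in A C" "\<And>j. j < m \<Longrightarrow> b' j = columns n b C j"
    and D: "D \<in> carrier_mat m n" "mat_in A D" "\<And>j. j < n \<Longrightarrow> b j = columns m b' D j"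
  shows "C * D = 1\<^sub>m n"
proof (rule eq_matI)
  note bc = is_basisD(1)[OF b] and bc' = is_basisD(1)[OF b']
  fix i j assume "i < dim_row (1\<^sub>m n :: 'r mat)" "j < dim_col (1\<^sub>m n :: 'r mat)"
  then have ij: "i < n" "j < n" by auto
  have "lin n b (\<lambda>i. if i = j then 1 else 0) = columns m b' D j" using lin_unit[OF bc ij(2)] D(3)[OF ij(2)] by simp
  also have "\<dots> = lin m (columns n b C) (\<lambda>i. D $$ (i, j))"
    unfolding columns_def[of m b' D] by (rule lin_cong) (use C(3) bc' in auto)
  also have "\<dots> = lin n b (mat_apply m C (\<lambda>i. D $$ (i, j)))" by (rule lin_columns[OF bc])
  finally have e: "lin n b (\<lambda>i. if i = j then 1 else 0) = lin n b (mat_apply m C (\<lambda>i. D $$ (i, j)))" .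
  have "(if i = j then 1 else 0) = mat_apply m C (\<lambda>i. D $$ (i, j)) i"
    by (rule basis_coords_unique[OF A b _ _ e ij(1)])
       (use A mat_apply_in[OF A C(1,2), of "\<lambda>i. D $$ (i, j)"] D ij in \<open>auto simp: subring_set_def mat_in_def\<close>)
  also have "\<dots> = (C * D) $$ (i, j)" using ij C D
    by (auto simp: mat_apply_def scalar_prod_def atLeast0LessThan)
  finally show "(C * D) $$ (i, j) = 1\<^sub>m n $$ (i, j)" using ij by auto
qed (use C D in auto)

end

text \<open>This comparison of two bases of one module is behind the uniqueness of rank and
  degree.\<close>

lemma (in umod) two_bases:
  fixes A :: "'r set"
  assumes A: "subring_set A" and b: "is_basis V A n b N" and b': "is_basis V A m b' N"
  obtains C D where "C \<in> carrier_mat n m" "D \<in> carrier_mat m n" "C * D = 1\<^sub>m n" "D * C = 1\<^sub>m m"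
    "mat_in A C" "mat_in A D" "\<forall>j<m. b' j = columns n b C j"
proof -
  obtain C where C: "C \<in> carrier_mat n m" "mat_in A C" "\<forall>j<m. b' j = columns n b C j"
    using basis_transition[OF A b b'] by blast
  obtain D where D: "D \<in> carrier_mat m n" "mat_in A D" "\<forall>j<n. b j = columns m b' D j"
    using basis_transition[OF A b' b] by blast
  have "C * D = 1\<^sub>m n" using basis_transition_product[OF A b b'] C D by blast
  moreover have "D * C = 1\<^sub>m m" using basis_transition_product[OF A b' b] C D by blast
  ultimately show thesis using that C D by blast
qed

section \<open>The vector space of fractions\<close>

locale tfmod = umod V for V :: "('r::idom, 'v, 'x) module_scheme" (structure) +
  assumes torsion_free: "a \<odot> x = \<zero> \<Longrightarrow> x \<in> carrier V \<Longrightarrow> a \<noteq> 0 \<Longrightarrow> x = \<zero>"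
begin

abbreviation FV :: "('r fract, ('v \<times> 'r) set) module" where "FV \<equiv> frac_module V"

abbreviation fr :: "'v \<Rightarrow> 'r \<Rightarrow> ('v \<times> 'r) set" where "fr \<equiv> fraction V"

lemma smult_cancel:
  assumes "a \<noteq> 0" "x \<in> carrier V" "y \<in> carrier V" "a \<odot> x = a \<odot> y"
  shows "x = y"
proof -
  have "a \<odot> (x \<oplus> (- 1) \<odot> y) = a \<odot> x \<oplus> (- 1) \<odot> (a \<odot> y)"
    using assms(2,3) by (simp add: umod_smult_add umod_smult_smult)
  also have "\<dots> = \<zero>" using assms umod_minus[of "a \<odot> y"] by (simp add: M.r_neg)
  finally have z: "a \<odot> (x \<oplus> (- 1) \<odot> y) = \<zero>" .
  have "x \<oplus> (- 1) \<odot> y = \<zero>" by (rule torsion_free[OF z _ assms(1)]) (use assms(2,3) in simp)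
  then have "x \<oplus> \<ominus> y = \<zero>" unfolding umod_minus[OF assms(3)] .
  then have "\<ominus> (\<ominus> y) = x" using assms(2,3) by (intro M.minus_equality) auto
  then show ?thesis using assms(3) by simp
qed

text \<open>Without torsion the auxiliary factor \<open>r\<close> in \<open>fraction\<close>
  cancels.\<close>

lemma fraction_mem:
  assumes "x \<in> carrier V" "s \<noteq> 0"
  shows "(y, t) \<in> fr x s \<longleftrightarrow> y \<in> carrier V \<and> t \<noteq> 0 \<and> t \<odot> x = s \<odot> y"
proof
  assume "(y, t) \<in> fr x s"
  then obtain r where r: "y \<in> carrier V" "t \<noteq> 0" "r \<noteq> 0" "(r * t) \<odot> x = (r * s) \<odot> y"
    by (auto simp: fraction_def)
  then have "r \<odot> (t \<odot> x) = r \<odot> (s \<odot> y)" using assms by (simp add: umod_smult_smult)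
  then have "t \<odot> x = s \<odot> y" by (rule smult_cancel[OF r(3), rotated 2]) (use r assms in auto)
  then show "y \<in> carrier V \<and> t \<noteq> 0 \<and> t \<odot> x = s \<odot> y" using r by simp
next
  assume "y \<in> carrier V \<and> t \<noteq> 0 \<and> t \<odot> x = s \<odot> y"
  then show "(y, t) \<in> fr x s" unfolding fraction_def using assms
    by (auto intro!: exI[of _ 1])
qed

lemma fraction_self: "x \<in> carrier V \<Longrightarrow> s \<noteq> 0 \<Longrightarrow> (x, s) \<in> fr x s"
  by (simp add: fraction_mem)

lemma fraction_eq_iff:
  assumes "x \<in> carrier V" "s \<noteq> 0" "y \<in> carrier V" "t \<noteq> 0"
  shows "fr x s = fr y t \<longleftrightarrow> t \<odot> x = s \<odot> y"
proof
  assume "fr x s = fr y t"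
  then have "(y, t) \<in> fr x s" using fraction_self assms by simp
  then show "t \<odot> x = s \<odot> y" using assms by (simp add: fraction_mem)
next
  have *: "fr x s \<subseteq> fr y t" if e: "t \<odot> x = s \<odot> y" "x \<in> carrier V" "s \<noteq> 0" "y \<in> carrier V" "t \<noteq> 0" for x s y t
  proof
    fix w assume "w \<in> fr x s"
    then obtain z u where w: "w = (z, u)" "z \<in> carrier V" "u \<noteq> 0" "u \<odot> x = s \<odot> z"
      using e by (cases w) (auto simp: fraction_mem)
    have "s \<odot> (u \<odot> y) = u \<odot> (s \<odot> y)" using e by (simp add: umod_smult_smult mult.commute)
    also have "\<dots> = t \<odot> (u \<odot> x)" unfolding e(1)[symmetric] using e(2) by (simp add: umod_smult_smult mult.commute)
    also have "\<dots> = s \<odot> (t \<odot> z)" unfolding w(4) using w(2) by (simp add: umod_smult_smult mult.commute)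
    finally have "u \<odot> y = t \<odot> z"
      by (rule smult_cancel[OF e(3), rotated 2]) (use e(2,4) w(2) in auto)
    then show "w \<in> fr y t" using w(1-3) e(4,5) by (simp add: fraction_mem)
  qed
  assume "t \<odot> x = s \<odot> y"
  then show "fr x s = fr y t" using *[of t x s y] *[of s y t x] assms by auto
qed

lemma frac_carrier: "carrier FV = {fr x s | x s. x \<in> carrier V \<and> s \<noteq> 0}"
  and frac_zero: "\<zero>\<^bsub>FV\<^esub> = fr \<zero> 1"
  by (simp_all add: frac_module_def)

lemma frac_closed: "x \<in> carrier V \<Longrightarrow> s \<noteq> 0 \<Longrightarrow> fr x s \<in> carrier FV"
  by (auto simp: frac_carrier)

text \<open>The sum is defined as a union over all pairs of representatives. All of them give the
  same class, so the union is that class.\<close>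

lemma frac_add:
  assumes x: "x \<in> carrier V" "s \<noteq> 0" and y: "y \<in> carrier V" "t \<noteq> 0"
  shows "fr x s \<oplus>\<^bsub>FV\<^esub> fr y t = fr (t \<odot> x \<oplus> s \<odot> y) (s * t)"
proof -
  have "fr (t' \<odot> x' \<oplus> s' \<odot> y') (s' * t') = fr (t \<odot> x \<oplus> s \<odot> y) (s * t)"
    if "(x', s') \<in> fr x s" "(y', t') \<in> fr y t" for x' s' y' t'
  proof -
    have 1: "x' \<in> carrier V" "s' \<noteq> 0" "s' \<odot> x = s \<odot> x'" using that(1) x by (auto simp: fraction_mem)
    have 2: "y' \<in> carrier V" "t' \<noteq> 0" "t' \<odot> y = t \<odot> y'" using that(2) y by (auto simp: fraction_mem)
    have "(s * t) \<odot> (t' \<odot> x' \<oplus> s' \<odot> y') = (t * t') \<odot> (s \<odot> x') \<oplus> (s * s') \<odot> (t \<odot> y')"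
      using 1 2 by (simp add: umod_smult_add umod_smult_smult ac_simps)
    also have "\<dots> = (s' * t') \<odot> (t \<odot> x \<oplus> s \<odot> y)"
      unfolding 1(3)[symmetric] 2(3)[symmetric] using x y by (simp add: umod_smult_add umod_smult_smult ac_simps)
    finally show ?thesis using x y 1 2 by (subst fraction_eq_iff) auto
  qed
  then have "{fr (t' \<odot> x' \<oplus> s' \<odot> y') (s' * t') | x' s' y' t'. (x', s') \<in> fr x s \<and> (y', t') \<in> fr y t} =
      {fr (t \<odot> x \<oplus> s \<odot> y) (s * t)}"
    using fraction_self[OF x] fraction_self[OF y] by blast
  then show ?thesis by (simp add: frac_module_def)
qed

lemma frac_smult:
  assumes x: "x \<in> carrier V" "s \<noteq> 0" and b: "b \<noteq> 0"
  shows "Fract a b \<odot>\<^bsub>FV\<^esub> fr x s = fr (a \<odot> x) (b * s)"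
proof -
  have "fr (a' \<odot> x') (b' * s') = fr (a \<odot> x) (b * s)"
    if "(x', s') \<in> fr x s" "b' \<noteq> 0" "Fract a b = Fract a' b'" for a' b' x' s'
  proof -
    have 1: "x' \<in> carrier V" "s' \<noteq> 0" "s' \<odot> x = s \<odot> x'" using that(1) x by (auto simp: fraction_mem)
    have ab: "a * b' = a' * b" using that(2,3) b by (simp add: eq_fract)
    have "(b * s) \<odot> (a' \<odot> x') = (a' * b) \<odot> (s \<odot> x')" using 1 by (simp add: umod_smult_smult ac_simps)
    also have "\<dots> = (b' * s') \<odot> (a \<odot> x)"
      unfolding 1(3)[symmetric] ab[symmetric] using x by (simp add: umod_smult_smult ac_simps)
    finally show ?thesis using x b 1 that by (subst fraction_eq_iff) auto
  qed
  then have "{fr (a' \<odot> x') (b' * s') | a' b' x' s'. (x', s') \<in> fr x s \<and> b' \<noteq> 0 \<and> Fract a b = Fract a' b'} =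
      {fr (a \<odot> x) (b * s)}"
    using fraction_self[OF x] b by blast
  then show ?thesis by (simp add: frac_module_def)
qed

lemma frac_rep:
  assumes "X \<in> carrier FV"
  obtains x s where "x \<in> carrier V" "s \<noteq> 0" "X = fr x s"
  using assms by (auto simp: frac_carrier)

lemma fract_rep: obtains a b :: 'r where "b \<noteq> 0" "c = Fract a b"
  by (cases c) auto

lemma frac_module_module: "Module.module (univ_ring :: 'r fract ring) FV"
proof (rule moduleI)
  show "cring (univ_ring :: 'r fract ring)" by (rule cring_univ_ring)
  show "abelian_group FV"
  proof (rule abelian_groupI)
    fix X Y assume "X \<in> carrier FV" "Y \<in> carrier FV"
    then obtain x s y t where 1: "x \<in> carrier V" "s \<noteq> 0" "X = fr x s" "y \<in> carrier V" "t \<noteq> 0" "Y = fr y t"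
      by (metis frac_rep)
    show "X \<oplus>\<^bsub>FV\<^esub> Y \<in> carrier FV" using 1 by (auto simp: frac_add intro!: frac_closed)
    show "X \<oplus>\<^bsub>FV\<^esub> Y = Y \<oplus>\<^bsub>FV\<^esub> X" using 1 by (simp add: frac_add M.a_comm mult.commute)
    fix Z assume "Z \<in> carrier FV"
    then obtain z u where 2: "z \<in> carrier V" "u \<noteq> 0" "Z = fr z u" by (metis frac_rep)
    show "X \<oplus>\<^bsub>FV\<^esub> Y \<oplus>\<^bsub>FV\<^esub> Z = X \<oplus>\<^bsub>FV\<^esub> (Y \<oplus>\<^bsub>FV\<^esub> Z)"
      using 1 2 by (simp add: frac_add umod_smult_add umod_smult_smult M.a_assoc ac_simps)
  next
    show "\<zero>\<^bsub>FV\<^esub> \<in> carrier FV" by (simp add: frac_zero frac_closed)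
    fix X assume "X \<in> carrier FV"
    then obtain x s where 1: "x \<in> carrier V" "s \<noteq> 0" "X = fr x s" by (metis frac_rep)
    show "\<zero>\<^bsub>FV\<^esub> \<oplus>\<^bsub>FV\<^esub> X = X" using 1 by (simp add: frac_zero frac_add)
    have "fr ((- 1) \<odot> x) s \<oplus>\<^bsub>FV\<^esub> X = \<zero>\<^bsub>FV\<^esub>"
    proof -
      have "s \<odot> (\<ominus> x) \<oplus> s \<odot> x = \<zero>"
        using 1 umod_smult_add[of "\<ominus> x" x s] by (simp add: M.l_neg)
      then show ?thesis using 1 umod_minus[of x] by (simp add: frac_zero frac_add fraction_eq_iff)
    qed
    then show "\<exists>Y\<in>carrier FV. Y \<oplus>\<^bsub>FV\<^esub> X = \<zero>\<^bsub>FV\<^esub>" using 1 frac_closed by (meson umod_smult(1))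
  qed
next
  fix c d :: "'r fract" and X Y
  assume "X \<in> carrier FV"
  then obtain x s where 1: "x \<in> carrier V" "s \<noteq> 0" "X = fr x s" by (metis frac_rep)
  obtain a b where c: "b \<noteq> 0" "c = Fract a b" by (rule fract_rep)
  obtain a' b' where d: "b' \<noteq> 0" "d = Fract a' b'" by (rule fract_rep)
  show "c \<odot>\<^bsub>FV\<^esub> X \<in> carrier FV" using 1 c by (auto simp: frac_smult intro!: frac_closed)
  have "fr ((a * b' + a' * b) \<odot> x) (b * b' * s) =
      fr ((b' * s) \<odot> (a \<odot> x) \<oplus> (b * s) \<odot> (a' \<odot> x)) (b * s * (b' * s))"
    using 1 c d by (subst fraction_eq_iff) (auto simp: umod_smult_add umod_smult_smult algebra_simps umod_add_smult M.a_comm)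
  then show "(c \<oplus>\<^bsub>univ_ring\<^esub> d) \<odot>\<^bsub>FV\<^esub> X = c \<odot>\<^bsub>FV\<^esub> X \<oplus>\<^bsub>FV\<^esub> d \<odot>\<^bsub>FV\<^esub> X"
    using 1 c d by (simp add: frac_smult frac_add)
  show "(c \<otimes>\<^bsub>univ_ring\<^esub> d) \<odot>\<^bsub>FV\<^esub> X = c \<odot>\<^bsub>FV\<^esub> (d \<odot>\<^bsub>FV\<^esub> X)"
    using 1 c d by (simp add: frac_smult umod_smult_smult mult.assoc)
  show "\<one>\<^bsub>univ_ring\<^esub> \<odot>\<^bsub>FV\<^esub> X = X"
    using 1 frac_smult[of x s 1 1] by (simp add: One_fract_def)
  assume "Y \<in> carrier FV"
  then obtain y t where 2: "y \<in> carrier V" "t \<noteq> 0" "Y = fr y t" by (metis frac_rep)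
  have "fr (a \<odot> (t \<odot> x \<oplus> s \<odot> y)) (b * (s * t)) =
      fr ((b * t) \<odot> (a \<odot> x) \<oplus> (b * s) \<odot> (a \<odot> y)) (b * s * (b * t))"
    using 1 2 c by (subst fraction_eq_iff) (auto simp: umod_smult_add umod_smult_smult ac_simps)
  then show "c \<odot>\<^bsub>FV\<^esub> (X \<oplus>\<^bsub>FV\<^esub> Y) = c \<odot>\<^bsub>FV\<^esub> X \<oplus>\<^bsub>FV\<^esub> c \<odot>\<^bsub>FV\<^esub> Y"
    using 1 2 c by (simp add: frac_smult frac_add)
qed

sublocale FV: umod FV
  by (simp add: umod_def frac_module_module)

lemma fr_add: "x \<in> carrier V \<Longrightarrow> y \<in> carrier V \<Longrightarrow> s \<noteq> 0 \<Longrightarrow> fr (x \<oplus> y) s = fr x s \<oplus>\<^bsub>FV\<^esub> fr y s"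
  by (simp add: frac_add fraction_eq_iff umod_smult_add umod_smult_smult)

lemma fr_scale: "x \<in> carrier V \<Longrightarrow> s \<noteq> 0 \<Longrightarrow> t \<noteq> 0 \<Longrightarrow> fr (t \<odot> x) (t * s) = fr x s"
  by (simp add: fraction_eq_iff umod_smult_smult ac_simps)

lemma lin_fractions:
  assumes b: "b \<in> {..<n} \<rightarrow> carrier V" and s: "s \<noteq> 0"
  shows "FV.lin n (\<lambda>i. fr (b i) 1) (\<lambda>i. Fract (c i) s) = fr (lin n b c) s"
  using b
proof (induction n)
  case 0
  then show ?case using s by (simp add: FV.lin_0 lin_0 frac_zero fraction_eq_iff)
next
  case (Suc n)
  then have bn: "b \<in> {..<n} \<rightarrow> carrier V" "b n \<in> carrier V" by auto
  have F: "(\<lambda>i. fr (b i) 1) \<in> {..<Suc n} \<rightarrow> carrier FV" using Suc.prems by (auto intro!: frac_closed)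
  have "FV.lin (Suc n) (\<lambda>i. fr (b i) 1) (\<lambda>i. Fract (c i) s) = fr (lin n b c) s \<oplus>\<^bsub>FV\<^esub> fr (c n \<odot> b n) s"
    using Suc.IH[OF bn(1)] F bn s by (simp add: FV.lin_Suc frac_smult)
  also have "\<dots> = fr (lin (Suc n) b c) s"
    using bn Suc.prems s lin_closed[OF bn(1)] by (simp add: lin_Suc fr_add)
  finally show ?case .
qed

end

definition mult_set :: "'r::idom set \<Rightarrow> bool" where
  "mult_set D \<longleftrightarrow> 1 \<in> D \<and> 0 \<notin> D \<and> (\<forall>x\<in>D. \<forall>y\<in>D. x * y \<in> D)"

text \<open>One localization at a multiplicative set stands for the three rings of scalars, with
  denominators 1, powers of \<open>e\<close>, or elements prime to \<open>e\<close>.\<close>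

definition scalars :: "'r::idom set \<Rightarrow> 'r fract set" where
  "scalars D = {Fract a s | a s. s \<in> D}"

lemma scalars_special:
  "integral_scalars = scalars {1}" "scalars_inverting e = scalars (range (\<lambda>k. e ^ k))"
  "scalars_local e = scalars {s. \<not> e dvd s}"
  by (auto simp: scalars_def integral_scalars_def scalars_inverting_def scalars_local_def)

lemma mult_set_special:
  "mult_set {1 :: 'r::idom}" "(e :: 'r) \<noteq> 0 \<Longrightarrow> mult_set (range (\<lambda>k. e ^ k))"
  "prime_elem e \<Longrightarrow> mult_set {s. \<not> e dvd s}"
  by (auto simp: mult_set_def prime_elem_def simp flip: power_add intro: exI[of _ 0] image_eqI[of _ _ 0])

lemma common_denominator:
  fixes n :: nat
  assumes D: "mult_set D" and c: "\<And>i. i < n \<Longrightarrow> c i \<in> scalars D"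
  shows "\<exists>s\<in>D. \<exists>a. \<forall>i<n. c i = Fract (a i) s"
  using c
proof (induction n)
  case 0
  then show ?case using D by (auto simp: mult_set_def)
next
  case (Suc n)
  then obtain s a where 1: "s \<in> D" "\<forall>i<n. c i = Fract (a i) s" by (metis less_SucI)
  obtain b t where 2: "c n = Fract b t" "t \<in> D" using Suc.prems[of n] by (auto simp: scalars_def)
  have nz: "s \<noteq> 0" "t \<noteq> 0" using 1 2 D by (auto simp: mult_set_def)
  show ?case
    by (rule bexI[of _ "s * t"], rule exI[of _ "\<lambda>i. if i = n then s * b else t * a i"])
       (use 1 2 nz D in \<open>auto simp: eq_fract less_Suc_eq mult_set_def ac_simps\<close>)
qed

lemma subring_scalars: "mult_set D \<Longrightarrow> subring_set (scalars D)"
  unfolding subring_set_def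
proof (intro conjI ballI)
  assume D: "mult_set D"
  show "0 \<in> scalars D" "1 \<in> scalars D"
    using D by (auto simp: scalars_def mult_set_def Zero_fract_def One_fract_def)
  fix x y assume "x \<in> scalars D" "y \<in> scalars D"
  then obtain a s b t where 1: "x = Fract a s" "s \<in> D" "y = Fract b t" "t \<in> D" by (auto simp: scalars_def)
  then have nz: "s \<noteq> 0" "t \<noteq> 0" "s * t \<in> D" using D by (auto simp: mult_set_def)
  show "x + y \<in> scalars D" "x - y \<in> scalars D" "x * y \<in> scalars D"
    using 1 nz by (auto simp: scalars_def)
qed

lemma scalars_mono: "mult_set D \<Longrightarrow> Fract a 1 \<in> scalars D"
  by (auto simp: scalars_def mult_set_def)

context tfmod
begin

text \<open>Finitely many coefficients have a common denominator in \<open>D\<close>, so a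
  combination over the localization is a single fraction of a combination over the ring.\<close>

lemma frac_basis:
  assumes b: "is_basis V UNIV n b (carrier V)" and D: "mult_set D"
  shows "is_basis FV (scalars D) n (\<lambda>i. fr (b i) 1) {fr x s | x s. x \<in> carrier V \<and> s \<in> D}"
  unfolding FV.is_basis_lin
proof (intro conjI allI impI)
  note bc = is_basisD(1)[OF b]
  have D0: "s \<noteq> 0" if "s \<in> D" for s using that D by (auto simp: mult_set_def)
  show "fr (b i) 1 \<in> carrier FV" if "i < n" for i using bc that by (auto intro!: frac_closed)
  have F: "(\<lambda>i. fr (b i) 1) \<in> {..<n} \<rightarrow> carrier FV" using bc by (auto intro!: frac_closed)
  have red: "\<exists>s\<in>D. \<exists>a. FV.lin n (\<lambda>i. fr (b i) 1) c = fr (lin n b a) s \<and> (\<forall>i<n. c i = Fract (a i) s)"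
    if c: "\<And>i. i < n \<Longrightarrow> c i \<in> scalars D" for c
  proof -
    have "\<exists>s\<in>D. \<exists>a. \<forall>i<n. c i = Fract (a i) s" by (rule common_denominator[OF D]) (rule c)
    then obtain s a where sa: "s \<in> D" "\<forall>i<n. c i = Fract (a i) s" by blast
    have "FV.lin n (\<lambda>i. fr (b i) 1) c = FV.lin n (\<lambda>i. fr (b i) 1) (\<lambda>i. Fract (a i) s)"
      by (rule FV.lin_cong) (use sa F in auto)
    also have "\<dots> = fr (lin n b a) s" by (rule lin_fractions[OF bc D0[OF sa(1)]])
    finally show ?thesis using sa by blast
  qed
  show "{fr x s | x s. x \<in> carrier V \<and> s \<in> D} = {FV.lin n (\<lambda>i. fr (b i) 1) c | c. \<forall>i<n. c i \<in> scalars D}"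
  proof (intro equalityI subsetI)
    fix X assume "X \<in> {fr x s | x s. x \<in> carrier V \<and> s \<in> D}"
    then obtain x s where X: "X = fr x s" "x \<in> carrier V" "s \<in> D" by blast
    obtain a where a: "x = lin n b a" using basis_coords_exists[OF b X(2)] by blast
    have "X = FV.lin n (\<lambda>i. fr (b i) 1) (\<lambda>i. Fract (a i) s)"
      unfolding X a by (rule lin_fractions[OF bc D0[OF X(3)], symmetric])
    then show "X \<in> {FV.lin n (\<lambda>i. fr (b i) 1) c | c. \<forall>i<n. c i \<in> scalars D}"
      using X(3) by (intro CollectI exI[of _ "\<lambda>i. Fract (a i) s"]) (auto simp: scalars_def)
  next
    fix X assume "X \<in> {FV.lin n (\<lambda>i. fr (b i) 1) c | c. \<forall>i<n. c i \<in> scalars D}"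
    then obtain c where c: "X = FV.lin n (\<lambda>i. fr (b i) 1) c" "\<forall>i<n. c i \<in> scalars D" by blast
    then show "X \<in> {fr x s | x s. x \<in> carrier V \<and> s \<in> D}"
      using red[of c] lin_closed[OF bc] by (smt (verit) mem_Collect_eq)
  qed
  fix c i assume c: "(\<forall>i<n. c i \<in> scalars D) \<and> FV.lin n (\<lambda>i. fr (b i) 1) c = \<zero>\<^bsub>FV\<^esub>" and i: "i < n"
  obtain s a where sa: "s \<in> D" "FV.lin n (\<lambda>i. fr (b i) 1) c = fr (lin n b a) s" "\<forall>i<n. c i = Fract (a i) s"
    using red[of c] c by blast
  have "fr (lin n b a) s = fr \<zero> 1" using sa c by (simp add: frac_zero)
  then have "lin n b a = \<zero>" using D0[OF sa(1)] lin_closed[OF bc] by (simp add: fraction_eq_iff)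
  then have "a i = 0" using is_basisD(3)[OF b, of a] i by blast
  then show "c i = 0" using sa(3) i by (simp add: Zero_fract_def eq_fract D0[OF sa(1)])
qed

end

lemma basis_torsion_free:
  fixes M :: "('r::idom, 'm, 'x) module_scheme"
  assumes "Module.module (univ_ring :: 'r ring) M" "is_basis M UNIV n b (carrier M)"
  shows "tfmod M"
proof -
  interpret M: umod M using assms(1) by (simp add: umod_def)
  show ?thesis
  proof
    fix a :: 'r and x assume a: "a \<odot>\<^bsub>M\<^esub> x = \<zero>\<^bsub>M\<^esub>" "x \<in> carrier M" "a \<noteq> 0"
    note bc = M.is_basisD(1)[OF assms(2)]
    obtain c where c: "x = M.lin n b c" using M.basis_coords_exists[OF assms(2) a(2)] by blast
    have "M.lin n b (\<lambda>i. a * c i) = \<zero>\<^bsub>M\<^esub>" using a(1) c M.lin_smult[OF bc] by simp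
    then have "a * c i = 0" if "i < n" for i
      using M.is_basisD(3)[OF assms(2), of "\<lambda>i. a * c i"] that by blast
    then have "c i = 0" if "i < n" for i using a(3) that by auto
    then have "x = M.lin n b (\<lambda>_. 0)" unfolding c by (intro M.lin_cong) (use bc in auto)
    then show "x = \<zero>\<^bsub>M\<^esub>" using M.lin_zero[OF bc] by simp
  qed
qed

section \<open>Frobenius modules presented by a matrix\<close>

lemma to_fract_hom: "comm_ring_hom (to_fract :: 'r::idom \<Rightarrow> 'r fract)"
  by unfold_locales auto

lemma to_fract_power: "to_fract (x ^ k) = to_fract x ^ k"
  by (induction k) auto

lemma subring_set_prod:
  "subring_set A \<Longrightarrow> finite S \<Longrightarrow> (\<And>i. i \<in> S \<Longrightarrow> f i \<in> A) \<Longrightarrow> prod f S \<in> A"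
  by (induction S rule: infinite_finite_induct) (auto simp: subring_set_def)

lemma subring_set_finite_sum:
  "subring_set A \<Longrightarrow> finite S \<Longrightarrow> (\<And>i. i \<in> S \<Longrightarrow> f i \<in> A) \<Longrightarrow> sum f S \<in> A"
  by (induction S rule: infinite_finite_induct) (auto simp: subring_set_def)

lemma subring_set_det:
  assumes A: "subring_set A" and C: "C \<in> carrier_mat n n" "mat_in A C"
  shows "det C \<in> A"
proof -
  have m1: "- 1 \<in> A" using A unfolding subring_set_def by (metis diff_0)
  have "signof p \<in> A" for p :: "nat \<Rightarrow> nat"
    using A m1 by (auto simp: sign_def subring_set_def)
  moreover have "(\<Prod>i = 0..<n. C $$ (i, p i)) \<in> A" if "p permutes {0..<n}" for p
  proof (rule subring_set_prod[OF A])
    fix i assume i: "i \<in> {0..<n}"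
    then have "p i \<in> {0..<n}" using permutes_in_image[OF that] by blast
    then show "C $$ (i, p i) \<in> A" using i C by (auto simp: mat_in_def)
  qed simp
  ultimately show ?thesis unfolding det_def'[OF C(1)]
    using A by (intro subring_set_finite_sum) (auto simp: subring_set_def finite_permutations)
qed

lemma mat_in_mult:
  assumes "subring_set A" "C \<in> carrier_mat m k" "D \<in> carrier_mat k n" "mat_in A C" "mat_in A D"
  shows "mat_in A (C * D)"
proof -
  have "(C * D) $$ (i, j) \<in> A" if "i < m" "j < n" for i j
    using assms that unfolding mat_in_def
    by (auto simp: scalar_prod_def subring_set_def intro!: subring_set_finite_sum[OF assms(1)])
  then show ?thesis using assms by (auto simp: mat_in_def)
qed

text \<open>The inverse is the adjugate divided by the determinant, and all denominators can be
  taken to be \<open>s\<close>.\<close>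

lemma local_inverse:
  fixes P :: "'r::idom mat"
  assumes P: "P \<in> carrier_mat n n" and D: "mult_set D" and s: "det P dvd s" "s \<in> D"
  obtains P' where "inverse_mats n (map_mat to_fract P) P'" "mat_in (scalars D) P'"
proof -
  interpret h: comm_ring_hom "to_fract :: 'r \<Rightarrow> 'r fract" by (rule to_fract_hom)
  obtain w where w: "s = det P * w" using s by (auto simp: dvd_def)
  have s0: "s \<noteq> 0" using s D by (auto simp: mult_set_def)
  note a = adj_mat[OF P]
  define P' where "P' = Fract w s \<cdot>\<^sub>m map_mat to_fract (adj_mat P)"
  have e: "Fract w s * to_fract (det P) = 1" using w s0 by (simp add: to_fract_def One_fract_def eq_fract)
  have "map_mat to_fract P * map_mat to_fract (adj_mat P) = to_fract (det P) \<cdot>\<^sub>m 1\<^sub>m n"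
    "map_mat to_fract (adj_mat P) * map_mat to_fract P = to_fract (det P) \<cdot>\<^sub>m 1\<^sub>m n"
    using a P by (simp_all add: h.mat_hom_smult h.mat_hom_one flip: h.mat_hom_mult)
  then have "inverse_mats n (map_mat to_fract P) P'"
    unfolding inverse_mats_def P'_def using P a(1) e
    by (auto simp: mult_smult_distrib[of _ n n _ n] mult_smult_assoc_mat[of _ n n _ n] intro!: eq_matI)
  moreover have "mat_in (scalars D) P'"
    unfolding mat_in_def P'_def using s(2) s0 by (auto simp: scalars_def to_fract_def)
  ultimately show thesis by (rule that)
qed

lemma mat_in_to_fract: "mult_set D \<Longrightarrow> mat_in (scalars D) (map_mat to_fract P)"
  by (auto simp: mat_in_def to_fract_def scalars_mono)

lemma prime_power_unique:
  fixes e :: "'r::idom"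
  assumes e: "prime_elem e" and "e ^ i * y = e ^ j * z" "\<not> e dvd y" "\<not> e dvd z"
  shows "i = j"
proof -
  have *: "\<not> i < j" if "e ^ i * y = e ^ j * z" "\<not> e dvd y" for i j y z
  proof
    assume "i < j"
    then obtain k where "j = i + Suc k" using less_imp_Suc_add by auto
    then have "e ^ i * y = e ^ i * (e * (e ^ k * z))" using that(1) by (simp add: power_add ac_simps)
    then have "y = e * (e ^ k * z)" using e by (simp add: prime_elem_def)
    then show False using that(2) by simp
  qed
  show ?thesis using *[of i y j z] *[of j z i y] assms by (metis linorder_neqE_nat)
qed

lemma local_powi_unit:
  fixes e :: "'r::idom"
  assumes e: "prime_elem e" and eq: "Fract e 1 powi m = Fract x z" and x: "\<not> e dvd x" "\<not> e dvd z"
  shows "m = 0"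
proof -
  have z: "z \<noteq> 0" "x \<noteq> 0" "e \<noteq> 0" using x e by auto
  show ?thesis
  proof (cases "0 \<le> m")
    case True
    then have "Fract (e ^ nat m) 1 = Fract x z"
      using eq by (simp add: power_int_def to_fract_power flip: to_fract_def)
    then have "e ^ nat m * z = e ^ 0 * x" using z by (simp add: eq_fract)
    then show ?thesis using prime_power_unique[OF e, of "nat m" z 0 x] x True by simp
  next
    case False
    then have "Fract 1 (e ^ nat (- m)) = Fract x z"
      using eq z by (simp add: power_int_def power_inverse to_fract_def[symmetric] flip: to_fract_power)
         (simp add: to_fract_def)
    then have "e ^ nat (- m) * x = e ^ 0 * z" using z by (simp add: eq_fract ac_simps)
    then show ?thesis using prime_power_unique[OF e, of "nat (- m)" x 0 z] x False by simp
  qed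
qed

lemma (in umod) is_basis_cong:
  assumes "is_basis V A n b N" "\<And>i. i < n \<Longrightarrow> b i = b' i"
  shows "is_basis V A n b' N"
proof -
  note bc = is_basisD(1)[OF assms(1)]
  have l: "lin n b c = lin n b' c" for c by (rule lin_cong) (use assms(2) bc in auto)
  show ?thesis using assms(1) assms(2) unfolding is_basis_lin l by auto
qed

text \<open>In the basis \<open>b\<close> the Frobenius has matrix \<open>A / d\<close>. The
  denominator is a parameter rather than a power of \<open>e\<close>, since passing to a quotient
  replaces it by its image under another ring homomorphism.\<close>

locale presented = \<phi>: comm_ring_hom \<phi> for \<phi> :: "'r::idom \<Rightarrow> 'r" +
  fixes d :: 'r and n :: nat and b :: "nat \<Rightarrow> 'm" and A :: "'r mat" and M :: "('r, 'm) phi_module"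
  assumes mod: "Module.module (univ_ring :: 'r ring) M" and basis: "is_basis M UNIV n b (carrier M)"
    and A_carrier: "A \<in> carrier_mat n n" and d_nonzero: "d \<noteq> 0"
    and frob_lin: "\<And>c. frob M (umod.lin M n b c) =
      fraction M (umod.lin M n b (mat_apply n A (\<lambda>i. \<phi> (c i)))) d"
begin

sublocale M: tfmod M
  by (rule basis_torsion_free[OF mod basis])

lemmas b_carrier = M.is_basisD(1)[OF basis]

abbreviation \<beta> :: "nat \<Rightarrow> ('m \<times> 'r) set" where "\<beta> i \<equiv> M.fr (b i) 1"

abbreviation G :: "'r fract mat" where "G \<equiv> map_mat (\<lambda>a. Fract a d) A"

lemma coords:
  assumes "x \<in> carrier M"
  obtains c where "x = M.lin n b c"
  using M.basis_coords_exists[OF basis assms] by blast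

lemma coords_unique: "M.lin n b c = M.lin n b c' \<Longrightarrow> i < n \<Longrightarrow> c i = c' i"
  by (rule M.basis_coords_unique[OF subring_set_UNIV basis]) auto

lemma \<beta>_carrier: "\<beta> \<in> {..<n} \<rightarrow> carrier M.FV"
  using b_carrier by (auto intro!: M.frac_closed)

lemma frob_basis:
  assumes "j < n"
  shows "frob M (b j) = M.FV.columns n \<beta> G j"
proof -
  have "b j = M.lin n b (\<lambda>i. if i = j then 1 else 0)" using M.lin_unit[OF b_carrier assms] by simp
  then have "frob M (b j) = M.fr (M.lin n b (mat_apply n A (\<lambda>i. \<phi> (if i = j then 1 else 0)))) d"
    using frob_lin by simp
  also have "M.lin n b (mat_apply n A (\<lambda>i. \<phi> (if i = j then 1 else 0))) = M.lin n b (\<lambda>i. A $$ (i, j))"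
  proof (rule M.lin_cong)
    fix i assume "i < n"
    show "mat_apply n A (\<lambda>i. \<phi> (if i = j then 1 else 0)) i = A $$ (i, j)"
      unfolding mat_apply_def using assms by (subst sum.mono_neutral_right[of _ "{j}"]) auto
  qed (use b_carrier in auto)
  also have "M.fr (M.lin n b (\<lambda>i. A $$ (i, j))) d = M.FV.lin n \<beta> (\<lambda>i. Fract (A $$ (i, j)) d)"
    by (rule M.lin_fractions[OF b_carrier d_nonzero, symmetric])
  also have "\<dots> = M.FV.columns n \<beta> G j"
    unfolding M.FV.columns_def by (rule M.FV.lin_cong) (use A_carrier assms \<beta>_carrier in auto)
  finally show ?thesis .
qed

lemma frob_basis_carrier: "(\<lambda>j. frob M (b j)) \<in> {..<n} \<rightarrow> carrier M.FV"
  using frob_basis M.FV.columns_closed[OF \<beta>_carrier] by auto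

lemma frob_lin_frob_basis:
  "frob M (M.lin n b c) = M.FV.lin n (\<lambda>j. frob M (b j)) (\<lambda>j. Fract (\<phi> (c j)) 1)"
proof -
  have sumF: "(\<Sum>j<k. Fract (f j) d) = Fract (\<Sum>j<k. f j) d" for f :: "nat \<Rightarrow> 'r" and k
    by (induction k) (auto simp: Zero_fract_def eq_fract d_nonzero algebra_simps)
  have "M.FV.lin n (\<lambda>j. frob M (b j)) (\<lambda>j. Fract (\<phi> (c j)) 1) =
      M.FV.lin n (M.FV.columns n \<beta> G) (\<lambda>j. Fract (\<phi> (c j)) 1)"
    by (rule M.FV.lin_cong) (use frob_basis frob_basis_carrier in auto)
  also have "\<dots> = M.FV.lin n \<beta> (mat_apply n G (\<lambda>j. Fract (\<phi> (c j)) 1))"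
    by (rule M.FV.lin_columns[OF \<beta>_carrier])
  also have "\<dots> = M.FV.lin n \<beta> (\<lambda>i. Fract (mat_apply n A (\<lambda>j. \<phi> (c j)) i) d)"
    by (rule M.FV.lin_cong) (use A_carrier \<beta>_carrier in \<open>auto simp: mat_apply_def sumF\<close>)
  also have "\<dots> = frob M (M.lin n b c)"
    unfolding frob_lin by (rule M.lin_fractions[OF b_carrier d_nonzero])
  finally show ?thesis ..
qed

lemma frob_closed: "x \<in> carrier M \<Longrightarrow> frob M x \<in> carrier M.FV"
  using coords frob_lin M.frac_closed[OF M.lin_closed[OF b_carrier] d_nonzero] by metis

lemma G_scaled: "G = Fract 1 d \<cdot>\<^sub>m map_mat to_fract A"
  by (intro eq_matI) (auto simp: to_fract_def)

lemma det_G: "det G = Fract 1 d ^ n * to_fract (det A)"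
proof -
  interpret h: comm_ring_hom "to_fract :: 'r \<Rightarrow> 'r fract" by (rule to_fract_hom)
  show ?thesis unfolding G_scaled using A_carrier by simp
qed

text \<open>Expanding arbitrary elements in the basis shows that the images of the basis vectors
  span; a common denominator accounts for the localization.\<close>

lemma frob_span:
  assumes D: "mult_set D"
  shows "{Fract 1 s \<odot>\<^bsub>M.FV\<^esub> v | s v. s \<in> D \<and> v \<in> frob_image M} =
    {M.FV.lin n (\<lambda>j. frob M (b j)) c | c. \<forall>i<n. c i \<in> scalars D}"
proof (intro equalityI subsetI)
  note S = subring_scalars[OF D] and gc = frob_basis_carrier
  fix X assume "X \<in> {Fract 1 s \<odot>\<^bsub>M.FV\<^esub> v | s v. s \<in> D \<and> v \<in> frob_image M}"
  then obtain s m c x where 1: "s \<in> D" "\<forall>i<m. x i \<in> carrier M"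
    "X = Fract 1 s \<odot>\<^bsub>M.FV\<^esub> M.FV.lin m (\<lambda>i. frob M (x i)) (\<lambda>i. Fract (c i) 1)"
    unfolding frob_image_def M.FV.lin_def by blast
  have fc: "(\<lambda>i. frob M (x i)) \<in> {..<m} \<rightarrow> carrier M.FV" using 1(2) frob_closed by auto
  have "\<exists>a. x i = M.lin n b a" if "i < m" for i using 1(2) that coords by metis
  then obtain a where a: "\<And>i. i < m \<Longrightarrow> x i = M.lin n b (a i)" by metis
  have "M.FV.lin m (\<lambda>i. frob M (x i)) (\<lambda>i. Fract (c i) 1) =
      M.FV.lin m (\<lambda>i. M.FV.lin n (\<lambda>j. frob M (b j)) (\<lambda>j. Fract (\<phi> (a i j)) 1)) (\<lambda>i. Fract (c i) 1)"
    by (rule M.FV.lin_cong[OF _ _ fc]) (simp_all add: a frob_lin_frob_basis)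
  also have "\<dots> = M.FV.lin n (\<lambda>j. frob M (b j)) (\<lambda>j. \<Sum>i<m. Fract (\<phi> (a i j)) 1 * Fract (c i) 1)"
    by (rule M.FV.lin_lin[OF gc])
  finally have "X = M.FV.lin n (\<lambda>j. frob M (b j)) (\<lambda>j. Fract 1 s * (\<Sum>i<m. Fract (\<phi> (a i j)) 1 * Fract (c i) 1))"
    unfolding 1(3) by (simp only: M.FV.lin_smult[OF gc])
  moreover have "Fract 1 s * (\<Sum>i<m. Fract (\<phi> (a i j)) 1 * Fract (c i) 1) \<in> scalars D" for j
  proof -
    have "Fract 1 s \<in> scalars D" using 1(1) by (auto simp: scalars_def)
    moreover have "(\<Sum>i<m. Fract (\<phi> (a i j)) 1 * Fract (c i) 1) \<in> scalars D"
      using S scalars_mono[OF D] by (intro subring_set_sum) (auto simp: subring_set_def)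
    ultimately show ?thesis using S by (auto simp: subring_set_def)
  qed
  ultimately show "X \<in> {M.FV.lin n (\<lambda>j. frob M (b j)) c | c. \<forall>i<n. c i \<in> scalars D}" by blast
next
  note gc = frob_basis_carrier
  fix X assume "X \<in> {M.FV.lin n (\<lambda>j. frob M (b j)) c | c. \<forall>i<n. c i \<in> scalars D}"
  then obtain c where c: "X = M.FV.lin n (\<lambda>j. frob M (b j)) c" "\<forall>i<n. c i \<in> scalars D" by blast
  have "\<exists>s\<in>D. \<exists>a. \<forall>i<n. c i = Fract (a i) s" by (rule common_denominator[OF D]) (use c in auto)
  then obtain s a where sa: "s \<in> D" "\<forall>i<n. c i = Fract (a i) s" by blast
  have s0: "s \<noteq> 0" using sa D by (auto simp: mult_set_def)
  have "X = M.FV.lin n (\<lambda>j. frob M (b j)) (\<lambda>i. Fract 1 s * Fract (a i) 1)"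
    unfolding c(1) by (rule M.FV.lin_cong) (use sa s0 gc in auto)
  also have "\<dots> = Fract 1 s \<odot>\<^bsub>M.FV\<^esub> M.FV.lin n (\<lambda>j. frob M (b j)) (\<lambda>i. Fract (a i) 1)"
    by (rule M.FV.lin_smult[OF gc])
  finally have "X = Fract 1 s \<odot>\<^bsub>M.FV\<^esub> M.FV.lin n (\<lambda>j. frob M (b j)) (\<lambda>i. Fract (a i) 1)" .
  moreover have "M.FV.lin n (\<lambda>j. frob M (b j)) (\<lambda>i. Fract (a i) 1) \<in> frob_image M"
    unfolding frob_image_def M.FV.lin_def using b_carrier by blast
  ultimately show "X \<in> {Fract 1 s \<odot>\<^bsub>M.FV\<^esub> v | s v. s \<in> D \<and> v \<in> frob_image M}" using sa(1) by blast
qed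

text \<open>Independence is checked over the whole field of fractions, where a nonzero determinant
  suffices, and is then restricted to the smaller ring of scalars.\<close>

lemma frob_image_basis:
  assumes D: "mult_set D" and nz: "det A \<noteq> 0"
  shows "is_basis M.FV (scalars D) n (\<lambda>j. frob M (b j)) {Fract 1 s \<odot>\<^bsub>M.FV\<^esub> v | s v. s \<in> D \<and> v \<in> frob_image M}"
proof -
  have "mult_set (UNIV - {0 :: 'r})" by (auto simp: mult_set_def)
  note bas = M.frac_basis[OF basis this]
  have "x \<in> scalars (UNIV - {0 :: 'r})" for x by (cases x) (auto simp: scalars_def)
  then have U: "scalars (UNIV - {0 :: 'r}) = UNIV" by blast
  have G: "G \<in> carrier_mat n n" using A_carrier by simp
  have "Fract 1 d \<noteq> 0" using d_nonzero by (simp add: Zero_fract_def eq_fract)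
  then have "det G \<noteq> 0" using nz by (simp add: det_G)
  then have "det G dvd 1" by (simp add: dvd_field_iff)
  then obtain G' where "inverse_mats n G G'" using inverse_mats_exists[OF G] by blast
  from M.FV.basis_change[OF subring_set_UNIV bas[unfolded U] this]
  have "is_basis M.FV UNIV n (M.FV.columns n \<beta> G) {M.fr x s | x s. x \<in> carrier M \<and> s \<in> UNIV - {0}}"
    by (auto simp: mat_in_def)
  then have B: "is_basis M.FV UNIV n (\<lambda>j. frob M (b j)) {M.fr x s | x s. x \<in> carrier M \<and> s \<in> UNIV - {0}}"
    by (rule M.FV.is_basis_cong) (simp add: frob_basis)
  show ?thesis unfolding M.FV.is_basis_lin frob_span[OF D]
  proof (intro conjI allI impI refl)
    show "frob M (b i) \<in> carrier M.FV" if "i < n" for i using frob_basis_carrier that by auto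
    fix c i assume "(\<forall>i<n. c i \<in> scalars D) \<and> M.FV.lin n (\<lambda>j. frob M (b j)) c = \<zero>\<^bsub>M.FV\<^esub>" "i < n"
    then show "c i = 0" using M.FV.is_basisD(3)[OF B, of c i] by simp
  qed
qed

lemma rank: "module_rank M = n"
  unfolding module_rank_def
proof (rule the_equality)
  show "\<exists>b. is_basis M UNIV n b (carrier M)" using basis by blast
  fix m assume "\<exists>b. is_basis M UNIV m b (carrier M)"
  then obtain b' where b': "is_basis M UNIV m b' (carrier M)" by blast
  obtain C D where "C \<in> carrier_mat n m" "D \<in> carrier_mat m n" "C * D = 1\<^sub>m n" "D * C = 1\<^sub>m m"
    "mat_in UNIV C" "mat_in UNIV D" "\<forall>j<m. b' j = M.columns n b C j"
    by (rule M.two_bases[OF subring_set_UNIV basis b'])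
  then show "m = n" using left_invertible_rank_le by (metis le_antisym)
qed

section \<open>Degrees as valuations of determinants\<close>

lemma localize_lattice:
  "localize e M.FV (lattice_of M) = {M.fr x s | x s. x \<in> carrier M \<and> s \<in> {s. \<not> e dvd s}}"
proof -
  have "Fract 1 s \<odot>\<^bsub>M.FV\<^esub> M.fr x 1 = M.fr x s" if "x \<in> carrier M" "\<not> e dvd s" for x s
    using that M.frac_smult[of x 1 s 1] by auto
  then show ?thesis unfolding localize_def lattice_of_def by auto blast+
qed

lemma columns_diag:
  assumes C: "C \<in> carrier_mat n n" and j: "j < n"
  shows "M.FV.columns n \<beta> (C * diag_rect n n n t) j = t j \<odot>\<^bsub>M.FV\<^esub> M.FV.columns n \<beta> C j"
proof -
  have "(C * diag_rect n n n t) $$ (i, j) = t j * C $$ (i, j)" if "i < n" for i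
  proof -
    have "(C * diag_rect n n n t) $$ (i, j) = (\<Sum>l\<in>{0..<n}. C $$ (i, l) * diag_rect n n n t $$ (l, j))"
      using C that j by (auto simp: scalar_prod_def diag_rect_def)
    also have "\<dots> = (\<Sum>l\<in>{j}. C $$ (i, l) * diag_rect n n n t $$ (l, j))"
      by (rule sum.mono_neutral_right) (use j in \<open>auto simp: diag_rect_def\<close>)
    finally show ?thesis using j by (simp add: diag_rect_def mult.commute)
  qed
  then have "M.FV.columns n \<beta> (C * diag_rect n n n t) j = M.FV.lin n \<beta> (\<lambda>i. t j * C $$ (i, j))"
    unfolding M.FV.columns_def by (intro M.FV.lin_cong) (use \<beta>_carrier in auto)
  then show ?thesis unfolding M.FV.columns_def by (simp only: M.FV.lin_smult[OF \<beta>_carrier])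
qed

lemma columns_columns:
  assumes "C \<in> carrier_mat n n" "D \<in> carrier_mat n n" "j < n"
  shows "M.FV.columns n (M.FV.columns n \<beta> C) D j = M.FV.columns n \<beta> (C * D) j"
  unfolding M.FV.columns_def[of n "M.FV.columns n \<beta> C"] M.FV.lin_columns[OF \<beta>_carrier]
  unfolding M.FV.columns_def
  by (rule M.FV.lin_cong)
     (use assms \<beta>_carrier in \<open>auto simp: mat_apply_def scalar_prod_def atLeast0LessThan\<close>)

lemma columns_frob_basis:
  assumes "D \<in> carrier_mat n n" "j < n"
  shows "M.FV.columns n (\<lambda>j. frob M (b j)) D j = M.FV.columns n \<beta> (G * D) j"
proof -
  have "M.FV.columns n (\<lambda>j. frob M (b j)) D j = M.FV.columns n (M.FV.columns n \<beta> G) D j"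
    unfolding M.FV.columns_def[of n "\<lambda>j. frob M (b j)"] M.FV.columns_def[of n "M.FV.columns n \<beta> G"]
    by (rule M.FV.lin_cong) (use frob_basis frob_basis_carrier in auto)
  then show ?thesis using columns_columns[of G D j] assms A_carrier by simp
qed

text \<open>The Smith form of \<open>A\<close> over the localization at \<open>e\<close> has entries
  \<open>e ^ k j\<close> times units. The left transformation gives the basis \<open>b'\<close>, the
  right one a basis of the Frobenius image, and the denominator \<open>e ^ h\<close> makes the
  exponents \<open>a j = h - k j\<close>.\<close>

lemma degree_exists:
  assumes e: "prime_elem e" and val: "\<And>x. x \<noteq> 0 \<Longrightarrow> \<exists>k y. x = e ^ k * y \<and> \<not> e dvd y"
    and d: "d = e ^ h" and det: "det A = e ^ i * y" "\<not> e dvd y"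
  shows "\<exists>b' a. is_basis M.FV (scalars_local e) n b' (localize e M.FV (lattice_of M)) \<and>
    is_basis M.FV (scalars_local e) n (\<lambda>i. (Fract e 1 powi (- a i)) \<odot>\<^bsub>M.FV\<^esub> b' i) (localize e M.FV (frob_image M)) \<and>
    int n * int h - int i = (\<Sum>i<n. a i)"
proof -
  interpret h: comm_ring_hom "to_fract :: 'r \<Rightarrow> 'r fract" by (rule to_fract_hom)
  let ?D = "{s. \<not> e dvd s}"
  have D: "mult_set ?D" by (rule mult_set_special(3)[OF e])
  note S = subring_scalars[OF D]
  have e0: "e \<noteq> 0" using e by auto
  have nz: "det A \<noteq> 0" using det e0 by auto
  obtain P Q t r where 1: "P \<in> carrier_mat n n" "Q \<in> carrier_mat n n" "\<not> e dvd det P" "\<not> e dvd det Q"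
    "r \<le> n" "\<forall>i<r. t i \<noteq> 0" "P * A * Q = diag_rect n n r t"
    using local_smith_form[OF e _ A_carrier] val by metis
  have detPAQ: "det P * det A * det Q = det (diag_rect n n r t)"
    using 1(1,2) A_carrier by (simp add: det_mult[of _ n] flip: 1(7))
  have r: "r = n"
  proof (rule ccontr)
    assume "r \<noteq> n"
    then have "r < n" using 1 by simp
    have "diag_rect n n r t = diag_rect n n n (\<lambda>i. if i < r then t i else 0)"
      using 1(5) by (intro eq_matI) (auto simp: diag_rect_def)
    then have "det (diag_rect n n r t) = 0" using \<open>r < n\<close> by (auto simp: det_diag_rect intro!: prod_zero)
    then show False using detPAQ nz 1(3,4) by auto
  qed
  have "\<forall>j. \<exists>k y. j < n \<longrightarrow> t j = e ^ k * y \<and> \<not> e dvd y" using val 1(6) r by blast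
  then obtain k z where kz: "\<And>j. j < n \<Longrightarrow> t j = e ^ k j * z j" "\<And>j. j < n \<Longrightarrow> \<not> e dvd z j" by metis
  have sumk: "i = (\<Sum>j<n. k j)"
  proof (rule prime_power_unique[OF e])
    have "e ^ i * (det P * y * det Q) = det P * det A * det Q" by (simp add: det ac_simps)
    also have "\<dots> = (\<Prod>j<n. t j)" unfolding detPAQ r by (rule det_diag_rect)
    also have "\<dots> = (\<Prod>j<n. e ^ k j * z j)" by (rule prod.cong) (auto simp: kz)
    also have "\<dots> = e ^ (\<Sum>j<n. k j) * (\<Prod>j<n. z j)" by (simp add: prod.distrib power_sum)
    finally show "e ^ i * (det P * y * det Q) = e ^ (\<Sum>j<n. k j) * (\<Prod>j<n. z j)" .
    show "\<not> e dvd det P * y * det Q" using 1(3,4) det(2) by (simp add: prime_elem_dvd_mult_iff[OF e])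
    have "\<not> e dvd (\<Prod>j<m. z j)" if "m \<le> n" for m
      using that by (induction m) (use kz(2) prime_elem_not_dvd_unit[OF e dvd_refl] in \<open>auto simp: prime_elem_dvd_mult_iff[OF e]\<close>)
    then show "\<not> e dvd (\<Prod>j<n. z j)" by simp
  qed
  let ?P = "map_mat to_fract P" and ?Q = "map_mat to_fract Q"
  obtain P' where P': "inverse_mats n ?P P'" "mat_in (scalars ?D) P'"
    using local_inverse[OF 1(1) D dvd_refl] 1(3) by blast
  obtain Q' where Q': "inverse_mats n ?Q Q'" "mat_in (scalars ?D) Q'"
    using local_inverse[OF 1(2) D dvd_refl] 1(4) by blast
  note iP = inverse_matsD[OF P'(1)] and iQ = inverse_matsD[OF Q'(1)]
  \<comment> \<open>The unit parts \<open>z j\<close> of the Smith form are absorbed into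
    \<open>b'\<close>.\<close>
  define Z where "Z = diag_rect n n n (\<lambda>j. to_fract (z j))"
  define Z' where "Z' = diag_rect n n n (\<lambda>j. Fract 1 (z j))"
  have z0: "z j \<noteq> 0" if "j < n" for j using kz(2)[OF that] by auto
  have dd: "diag_rect n n n f * diag_rect n n n g = diag_rect n n n (\<lambda>j. f j * g j)" for f g :: "nat \<Rightarrow> 'r fract"
  proof (rule eq_matI)
    fix i j assume "i < dim_row (diag_rect n n n (\<lambda>j. f j * g j))" "j < dim_col (diag_rect n n n (\<lambda>j. f j * g j))"
    then have ij: "i < n" "j < n" by (auto simp: diag_rect_def)
    have "(diag_rect n n n f * diag_rect n n n g) $$ (i, j) =
        (\<Sum>l\<in>{0..<n}. diag_rect n n n f $$ (i, l) * diag_rect n n n g $$ (l, j))"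
      using ij by (auto simp: scalar_prod_def diag_rect_def)
    also have "\<dots> = (\<Sum>l\<in>{j}. diag_rect n n n f $$ (i, l) * diag_rect n n n g $$ (l, j))"
      by (rule sum.mono_neutral_right) (use ij in \<open>auto simp: diag_rect_def\<close>)
    finally show "(diag_rect n n n f * diag_rect n n n g) $$ (i, j) = diag_rect n n n (\<lambda>j. f j * g j) $$ (i, j)"
      using ij by (auto simp: diag_rect_def)
  qed (auto simp: diag_rect_def)
  have one: "diag_rect n n n f = 1\<^sub>m n" if "\<And>j. j < n \<Longrightarrow> f j = 1" for f :: "nat \<Rightarrow> 'r fract"
    using that by (intro eq_matI) (auto simp: diag_rect_def)
  have iZ: "inverse_mats n Z Z'"
    unfolding inverse_mats_def Z_def Z'_def dd using z0
    by (auto intro!: one simp: to_fract_def One_fract_def eq_fract)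
  have inZ: "mat_in (scalars ?D) Z" "mat_in (scalars ?D) Z'"
    using kz(2) S by (auto simp: mat_in_def Z_def Z'_def diag_rect_def scalars_def to_fract_def subring_set_def)
  note cZ = inverse_matsD[OF iZ]
  have iC: "inverse_mats n (P' * Z) (Z' * ?P)"
  proof -
    have "P' * Z * (Z' * ?P) = P' * (Z * Z') * ?P" using iP(1,2) cZ(1,2) by (simp add: mat_assoc)
    then have x: "P' * Z * (Z' * ?P) = 1\<^sub>m n" unfolding cZ(3) using iP by simp
    have "Z' * ?P * (P' * Z) = Z' * (?P * P') * Z" using iP(1,2) cZ(1,2) by (simp add: mat_assoc)
    then have "Z' * ?P * (P' * Z) = 1\<^sub>m n" unfolding iP(3) using cZ by simp
    with x show ?thesis unfolding inverse_mats_def using iP(1,2) cZ(1,2) by simp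
  qed
  have inC: "mat_in (scalars ?D) (P' * Z)" "mat_in (scalars ?D) (Z' * ?P)"
    using mat_in_mult[OF S iP(2) cZ(1) P'(2) inZ(1)] mat_in_mult[OF S cZ(2) iP(1) inZ(2) mat_in_to_fract[OF D]] .
  define b' where "b' = M.FV.columns n \<beta> (P' * Z)"
  define a where "a = (\<lambda>j. int h - int (k j))"
  have B1: "is_basis M.FV (scalars ?D) n b' (localize e M.FV (lattice_of M))"
    unfolding b'_def localize_lattice by (rule M.FV.basis_change[OF S M.frac_basis[OF basis D] iC inC])
  have loc: "localize e M.FV (frob_image M) = {Fract 1 s \<odot>\<^bsub>M.FV\<^esub> v | s v. s \<in> ?D \<and> v \<in> frob_image M}"
    by (simp add: localize_def)
  have B2: "is_basis M.FV (scalars ?D) n (M.FV.columns n (\<lambda>j. frob M (b j)) ?Q) (localize e M.FV (frob_image M))"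
    unfolding loc
    by (rule M.FV.basis_change[OF S frob_image_basis[OF D nz] Q'(1) mat_in_to_fract[OF D] Q'(2)])
  have GQ: "G * ?Q = P' * Z * diag_rect n n n (\<lambda>j. Fract e 1 powi (- a j))"
  proof -
    have "?P * (G * ?Q) = Fract 1 d \<cdot>\<^sub>m (?P * map_mat to_fract A * ?Q)"
      unfolding G_scaled using 1(1,2) A_carrier
      by (simp add: mult_smult_distrib[of _ n n _ n] mult_smult_assoc_mat[of _ n n _ n] mat_assoc)
    also have "?P * map_mat to_fract A * ?Q = map_mat to_fract (diag_rect n n n t)"
      using 1(1,2) A_carrier 1(7) unfolding r by (simp flip: h.mat_hom_mult_dim)
    also have "Fract 1 d \<cdot>\<^sub>m map_mat to_fract (diag_rect n n n t) = diag_rect n n n (\<lambda>j. to_fract (z j) * (Fract e 1 powi (- a j)))"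
    proof (rule eq_matI)
      fix i j assume "i < dim_row (diag_rect n n n (\<lambda>j. to_fract (z j) * (Fract e 1 powi (- a j))))"
        "j < dim_col (diag_rect n n n (\<lambda>j. to_fract (z j) * (Fract e 1 powi (- a j))))"
      then have ij: "i < n" "j < n" by (auto simp: diag_rect_def)
      have "Fract 1 d * to_fract (t i) = to_fract (z i) * (Fract e 1 powi (- a i))"
      proof -
        have "to_fract e powi (- a i) = to_fract e powi (int (k i)) / to_fract e powi (int h)"
          unfolding a_def using e0 by (subst power_int_diff[symmetric]) auto
        also have "\<dots> = to_fract (e ^ k i) / to_fract (e ^ h)" by (simp add: to_fract_power)
        also have "\<dots> = Fract (e ^ k i) (e ^ h)" using e0 by (simp add: to_fract_def)
        finally have "Fract e 1 powi (- a i) = Fract (e ^ k i) (e ^ h)" by (simp add: to_fract_def)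
        then show ?thesis using kz(1)[OF ij(1)] by (simp add: to_fract_def d mult.commute)
      qed
      then show "(Fract 1 d \<cdot>\<^sub>m map_mat to_fract (diag_rect n n n t)) $$ (i, j) =
          diag_rect n n n (\<lambda>j. to_fract (z j) * (Fract e 1 powi (- a j))) $$ (i, j)"
        using ij by (auto simp: diag_rect_def)
    qed (auto simp: diag_rect_def)
    also have "\<dots> = Z * diag_rect n n n (\<lambda>j. Fract e 1 powi (- a j))" unfolding Z_def dd ..
    finally have "P' * (?P * (G * ?Q)) = P' * (Z * diag_rect n n n (\<lambda>j. Fract e 1 powi (- a j)))" by simp
    moreover have "P' * (?P * (G * ?Q)) = G * ?Q"
      by (rule inverse_mats_cancel(2)[OF P'(1), of _ n]) (use A_carrier 1(2) in auto)
    moreover have "P' * (Z * diag_rect n n n (\<lambda>j. Fract e 1 powi (- a j))) = P' * Z * diag_rect n n n (\<lambda>j. Fract e 1 powi (- a j))"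
      by (rule assoc_mult_mat[symmetric, of _ n n _ n _ n]) (use iP cZ in auto)
    ultimately show ?thesis by simp
  qed
  have "M.FV.columns n (\<lambda>j. frob M (b j)) ?Q j = (Fract e 1 powi (- a j)) \<odot>\<^bsub>M.FV\<^esub> b' j" if "j < n" for j
    using columns_frob_basis[of ?Q j] columns_diag[of "P' * Z" j] iP cZ 1(2) that unfolding GQ b'_def by simp
  then have B3: "is_basis M.FV (scalars ?D) n (\<lambda>i. (Fract e 1 powi (- a i)) \<odot>\<^bsub>M.FV\<^esub> b' i) (localize e M.FV (frob_image M))"
    by (intro M.FV.is_basis_cong[OF B2]) auto
  have "int n * int h - int i = (\<Sum>i<n. a i)" by (simp add: a_def sum_subtractf sumk)
  then show ?thesis using B1 B3 unfolding scalars_special by blast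
qed

text \<open>The degree is defined by a definite description, so all choices of bases must agree.
  Transition matrices from the standard bases have determinants that are units of the local ring, so
  taking determinants in \<open>C * ?\<Delta> = G * E\<close> compares powers of
  \<open>e\<close>.\<close>

lemma degree_unique:
  assumes e: "prime_elem e" and d: "d = e ^ h" and det: "det A = e ^ i * y" "\<not> e dvd y"
    and b1: "is_basis M.FV (scalars_local e) m b' (localize e M.FV (lattice_of M))"
    and b2: "is_basis M.FV (scalars_local e) m (\<lambda>i. (Fract e 1 powi (- a i)) \<odot>\<^bsub>M.FV\<^esub> b' i) (localize e M.FV (frob_image M))"
  shows "(\<Sum>i<m. a i) = int n * int h - int i"
proof -
  interpret h: comm_ring_hom "to_fract :: 'r \<Rightarrow> 'r fract" by (rule to_fract_hom)
  let ?D = "{s. \<not> e dvd s}"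
  have D: "mult_set ?D" by (rule mult_set_special(3)[OF e])
  note S = subring_scalars[OF D]
  have e0: "e \<noteq> 0" using e by auto
  have nz: "det A \<noteq> 0" using det e0 by auto
  have B1: "is_basis M.FV (scalars ?D) n \<beta> (localize e M.FV (lattice_of M))"
    unfolding localize_lattice by (rule M.frac_basis[OF basis D])
  have B2: "is_basis M.FV (scalars ?D) n (\<lambda>j. frob M (b j)) (localize e M.FV (frob_image M))"
    using frob_image_basis[OF D nz] by (simp add: localize_def)
  obtain C C' where C: "C \<in> carrier_mat n m" "C' \<in> carrier_mat m n" "C * C' = 1\<^sub>m n" "C' * C = 1\<^sub>m m"
    "mat_in (scalars ?D) C" "mat_in (scalars ?D) C'" "\<forall>j<m. b' j = M.FV.columns n \<beta> C j"
    by (rule M.FV.two_bases[OF S B1 b1[unfolded scalars_special]])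
  have mn: "m = n" using left_invertible_rank_le[OF C(1,2,3)] left_invertible_rank_le[OF C(2,1,4)] by simp
  obtain E E' where E: "E \<in> carrier_mat n m" "E' \<in> carrier_mat m n" "E * E' = 1\<^sub>m n" "E' * E = 1\<^sub>m m"
    "mat_in (scalars ?D) E" "mat_in (scalars ?D) E'"
    "\<forall>j<m. (Fract e 1 powi (- a j)) \<odot>\<^bsub>M.FV\<^esub> b' j = M.FV.columns n (\<lambda>j. frob M (b j)) E j"
    by (rule M.FV.two_bases[OF S B2 b2[unfolded scalars_special]])
  note C = C[unfolded mn] and E = E[unfolded mn]
  let ?\<Delta> = "diag_rect n n n (\<lambda>j. Fract e 1 powi (- a j))"
  have col: "M.FV.columns n \<beta> (C * ?\<Delta>) j = M.FV.columns n \<beta> (G * E) j" if "j < n" for j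
    using columns_diag[OF C(1) that] columns_frob_basis[OF E(1) that] C(7) E(7) that by simp
  have "mult_set (UNIV - {0 :: 'r})" by (auto simp: mult_set_def)
  note bas = M.frac_basis[OF basis this]
  have CG: "C * ?\<Delta> = G * E"
  proof (rule eq_matI)
    fix i j assume "i < dim_row (G * E)" "j < dim_col (G * E)"
    then have ij: "i < n" "j < n" using A_carrier E by auto
    have U: "x \<in> scalars (UNIV - {0 :: 'r})" for x by (cases x) (auto simp: scalars_def)
    show "(C * ?\<Delta>) $$ (i, j) = (G * E) $$ (i, j)"
      by (rule M.FV.basis_coords_unique[OF _ bas, of "\<lambda>i. (C * ?\<Delta>) $$ (i, j)" "\<lambda>i. (G * E) $$ (i, j)"])
         (use U col[OF ij(2)] ij subring_scalars[of "UNIV - {0 :: 'r}"] in \<open>auto simp: M.FV.columns_def mult_set_def\<close>)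
  qed (use C(1) E(1) A_carrier in \<open>auto simp: diag_rect_def\<close>)
  have unit: "\<exists>x z. det X = Fract x z \<and> \<not> e dvd x \<and> \<not> e dvd z"
    if X: "X \<in> carrier_mat n n" "Y \<in> carrier_mat n n" "X * Y = 1\<^sub>m n" "mat_in (scalars ?D) X" "mat_in (scalars ?D) Y" for X Y
  proof -
    obtain x z where x: "det X = Fract x z" "\<not> e dvd z" using subring_set_det[OF S X(1,4)] by (auto simp: scalars_def)
    obtain x' z' where x': "det Y = Fract x' z'" "\<not> e dvd z'" using subring_set_det[OF S X(2,5)] by (auto simp: scalars_def)
    have z: "z \<noteq> 0" "z' \<noteq> 0" using x x' by auto
    have "det X * det Y = 1" using det_mult[OF X(1,2)] X(3) by simp
    then have "x * x' = z * z'" using x x' z by (simp add: One_fract_def eq_fract)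
    moreover have "\<not> e dvd z * z'" using x(2) x'(2) by (simp add: prime_elem_dvd_mult_iff[OF e])
    ultimately have "\<not> e dvd x" by (metis dvd_mult2)
    then show ?thesis using x by blast
  qed
  obtain x1 z1 where 1: "det C = Fract x1 z1" "\<not> e dvd x1" "\<not> e dvd z1" using unit[OF C(1,2,3,5,6)] by blast
  obtain x2 z2 where 2: "det E = Fract x2 z2" "\<not> e dvd x2" "\<not> e dvd z2" using unit[OF E(1,2,3,5,6)] by blast
  have ne: "x1 \<noteq> 0" "z1 \<noteq> 0" "x2 \<noteq> 0" "z2 \<noteq> 0" "y \<noteq> 0" using 1 2 det by auto
  let ?w = "to_fract e"
  have w0: "?w \<noteq> 0" using e0 by simp
  have d\<Delta>: "det ?\<Delta> = ?w powi (- (\<Sum>j<n. a j))"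
  proof -
    have "(\<Prod>j<k. ?w powi (- a j)) = ?w powi (- (\<Sum>j<k. a j))" for k
      by (induction k) (use w0 in \<open>auto simp: power_int_add[symmetric] add.commute\<close>)
    then show ?thesis by (simp add: det_diag_rect to_fract_def)
  qed
  have "det C * det ?\<Delta> = det G * det E"
    using arg_cong[OF CG, of det] C E A_carrier by (simp add: det_mult[of _ n])
  also have "det G = ?w powi (int i - int (h * n)) * to_fract y"
  proof -
    have "Fract 1 d ^ n = inverse (?w ^ (h * n))"
    proof -
      have "Fract 1 d = inverse (to_fract d)" by (simp add: to_fract_def)
      then have "Fract 1 d = inverse (?w ^ h)" by (simp add: d to_fract_power)
      then show ?thesis by (simp add: power_mult power_inverse)
    qed
    moreover have "?w powi (int i - int (h * n)) = ?w ^ i / ?w ^ (h * n)"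
      using w0 by (simp add: power_int_diff del: of_nat_mult)
    ultimately show ?thesis by (simp add: det_G det to_fract_power field_simps)
  qed
  finally have eq: "Fract x1 z1 * ?w powi (- (\<Sum>j<n. a j)) = ?w powi (int i - int (h * n)) * to_fract y * Fract x2 z2"
    unfolding 1(1) 2(1) d\<Delta> .
  have "?w powi (int h * int n - int i - (\<Sum>j<n. a j)) = Fract (y * x2 * z1) (z2 * x1)"
  proof -
    have "?w powi (int h * int n - int i - (\<Sum>j<n. a j)) =
        ?w powi (- (\<Sum>j<n. a j)) / ?w powi (int i - int (h * n))"
    proof -
      have "int h * int n - int i - (\<Sum>j<n. a j) = - (\<Sum>j<n. a j) - (int i - int (h * n))" by simp
      then show ?thesis by (simp only:) (rule power_int_diff[OF disjI1[OF w0]])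
    qed
    also have "\<dots> = to_fract y * Fract x2 z2 / Fract x1 z1"
    proof -
      have "Fract x1 z1 \<noteq> 0" using ne by (simp add: Zero_fract_def eq_fract)
      moreover have "?w powi (int i - int (h * n)) \<noteq> 0" using w0 by simp
      moreover have "P / W = Y * Z / X" if "X \<noteq> 0" "W \<noteq> 0" "X * P = W * Y * Z" for X P W Y Z :: "'r fract"
        using that by (simp add: field_simps)
      ultimately show ?thesis using eq by blast
    qed
    also have "\<dots> = Fract (y * x2 * z1) (z2 * x1)" using ne by (simp add: to_fract_def)
    finally show ?thesis .
  qed
  then have "int h * int n - int i - (\<Sum>j<n. a j) = 0"
    by (intro local_powi_unit[OF e, of _ "y * x2 * z1" "z2 * x1"])
       (use 1(2,3) 2(2,3) det(2) in \<open>auto simp: to_fract_def prime_elem_dvd_mult_iff[OF e]\<close>)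
  then show ?thesis by (simp add: mn mult.commute)
qed

lemma degree_eq:
  assumes e: "prime_elem e" and val: "\<And>x. x \<noteq> 0 \<Longrightarrow> \<exists>k y. x = e ^ k * y \<and> \<not> e dvd y"
    and d: "d = e ^ h" and det: "det A = e ^ i * y" "\<not> e dvd y"
  shows "relative_degree M.FV (scalars_local e) (Fract e 1) (localize e M.FV (lattice_of M))
    (localize e M.FV (frob_image M)) = int n * int h - int i"
  unfolding relative_degree_def
proof (rule the_equality)
  show "\<exists>n' b' a. is_basis M.FV (scalars_local e) n' b' (localize e M.FV (lattice_of M)) \<and>
    is_basis M.FV (scalars_local e) n' (\<lambda>i. (Fract e 1 powi (- a i)) \<odot>\<^bsub>M.FV\<^esub> b' i) (localize e M.FV (frob_image M)) \<and>
    int n * int h - int i = (\<Sum>i<n'. a i)"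
    by (rule exI[of _ n], rule degree_exists[OF e val d det])
next
  fix D
  assume "\<exists>n' b' a. is_basis M.FV (scalars_local e) n' b' (localize e M.FV (lattice_of M)) \<and>
    is_basis M.FV (scalars_local e) n' (\<lambda>i. (Fract e 1 powi (- a i)) \<odot>\<^bsub>M.FV\<^esub> b' i) (localize e M.FV (frob_image M)) \<and>
    D = (\<Sum>i<n'. a i)"
  then show "D = int n * int h - int i" using degree_unique[OF e d det] by blast
qed

end

lemma (in presented) frob_coords:
  assumes "x \<in> carrier M"
  obtains c where "x = M.lin n b c" "frob M x = M.fr (M.lin n b (mat_apply n A (\<lambda>i. \<phi> (c i)))) d"
  using coords[OF assms] frob_lin by metis

lemma mat_apply_add: "mat_apply n A (\<lambda>i. c i + c' i) = (\<lambda>i. mat_apply n A c i + mat_apply n A c' i)"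
  by (rule ext) (simp add: mat_apply_def sum.distrib distrib_left)

lemma mat_apply_smult: "mat_apply n A (\<lambda>i. a * c i) = (\<lambda>i. a * mat_apply n A c i)"
  by (rule ext) (simp add: mat_apply_def sum_distrib_left mult.left_commute)

lemma (in presented) inverting_eq:
  "inverting e M (carrier M) = {M.fr x s | x s. x \<in> carrier M \<and> s \<in> range (\<lambda>k. e ^ k)}"
  by (auto simp: inverting_def)

text \<open>If \<open>det A\<close> divides a power of \<open>e\<close>, then \<open>A / d\<close>
  is invertible over \<open>R[1/e]\<close>, which is the isomorphism clause.\<close>

lemma (in presented) frobenius_moduleI:
  assumes e: "e \<noteq> 0" and d: "d = e ^ h" and det: "det A dvd e ^ j"
  shows "frobenius_module \<phi> e M"
  unfolding frobenius_module_def
proof (intro conjI ballI allI)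
  interpret h: comm_ring_hom "to_fract :: 'r \<Rightarrow> 'r fract" by (rule to_fract_hom)
  note bc = b_carrier
  have lc: "M.lin n b c \<in> carrier M" for c by (rule M.lin_closed[OF bc])
  show "Module.module univ_ring M" by (rule mod)
  fix x assume x: "x \<in> carrier M"
  obtain c where c: "x = M.lin n b c" "frob M x = M.fr (M.lin n b (mat_apply n A (\<lambda>i. \<phi> (c i)))) d"
    by (rule frob_coords[OF x])
  show "frob M x \<in> inverting e M (carrier M)"
    unfolding c(2) inverting_def using lc d by blast
  show "frob M (a \<odot>\<^bsub>M\<^esub> x) = Fract (\<phi> a) 1 \<odot>\<^bsub>M.FV\<^esub> frob M x" for a
  proof -
    have "frob M (a \<odot>\<^bsub>M\<^esub> x) = frob M (M.lin n b (\<lambda>i. a * c i))" unfolding c by (simp add: M.lin_smult[OF bc])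
    also have "\<dots> = M.fr (\<phi> a \<odot>\<^bsub>M\<^esub> M.lin n b (mat_apply n A (\<lambda>i. \<phi> (c i)))) d"
      unfolding frob_lin by (simp add: \<phi>.hom_mult mat_apply_smult M.lin_smult[OF bc])
    also have "\<dots> = Fract (\<phi> a) 1 \<odot>\<^bsub>M.FV\<^esub> frob M x" unfolding c(2) using lc d_nonzero by (simp add: M.frac_smult)
    finally show ?thesis .
  qed
  fix y assume y: "y \<in> carrier M"
  obtain c' where c': "y = M.lin n b c'" "frob M y = M.fr (M.lin n b (mat_apply n A (\<lambda>i. \<phi> (c' i)))) d"
    by (rule frob_coords[OF y])
  have "frob M (x \<oplus>\<^bsub>M\<^esub> y) = frob M (M.lin n b (\<lambda>i. c i + c' i))" unfolding c c' by (simp add: M.lin_add[OF bc])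
  also have "\<dots> = M.fr (M.lin n b (mat_apply n A (\<lambda>i. \<phi> (c i))) \<oplus>\<^bsub>M\<^esub> M.lin n b (mat_apply n A (\<lambda>i. \<phi> (c' i)))) d"
    unfolding frob_lin by (simp add: \<phi>.hom_add mat_apply_add M.lin_add[OF bc])
  also have "\<dots> = frob M x \<oplus>\<^bsub>M.FV\<^esub> frob M y"
    unfolding c(2) c'(2) by (rule M.fr_add[OF lc lc d_nonzero])
  finally show "frob M (x \<oplus>\<^bsub>M\<^esub> y) = frob M x \<oplus>\<^bsub>M.FV\<^esub> frob M y" .
next
  let ?D = "range (\<lambda>k. e ^ k)"
  have D: "mult_set ?D" by (rule mult_set_special(2)[OF e])
  note S = subring_scalars[OF D]
  obtain A' where A': "inverse_mats n (map_mat to_fract A) A'" "mat_in (scalars ?D) A'"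
    using local_inverse[OF A_carrier D det] by blast
  note iA = inverse_matsD[OF A'(1)]
  have dd: "Fract 1 d * to_fract d = 1" using d_nonzero by (simp add: to_fract_def One_fract_def eq_fract)
  have inv: "inverse_mats n G (to_fract d \<cdot>\<^sub>m A')"
    unfolding inverse_mats_def G_scaled using iA dd
    by (auto simp: mult_smult_distrib[of _ n n _ n] mult_smult_assoc_mat[of _ n n _ n] mult.commute intro!: eq_matI)
  have in1: "mat_in (scalars ?D) G" using d A_carrier by (auto simp: mat_in_def scalars_def)
  have in2: "mat_in (scalars ?D) (to_fract d \<cdot>\<^sub>m A')"
    using A'(2) iA(2) S scalars_mono[OF D, of d] by (auto simp: mat_in_def subring_set_def to_fract_def)
  have "is_basis M.FV (scalars ?D) n (M.FV.columns n \<beta> G) (inverting e M (carrier M))"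
    unfolding inverting_eq by (rule M.FV.basis_change[OF S M.frac_basis[OF basis D] inv in1 in2])
  then have "is_basis M.FV (scalars_inverting e) n (\<lambda>i. frob M (b i)) (inverting e M (carrier M))"
    unfolding scalars_special by (rule M.FV.is_basis_cong) (simp add: frob_basis)
  then show "\<exists>n b. is_basis M UNIV n b (carrier M) \<and>
      is_basis M.FV (scalars_inverting e) n (\<lambda>i. frob M (b i)) (inverting e M (carrier M))"
    using basis by blast
qed

text \<open>The finitely many denominators of the images of basis vectors are cleared by one power
  of \<open>e\<close>, and the isomorphism clause makes the determinant a divisor of a power of
  \<open>e\<close>.\<close>

lemma frobenius_module_presented:
  fixes M :: "('r::idom, 'm) phi_module"
  assumes hom: "comm_ring_hom \<phi>" and e: "e \<noteq> 0" and M: "frobenius_module \<phi> e M"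
  obtains h n b A where "presented \<phi> (e ^ h) n b A M" "\<exists>j. det A dvd e ^ j"
proof -
  interpret \<phi>: comm_ring_hom \<phi> by (rule hom)
  have mod: "Module.module (univ_ring :: 'r ring) M"
    and fr_in: "\<And>x. x \<in> carrier M \<Longrightarrow> frob M x \<in> inverting e M (carrier M)"
    and fr_add: "\<And>x y. x \<in> carrier M \<Longrightarrow> y \<in> carrier M \<Longrightarrow> frob M (x \<oplus>\<^bsub>M\<^esub> y) = frob M x \<oplus>\<^bsub>frac_module M\<^esub> frob M y"
    and fr_smult: "\<And>a x. x \<in> carrier M \<Longrightarrow> frob M (a \<odot>\<^bsub>M\<^esub> x) = Fract (\<phi> a) 1 \<odot>\<^bsub>frac_module M\<^esub> frob M x"
    using M unfolding frobenius_module_def by blast+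
  obtain n b where basis: "is_basis M UNIV n b (carrier M)"
    and fbasis: "is_basis (frac_module M) (scalars_inverting e) n (\<lambda>i. frob M (b i)) (inverting e M (carrier M))"
    using M unfolding frobenius_module_def by blast
  interpret M: tfmod M by (rule basis_torsion_free[OF mod basis])
  note bc = M.is_basisD(1)[OF basis]
  have lc: "M.lin k b c \<in> carrier M" if "k \<le> n" for k c by (rule M.lin_closed) (use bc that in auto)
  have "\<exists>x k. frob M (b j) = M.fr x (e ^ k) \<and> x \<in> carrier M" if "j < n" for j
    using fr_in[of "b j"] bc that unfolding inverting_def by auto
  then obtain x k where xk: "\<And>j. j < n \<Longrightarrow> frob M (b j) = M.fr (x j) (e ^ k j)" "\<And>j. j < n \<Longrightarrow> x j \<in> carrier M"
    by metis
  \<comment> \<open>The sum of the exponents serves as an upper bound for each of them.\<close>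
  define h where "h = (\<Sum>j<n. k j)"
  let ?d = "e ^ h"
  have d0: "?d \<noteq> 0" using e by simp
  have fb: "frob M (b j) = M.fr (e ^ (h - k j) \<odot>\<^bsub>M\<^esub> x j) ?d" if "j < n" for j
  proof -
    have "k j \<le> h" unfolding h_def using that by (intro member_le_sum) auto
    then have "e ^ (h - k j) * e ^ k j = ?d" by (simp flip: power_add)
    then show ?thesis using M.fr_scale[of "x j" "e ^ k j" "e ^ (h - k j)"] xk that e by simp
  qed
  have "\<exists>c. e ^ (h - k j) \<odot>\<^bsub>M\<^esub> x j = M.lin n b c" if "j < n" for j
    using M.basis_coords_exists[OF basis] xk(2)[OF that] by (metis M.umod_smult(1))
  then obtain c where c: "\<And>j. j < n \<Longrightarrow> e ^ (h - k j) \<odot>\<^bsub>M\<^esub> x j = M.lin n b (c j)" by metis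
  define A where "A = mat n n (\<lambda>(i, j). c j i)"
  have Ac: "A \<in> carrier_mat n n" by (simp add: A_def)
  define \<beta> where "\<beta> = (\<lambda>i. M.fr (b i) 1)"
  have \<beta>c: "\<beta> \<in> {..<n} \<rightarrow> carrier M.FV" using bc by (auto simp: \<beta>_def intro!: M.frac_closed)
  have gb: "frob M (b j) = M.FV.lin n \<beta> (\<lambda>i. Fract (A $$ (i, j)) ?d)" if "j < n" for j
  proof -
    have "frob M (b j) = M.fr (M.lin n b (\<lambda>i. A $$ (i, j))) ?d"
      unfolding fb[OF that] c[OF that]
      by (rule arg_cong[of _ _ "\<lambda>z. M.fr z ?d"], rule M.lin_cong) (use that bc in \<open>auto simp: A_def\<close>)
    then show ?thesis unfolding \<beta>_def using M.lin_fractions[OF bc d0] by simp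
  qed
  have gc: "(\<lambda>j. frob M (b j)) \<in> {..<n} \<rightarrow> carrier M.FV"
    using gb M.FV.lin_closed[OF \<beta>c] by auto
  have sumF: "(\<Sum>j<k. Fract (f j) ?d) = Fract (\<Sum>j<k. f j) ?d" for f :: "nat \<Rightarrow> 'r" and k
    by (induction k) (use d0 in \<open>auto simp: Zero_fract_def eq_fract algebra_simps\<close>)
  have flin: "frob M (M.lin n b a) = M.fr (M.lin n b (mat_apply n A (\<lambda>i. \<phi> (a i)))) ?d" for a
  proof -
    have "frob M (M.lin m b a) = M.FV.lin m (\<lambda>j. frob M (b j)) (\<lambda>j. Fract (\<phi> (a j)) 1)" if "m \<le> n" for m
      using that
    proof (induction m)
      case 0
      have "frob M \<zero>\<^bsub>M\<^esub> \<in> carrier M.FV"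
        using fr_in[of "\<zero>\<^bsub>M\<^esub>"] e unfolding inverting_def by (auto intro!: M.frac_closed)
      then have "0 \<odot>\<^bsub>M.FV\<^esub> frob M \<zero>\<^bsub>M\<^esub> = \<zero>\<^bsub>M.FV\<^esub>" by simp
      then have "frob M \<zero>\<^bsub>M\<^esub> = \<zero>\<^bsub>M.FV\<^esub>"
        using fr_smult[of "\<zero>\<^bsub>M\<^esub>" 0] by (simp add: Zero_fract_def)
      then show ?case by (simp add: M.lin_0 M.FV.lin_0)
    next
      case (Suc m)
      then have bm: "b \<in> {..<Suc m} \<rightarrow> carrier M" "b m \<in> carrier M"
        "(\<lambda>j. frob M (b j)) \<in> {..<Suc m} \<rightarrow> carrier M.FV" using bc gc by auto
      have "frob M (M.lin (Suc m) b a) = frob M (M.lin m b a) \<oplus>\<^bsub>M.FV\<^esub> frob M (a m \<odot>\<^bsub>M\<^esub> b m)"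
        unfolding M.lin_Suc[OF bm(1)] by (rule fr_add) (use lc[of m] Suc.prems bm in auto)
      then show ?case using Suc bm by (simp add: M.FV.lin_Suc fr_smult)
    qed
    then have "frob M (M.lin n b a) = M.FV.lin n (\<lambda>j. frob M (b j)) (\<lambda>j. Fract (\<phi> (a j)) 1)" by simp
    also have "\<dots> = M.FV.lin n (\<lambda>j. M.FV.lin n \<beta> (\<lambda>i. Fract (A $$ (i, j)) ?d)) (\<lambda>j. Fract (\<phi> (a j)) 1)"
      by (rule M.FV.lin_cong) (use gb gc in auto)
    also have "\<dots> = M.FV.lin n \<beta> (\<lambda>i. \<Sum>j<n. Fract (A $$ (i, j)) ?d * Fract (\<phi> (a j)) 1)"
      by (rule M.FV.lin_lin[OF \<beta>c])
    also have "\<dots> = M.FV.lin n \<beta> (\<lambda>i. Fract (mat_apply n A (\<lambda>i. \<phi> (a i)) i) ?d)"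
      by (simp add: mat_apply_def sumF)
    also have "\<dots> = M.fr (M.lin n b (mat_apply n A (\<lambda>i. \<phi> (a i)))) ?d"
      unfolding \<beta>_def by (rule M.lin_fractions[OF bc d0])
    finally show ?thesis .
  qed
  have P: "presented \<phi> ?d n b A M" by unfold_locales (use mod basis Ac d0 flin in auto)
  interpret P: presented \<phi> ?d n b A M by (rule P)
  let ?D = "range (\<lambda>k. e ^ k)"
  have D: "mult_set ?D" by (rule mult_set_special(2)[OF e])
  note S = subring_scalars[OF D]
  have b1: "is_basis M.FV (scalars ?D) n P.\<beta> (inverting e M (carrier M))"
    unfolding P.inverting_eq by (rule M.frac_basis[OF basis D])
  note b2 = fbasis[unfolded scalars_special]
  have in1: "mat_in (scalars ?D) P.G" using Ac by (auto simp: mat_in_def scalars_def)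
  obtain C where C: "C \<in> carrier_mat n n" "mat_in (scalars ?D) C" "\<forall>j<n. P.\<beta> j = M.FV.columns n (\<lambda>i. frob M (b i)) C j"
    using M.FV.basis_transition[OF S b2 b1] by blast
  \<comment> \<open>\<open>C\<close> expresses the standard basis through the Frobenius images with
    coefficients in \<open>R[1/e]\<close>, so its determinant inverts \<open>det A / ?d ^ n\<close>
    there.\<close>
  have "P.G * C = 1\<^sub>m n"
    by (rule M.FV.basis_transition_product[OF S b1 b2 _ in1 _ C(1,2)]) (use Ac C(3) P.frob_basis in auto)
  then have "det P.G * det C = 1" using det_mult[of P.G n C] Ac C(1) by simp
  moreover obtain z j where z: "det C = Fract z (e ^ j)" using subring_set_det[OF S C(1,2)] by (auto simp: scalars_def)
  ultimately have "Fract 1 ?d ^ n * to_fract (det A) * Fract z (e ^ j) = 1" unfolding P.det_G by simp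
  moreover have "Fract 1 ?d ^ n = Fract 1 (?d ^ n)" by (induction n) (auto simp: One_fract_def)
  ultimately have "Fract (det A * z) (?d ^ n * e ^ j) = 1" by (simp add: to_fract_def)
  then have "det A * z = ?d ^ n * e ^ j" using d0 e by (simp add: One_fract_def eq_fract)
  then have "det A dvd e ^ (h * n + j)" by (metis dvd_triv_left power_add power_mult)
  then show thesis using that[OF P] by blast
qed

section \<open>Submodules and quotients\<close>

lemma (in umod) sub_lin:
  assumes V': "umod V'" and ops: "add V' = add V" "zero V' = zero V" "smult V' = smult V"
    and b: "b \<in> {..<n} \<rightarrow> carrier V" "b \<in> {..<n} \<rightarrow> carrier V'"
  shows "umod.lin V' n b c = lin n b c"
  using b
proof (induction n)
  case 0
  then show ?case using ops by (simp add: lin_0 umod.lin_0[OF V'])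
next
  case (Suc n)
  then have "b \<in> {..<n} \<rightarrow> carrier V" "b \<in> {..<n} \<rightarrow> carrier V'" by auto
  then show ?case using Suc ops by (simp add: lin_Suc umod.lin_Suc[OF V'])
qed

context presented
begin

definition span_cols :: "nat \<Rightarrow> 'r mat \<Rightarrow> 'm set" where
  "span_cols m C = {M.lin n b (mat_apply m C c) | c. True}"

lemma span_cols_submodule: "submodule (span_cols m C) univ_ring M"
proof (rule M.submoduleI)
  note bc = b_carrier
  show "span_cols m C \<subseteq> carrier M" using M.lin_closed[OF bc] by (auto simp: span_cols_def)
  have "M.lin n b (mat_apply m C (\<lambda>_. 0)) = \<zero>\<^bsub>M\<^esub>" using M.lin_zero[OF bc] by (simp add: mat_apply_zero[abs_def])
  then show "\<zero>\<^bsub>M\<^esub> \<in> span_cols m C" unfolding span_cols_def by (metis (mono_tags, lifting) mem_Collect_eq)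
  show sm: "a \<odot>\<^bsub>M\<^esub> x \<in> span_cols m C" if x: "x \<in> span_cols m C" for a x
  proof -
    obtain c where "x = M.lin n b (mat_apply m C c)" using x by (auto simp: span_cols_def)
    then have "a \<odot>\<^bsub>M\<^esub> x = M.lin n b (mat_apply m C (\<lambda>i. a * c i))" by (simp add: mat_apply_smult M.lin_smult[OF bc])
    then show ?thesis by (auto simp: span_cols_def)
  qed
  show "\<ominus>\<^bsub>M\<^esub> x \<in> span_cols m C" if x: "x \<in> span_cols m C" for x
  proof -
    have "x \<in> carrier M" using x M.lin_closed[OF bc] by (auto simp: span_cols_def)
    then show ?thesis using sm[OF x, of "- 1"] M.umod_minus by simp
  qed
  show "x \<oplus>\<^bsub>M\<^esub> y \<in> span_cols m C" if xy: "x \<in> span_cols m C" "y \<in> span_cols m C" for x y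
  proof -
    obtain c c' where "x = M.lin n b (mat_apply m C c)" "y = M.lin n b (mat_apply m C c')"
      using xy by (auto simp: span_cols_def)
    then have "x \<oplus>\<^bsub>M\<^esub> y = M.lin n b (mat_apply m C (\<lambda>i. c i + c' i))" by (simp add: mat_apply_add M.lin_add[OF bc])
    then show ?thesis by (auto simp: span_cols_def)
  qed
qed

lemma frob_columns:
  assumes C: "C \<in> carrier_mat n m" and A': "A' \<in> carrier_mat m m" and AC: "A * map_mat \<phi> C = C * A'"
  shows "frob M (M.lin n b (mat_apply m C c)) = M.fr (M.lin n b (mat_apply m C (mat_apply m A' (\<lambda>i. \<phi> (c i))))) d"
proof -
  have "mat_apply n A (\<lambda>i. \<phi> (mat_apply m C c i)) i = mat_apply m C (mat_apply m A' (\<lambda>i. \<phi> (c i))) i" if i: "i < n" for i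
  proof -
    have "\<phi> (mat_apply m C c l) = mat_apply m (map_mat \<phi> C) (\<lambda>i. \<phi> (c i)) l" if "l < n" for l
      using C that unfolding mat_apply_def by (simp add: \<phi>.hom_sum \<phi>.hom_mult)
    then have "mat_apply n A (\<lambda>i. \<phi> (mat_apply m C c i)) i = mat_apply n A (mat_apply m (map_mat \<phi> C) (\<lambda>i. \<phi> (c i))) i"
      by (rule mat_apply_cong)
    also have "\<dots> = mat_apply m (A * map_mat \<phi> C) (\<lambda>i. \<phi> (c i)) i"
      by (rule mat_apply_mult[OF A_carrier _ i]) (use C in simp)
    also have "\<dots> = mat_apply m C (mat_apply m A' (\<lambda>i. \<phi> (c i))) i"
      unfolding AC by (rule mat_apply_mult[OF C A' i, symmetric])
    finally show ?thesis .
  qed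
  then have "M.lin n b (mat_apply n A (\<lambda>i. \<phi> (mat_apply m C c i))) = M.lin n b (mat_apply m C (mat_apply m A' (\<lambda>i. \<phi> (c i))))"
    by (intro M.lin_cong) (use b_carrier in auto)
  then show ?thesis using frob_lin by simp
qed

lemma span_cols_stable:
  assumes "C \<in> carrier_mat n m" "A' \<in> carrier_mat m m" "A * map_mat \<phi> C = C * A'" "d = e ^ h"
  shows "frob_stable e M (span_cols m C)"
  unfolding frob_stable_def
proof
  fix x assume "x \<in> span_cols m C"
  then obtain c where "x = M.lin n b (mat_apply m C c)" by (auto simp: span_cols_def)
  then show "frob M x \<in> inverting e M (span_cols m C)"
    using frob_columns[OF assms(1-3)] assms(4) unfolding inverting_def span_cols_def by blast
qed

text \<open>A left inverse up to a nonzero scalar makes the columns of \<open>C\<close> independent.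
  It covers direct summands, with \<open>s = 1\<close>, as well as the image of an isogeny, with
  \<open>s\<close> a power of \<open>p\<close>.\<close>

lemma sub_module_presented:
  assumes C: "C \<in> carrier_mat n m" and A': "A' \<in> carrier_mat m m" and L: "L \<in> carrier_mat m n"
    and LC: "L * C = s \<cdot>\<^sub>m 1\<^sub>m m" "s \<noteq> 0" and AC: "A * map_mat \<phi> C = C * A'"
  shows "presented \<phi> d m (M.columns n b C) A' (sub_module M (span_cols m C))"
proof -
  let ?N = "span_cols m C" and ?S = "sub_module M (span_cols m C)"
  note bc = b_carrier
  note sub = span_cols_submodule[of m C]
  have Nsub: "?N \<subseteq> carrier M" by (rule M.submoduleE(1)[OF sub])
  have fields: "carrier ?S = ?N" "add ?S = add M" "zero ?S = zero M" "smult ?S = smult M"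
    "\<And>x. frob ?S x = frob M x \<inter> (?N \<times> UNIV)"
    by (simp_all add: sub_module_def)
  have mod': "Module.module univ_ring ?S"
  proof (rule moduleI)
    show "cring univ_ring" by (rule cring_univ_ring)
    show "abelian_group ?S"
    proof (rule abelian_groupI)
      fix x assume "x \<in> carrier ?S"
      then have x: "x \<in> ?N" by (simp add: fields)
      then have "\<ominus>\<^bsub>M\<^esub> x \<in> ?N" by (rule M.submoduleE(3)[OF sub])
      moreover have "\<ominus>\<^bsub>M\<^esub> x \<oplus>\<^bsub>M\<^esub> x = \<zero>\<^bsub>M\<^esub>" using x Nsub M.M.l_neg by blast
      ultimately show "\<exists>y\<in>carrier ?S. y \<oplus>\<^bsub>?S\<^esub> x = \<zero>\<^bsub>?S\<^esub>" by (auto simp: fields)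
    next
      have "M.lin n b (mat_apply m C (\<lambda>_. 0)) \<in> ?N" by (auto simp: span_cols_def)
      then show "\<zero>\<^bsub>?S\<^esub> \<in> carrier ?S" using M.lin_zero[OF bc] by (simp add: fields mat_apply_zero[abs_def])
    qed (use Nsub in \<open>auto simp: fields M.M.a_ac subset_eq intro: M.submoduleE(5)[OF sub]\<close>)
  qed (use Nsub in \<open>auto simp: fields subset_eq M.umod_add_smult M.umod_smult_add M.umod_smult_smult intro: M.submoduleE(4)[OF sub]\<close>)
  interpret S: umod ?S by (simp add: umod_def mod')
  have colN: "M.columns n b C j \<in> ?N" if "j < m" for j
  proof -
    have "M.columns n b C j = M.lin n b (mat_apply m C (\<lambda>i. if i = j then 1 else 0))"
      unfolding M.columns_def
    proof (rule M.lin_cong)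
      fix i
      show "C $$ (i, j) = mat_apply m C (\<lambda>i. if i = j then 1 else 0) i"
        unfolding mat_apply_def using that by (subst sum.mono_neutral_right[of _ "{j}"]) auto
    qed (use bc in auto)
    then show ?thesis by (auto simp: span_cols_def)
  qed
  have cc: "M.columns n b C \<in> {..<m} \<rightarrow> carrier M" using colN Nsub by auto
  have lin_eq: "S.lin m (M.columns n b C) c = M.lin n b (mat_apply m C c)" for c
    using M.sub_lin[OF S.umod_axioms fields(2,3,4) cc] colN M.lin_columns[OF bc] by (simp add: fields)
  have basis': "is_basis ?S UNIV m (M.columns n b C) (carrier ?S)"
    unfolding S.is_basis_lin lin_eq
  proof (intro conjI allI impI)
    show "M.columns n b C i \<in> carrier ?S" if "i < m" for i using colN[OF that] by (simp add: fields)
    show "carrier ?S = {M.lin n b (mat_apply m C c) | c. \<forall>i<m. c i \<in> UNIV}"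
      unfolding fields by (simp add: span_cols_def)
    fix c i assume c: "(\<forall>i<m. c i \<in> UNIV) \<and> M.lin n b (mat_apply m C c) = \<zero>\<^bsub>?S\<^esub>" and i: "i < m"
    then have "M.lin n b (mat_apply m C c) = M.lin n b (\<lambda>_. 0)" using M.lin_zero[OF bc] by (simp add: fields)
    then have z: "mat_apply m C c l = 0" if "l < n" for l using coords_unique that by blast
    have "mat_apply m (L * C) c i = mat_apply n L (mat_apply m C c) i" by (rule mat_apply_mult[OF L C i, symmetric])
    also have "\<dots> = mat_apply n L (\<lambda>_. 0) i" by (rule mat_apply_cong) (use z in auto)
    finally have "mat_apply m (s \<cdot>\<^sub>m 1\<^sub>m m) c i = 0" unfolding LC by (simp add: mat_apply_zero)
    moreover have "mat_apply m (s \<cdot>\<^sub>m 1\<^sub>m m) c i = s * c i"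
      unfolding mat_apply_def using i by (subst sum.mono_neutral_right[of _ "{i}"]) auto
    ultimately show "c i = 0" using LC(2) by simp
  qed
  \<comment> \<open>The relation between fractions is the same over the submodule, so restricting a
    class to numerators in the submodule gives the class over it.\<close>
  have frac_eq: "fraction ?S x t = M.fr x t \<inter> (?N \<times> UNIV)" for x t
    unfolding fraction_def using Nsub by (auto simp: fields)
  show ?thesis
  proof (intro presented.intro presented_axioms.intro)
    show "comm_ring_hom \<phi>" by unfold_locales
    show "Module.module univ_ring ?S" by (rule mod')
    show "is_basis ?S UNIV m (M.columns n b C) (carrier ?S)" by (rule basis')
    show "A' \<in> carrier_mat m m" "d \<noteq> 0" using A' d_nonzero by auto
    fix c
    show "frob ?S (S.lin m (M.columns n b C) c) =
      fraction ?S (S.lin m (M.columns n b C) (mat_apply m A' (\<lambda>i. \<phi> (c i)))) d"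
      unfolding lin_eq fields frac_eq frob_columns[OF C A' AC] ..
  qed
qed

end

text \<open>With \<open>\<rho>\<close> the reduction modulo \<open>p\<close> and
  \<open>m = 0\<close> this yields \<open>M / p M\<close>; with \<open>\<rho>\<close> the identity,
  the quotient by the span of the first \<open>m\<close> basis vectors. \<open>\<rho>_A\<close>
  expresses that what is divided out is stable.\<close>

locale presented_quotient = presented \<phi> d n b A M
  for \<phi> :: "'r::idom \<Rightarrow> 'r" and d n b A and M :: "('r, 'm) phi_module" +
  fixes \<rho> :: "'r \<Rightarrow> 's::idom" and \<psi> :: "'s \<Rightarrow> 's" and m l :: nat
  assumes \<rho>_hom: "comm_ring_hom \<rho>" and \<rho>_surj: "surj \<rho>" and \<psi>_hom: "comm_ring_hom \<psi>"
    and \<rho>_\<phi>: "\<And>x. \<rho> (\<phi> x) = \<psi> (\<rho> x)" and n_eq: "n = m + l" and \<rho>_d: "\<rho> d \<noteq> 0"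
    and \<rho>_A: "\<And>i j. m \<le> i \<Longrightarrow> i < n \<Longrightarrow> j < m \<Longrightarrow> \<rho> (A $$ (i, j)) = 0"
begin

sublocale \<rho>: comm_ring_hom \<rho> by (rule \<rho>_hom)

text \<open>A coset is described by the images under \<open>\<rho>\<close> of the last
  \<open>l\<close> coordinates, which identifies the quotient with a free module of rank
  \<open>l\<close>.\<close>

definition res_class :: "(nat \<Rightarrow> 's) \<Rightarrow> 'm set" where
  "res_class v = {M.lin n b c | c. \<forall>i<l. \<rho> (c (m + i)) = v i}"

abbreviation N :: "'m set" where "N \<equiv> res_class (\<lambda>_. 0)"

abbreviation Q :: "('s, 'm set) phi_module" where "Q \<equiv> quotient_phi_module \<rho> M N"

lemma lift_exists: "\<exists>c. \<forall>i<l. \<rho> (c (m + i)) = v i"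
  by (rule exI[of _ "\<lambda>i. SOME x. \<rho> x = v (i - m)"]) (use \<rho>_surj in \<open>auto intro: someI_ex simp: surj_def, metis (mono_tags) someI_ex\<close>)

lemma res_class_cong: "(\<And>i. i < l \<Longrightarrow> v i = w i) \<Longrightarrow> res_class v = res_class w"
  by (simp add: res_class_def)

lemma res_class_eq_iff: "res_class v = res_class w \<longleftrightarrow> (\<forall>i<l. v i = w i)"
proof
  assume eq: "res_class v = res_class w"
  obtain c where c: "\<forall>i<l. \<rho> (c (m + i)) = v i" using lift_exists by blast
  then have "M.lin n b c \<in> res_class w" unfolding eq[symmetric] by (auto simp: res_class_def)
  then obtain c' where c': "M.lin n b c = M.lin n b c'" "\<forall>i<l. \<rho> (c' (m + i)) = w i" by (auto simp: res_class_def)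
  show "\<forall>i<l. v i = w i"
  proof (intro allI impI)
    fix i assume i: "i < l"
    then have "c (m + i) = c' (m + i)" by (intro coords_unique[OF c'(1)]) (simp add: n_eq)
    then show "v i = w i" using c c' i by metis
  qed
next
  assume "\<forall>i<l. v i = w i"
  then show "res_class v = res_class w" by (intro res_class_cong) blast
qed

lemma coset_lin: "N +>\<^bsub>M\<^esub> M.lin n b c = res_class (\<lambda>i. \<rho> (c (m + i)))"
proof (intro equalityI subsetI)
  note bc = b_carrier
  fix x assume "x \<in> N +>\<^bsub>M\<^esub> M.lin n b c"
  then obtain z where z: "x = M.lin n b z \<oplus>\<^bsub>M\<^esub> M.lin n b c" "\<forall>i<l. \<rho> (z (m + i)) = 0"
    by (auto simp: a_r_coset_def' res_class_def)
  then have "x = M.lin n b (\<lambda>i. z i + c i)" by (simp add: M.lin_add[OF bc])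
  moreover have "\<forall>i<l. \<rho> (z (m + i) + c (m + i)) = \<rho> (c (m + i))" using z by (simp add: \<rho>.hom_add)
  ultimately show "x \<in> res_class (\<lambda>i. \<rho> (c (m + i)))" unfolding res_class_def by blast
next
  note bc = b_carrier
  fix x assume "x \<in> res_class (\<lambda>i. \<rho> (c (m + i)))"
  then obtain c' where c': "x = M.lin n b c'" "\<forall>i<l. \<rho> (c' (m + i)) = \<rho> (c (m + i))" by (auto simp: res_class_def)
  have "x = M.lin n b (\<lambda>i. c' i - c i) \<oplus>\<^bsub>M\<^esub> M.lin n b c"
    unfolding c' by (simp flip: M.lin_add[OF bc])
  moreover have "M.lin n b (\<lambda>i. c' i - c i) \<in> N" using c'(2) by (auto simp: res_class_def \<rho>.hom_minus)
  ultimately show "x \<in> N +>\<^bsub>M\<^esub> M.lin n b c" by (auto simp: a_r_coset_def')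
qed

lemma res_classE:
  obtains c where "res_class v = N +>\<^bsub>M\<^esub> M.lin n b c" "\<forall>i<l. \<rho> (c (m + i)) = v i"
proof -
  obtain c where c: "\<forall>i<l. \<rho> (c (m + i)) = v i" using lift_exists by blast
  then have "res_class v = N +>\<^bsub>M\<^esub> M.lin n b c" unfolding coset_lin by (intro res_class_cong) simp
  then show thesis using that c by blast
qed

lemma Q_carrier: "carrier Q = {res_class v | v. True}"
proof (intro equalityI subsetI)
  fix X assume "X \<in> carrier Q"
  then obtain x where x: "x \<in> carrier M" "X = N +>\<^bsub>M\<^esub> x"
    by (auto simp: quotient_phi_module_def quotient_module_def Let_def A_RCOSETS_def')
  obtain c where "x = M.lin n b c" by (rule coords[OF x(1)])
  then have "X = res_class (\<lambda>i. \<rho> (c (m + i)))" using x(2) coset_lin by simp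
  then show "X \<in> {res_class v | v. True}" by blast
next
  fix X assume "X \<in> {res_class v | v. True}"
  then obtain v where X: "X = res_class v" by blast
  obtain c where "res_class v = N +>\<^bsub>M\<^esub> M.lin n b c" "\<forall>i<l. \<rho> (c (m + i)) = v i" by (rule res_classE)
  then show "X \<in> carrier Q" using M.lin_closed[OF b_carrier] X
    by (auto simp: quotient_phi_module_def quotient_module_def Let_def A_RCOSETS_def')
qed

lemma Q_zero: "\<zero>\<^bsub>Q\<^esub> = N"
  by (simp add: quotient_phi_module_def quotient_module_def Let_def)

lemma Q_add: "res_class v \<oplus>\<^bsub>Q\<^esub> res_class w = res_class (\<lambda>i. v i + w i)"
proof -
  note bc = b_carrier
  have "set_add M (res_class v) (res_class w) = res_class (\<lambda>i. v i + w i)"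
  proof (intro equalityI subsetI)
    fix x assume "x \<in> set_add M (res_class v) (res_class w)"
    then obtain c c' where c: "x = M.lin n b c \<oplus>\<^bsub>M\<^esub> M.lin n b c'" "\<forall>i<l. \<rho> (c (m + i)) = v i" "\<forall>i<l. \<rho> (c' (m + i)) = w i"
      by (auto simp: set_add_def' res_class_def)
    then have "x = M.lin n b (\<lambda>i. c i + c' i)" by (simp add: M.lin_add[OF bc])
    moreover have "\<forall>i<l. \<rho> (c (m + i) + c' (m + i)) = v i + w i" using c by (simp add: \<rho>.hom_add)
    ultimately show "x \<in> res_class (\<lambda>i. v i + w i)" unfolding res_class_def by blast
  next
    fix x assume "x \<in> res_class (\<lambda>i. v i + w i)"
    then obtain c where c: "x = M.lin n b c" "\<forall>i<l. \<rho> (c (m + i)) = v i + w i" by (auto simp: res_class_def)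
    obtain c1 where c1: "\<forall>i<l. \<rho> (c1 (m + i)) = v i" using lift_exists by blast
    have "x = M.lin n b c1 \<oplus>\<^bsub>M\<^esub> M.lin n b (\<lambda>i. c i - c1 i)"
      unfolding c by (simp flip: M.lin_add[OF bc])
    moreover have "M.lin n b c1 \<in> res_class v" using c1 by (auto simp: res_class_def)
    moreover have "M.lin n b (\<lambda>i. c i - c1 i) \<in> res_class w" using c c1 by (auto simp: res_class_def \<rho>.hom_minus)
    ultimately show "x \<in> set_add M (res_class v) (res_class w)" by (auto simp: set_add_def')
  qed
  then show ?thesis by (simp add: quotient_phi_module_def quotient_module_def Let_def)
qed

lemma Q_smult: "a \<odot>\<^bsub>Q\<^esub> res_class v = res_class (\<lambda>i. a * v i)"
proof -
  note bc = b_carrier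
  have "N +>\<^bsub>M\<^esub> (r \<odot>\<^bsub>M\<^esub> x) = res_class (\<lambda>i. a * v i)" if r: "\<rho> r = a" and x: "x \<in> res_class v" for r x
  proof -
    obtain c where c: "x = M.lin n b c" "\<forall>i<l. \<rho> (c (m + i)) = v i" using x by (auto simp: res_class_def)
    have "r \<odot>\<^bsub>M\<^esub> x = M.lin n b (\<lambda>i. r * c i)" unfolding c by (simp add: M.lin_smult[OF bc])
    then have "N +>\<^bsub>M\<^esub> (r \<odot>\<^bsub>M\<^esub> x) = res_class (\<lambda>i. \<rho> (r * c (m + i)))" by (simp add: coset_lin)
    also have "\<dots> = res_class (\<lambda>i. a * v i)" using c r by (intro res_class_cong) (simp add: \<rho>.hom_mult)
    finally show ?thesis .
  qed
  moreover obtain r where "\<rho> r = a" using \<rho>_surj by (metis surjD)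
  moreover have "\<exists>x. x \<in> res_class v" using lift_exists[of v] by (auto simp: res_class_def)
  ultimately have "{N +>\<^bsub>M\<^esub> (r \<odot>\<^bsub>M\<^esub> x) | r x. \<rho> r = a \<and> x \<in> res_class v} = {res_class (\<lambda>i. a * v i)}" by blast
  then show ?thesis by (simp add: quotient_phi_module_def quotient_module_def Let_def)
qed

lemma Q_module: "Module.module (univ_ring :: 's ring) Q"
proof (rule moduleI)
  show "cring (univ_ring :: 's ring)" by (rule cring_univ_ring)
  show "abelian_group Q"
  proof (rule abelian_groupI)
    fix X assume "X \<in> carrier Q"
    then obtain v where v: "X = res_class v" by (auto simp: Q_carrier)
    have "res_class (\<lambda>i. - v i) \<oplus>\<^bsub>Q\<^esub> X = \<zero>\<^bsub>Q\<^esub>" by (simp add: v Q_add Q_zero)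
    then show "\<exists>Y\<in>carrier Q. Y \<oplus>\<^bsub>Q\<^esub> X = \<zero>\<^bsub>Q\<^esub>" by (auto simp: Q_carrier)
  qed (auto simp: Q_carrier Q_add Q_zero algebra_simps)
qed (auto simp: Q_carrier Q_add Q_smult algebra_simps)

definition qb :: "nat \<Rightarrow> 'm set" where "qb i = N +>\<^bsub>M\<^esub> b (m + i)"

definition qA :: "'s mat" where "qA = mat l l (\<lambda>(i, j). \<rho> (A $$ (m + i, m + j)))"

lemma qb_eq: "j < l \<Longrightarrow> qb j = res_class (\<lambda>i. if i = j then 1 else 0)"
proof -
  assume j: "j < l"
  have "b (m + j) = M.lin n b (\<lambda>i. if i = m + j then 1 else 0)"
    using M.lin_unit[OF b_carrier, of "m + j"] j by (simp add: n_eq)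
  then have "qb j = res_class (\<lambda>i. \<rho> (if m + i = m + j then 1 else 0))" by (simp add: qb_def coset_lin)
  also have "\<dots> = res_class (\<lambda>i. if i = j then 1 else 0)" by (intro res_class_cong) simp
  finally show ?thesis .
qed

lemma quotient_presented: "presented \<psi> (\<rho> d) l qb qA Q"
proof -
  interpret \<psi>: comm_ring_hom \<psi> by (rule \<psi>_hom)
  interpret Q: umod Q by (simp add: umod_def Q_module)
  have qbc: "qb \<in> {..<l} \<rightarrow> carrier Q" by (auto simp: qb_eq Q_carrier)
  have "Q.lin k qb c = res_class (\<lambda>i. if i < k then c i else 0)" if "k \<le> l" for k c
    using that
  proof (induction k)
    case 0
    then show ?case by (simp add: Q.lin_0 Q_zero)
  next
    case (Suc k)
    have "qb \<in> {..<Suc k} \<rightarrow> carrier Q" using qbc Suc.prems by auto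
    then have "Q.lin (Suc k) qb c = res_class (\<lambda>i. if i < k then c i else 0) \<oplus>\<^bsub>Q\<^esub> c k \<odot>\<^bsub>Q\<^esub> res_class (\<lambda>i. if i = k then 1 else 0)"
      using Suc qb_eq[of k] by (simp add: Q.lin_Suc)
    also have "\<dots> = res_class (\<lambda>i. if i < Suc k then c i else 0)" unfolding Q_smult Q_add by (intro res_class_cong) (auto simp: less_Suc_eq)
    finally show ?case .
  qed
  then have lin: "Q.lin l qb c = res_class c" for c using res_class_cong[of "\<lambda>i. if i < l then c i else 0" c] by simp
  have basis': "is_basis Q UNIV l qb (carrier Q)"
    unfolding Q.is_basis_lin lin Q_zero res_class_eq_iff using qbc by (auto simp: Q_carrier)
  interpret Q: tfmod Q by (rule basis_torsion_free[OF Q_module basis'])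
  have fr: "frob Q (res_class v) = fraction Q (res_class (mat_apply l qA (\<lambda>i. \<psi> (v i)))) (\<rho> d)" for v
  proof -
    let ?F = "fraction Q (res_class (mat_apply l qA (\<lambda>i. \<psi> (v i)))) (\<rho> d)"
    \<comment> \<open>The Frobenius of the quotient is a union over all lifts \<open>x\<close> and
      all fractions \<open>y / s\<close> representing their images; each of them gives the class
      computed by \<open>qA\<close>.\<close>
    have key: "fraction Q (N +>\<^bsub>M\<^esub> y) (\<rho> s) = ?F"
      if x: "x \<in> res_class v" and y: "(y, s) \<in> frob M x" and s: "\<rho> s \<noteq> 0" for x y s
    proof -
      obtain c where c: "x = M.lin n b c" "\<forall>i<l. \<rho> (c (m + i)) = v i" using x by (auto simp: res_class_def)
      let ?w = "mat_apply n A (\<lambda>i. \<phi> (c i))"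
      have yc: "y \<in> carrier M" "s \<odot>\<^bsub>M\<^esub> M.lin n b ?w = d \<odot>\<^bsub>M\<^esub> y"
        using y unfolding c frob_lin M.fraction_mem[OF M.lin_closed[OF b_carrier] d_nonzero] by auto
      obtain z where z: "y = M.lin n b z" by (rule coords[OF yc(1)])
      have "M.lin n b (\<lambda>i. s * ?w i) = M.lin n b (\<lambda>i. d * z i)"
        using yc(2) z by (simp add: M.lin_smult[OF b_carrier])
      then have sd: "s * ?w i = d * z i" if "i < n" for i using coords_unique that by blast
      have w: "\<rho> (?w (m + i)) = mat_apply l qA (\<lambda>i. \<psi> (v i)) i" if i: "i < l" for i
      proof -
        have "\<rho> (?w (m + i)) = (\<Sum>j<m + l. \<rho> (A $$ (m + i, j)) * \<psi> (\<rho> (c j)))"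
          by (simp add: mat_apply_def \<rho>.hom_sum \<rho>.hom_mult \<rho>_\<phi> n_eq)
        also have "\<dots> = (\<Sum>j<m. \<rho> (A $$ (m + i, j)) * \<psi> (\<rho> (c j))) + (\<Sum>j<l. \<rho> (A $$ (m + i, m + j)) * \<psi> (\<rho> (c (m + j))))"
          by (induction l) (auto simp: add.assoc)
        also have "(\<Sum>j<m. \<rho> (A $$ (m + i, j)) * \<psi> (\<rho> (c j))) = 0"
          using \<rho>_A[of "m + i"] i by (intro sum.neutral) (simp add: n_eq)
        also have "(\<Sum>j<l. \<rho> (A $$ (m + i, m + j)) * \<psi> (\<rho> (c (m + j)))) = mat_apply l qA (\<lambda>i. \<psi> (v i)) i"
          unfolding mat_apply_def using i c by (intro sum.cong) (auto simp: qA_def)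
        finally show ?thesis by simp
      qed
      have "\<rho> d \<odot>\<^bsub>Q\<^esub> res_class (\<lambda>i. \<rho> (z (m + i))) = \<rho> s \<odot>\<^bsub>Q\<^esub> res_class (mat_apply l qA (\<lambda>i. \<psi> (v i)))"
        unfolding Q_smult
      proof (rule res_class_cong)
        fix i assume i: "i < l"
        have "\<rho> (d * z (m + i)) = \<rho> (s * ?w (m + i))" using sd[of "m + i"] i by (simp add: n_eq)
        then show "\<rho> d * \<rho> (z (m + i)) = \<rho> s * mat_apply l qA (\<lambda>i. \<psi> (v i)) i"
          using w[OF i] by (simp add: \<rho>.hom_mult)
      qed
      then show ?thesis unfolding z coset_lin
        by (subst Q.fraction_eq_iff) (use \<rho>_d s in \<open>auto simp: Q_carrier\<close>)
    qed
    obtain c where c: "\<forall>i<l. \<rho> (c (m + i)) = v i" using lift_exists by blast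
    let ?S = "{fraction Q (N +>\<^bsub>M\<^esub> y) (\<rho> s) | x y s. x \<in> res_class v \<and> (y, s) \<in> frob M x \<and> \<rho> s \<noteq> 0}"
    have xc: "M.lin n b c \<in> res_class v" using c by (auto simp: res_class_def)
    have yc: "(M.lin n b (mat_apply n A (\<lambda>i. \<phi> (c i))), d) \<in> frob M (M.lin n b c)"
      unfolding frob_lin by (rule M.fraction_self[OF M.lin_closed[OF b_carrier] d_nonzero])
    have "?F \<in> ?S" using xc yc \<rho>_d key[OF xc yc \<rho>_d, symmetric] by blast
    moreover have "X = ?F" if X: "X \<in> ?S" for X
    proof -
      obtain x y s where "X = fraction Q (N +>\<^bsub>M\<^esub> y) (\<rho> s)" "x \<in> res_class v" "(y, s) \<in> frob M x" "\<rho> s \<noteq> 0"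
        using X by blast
      then show ?thesis using key[of x y s] by simp
    qed
    ultimately have S: "?S = {?F}" by blast
    have fq: "fraction (quotient_module \<rho> M N) = fraction Q"
      by (intro ext) (simp add: fraction_def quotient_phi_module_def Let_def)
    have "frob Q (res_class v) = \<Union>?S"
      unfolding fq[symmetric] by (simp add: quotient_phi_module_def Let_def)
    then show ?thesis by (simp only: S Union_insert Union_empty Un_empty_right)
  qed
  show ?thesis
  proof (intro presented.intro presented_axioms.intro)
    show "comm_ring_hom \<psi>" by (rule \<psi>_hom)
    show "Module.module univ_ring Q" by (rule Q_module)
    show "is_basis Q UNIV l qb (carrier Q)" by (rule basis')
    show "qA \<in> carrier_mat l l" by (simp add: qA_def)
    show "\<rho> d \<noteq> 0" by (rule \<rho>_d)
    show "frob Q (Q.lin l qb c) = fraction Q (Q.lin l qb (mat_apply l qA (\<lambda>i. \<psi> (c i)))) (\<rho> d)" for c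
      unfolding lin fr ..
  qed
qed

end

section \<open>Semistability\<close>

text \<open>Elements prime to \<open>u\<close> are units of \<open>F[[u]]\<close>, so localizing at
  \<open>u\<close> changes nothing and the degree formula applies to torsion slopes.\<close>

lemma fps_scalars_local: "integral_scalars = scalars_local (fps_X :: 'f::field fps)"
proof (intro equalityI subsetI)
  fix x :: "'f fps fract" assume "x \<in> integral_scalars"
  then show "x \<in> scalars_local fps_X" unfolding integral_scalars_def scalars_local_def
    using fps_not_X_dvd_iff by fastforce
next
  fix x :: "'f fps fract" assume "x \<in> scalars_local fps_X"
  then obtain a s where s: "x = Fract a s" "s dvd 1" by (auto simp: scalars_local_def fps_not_X_dvd_iff)
  then obtain s' where s': "1 = s * s'" by (auto simp: dvd_def)
  have "s \<noteq> 0" using s' by auto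
  moreover have "a = a * s' * s" using s' by (metis mult.assoc mult.commute mult_1)
  ultimately have "x = Fract (a * s') 1" unfolding s(1) by (simp add: eq_fract)
  then show "x \<in> integral_scalars" by (auto simp: integral_scalars_def)
qed

lemma torsion_slope_presented:
  fixes M :: "('f::field fps, 'm) phi_module"
  assumes P: "presented \<psi> (fps_X ^ h) n b A M" and nz: "det A \<noteq> 0"
  shows "torsion_slope M = (real n * real h - real (subdegree (det A))) / real n"
proof -
  interpret P: presented \<psi> "fps_X ^ h" n b A M by (rule P)
  have L: "localize fps_X P.M.FV (lattice_of M) = lattice_of M"
  proof (unfold P.localize_lattice, intro equalityI subsetI)
    fix X assume "X \<in> {P.M.fr x s | x s. x \<in> carrier M \<and> s \<in> {s. \<not> fps_X dvd s}}"
    then obtain x s where 1: "X = P.M.fr x s" "x \<in> carrier M" "s dvd 1" by (auto simp: fps_not_X_dvd_iff)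
    then obtain s' where s': "1 = s * s'" by (auto simp: dvd_def)
    have "X = P.M.fr (s' \<odot>\<^bsub>M\<^esub> x) 1"
      unfolding 1(1) using 1(2) s' by (subst P.M.fraction_eq_iff) (auto simp: P.M.umod_smult_smult)
    then show "X \<in> lattice_of M" using 1(2) unfolding lattice_of_def by fastforce
  next
    fix X assume "X \<in> lattice_of M"
    then show "X \<in> {P.M.fr x s | x s. x \<in> carrier M \<and> s \<in> {s. \<not> fps_X dvd s}}"
      unfolding lattice_of_def using fps_not_X_dvd_iff by fastforce
  qed
  have sc: "scalars {s. \<not> fps_X dvd s} = scalars {1 :: 'f fps}"
    by (rule fps_scalars_local[unfolded scalars_special, symmetric])
  have fc: "v \<in> carrier P.M.FV" if im: "v \<in> frob_image M" for v
  proof -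
    obtain m c x where v: "v = P.M.FV.lin m (\<lambda>i. frob M (x i)) (\<lambda>i. Fract (c i) 1)" "\<forall>i<m. x i \<in> carrier M"
      using im unfolding frob_image_def P.M.FV.lin_def by blast
    show ?thesis unfolding v by (rule P.M.FV.lin_closed) (use v P.frob_closed in auto)
  qed
  have L': "localize fps_X P.M.FV (frob_image M) = frob_image M"
  proof -
    have "localize fps_X P.M.FV (frob_image M) = {Fract 1 s \<odot>\<^bsub>P.M.FV\<^esub> v | s v. s \<in> {s. \<not> fps_X dvd s} \<and> v \<in> frob_image M}"
      by (simp add: localize_def)
    also have "\<dots> = {Fract 1 s \<odot>\<^bsub>P.M.FV\<^esub> v | s v. s \<in> {1} \<and> v \<in> frob_image M}"
      unfolding P.frob_span[OF mult_set_special(3)[OF fps_X_prime]] P.frob_span[OF mult_set_special(1)] sc ..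
    also have "\<dots> = {1 \<odot>\<^bsub>P.M.FV\<^esub> v | v. v \<in> frob_image M}" by (auto simp: One_fract_def)
    also have "\<dots> = {v. v \<in> frob_image M}"
      by (rule Collect_cong) (metis fc P.M.FV.umod_smult(2))
    finally show ?thesis by simp
  qed
  obtain k y where ky: "det A = fps_X ^ k * y" "\<not> fps_X dvd y" using fps_X_valuation[OF nz] by blast
  have y: "y \<noteq> 0" "subdegree y = 0" using ky(2) fps_unit_iff_subdegree fps_not_X_dvd_iff by blast+
  have k: "k = subdegree (det A)" unfolding ky(1) using y by simp
  have "relative_degree P.M.FV integral_scalars (Fract fps_X 1) (lattice_of M) (frob_image M) = int n * int h - int k"
    using P.degree_eq[OF fps_X_prime fps_X_valuation refl ky] unfolding L L' fps_scalars_local by blast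
  then show ?thesis unfolding torsion_slope_def P.rank k by simp
qed

context witt_base
begin

text \<open>Take a direct summand of maximal rank with columns in \<open>N\<close>. If
  \<open>N\<close> were larger, the part of an element outside the summand, divided by the highest
  possible power of \<open>u\<close>, would lie in \<open>N\<close> by saturation and have a unit
  coordinate; adjoining it would give a larger summand.\<close>

lemma saturated_summand:
  fixes M :: "('f fps, 'm) phi_module"
  assumes P: "presented \<psi> d n b A M" and sub: "submodule N univ_ring M"
    and sat: "\<And>a x. a \<noteq> 0 \<Longrightarrow> x \<in> carrier M \<Longrightarrow> a \<odot>\<^bsub>M\<^esub> x \<in> N \<Longrightarrow> x \<in> N"
  obtains k C L where "C \<in> carrier_mat n k" "L \<in> carrier_mat k n" "L * C = 1\<^sub>m k"
    "N = {umod.lin M n b (mat_apply k C c) | c. True}"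
proof -
  interpret P: presented \<psi> d n b A M by (rule P)
  note bc = P.b_carrier
  have Nc: "N \<subseteq> carrier M" by (rule P.M.submoduleE(1)[OF sub])
  have Nadd: "x \<oplus>\<^bsub>M\<^esub> y \<in> N" if "x \<in> N" "y \<in> N" for x y by (rule P.M.submoduleE(5)[OF sub that])
  have Nsm: "a \<odot>\<^bsub>M\<^esub> x \<in> N" if "x \<in> N" for a x using P.M.submoduleE(4)[OF sub] that by simp
  have N0: "\<zero>\<^bsub>M\<^esub> \<in> N"
  proof -
    obtain x where "x \<in> N" using P.M.submoduleE(2)[OF sub] by blast
    then show ?thesis using Nsm[of x 0] Nc by auto
  qed
  have Nlin: "P.M.lin m v c \<in> N" if "\<And>i. i < m \<Longrightarrow> v i \<in> N" for m v c
    using that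
  proof (induction m)
    case (Suc m)
    then have "v \<in> {..<Suc m} \<rightarrow> carrier M" using Nc by auto
    then show ?case using Suc by (auto simp: P.M.lin_Suc intro!: Nadd Nsm)
  qed (simp add: P.M.lin_0 N0)
  have Ncols: "P.M.lin n b (mat_apply m C c) \<in> N" if "\<And>j. j < m \<Longrightarrow> P.M.columns n b C j \<in> N" for m C c
    unfolding P.M.lin_columns[OF bc, symmetric] by (rule Nlin) (use that in auto)
  define T where "T k \<longleftrightarrow> (\<exists>C L. C \<in> carrier_mat n k \<and> L \<in> carrier_mat k n \<and> L * C = 1\<^sub>m k \<and>
    (\<forall>j<k. P.M.columns n b C j \<in> N))" for k
  have "T 0" unfolding T_def by (intro exI[of _ "0\<^sub>m n 0"] exI[of _ "0\<^sub>m 0 n"]) (auto intro!: eq_matI)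
  moreover have "k < Suc n" if "T k" for k
    using that left_invertible_rank_le unfolding T_def by (meson le_imp_less_Suc)
  ultimately obtain k where k: "T k" "\<And>k'. T k' \<Longrightarrow> k' \<le> k"
    using ex_has_greatest_nat[of T 0 "\<lambda>k. k" "Suc n"] by blast
  obtain C L where CL: "C \<in> carrier_mat n k" "L \<in> carrier_mat k n" "L * C = 1\<^sub>m k" "\<forall>j<k. P.M.columns n b C j \<in> N"
    using k(1) unfolding T_def by blast
  define l where "l = n - k"
  have n: "n = k + l" using left_invertible_rank_le[OF CL(2,1,3)] by (simp add: l_def)
  obtain U V Q Q' where 2: "inverse_mats (k + l) U V" "inverse_mats k Q Q'"
    "C * Q = U * four_block_mat (1\<^sub>m k) (0\<^sub>m k 0) (0\<^sub>m l k) (0\<^sub>m l 0)"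
    by (rule frob.left_invertible_summand[OF CL(1,2)[unfolded n] CL(3)])
  note U = inverse_matsD[OF 2(1), folded n] and Q = inverse_matsD[OF 2(2)]
  have colQ: "(C * Q) $$ (i, j) = U $$ (i, j)" if ij: "i < n" "j < k" for i j
  proof -
    let ?J = "four_block_mat (1\<^sub>m k) (0\<^sub>m k 0) (0\<^sub>m l k) (0\<^sub>m l 0) :: 'f fps mat"
    have "(U * ?J) $$ (i, j) = (\<Sum>x\<in>{0..<n}. U $$ (i, x) * ?J $$ (x, j))"
      using ij U by (auto simp: scalar_prod_def n)
    also have "\<dots> = (\<Sum>x\<in>{j}. U $$ (i, x) * ?J $$ (x, j))"
      by (rule sum.mono_neutral_right) (use ij n in auto)
    finally show ?thesis unfolding 2(3) using ij by simp
  qed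
  define C1 where "C1 = C * Q"
  have C1: "C1 \<in> carrier_mat n k" using CL Q by (simp add: C1_def)
  have colN: "P.M.columns n b U j \<in> N" if j: "j < k" for j
  proof -
    have "P.M.columns n b U j = P.M.lin n b (mat_apply k C (\<lambda>i. Q $$ (i, j)))"
      unfolding P.M.columns_def
    proof (rule P.M.lin_cong)
      fix i assume "i < n"
      then show "U $$ (i, j) = mat_apply k C (\<lambda>i. Q $$ (i, j)) i"
        using colQ[of i j] j CL(1) Q by (auto simp: mat_apply_def scalar_prod_def atLeast0LessThan)
    qed (use bc in auto)
    then show ?thesis using Ncols[of k C] CL(4) by simp
  qed
  have C1U: "mat_apply k C1 v i = (\<Sum>j<k. U $$ (i, j) * v j)" if "i < n" for v i
    using colQ that by (simp add: mat_apply_def C1_def)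
  have C1N: "P.M.lin n b (mat_apply k C1 v) \<in> N" for v
  proof (rule Ncols)
    fix j assume j: "j < k"
    have "P.M.columns n b C1 j = P.M.columns n b U j"
      unfolding P.M.columns_def C1_def by (rule P.M.lin_cong) (use colQ j bc in auto)
    then show "P.M.columns n b C1 j \<in> N" using colN[OF j] by simp
  qed
  have L1: "(Q' * L) * C1 = 1\<^sub>m k"
  proof -
    have "(Q' * L) * C1 = Q' * ((L * C) * Q)" unfolding C1_def using Q(1,2) CL(1,2) by (simp add: mat_assoc)
    then show ?thesis unfolding CL(3) using Q by simp
  qed
  have "N = {P.M.lin n b (mat_apply k C1 c) | c. True}"
  proof (intro equalityI subsetI)
    fix x assume xN: "x \<in> N"
    then obtain c where c: "x = P.M.lin n b c" using P.coords Nc by blast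
    define y where "y = mat_apply n V c"
    have Uy: "mat_apply n U y i = c i" if "i < n" for i
      unfolding y_def mat_apply_mult[OF U(1,2) that] U(3) by (rule mat_apply_one[OF that])
    have split: "mat_apply n U v i = mat_apply k C1 v i + (\<Sum>j<l. U $$ (i, k + j) * v (k + j))" if "i < n" for v i
    proof -
      have "(\<Sum>j<k + l'. U $$ (i, j) * v j) = (\<Sum>j<k. U $$ (i, j) * v j) + (\<Sum>j<l'. U $$ (i, k + j) * v (k + j))" for l'
        by (induction l') (auto simp: add.assoc)
      moreover have "mat_apply n U v i = (\<Sum>j<k + l. U $$ (i, j) * v j)" by (simp add: mat_apply_def n)
      ultimately show ?thesis unfolding C1U[OF that] by simp
    qed
    have zero: "y j = 0" if j: "k \<le> j" "j < n" for j
    proof (rule ccontr)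
      assume "y j \<noteq> 0"
      then have "\<exists>j. k \<le> j \<and> j < n \<and> y j \<noteq> 0" using j by blast
      then obtain j0 where j0: "k \<le> j0" "j0 < n" "y j0 \<noteq> 0"
        and least: "\<And>j. k \<le> j \<Longrightarrow> j < n \<Longrightarrow> y j \<noteq> 0 \<Longrightarrow> subdegree (y j0) \<le> subdegree (y j)"
        using ex_has_least_nat[of "\<lambda>j. k \<le> j \<and> j < n \<and> y j \<noteq> 0" _ "\<lambda>j. subdegree (y j)"] by blast
      \<comment> \<open>\<open>u ^ s\<close> is the highest power dividing all coordinates from
        index \<open>k\<close> on, so \<open>z\<close> has a unit at \<open>j0\<close>.\<close>
      define s where "s = subdegree (y j0)"
      define z where "z = (\<lambda>j. if j < k then 0 else fps_shift s (y j))"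
      have yz: "(if j < k then 0 else y j) = fps_X ^ s * z j" if "j < n" for j
      proof (cases "j < k \<or> y j = 0")
        case True
        then show ?thesis by (auto simp: z_def)
      next
        case False
        then have "s \<le> subdegree (y j)" using least[of j] that by (simp add: s_def)
        then have "fps_shift s (y j) * fps_X ^ s = y j" by (rule fps_shift_times_fps_X_power)
        then show ?thesis using False by (simp add: z_def mult.commute)
      qed
      have zj0: "z j0 $ 0 \<noteq> 0" using j0 by (simp add: z_def s_def)
      have "P.M.lin n b (mat_apply n U z) \<in> N"
      proof (rule sat[of "fps_X ^ s"])
        show "P.M.lin n b (mat_apply n U z) \<in> carrier M" by (rule P.M.lin_closed[OF bc])
        have "fps_X ^ s \<odot>\<^bsub>M\<^esub> P.M.lin n b (mat_apply n U z) = P.M.lin n b (\<lambda>i. fps_X ^ s * mat_apply n U z i)"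
          by (simp only: P.M.lin_smult[OF bc])
        also have "\<dots> = P.M.lin n b (\<lambda>i. c i + (- 1) * mat_apply k C1 y i)"
        proof (rule P.M.lin_cong)
          fix i assume i: "i < n"
          have "fps_X ^ s * mat_apply n U z i = mat_apply n U (\<lambda>j. fps_X ^ s * z j) i" by (simp add: mat_apply_smult)
          also have "\<dots> = mat_apply n U (\<lambda>j. if j < k then 0 else y j) i" by (rule mat_apply_cong) (simp only: yz)
          also have "\<dots> = (\<Sum>j<l. U $$ (i, k + j) * y (k + j))" unfolding split[OF i] C1U[OF i] by simp
          also have "\<dots> = c i + (- 1) * mat_apply k C1 y i" using split[OF i, of y] Uy[OF i] by simp
          finally show "fps_X ^ s * mat_apply n U z i = c i + (- 1) * mat_apply k C1 y i" .
        qed (use bc in auto)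
        also have "\<dots> = x \<oplus>\<^bsub>M\<^esub> (- 1) \<odot>\<^bsub>M\<^esub> P.M.lin n b (mat_apply k C1 y)"
          unfolding c by (simp only: P.M.lin_add[OF bc] P.M.lin_smult[OF bc])
        also have "\<dots> \<in> N" by (intro Nadd xN Nsm C1N)
        finally show "fps_X ^ s \<odot>\<^bsub>M\<^esub> P.M.lin n b (mat_apply n U z) \<in> N" .
      qed simp
      note zN = this
      \<comment> \<open>In the adapted basis \<open>Y\<close> consists of the first \<open>k\<close>
        unit vectors and \<open>z\<close>. It has the left inverse \<open>R\<close> because
        \<open>z\<close> is zero at indices less than \<open>k\<close> and \<open>z j0\<close> is
        invertible.\<close>
      define Y where "Y = mat n (Suc k) (\<lambda>(i, j). if j < k then (if i = j then 1 else 0) else z i)"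
      define R where "R = mat (Suc k) n (\<lambda>(i, j). if i < k then (if i = j then 1 else 0) else (if j = j0 then inverse (z j0) else 0))"
      have YR: "Y \<in> carrier_mat n (Suc k)" "R \<in> carrier_mat (Suc k) n" by (auto simp: Y_def R_def)
      have "R * Y = 1\<^sub>m (Suc k)"
      proof (rule eq_matI)
        fix i j assume "i < dim_row (1\<^sub>m (Suc k) :: 'f fps mat)" "j < dim_col (1\<^sub>m (Suc k) :: 'f fps mat)"
        then have ij: "i < Suc k" "j < Suc k" by auto
        let ?i = "if i < k then i else j0"
        have i': "?i < n" using j0 ij by (auto simp: n)
        have "(R * Y) $$ (i, j) = (\<Sum>x\<in>{0..<n}. R $$ (i, x) * Y $$ (x, j))"
          using ij YR by (auto simp: scalar_prod_def)
        also have "\<dots> = (\<Sum>x\<in>{?i}. R $$ (i, x) * Y $$ (x, j))"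
          by (rule sum.mono_neutral_right) (use ij i' in \<open>auto simp: R_def split: if_splits\<close>)
        also have "\<dots> = R $$ (i, ?i) * Y $$ (?i, j)" by simp
        also have "\<dots> = 1\<^sub>m (Suc k) $$ (i, j)"
          using ij i' j0 zj0 by (auto simp: R_def Y_def z_def inverse_mult_eq_1 split: if_splits)
        finally show "(R * Y) $$ (i, j) = 1\<^sub>m (Suc k) $$ (i, j)" .
      qed (use YR in auto)
      moreover have "(R * V) * (U * Y) = R * ((V * U) * Y)" using YR U(1,2) by (simp add: mat_assoc)
      ultimately have inv: "(R * V) * (U * Y) = 1\<^sub>m (Suc k)" unfolding U(4) using YR by simp
      have UY: "(U * Y) $$ (i, j) = mat_apply n U (\<lambda>x. Y $$ (x, j)) i" if "i < n" "j < Suc k" for i j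
        using that U(1) YR by (auto simp: mat_apply_def scalar_prod_def atLeast0LessThan)
      have "P.M.columns n b (U * Y) j \<in> N" if j: "j < Suc k" for j
      proof (cases "j < k")
        case True
        have "P.M.columns n b (U * Y) j = P.M.columns n b U j"
          unfolding P.M.columns_def
        proof (rule P.M.lin_cong)
          fix i assume i: "i < n"
          have "(\<Sum>x<n. U $$ (i, x) * Y $$ (x, j)) = (\<Sum>x\<in>{j}. U $$ (i, x) * Y $$ (x, j))"
            by (rule sum.mono_neutral_right) (use True n in \<open>auto simp: Y_def\<close>)
          then show "(U * Y) $$ (i, j) = U $$ (i, j)" unfolding UY[OF i j] mat_apply_def using True n by (simp add: Y_def)
        qed (use bc in auto)
        then show ?thesis using colN[OF True] by simp
      next
        case False
        have "P.M.columns n b (U * Y) j = P.M.lin n b (mat_apply n U z)"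
          unfolding P.M.columns_def
        proof (rule P.M.lin_cong)
          fix i assume i: "i < n"
          show "(U * Y) $$ (i, j) = mat_apply n U z i" unfolding UY[OF i j]
            by (rule mat_apply_cong) (use False j in \<open>auto simp: Y_def\<close>)
        qed (use bc in auto)
        then show ?thesis using zN by simp
      qed
      then have "T (Suc k)" unfolding T_def using inv YR U(1,2)
        by (intro exI[of _ "U * Y"] exI[of _ "R * V"]) auto
      then show False using k(2) by fastforce
    qed
    have "x = P.M.lin n b (mat_apply k C1 y)"
      unfolding c
    proof (rule P.M.lin_cong)
      fix i assume i: "i < n"
      show "c i = mat_apply k C1 y i" using split[OF i, of y] Uy[OF i] zero by (simp add: n)
    qed (use bc in auto)
    then show "x \<in> {P.M.lin n b (mat_apply k C1 c) | c. True}" by blast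
  next
    fix x assume "x \<in> {P.M.lin n b (mat_apply k C1 c) | c. True}"
    then show "x \<in> N" using C1N by blast
  qed
  then show thesis using that[OF C1 _ L1] Q CL by simp
qed

text \<open>A saturated stable submodule is a direct summand, hence a stable summand in coordinates,
  and \<open>ss\<close> is the slope inequality for it.\<close>

lemma torsion_semistable_presented:
  fixes M :: "('f fps, 'm) phi_module"
  assumes P: "presented \<phi>\<^sub>0 (fps_X ^ h) n b A M" and n: "0 < n" and nz: "det A \<noteq> 0"
    and ss: "\<And>m w. frob.stable_sub A n m w \<Longrightarrow> subdegree (det A) * m \<le> w * n"
  shows "torsion_semistable M"
  unfolding torsion_semistable_def
proof (intro allI impI)
  interpret P: presented \<phi>\<^sub>0 "fps_X ^ h" n b A M by (rule P)
  note bc = P.b_carrier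
  fix N assume N: "submodule N univ_ring M \<and> N \<noteq> {\<zero>\<^bsub>M\<^esub>} \<and> frob_stable fps_X M N \<and>
     (\<forall>a. \<forall>x\<in>carrier M. a \<noteq> 0 \<and> a \<odot>\<^bsub>M\<^esub> x \<in> N \<longrightarrow> x \<in> N)"
  then have sub: "submodule N univ_ring M" and ne: "N \<noteq> {\<zero>\<^bsub>M\<^esub>}" and st: "frob_stable fps_X M N"
    and sat: "\<And>a x. a \<noteq> 0 \<Longrightarrow> x \<in> carrier M \<Longrightarrow> a \<odot>\<^bsub>M\<^esub> x \<in> N \<Longrightarrow> x \<in> N" by blast+
  obtain k C L where 1: "C \<in> carrier_mat n k" "L \<in> carrier_mat k n" "L * C = 1\<^sub>m k"
    "N = {umod.lin M n b (mat_apply k C c) | c. True}"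
    by (rule saturated_summand[OF P sub sat])
  have Ns: "N = P.span_cols k C" unfolding 1(4) P.span_cols_def ..
  have k0: "0 < k"
  proof (rule ccontr)
    assume "\<not> 0 < k"
    then have "mat_apply k C c = (\<lambda>_. 0)" for c by (auto simp: mat_apply_def)
    then show False using ne 1(4) P.M.lin_zero[OF bc] by auto
  qed
  define A' where "A' = L * (A * frob.Phi C)"
  have A': "A' \<in> carrier_mat k k" using 1 P.A_carrier by (simp add: A'_def)
  have AC: "A * frob.Phi C = C * A'"
  proof -
    \<comment> \<open>Stability only puts the images into \<open>N[1/u]\<close>. They have the
      denominator \<open>u ^ h\<close>, and saturation puts their numerators back into
      \<open>N\<close>.\<close>
    have col: "\<exists>z. \<forall>i<n. (A * frob.Phi C) $$ (i, j) = mat_apply k C z i" if j: "j < k" for j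
    proof -
      let ?c = "\<lambda>i. if i = j then 1 else 0 :: 'f fps"
      have Cj: "mat_apply k C ?c i = C $$ (i, j)" if "i < n" for i
        unfolding mat_apply_def using j by (subst sum.mono_neutral_right[of _ "{j}"]) auto
      let ?w = "mat_apply n A (\<lambda>i. \<phi>\<^sub>0 (mat_apply k C ?c i))"
      have w: "?w i = (A * frob.Phi C) $$ (i, j)" if i: "i < n" for i
      proof -
        have "?w i = mat_apply n A (\<lambda>i. frob.Phi C $$ (i, j)) i"
          by (rule mat_apply_cong) (use Cj 1(1) j in auto)
        then show ?thesis using P.A_carrier 1(1) i j by (auto simp: mat_apply_def scalar_prod_def atLeast0LessThan)
      qed
      have "P.M.lin n b (mat_apply k C ?c) \<in> N" unfolding 1(4) by blast
      then have "frob M (P.M.lin n b (mat_apply k C ?c)) \<in> inverting fps_X M N" using st unfolding frob_stable_def by blast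
      then obtain x i where x: "P.M.fr (P.M.lin n b ?w) (fps_X ^ h) = P.M.fr x (fps_X ^ i)" "x \<in> N"
        unfolding P.frob_lin inverting_def by blast
      have Nc: "N \<subseteq> carrier M" by (rule P.M.submoduleE(1)[OF sub])
      have "fps_X ^ i \<odot>\<^bsub>M\<^esub> P.M.lin n b ?w = fps_X ^ h \<odot>\<^bsub>M\<^esub> x"
        using x Nc P.M.lin_closed[OF bc] P.M.fraction_eq_iff[of "P.M.lin n b ?w" "fps_X ^ h" x "fps_X ^ i"] by auto
      also have "\<dots> \<in> N" using P.M.submoduleE(4)[OF sub] x(2) by simp
      finally have "P.M.lin n b ?w \<in> N" by (rule sat[rotated 2]) (use P.M.lin_closed[OF bc] in auto)
      then obtain z where "P.M.lin n b ?w = P.M.lin n b (mat_apply k C z)" unfolding 1(4) by blast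
      then have "?w i = mat_apply k C z i" if "i < n" for i using P.coords_unique that by blast
      then show ?thesis using w by metis
    qed
    then obtain z where z: "\<And>i j. j < k \<Longrightarrow> i < n \<Longrightarrow> (A * frob.Phi C) $$ (i, j) = mat_apply k C (z j) i" by metis
    define Z where "Z = mat k k (\<lambda>(i, j). z j i)"
    have Z: "Z \<in> carrier_mat k k" by (simp add: Z_def)
    have CZ: "A * frob.Phi C = C * Z"
    proof (rule eq_matI)
      fix i j assume "i < dim_row (C * Z)" "j < dim_col (C * Z)"
      then have ij: "i < n" "j < k" using 1 Z by auto
      then show "(A * frob.Phi C) $$ (i, j) = (C * Z) $$ (i, j)"
        unfolding z[OF ij(2,1)] using 1(1) by (auto simp: mat_apply_def Z_def scalar_prod_def atLeast0LessThan)
    qed (use 1 Z P.A_carrier in auto)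
    have "A' = (L * C) * Z" unfolding A'_def CZ using 1(1,2) Z by (simp add: mat_assoc)
    then have "A' = Z" unfolding 1(3) using Z by simp
    then show ?thesis using CZ by simp
  qed
  have LC: "L * C = 1 \<cdot>\<^sub>m 1\<^sub>m k" unfolding 1(3) by (intro eq_matI) auto
  have PS: "presented \<phi>\<^sub>0 (fps_X ^ h) k (P.M.columns n b C) A' (sub_module M N)"
    unfolding Ns by (rule P.sub_module_presented[OF 1(1) A' 1(2) LC _ AC]) simp
  have nz': "det A' \<noteq> 0" by (rule frob.stable_sub_det_nonzero[OF P.A_carrier nz 1(1,2) A' 1(3) AC])
  have "frob.stable_sub A n k (subdegree (det A'))"
    unfolding frob.stable_sub_def using k0 1(1-3) A' AC by blast
  then have "subdegree (det A) * k \<le> subdegree (det A') * n" by (rule ss)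
  then have "real (subdegree (det A)) * real k \<le> real (subdegree (det A')) * real n"
    by (metis of_nat_le_iff of_nat_mult)
  then show "torsion_slope (sub_module M N) \<le> torsion_slope M"
    unfolding torsion_slope_presented[OF PS nz'] torsion_slope_presented[OF P nz]
    using k0 n by (simp add: field_simps)
qed

end

section \<open>Flags of Kisin modules\<close>

lemma (in presented) presented_cong:
  assumes "\<And>i. i < n \<Longrightarrow> b i = b' i"
  shows "presented \<phi> d n b' A M"
proof (intro presented.intro presented_axioms.intro)
  have l: "M.lin n b c = M.lin n b' c" for c by (rule M.lin_cong) (use assms b_carrier in auto)
  show "comm_ring_hom \<phi>" by unfold_locales
  show "Module.module univ_ring M" by (rule mod)
  show "is_basis M UNIV n b' (carrier M)" by (rule M.is_basis_cong[OF basis assms])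
  show "A \<in> carrier_mat n n" "d \<noteq> 0" using A_carrier d_nonzero by auto
  show "frob M (M.lin n b' c) = M.fr (M.lin n b' (mat_apply n A (\<lambda>i. \<phi> (c i)))) d" for c
    unfolding l[symmetric] by (rule frob_lin)
qed

section \<open>Leading blocks of a block triangular matrix and the submodules they describe\<close>

definition leading_block :: "'r mat \<Rightarrow> nat \<Rightarrow> 'r mat" where
  "leading_block A m = mat m m (\<lambda>(i, j). A $$ (i, j))"

definition inclusion_mat :: "nat \<Rightarrow> nat \<Rightarrow> 'r::{zero,one} mat" where
  "inclusion_mat n m = mat n m (\<lambda>(i, j). if i = j then 1 else 0)"

lemma leading_block_carrier [simp]: "leading_block A m \<in> carrier_mat m m"
  by (simp add: leading_block_def)

lemma inclusion_mat_carrier [simp]: "inclusion_mat n m \<in> carrier_mat n m"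
  by (simp add: inclusion_mat_def)

lemma mat_apply_inclusion: "i < n \<Longrightarrow> mat_apply m (inclusion_mat n m) c i = (if i < m then c i else 0)"
proof -
  assume i: "i < n"
  have "mat_apply m (inclusion_mat n m) c i = (\<Sum>j<m. if i = j then c j else 0)"
    unfolding mat_apply_def using i by (intro sum.cong) (auto simp: inclusion_mat_def)
  then show ?thesis by (simp add: sum.delta)
qed

lemma inclusion_left_inverse:
  assumes "m \<le> n"
  shows "inclusion_mat m n * inclusion_mat n m = (1\<^sub>m m :: 'r::comm_ring_1 mat)"
proof (rule eq_matI)
  fix i j assume "i < dim_row (1\<^sub>m m :: 'r mat)" "j < dim_col (1\<^sub>m m :: 'r mat)"
  then have ij: "i < m" "j < m" by auto
  have "(inclusion_mat m n * inclusion_mat n m) $$ (i, j) =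
      mat_apply n (inclusion_mat m n) (\<lambda>l. inclusion_mat n m $$ (l, j) :: 'r) i"
    using ij by (auto simp: mat_apply_def scalar_prod_def atLeast0LessThan inclusion_mat_def)
  also have "\<dots> = inclusion_mat n m $$ (i, j)" using ij assms by (simp add: mat_apply_inclusion)
  finally show "(inclusion_mat m n * inclusion_mat n m) $$ (i, j) = (1\<^sub>m m :: 'r mat) $$ (i, j)"
    using ij assms by (simp add: inclusion_mat_def)
qed (auto simp: inclusion_mat_def)

lemma leading_block_inclusion:
  fixes A :: "'r::comm_ring_1 mat"
  assumes A: "A \<in> carrier_mat n n" and m: "m \<le> n"
    and z: "\<And>i j. j < m \<Longrightarrow> m \<le> i \<Longrightarrow> i < n \<Longrightarrow> A $$ (i, j) = 0"
  shows "A * inclusion_mat n m = inclusion_mat n m * leading_block A m"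
proof (rule eq_matI)
  fix i j assume "i < dim_row (inclusion_mat n m * leading_block A m)" "j < dim_col (inclusion_mat n m * leading_block A m)"
  then have ij: "i < n" "j < m" by (auto simp: inclusion_mat_def leading_block_def)
  have "(A * inclusion_mat n m) $$ (i, j) = (\<Sum>l\<in>{0..<n}. A $$ (i, l) * (if l = j then 1 else 0))"
    using ij A m by (auto simp: scalar_prod_def inclusion_mat_def)
  also have "\<dots> = A $$ (i, j)" using ij m by (subst sum.mono_neutral_right[of _ "{j}"]) auto
  also have "\<dots> = mat_apply m (inclusion_mat n m) (\<lambda>l. leading_block A m $$ (l, j)) i"
    using ij z[of j i] by (simp add: mat_apply_inclusion leading_block_def)
  also have "\<dots> = (inclusion_mat n m * leading_block A m) $$ (i, j)"
    using ij by (auto simp: mat_apply_def scalar_prod_def atLeast0LessThan inclusion_mat_def leading_block_def)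
  finally show "(A * inclusion_mat n m) $$ (i, j) = (inclusion_mat n m * leading_block A m) $$ (i, j)" .
qed (use A in \<open>auto simp: inclusion_mat_def leading_block_def\<close>)

lemma det_leading_block:
  fixes A :: "'r::idom mat"
  assumes A: "A \<in> carrier_mat n n" and m: "m \<le> n"
    and z: "\<And>i j. j < m \<Longrightarrow> m \<le> i \<Longrightarrow> i < n \<Longrightarrow> A $$ (i, j) = 0"
  shows "det A = det (leading_block A m) * det (mat (n - m) (n - m) (\<lambda>(i, j). A $$ (m + i, m + j)))"
proof -
  have "A = four_block_mat (leading_block A m) (mat m (n - m) (\<lambda>(i, j). A $$ (i, m + j))) (0\<^sub>m (n - m) m)
      (mat (n - m) (n - m) (\<lambda>(i, j). A $$ (m + i, m + j)))"
    using A m z by (intro eq_matI) (auto simp: leading_block_def)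
  then have "det A = det (four_block_mat (leading_block A m) (mat m (n - m) (\<lambda>(i, j). A $$ (i, m + j))) (0\<^sub>m (n - m) m)
      (mat (n - m) (n - m) (\<lambda>(i, j). A $$ (m + i, m + j))))" by simp
  also have "\<dots> = det (leading_block A m) * det (mat (n - m) (n - m) (\<lambda>(i, j). A $$ (m + i, m + j)))"
    by (rule det_four_block_mat_lower_left_zero) auto
  finally show ?thesis .
qed

context kisin_base
begin

lemma EE_nonzero: "EE \<noteq> 0" using EE_prime by auto

text \<open>As \<open>E\<close> is prime, \<open>det A\<close> is some \<open>E ^ i\<close> times a
  unit, and its reduction has valuation \<open>degree E * i\<close>. So slopes at \<open>E\<close>
  and slopes modulo \<open>p\<close> differ by the factor \<open>degree E\<close>.\<close>

lemma kisin_slope_presented: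
  fixes M :: "('w fps, 'm) phi_module"
  assumes P: "presented \<phi> (EE ^ h) n b A M" and n: "0 < n" and det: "det A dvd EE ^ j"
  shows "kisin_slope E M * real (degree E) =
    real h * real (degree E) - real (subdegree (det (Red A))) / real n"
proof -
  interpret P: presented \<phi> "EE ^ h" n b A M by (rule P)
  obtain i w where iw: "det A = EE ^ i * w" "w dvd 1" using prime_power_divisor[OF EE_prime det] by blast
  have w: "\<not> EE dvd w" by (rule prime_elem_not_dvd_unit[OF EE_prime iw(2)])
  have deg: "kisin_degree E M = int n * int h - int i"
    unfolding kisin_degree_def by (rule P.degree_eq[OF EE_prime EE_valuation refl iw(1) w])
  have "red w dvd 1" using iw(2) red.hom_dvd_1 by blast
  then have rw: "red w \<noteq> 0" "subdegree (red w) = 0" using fps_unit_iff_subdegree by blast+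
  have "det (Red A) = fps_X ^ (degree E * i) * red w"
    using iw(1) by (simp add: red.hom_mult red.hom_power red_EE power_mult)
  then have sd: "subdegree (det (Red A)) = degree E * i" using rw by simp
  show ?thesis unfolding kisin_slope_def deg P.rank sd using n by (simp add: field_simps)
qed

text \<open>With \<open>m = 0\<close> the quotient construction divides out the elements all of
  whose coordinates reduce to zero, that is, \<open>p M\<close>.\<close>

lemma mod_p_presented:
  fixes M :: "('w fps, 'm) phi_module"
  assumes P: "presented \<phi> (EE ^ h) n b A M"
  shows "\<exists>b'. presented \<phi>\<^sub>0 (fps_X ^ (degree E * h)) n b' (Red A) (mod_p p res M)"
proof -
  interpret P: presented \<phi> "EE ^ h" n b A M by (rule P)
  have red_d: "red (EE ^ h) = fps_X ^ (degree E * h)" by (simp add: red.hom_power red_EE power_mult)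
  interpret PQ: presented_quotient \<phi> "EE ^ h" n b A M red \<phi>\<^sub>0 0 n
  proof (unfold_locales)
    show "surj red" using red_surj by (metis surjI)
    show "red (EE ^ h) \<noteq> 0" unfolding red_d by simp
  qed (auto simp: red_\<phi>)
  have "PQ.N = {pp \<odot>\<^bsub>M\<^esub> x | x. x \<in> carrier M}"
  proof (intro equalityI subsetI)
    fix x assume "x \<in> PQ.N"
    then obtain c where c: "x = P.M.lin n b c" "\<forall>i<n. red (c i) = 0" by (auto simp: PQ.res_class_def)
    then have "\<forall>i. \<exists>z. i < n \<longrightarrow> c i = pp * z" by (auto simp: red_zero_iff dvd_def)
    then obtain z where z: "\<And>i. i < n \<Longrightarrow> c i = pp * z i" by metis
    have "x = P.M.lin n b (\<lambda>i. pp * z i)" unfolding c by (rule P.M.lin_cong) (use z P.b_carrier in auto)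
    then have "x = pp \<odot>\<^bsub>M\<^esub> P.M.lin n b z" by (simp only: P.M.lin_smult[OF P.b_carrier])
    then show "x \<in> {pp \<odot>\<^bsub>M\<^esub> x | x. x \<in> carrier M}" using P.M.lin_closed[OF P.b_carrier] by blast
  next
    fix x assume "x \<in> {pp \<odot>\<^bsub>M\<^esub> x | x. x \<in> carrier M}"
    then obtain y where y: "x = pp \<odot>\<^bsub>M\<^esub> y" "y \<in> carrier M" by blast
    obtain c where c: "y = P.M.lin n b c" by (rule P.coords[OF y(2)])
    have "x = P.M.lin n b (\<lambda>i. pp * c i)" unfolding y c by (simp only: P.M.lin_smult[OF P.b_carrier])
    moreover have "red (pp * c i) = 0" for i by (simp add: red_zero_iff)
    ultimately show "x \<in> PQ.N" unfolding PQ.res_class_def by auto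
  qed
  then have "PQ.Q = mod_p p res M" unfolding mod_p_def by simp
  moreover have "PQ.qA = Red A" unfolding PQ.qA_def using P.A_carrier by (intro eq_matI) auto
  ultimately show ?thesis using PQ.quotient_presented unfolding red_d by metis
qed

text \<open>The first \<open>N t\<close> basis vectors span the \<open>t\<close>-th step of the
  flag, which is stable because the matrix is block triangular.\<close>

lemma hn_matrix_imp_HN_type:
  fixes M :: "('w fps, 'm) phi_module"
  assumes P: "presented \<phi> (EE ^ h) n b A M" and det: "det A dvd EE ^ j" and hn: "hn_matrix n A r N"
  shows "HN_type p res \<sigma> E M"
proof -
  interpret P: presented \<phi> "EE ^ h" n b A M by (rule P)
  note bc = P.b_carrier
  have N: "N 0 = 0" "N r = n" "\<And>t. t < r \<Longrightarrow> N t < N (Suc t)"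
    and z: "\<And>t i j. t \<le> r \<Longrightarrow> j < N t \<Longrightarrow> N t \<le> i \<Longrightarrow> i < n \<Longrightarrow> A $$ (i, j) = 0"
    and ss: "\<And>t m w. t < r \<Longrightarrow> frob.stable_sub (Red (diag_block A N t)) (N (Suc t) - N t) m w \<Longrightarrow>
        subdegree (det (Red (diag_block A N t))) * m \<le> w * (N (Suc t) - N t)"
    and lt: "\<And>s t. s < t \<Longrightarrow> t < r \<Longrightarrow> subdegree (det (Red (diag_block A N s))) * (N (Suc t) - N t) <
        subdegree (det (Red (diag_block A N t))) * (N (Suc s) - N s)"
    using hn unfolding hn_matrix_def by blast+
  have Nle: "N t \<le> n" if "t \<le> r" for t
  proof -
    have "N t \<le> N r" using that
      by (induction rule: inc_induct) (use N(3) in \<open>auto intro: less_imp_le order_trans\<close>)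
    then show ?thesis using N by simp
  qed
  define Fil where "Fil t = P.span_cols (N t) (inclusion_mat n (N t))" for t
  have PhJ: "Ph (inclusion_mat n m) = inclusion_mat n m" for m
    by (intro eq_matI) (auto simp: inclusion_mat_def)
  have AJ: "A * Ph (inclusion_mat n (N t)) = inclusion_mat n (N t) * leading_block A (N t)" if "t \<le> r" for t
    unfolding PhJ by (rule leading_block_inclusion[OF P.A_carrier Nle[OF that] z[OF that]])
  have Fil_mem: "P.M.lin n b c \<in> Fil t \<longleftrightarrow> (\<forall>i. N t \<le> i \<and> i < n \<longrightarrow> c i = 0)" if t: "t \<le> r" for t c
  proof
    assume "P.M.lin n b c \<in> Fil t"
    then obtain c' where "P.M.lin n b c = P.M.lin n b (mat_apply (N t) (inclusion_mat n (N t)) c')"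
      by (auto simp: Fil_def P.span_cols_def)
    then have "c i = mat_apply (N t) (inclusion_mat n (N t)) c' i" if "i < n" for i using P.coords_unique that by blast
    then show "\<forall>i. N t \<le> i \<and> i < n \<longrightarrow> c i = 0" by (simp add: mat_apply_inclusion)
  next
    assume c: "\<forall>i. N t \<le> i \<and> i < n \<longrightarrow> c i = 0"
    have "P.M.lin n b c = P.M.lin n b (mat_apply (N t) (inclusion_mat n (N t)) c)"
      by (rule P.M.lin_cong) (use c bc in \<open>auto simp: mat_apply_inclusion\<close>)
    then show "P.M.lin n b c \<in> Fil t" by (auto simp: Fil_def P.span_cols_def)
  qed
  have one: "(1\<^sub>m m :: 'w fps mat) = 1 \<cdot>\<^sub>m 1\<^sub>m m" for m by (intro eq_matI) auto
  have PF: "presented \<phi> (EE ^ h) (N t) b (leading_block A (N t)) (sub_module M (Fil t))" if t: "t \<le> r" for t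
  proof -
    interpret PS: presented \<phi> "EE ^ h" "N t" "P.M.columns n b (inclusion_mat n (N t))" "leading_block A (N t)" "sub_module M (Fil t)"
      unfolding Fil_def
      by (rule P.sub_module_presented[OF _ _ _ trans[OF inclusion_left_inverse[OF Nle[OF t]] one] _ AJ[OF t]]) auto
    show ?thesis
    proof (rule PS.presented_cong)
      fix i assume i: "i < N t"
      have "P.M.columns n b (inclusion_mat n (N t)) i = P.M.lin n b (\<lambda>l. if l = i then 1 else 0)"
        unfolding P.M.columns_def by (rule P.M.lin_cong) (use i bc Nle[OF t] in \<open>auto simp: inclusion_mat_def\<close>)
      then show "P.M.columns n b (inclusion_mat n (N t)) i = b i"
        using P.M.lin_unit[OF bc, of i] i Nle[OF t] by simp
    qed
  qed
  have detF: "det (leading_block A (N t)) dvd EE ^ j" if t: "t \<le> r" for t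
    using det_leading_block[OF P.A_carrier Nle[OF t] z[OF t]] det by (metis dvd_mult_left)
  define Gr where "Gr i = quotient_phi_module id (sub_module M (Fil (Suc i))) (Fil i)" for i
  \<comment> \<open>The step \<open>Suc t\<close> of the flag is presented by a leading block;
    dividing by the span of the first \<open>N t\<close> vectors leaves the diagonal block.\<close>
  have PG: "\<exists>b'. presented \<phi> (EE ^ h) (N (Suc t) - N t) b' (diag_block A N t) (Gr t)" if t: "t < r" for t
  proof -
    have tt: "t \<le> r" "Suc t \<le> r" using t by auto
    let ?S = "sub_module M (Fil (Suc t))" and ?m = "N (Suc t)"
    interpret PS: presented \<phi> "EE ^ h" ?m b "leading_block A ?m" ?S by (rule PF[OF tt(2)])
    interpret PQ: presented_quotient \<phi> "EE ^ h" ?m b "leading_block A ?m" ?S id \<phi> "N t" "N (Suc t) - N t"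
    proof (unfold_locales)
      show "?m = N t + (N (Suc t) - N t)" using N(3)[OF t] by simp
      show "id (EE ^ h) \<noteq> 0" using EE_nonzero by simp
      show "id (leading_block A ?m $$ (i, j)) = 0" if "N t \<le> i" "i < ?m" "j < N t" for i j
        using z[OF tt(1), of j i] that Nle[OF tt(2)] N(3)[OF t] by (simp add: leading_block_def)
    qed auto
    have lin: "PS.M.lin ?m b c = P.M.lin ?m b c" for c
    proof (rule P.M.sub_lin)
      show "umod ?S" by unfold_locales
      show "b \<in> {..<?m} \<rightarrow> carrier M" using bc Nle[OF tt(2)] by auto
      show "b \<in> {..<?m} \<rightarrow> carrier ?S" by (rule PS.b_carrier)
    qed (simp_all add: sub_module_def)
    \<comment> \<open>Extending coefficients by zero turns combinations in the submodule into
      combinations of the whole basis, to which \<open>Fil_mem\<close> applies.\<close>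
    have ext: "P.M.lin k b c = P.M.lin n b (\<lambda>i. if i < k then c i else 0)" if "k \<le> n" for k c
    proof -
      have "q \<le> n \<longrightarrow> P.M.lin q b (\<lambda>i. if i < k then c i else 0) = P.M.lin k b c" if "k \<le> q" for q
        using that
      proof (induction rule: dec_induct)
        case base
        show ?case by (intro impI P.M.lin_cong) (use bc in auto)
      next
        case (step q)
        show ?case
        proof
          assume q: "Suc q \<le> n"
          then have "b \<in> {..<Suc q} \<rightarrow> carrier M" "b \<in> {..<k} \<rightarrow> carrier M" "b q \<in> carrier M" using bc step by auto
          then show "P.M.lin (Suc q) b (\<lambda>i. if i < k then c i else 0) = P.M.lin k b c"
            using step q P.M.lin_closed[of b k c] by (simp add: P.M.lin_Suc)
        qed
      qed
      then show ?thesis using that by simp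
    qed
    have "PQ.N = Fil t"
    proof (intro equalityI subsetI)
      fix x assume "x \<in> PQ.N"
      then obtain c where c: "x = P.M.lin ?m b c" "\<forall>i<N (Suc t) - N t. c (N t + i) = 0"
        by (auto simp: PQ.res_class_def lin)
      have "x = P.M.lin n b (\<lambda>i. if i < ?m then c i else 0)" unfolding c by (rule ext[OF Nle[OF tt(2)]])
      moreover have "c i = 0" if "N t \<le> i" "i < ?m" for i using c(2)[rule_format, of "i - N t"] that by simp
      ultimately show "x \<in> Fil t" using Fil_mem[OF tt(1)] by simp
    next
      fix x assume x: "x \<in> Fil t"
      then have "x \<in> carrier M" unfolding Fil_def using P.M.submoduleE(1)[OF P.span_cols_submodule] by blast
      then obtain c where c: "x = P.M.lin n b c" by (rule P.coords)
      have c0: "c i = 0" if "N t \<le> i" "i < n" for i using Fil_mem[OF tt(1)] x c that by blast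
      have "x = P.M.lin n b (\<lambda>i. if i < ?m then c i else 0)" unfolding c
        by (rule P.M.lin_cong) (use c0 N(3)[OF t] bc in auto)
      then have "x = PS.M.lin ?m b c" unfolding lin ext[OF Nle[OF tt(2)]] .
      moreover have "\<forall>i<N (Suc t) - N t. id (c (N t + i)) = 0" using c0 Nle[OF tt(2)] by auto
      ultimately show "x \<in> PQ.N" unfolding PQ.res_class_def by blast
    qed
    then have "PQ.Q = Gr t" by (simp add: Gr_def)
    moreover have "PQ.qA = diag_block A N t"
      unfolding PQ.qA_def diag_block_def by (intro eq_matI) (auto simp: leading_block_def)
    ultimately show ?thesis using PQ.quotient_presented by (metis id_apply)
  qed
  have detG: "det (diag_block A N t) dvd EE ^ j" if t: "t < r" for t
  proof -
    have tt: "t \<le> r" "Suc t \<le> r" using t by auto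
    have "det (leading_block A (N (Suc t))) = det (leading_block (leading_block A (N (Suc t))) (N t)) *
        det (mat (N (Suc t) - N t) (N (Suc t) - N t) (\<lambda>(i, j). leading_block A (N (Suc t)) $$ (N t + i, N t + j)))"
      by (rule det_leading_block) (use N(3)[OF t] z[OF tt(1)] Nle[OF tt(2)] in \<open>auto simp: leading_block_def\<close>)
    also have "mat (N (Suc t) - N t) (N (Suc t) - N t) (\<lambda>(i, j). leading_block A (N (Suc t)) $$ (N t + i, N t + j)) = diag_block A N t"
      unfolding diag_block_def by (intro eq_matI) (auto simp: leading_block_def)
    finally show ?thesis using detF[OF tt(2)] by (metis dvd_mult_right)
  qed
  have slope: "kisin_slope E (Gr t) * real (degree E) = real h * real (degree E) -
      real (subdegree (det (Red (diag_block A N t)))) / real (N (Suc t) - N t)" if t: "t < r" for t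
  proof -
    obtain b' where b': "presented \<phi> (EE ^ h) (N (Suc t) - N t) b' (diag_block A N t) (Gr t)" using PG[OF t] by blast
    show ?thesis by (rule kisin_slope_presented[OF b' _ detG[OF t]]) (use N(3)[OF t] in simp)
  qed
  show ?thesis
    unfolding HN_type_def Let_def
  proof (intro exI[of _ r] exI[of _ Fil] conjI allI impI, fold Gr_def)
    show "Fil 0 = {\<zero>\<^bsub>M\<^esub>}"
    proof -
      have "mat_apply 0 C c = (\<lambda>_. 0)" for C :: "'w fps mat" and c by (auto simp: mat_apply_def)
      then show ?thesis using P.M.lin_zero[OF bc] by (auto simp: Fil_def P.span_cols_def N)
    qed
    show "Fil r = carrier M"
    proof (intro equalityI subsetI)
      fix x assume "x \<in> carrier M"
      then obtain c where "x = P.M.lin n b c" by (rule P.coords)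
      then show "x \<in> Fil r" using Fil_mem[of r c] N(2) by auto
    qed (use P.M.submoduleE(1)[OF P.span_cols_submodule] in \<open>auto simp: Fil_def\<close>)
    fix t assume t: "t \<le> r"
    show "submodule (Fil t) univ_ring M" unfolding Fil_def by (rule P.span_cols_submodule)
    show "frob_stable EE M (Fil t)" unfolding Fil_def by (rule P.span_cols_stable[OF _ _ AJ[OF t] refl]) auto
    show "kisin_module p \<sigma> E (sub_module M (Fil t))"
      unfolding kisin_module_def by (rule presented.frobenius_moduleI[OF PF[OF t] EE_nonzero refl detF[OF t]])
  next
    fix t assume t: "t < r"
    show "Fil t \<subset> Fil (Suc t)"
    proof
      show "Fil t \<subseteq> Fil (Suc t)"
      proof
        fix x assume x: "x \<in> Fil t"
        then have "x \<in> carrier M" unfolding Fil_def using P.M.submoduleE(1)[OF P.span_cols_submodule] by blast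
        then obtain c where c: "x = P.M.lin n b c" by (rule P.coords)
        then show "x \<in> Fil (Suc t)" using x Fil_mem[of t c] Fil_mem[of "Suc t" c] t N(3)[OF t] by simp
      qed
      \<comment> \<open>Counting from 0, the basis vector of index \<open>N t\<close> is the first
        one outside \<open>Fil t\<close>.\<close>
      let ?c = "\<lambda>i. if i = N t then 1 else 0 :: 'w fps"
      have "P.M.lin n b ?c \<in> Fil (Suc t)" using Fil_mem[of "Suc t" ?c] t N(3)[OF t] by auto
      moreover have "P.M.lin n b ?c \<notin> Fil t"
        using Fil_mem[of t ?c] t N(3)[OF t] Nle[of "Suc t"] by (auto intro!: exI[of _ "N t"])
      ultimately show "Fil t \<noteq> Fil (Suc t)" by blast
    qed
    obtain b' where b': "presented \<phi> (EE ^ h) (N (Suc t) - N t) b' (diag_block A N t) (Gr t)" using PG[OF t] by blast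
    show "kisin_module p \<sigma> E (Gr t)"
      unfolding kisin_module_def by (rule presented.frobenius_moduleI[OF b' EE_nonzero refl detG[OF t]])
    obtain b'' where b'': "presented \<phi>\<^sub>0 (fps_X ^ (degree E * h)) (N (Suc t) - N t) b'' (Red (diag_block A N t)) (mod_p p res (Gr t))"
      using mod_p_presented[OF b'] by blast
    show "kisin_semistable p res (Gr t)"
      unfolding kisin_semistable_def
    proof (rule torsion_semistable_presented[OF b''])
      show "0 < N (Suc t) - N t" using N(3)[OF t] by simp
      have "red (det (diag_block A N t)) dvd red (EE ^ j)" using detG[OF t] red.hom_dvd by blast
      moreover have "red (EE ^ j) \<noteq> 0" by (simp add: red.hom_power red_EE)
      ultimately show "det (Red (diag_block A N t)) \<noteq> 0" by auto
      show "subdegree (det (Red (diag_block A N t))) * m \<le> w * (N (Suc t) - N t)"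
        if "frob.stable_sub (Red (diag_block A N t)) (N (Suc t) - N t) m w" for m w using ss[OF t that] .
    qed
  next
    fix s t assume st: "s < t \<and> t < r"
    then have s: "s < r" and t: "t < r" by auto
    let ?a = "subdegree (det (Red (diag_block A N s)))" and ?b = "subdegree (det (Red (diag_block A N t)))"
    let ?k = "N (Suc s) - N s" and ?l = "N (Suc t) - N t"
    have pos: "0 < ?k" "0 < ?l" using N(3)[OF s] N(3)[OF t] by auto
    have "?a * ?l < ?b * ?k" using lt st by blast
    then have "real ?a * real ?l < real ?b * real ?k" by (metis of_nat_less_iff of_nat_mult)
    then have "real ?a / real ?k < real ?b / real ?l" using pos by (simp only: divide_less_eq less_divide_eq) (simp add: field_simps)
    \<comment> \<open>The valuation enters the slope with a minus sign, so the inequality turns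
      around.\<close>
    then have "kisin_slope E (Gr t) * real (degree E) < kisin_slope E (Gr s) * real (degree E)"
      unfolding slope[OF s] slope[OF t] by (rule diff_strict_left_mono)
    then show "kisin_slope E (Gr t) < kisin_slope E (Gr s)" using degree_E by simp
  qed
qed

end

theorem theorem3p26:
  fixes p :: nat
    and res :: "'w::idom \<Rightarrow> 'f::field"
    and \<sigma> :: "'w \<Rightarrow> 'w"
    and \<iota> :: "'w \<Rightarrow> 'k::field"
    and \<pi> :: 'k
    and E :: "'w poly"
    and M :: "('w fps, 'm) phi_module"
  assumes "perfect_of_char p TYPE('f)"
    and "witt_vectors p res \<sigma>"
    and "totally_ramified_with_uniformizer p \<iota> \<pi>"
    and "minimal_polynomial p \<iota> \<pi> E"
    and "eisenstein p E"
    and "kisin_module p \<sigma> E M"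
  shows "\<exists>M' :: ('w fps, 'm) phi_module.
    kisin_module p \<sigma> E M' \<and> HN_type p res \<sigma> E M' \<and> isogenous p M M'"
proof -
  have "prime p" using assms(1) by (simp add: perfect_of_char_def)
  moreover have "comm_ring_hom \<iota>" "inj \<iota>"
    using assms(3) by (auto simp: totally_ramified_with_uniformizer_def intro: ring_hom_univ_ringD)
  ultimately interpret kisin_base p res \<sigma> \<iota> \<pi> E
    by (intro kisin_base.intro witt_base.intro kisin_base_axioms.intro) (use assms in auto)
  have FM: "frobenius_module \<phi> EE M" using assms(6) by (simp add: kisin_module_def)
  obtain h n b A where P: "presented \<phi> (EE ^ h) n b A M" and "\<exists>j. det A dvd EE ^ j"
    by (rule frobenius_module_presented[OF \<phi>.comm_ring_hom_axioms EE_nonzero FM])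
  then obtain j where det: "det A dvd EE ^ j" by blast
  interpret P: presented \<phi> "EE ^ h" n b A M by (rule P)
  note bc = P.b_carrier
  have nz: "det (Red A) \<noteq> 0"
  proof -
    have "red (det A) dvd red (EE ^ j)" using det red.hom_dvd by blast
    moreover have "red (EE ^ j) \<noteq> 0" by (simp add: red.hom_power red_EE)
    ultimately show ?thesis by auto
  qed
  \<comment> \<open>\<open>V = - 1\<close> and \<open>K = 1\<close> give a bound that every stable
    summand satisfies.\<close>
  have "- 1 * int m < int w * int 1" if "frob.stable_sub (Red A) n m w" for m w
    using that by (simp add: frob.stable_sub_def)
  then obtain A' r N where A': "A' \<in> carrier_mat n n" "isog n A A'" "hn_matrix n A' r N"
    using isog_hn_matrix[OF P.A_carrier nz, of 1 "- 1"] by auto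
  obtain U V k where UV: "U \<in> carrier_mat n n" "V \<in> carrier_mat n n" "U * V = pp ^ k \<cdot>\<^sub>m 1\<^sub>m n"
    "V * U = pp ^ k \<cdot>\<^sub>m 1\<^sub>m n" "A * Ph U = U * A'" using A'(2) unfolding isog_def by blast
  \<comment> \<open>The lattice with Frobenius \<open>A'\<close> is realized inside
    \<open>M\<close>, as the image of \<open>U\<close>.\<close>
  define N' where "N' = P.span_cols n U"
  define M' where "M' = sub_module M N'"
  have pk: "pp ^ k \<noteq> 0" using pp_nonzero by simp
  have P': "presented \<phi> (EE ^ h) n (P.M.columns n b U) A' M'"
    unfolding M'_def N'_def by (rule P.sub_module_presented[OF UV(1) A'(1) UV(2) UV(4) pk UV(5)])
  have det': "det A' dvd EE ^ j"
  proof -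
    obtain w w' where w: "w dvd 1" "w' dvd 1" "det A * w = det A' * w'" using isog_det[OF P.A_carrier A'(1,2)] by blast
    have "det A' dvd det A * w" unfolding w(3) by simp
    moreover have "det A * w dvd EE ^ j * 1" using det w(1) by (rule mult_dvd_mono)
    ultimately show ?thesis using dvd_trans by fastforce
  qed
  have "kisin_module p \<sigma> E M'"
    unfolding kisin_module_def by (rule presented.frobenius_moduleI[OF P' EE_nonzero refl det'])
  moreover have "HN_type p res \<sigma> E M'" by (rule hn_matrix_imp_HN_type[OF P' det' A'(3)])
  moreover have "isogenous p M M'"
  proof -
    have Nc: "N' \<subseteq> carrier M" unfolding N'_def by (rule P.M.submoduleE(1)[OF P.span_cols_submodule])
    have fields: "carrier M' = N'" "add M' = add M" "smult M' = smult M" "\<And>x. frob M' x = frob M x \<inter> (N' \<times> UNIV)"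
      by (simp_all add: M'_def sub_module_def)
    have frac: "fraction M' x t = P.M.fr x t \<inter> (N' \<times> UNIV)" for x t
      unfolding fraction_def using Nc by (auto simp: fields)
    \<comment> \<open>The coordinates are provided by \<open>V\<close>, because \<open>U * V\<close>
      is multiplication by \<open>pp ^ k\<close>.\<close>
    have inN: "pp ^ k \<odot>\<^bsub>M\<^esub> x \<in> N'" if x: "x \<in> carrier M" for x
    proof -
      obtain c where c: "x = P.M.lin n b c" by (rule P.coords[OF x])
      have "pp ^ k \<odot>\<^bsub>M\<^esub> x = P.M.lin n b (\<lambda>i. pp ^ k * c i)" unfolding c by (simp only: P.M.lin_smult[OF bc])
      also have "\<dots> = P.M.lin n b (mat_apply n U (mat_apply n V c))"
      proof (rule P.M.lin_cong)
        fix i assume i: "i < n"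
        have "mat_apply n (pp ^ k \<cdot>\<^sub>m 1\<^sub>m n) c i = pp ^ k * c i"
          unfolding mat_apply_def using i by (subst sum.mono_neutral_right[of _ "{i}"]) auto
        then show "pp ^ k * c i = mat_apply n U (mat_apply n V c) i"
          unfolding mat_apply_mult[OF UV(1,2) i] UV(3) by simp
      qed (use bc in auto)
      also have "\<dots> \<in> N'" unfolding N'_def P.span_cols_def by blast
      finally show ?thesis .
    qed
    have frep: "frob M x = P.M.fr y s" "y \<in> carrier M" "s \<noteq> 0" if xy: "x \<in> carrier M" "(y, s) \<in> frob M x" for x y s
    proof -
      obtain c where c: "x = P.M.lin n b c" "frob M x = P.M.fr (P.M.lin n b (mat_apply n A (\<lambda>i. \<phi> (c i)))) (EE ^ h)"
        by (rule P.frob_coords[OF xy(1)])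
      note lc = P.M.lin_closed[OF bc]
      have y: "y \<in> carrier M" "s \<noteq> 0" "s \<odot>\<^bsub>M\<^esub> P.M.lin n b (mat_apply n A (\<lambda>i. \<phi> (c i))) = EE ^ h \<odot>\<^bsub>M\<^esub> y"
        using xy(2) unfolding c(2) P.M.fraction_mem[OF lc P.d_nonzero] by auto
      then show "frob M x = P.M.fr y s" "y \<in> carrier M" "s \<noteq> 0"
        unfolding c(2) using P.M.fraction_eq_iff[OF lc P.d_nonzero y(1,2)] by auto
    qed
    \<comment> \<open>Multiplication by \<open>pp ^ k\<close> maps \<open>M\<close> into
      \<open>M'\<close>; divided by \<open>p ^ k\<close> in the isogeny category, it is inverse to
      the inclusion of \<open>M'\<close> in \<open>M\<close>.\<close>
    have f: "(\<lambda>x. pp ^ k \<odot>\<^bsub>M\<^esub> x) \<in> kisin_hom M M'"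
      unfolding kisin_hom_def fields
    proof (intro CollectI conjI ballI allI)
      show "(\<lambda>x. pp ^ k \<odot>\<^bsub>M\<^esub> x) \<in> carrier M \<rightarrow> N'" using inN by blast
      show "pp ^ k \<odot>\<^bsub>M\<^esub> (x \<oplus>\<^bsub>M\<^esub> y) = pp ^ k \<odot>\<^bsub>M\<^esub> x \<oplus>\<^bsub>M\<^esub> pp ^ k \<odot>\<^bsub>M\<^esub> y"
        if "x \<in> carrier M" "y \<in> carrier M" for x y using that by (rule P.M.umod_smult_add)
      show "pp ^ k \<odot>\<^bsub>M\<^esub> (a \<odot>\<^bsub>M\<^esub> x) = a \<odot>\<^bsub>M\<^esub> (pp ^ k \<odot>\<^bsub>M\<^esub> x)" if "x \<in> carrier M" for a x
        using that by (simp add: P.M.umod_smult_smult mult.commute)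
      fix x ys assume x: "x \<in> carrier M" "ys \<in> frob M x"
      obtain y s where ys: "ys = (y, s)" by (cases ys)
      note r = frep[OF x(1) x(2)[unfolded ys]]
      have "frob M (pp ^ k \<odot>\<^bsub>M\<^esub> x) = Fract (\<phi> (pp ^ k)) 1 \<odot>\<^bsub>P.M.FV\<^esub> frob M x"
        using FM x(1) unfolding frobenius_module_def by blast
      also have "\<dots> = P.M.fr (pp ^ k \<odot>\<^bsub>M\<^esub> y) s"
        unfolding r(1) \<phi>_pp_power using r(2,3) by (simp add: P.M.frac_smult)
      finally have "frob M (pp ^ k \<odot>\<^bsub>M\<^esub> x) = P.M.fr (pp ^ k \<odot>\<^bsub>M\<^esub> y) s" .
      then show "case ys of (y, s) \<Rightarrow> frob M (pp ^ k \<odot>\<^bsub>M\<^esub> x) \<inter> (N' \<times> UNIV) = fraction M' (pp ^ k \<odot>\<^bsub>M\<^esub> y) s"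
        by (simp add: ys frac)
    qed
    have g: "(\<lambda>x. x) \<in> kisin_hom M' M"
      unfolding kisin_hom_def fields
    proof (intro CollectI conjI ballI allI)
      fix x ys assume x: "x \<in> N'" "ys \<in> frob M x \<inter> (N' \<times> UNIV)"
      obtain y s where ys: "ys = (y, s)" by (cases ys)
      have "frob M x = P.M.fr y s" by (rule frep(1)) (use x ys Nc in auto)
      then show "case ys of (y, s) \<Rightarrow> frob M x = P.M.fr y s" by (simp add: ys)
    qed (use Nc in auto)
    have fg: "\<forall>x\<in>carrier M. of_nat p ^ 0 \<odot>\<^bsub>M\<^esub> (pp ^ k \<odot>\<^bsub>M\<^esub> x) = of_nat p ^ (0 + k + 0) \<odot>\<^bsub>M\<^esub> x" by simp
    have gf: "\<forall>y\<in>carrier M'. of_nat p ^ 0 \<odot>\<^bsub>M'\<^esub> (pp ^ k \<odot>\<^bsub>M\<^esub> y) = of_nat p ^ (0 + k + 0) \<odot>\<^bsub>M'\<^esub> y"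
      using Nc by (auto simp: fields)
    show ?thesis unfolding isogenous_def
      by (rule bexI[OF _ f], rule bexI[OF _ g], rule exI[of _ k], rule exI[of _ 0], rule exI[of _ 0],
          rule conjI[OF fg gf])
  qed
  ultimately show ?thesis by blast
qed

end
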